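(* Consider the $A_\infty$ structure $X$ on $\mathcal{H}=H(\mathcal{A}(\mathcal{Z}))$ and the $A_\infty$ morphism $f:\mathcal{H}\to\mathcal{A}=\mathcal{A}(\mathcal{Z})$ arising from a pair ordering $\preceq$ on an arc diagram $\mathcal{Z}$. Let $M=M_1\otimes\cdots\otimes M_n$ be a tensor product of nonzero homology classes of diagrams. If $X_n(M)\neq0$ or $\overline{f}_n(M)\neq0$, then there is a valid distributive operation tree for $M$.
   Context: All algebra is over $\mathbb{Z}_2$. An arc diagram $\mathcal{Z}=(\mathbf{Z},\mathbf{a},r)$ consists of oriented intervals $\mathbf{Z}=\{Z_1,\dots,Z_l\}$, distinct points $\mathbf{a}=(a_1,\dots,a_{2k})$ (places) in the interiors of the intervals, ordered along them, and a 2-to-1 map $r:\mathbf{a}\to\{1,\dots,k\}$ such that oriented surgery on $\mathbf{Z}$ at all $0$-spheres $r^{-1}(i)$ yields a 1-manifold with no circle components. The fibres $P=\{p,q\}$ of $r$ are the matched pairs, identified with $1,\dots,k$. Let $-\infty_i,+\infty_i$ be the start and end of $Z_i$ and $\mathbf{a}_{\pm\infty}=\mathbf{a}\cup\{\pm\infty_i\}$, partially ordered along the intervals; the places cut the intervals into steps. A strand diagram is a triple $(S,T,\phi)$ with $S,T\subseteq\mathbf{a}_{\pm\infty}$ and $\phi:S\to T$ a bijection with $\phi(x)\ge x$; it is drawn as strands in $[0,1]\times\mathbf{Z}$ from $\{0\}\times S$ to $\{1\}\times T$, meeting efficiently; crossings are inversions ($x<y$ with $\phi(x)>\phi(y)$),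 counted by $\mathrm{inv}$. The product of $(S,T,\phi)$ and $(U,V,\psi)$ is $(S,V,\psi\phi)$ if $T=U$ and $\mathrm{inv}(\psi\phi)=\mathrm{inv}(\phi)+\mathrm{inv}(\psi)$, and $0$ otherwise; $\partial$ is the sum of all resolutions of one crossing which lower the number of crossings by exactly $1$. $I(S)$ is the identity diagram on $S$. For a set $s$ of matched pairs let $I(s)=\sum_S I(S)$, over all $S\subseteq \mathbf{a}_{\pm\infty}$ consisting of exactly one place of each pair in $s$, no other places, and any subset of $\{\pm\infty_i\}$. For $\mu=(S,T,\phi)$ without horizontal strands (fixed points) let $a(\mu)=\sum_U(S\cup U,T\cup U,\phi_U)$ over $U\subseteq\mathbf{a}_{\pm\infty}\setminus(S\cup T)$, $\phi_U$ extending $\phi$ by the identity. A diagram from $s$ to $t$ is a nonzero element $I(s)a(\mu)I(t)$; it is drawn as one picture with dotted horizontal strands at both places $p,q$ of every matched pair carrying a horizontal strand. The (augmented) strand algebra $\mathcal{A}=\mathcal{A}(\mathcal{Z})$ is the DGA with basis the diagrams; $\mathcal{H}=H(\mathcal{A})$, a DGA with zero differential. H-data is a triple $(h,s,t)$ with $h\in H_1(\mathbf{Z},\mathbf{a}_{\pm\infty})$ and $s,t$ sets of matched pairs. A diagram from $s$ to $t$ has H-data $(h,s,t)$, $h=\sum_x[x,\phi(x)]$; $\mathcal{A}(h,s,t)$ is the span of diagrams with this H-data and $\mathcal{H}(h,s,t)$ its homology, so $\mathcal{A}=\bigoplus\mathcal{A}(h,s,t)$, $\mathcal{H}=\bigoplus\mathcal{H}(h,s,t)$.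 The Maslov grading is $\iota(D)=\mathrm{inv}(\mu)-m(h,S)$ for any term $\mu=(S,T,\phi)$ of $D$, where $m(h,S)$ is the sum over places $a\in S\cap\mathbf{a}$ of the average multiplicity of $h$ on the two steps at $a$ (and $m$ is extended linearly to $0$-chains, ignoring $\pm\infty_i$). $h$ (and any H-data or diagram with H-grading $h$) is viable if $h$ has multiplicity $0$ or $1$ on every step. In a viable diagram every crossing involves a horizontal strand, hence lies at a matched pair. Cutting the intervals between consecutive places gives, for each matched pair $P=\{p,q\}$, the fragment $\mathcal{Z}_P$ (two intervals with one place each); cutting a viable diagram $D$ accordingly gives local diagrams $D_P\in\mathcal{A}(\mathcal{Z}_P)$. A viable diagram is tight if it has no crossings and is nonzero in homology, twisted if it has no crossings and is zero in homology, crossed if it has crossings; it has such a property at $P$ if $D_P$ does. Viable H-data is tight (resp. twisted) if some tight (resp. twisted) diagram has that H-data, and singular otherwise. Each $\mathcal{H}(h,s,t)$ is $0$ or $\mathbb{Z}_2$, nonzero exactly for tight $(h,s,t)$, with generator represented by any tight diagram with H-data $(h,s,t)$. A pair $P$ is 11 if $P\in s$ and $P\in t$; it is once occupied at $p$ by $h$ if $h$ covers both steps at $p$ and neither step at the twin $q$; doubly occupied if $h$ covers all four steps at $p,q$. $\mathcal{F}\subset\mathcal{A}$ is the two-sided ideal spanned by diagrams that are non-viable or have a crossing at some doubly occupied pair. $\overline{f}$ denotes the composition of a map $f$ into $\mathcal{A}$ with $\mathcal{A}\to\mathcal{A}/\mathcal{F}$. For classes $M_i$ with H-data $(h_i,s_i,t_i)$,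 $M=M_1\otimes\cdots\otimes M_n$ has an idempotent mismatch if some $t_i\neq s_{i+1}$; $M$ is viable if it has no mismatch and $\sum h_i$ is viable. Its H-data is $(h,s,t)=(\sum h_i,s_1,t_n)$ and its Maslov grading is $\sum\iota(M_i)+\sum_{j<k}m(h_k,\partial h_j)$. A map preserves H-data if it sends such $M$ into the $(\sum h_i,s_1,t_n)$ summand. Tightness of a viable tensor product $M$ of nonzero classes: let $D_i$ be (tight) diagrams representing $M_i$; $M$ is tight if $D_1\cdots D_n$ is nonzero and tight; twisted if $D_1\cdots D_n$ is nonzero and twisted; critical if $D_1\cdots D_n=0$ but $\mathcal{A}(h,s,t)\ne0$; singular if $\mathcal{A}(h,s,t)=0$. Exactly one holds, independently of the choice of $D_i$. $M$ is tight, twisted, critical or singular at a matched pair $P$ if $M_P=(M_1)_P\otimes\cdots\otimes(M_n)_P$ is so on $\mathcal{Z}_P$, where $(M_i)_P$ is the homology class of $(D_i)_P$. A pair ordering $\preceq$ is a total order on the set of matched pairs together with a total order on the two places of each matched pair. $f^{\preceq}:\mathcal{H}\to\mathcal{A}$ is the linear map sending, for each tight $(h,s,t)$, the generator of $\mathcal{H}(h,s,t)$ to the unique tight diagram with H-data $(h,s,t)$ in which, at each 11 doubly occupied pair, strands begin and end at the $\preceq$-smaller place of the pair. The operator $A^*_{\preceq}$ on $\bigoplus_{(h,s,t)\text{ twisted}}\mathcal{A}(h,s,t)$ is defined on diagrams $D\in\mathcal{A}(h,s,t)$ as follows: let $P=\{p,q\}$ be the $\preceq$-smallest 11 once occupied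 pair, $p$ its occupied place (a twisted $(h,s,t)$ has such a pair). If $D$ has a crossing at $P$, $A^*_{\preceq}D=0$. Otherwise one strand of $D$ ends at $p$ and another begins at $p$; $A^*_{\preceq}D$ is obtained by joining these into a single strand running past $p$ and adding dotted horizontal strands at $p$ and $q$. The $A_\infty$ structure $X$ on $\mathcal{H}$ and $A_\infty$ morphism $f:\mathcal{H}\to\mathcal{A}$ ($\mathcal{A}$ having trivial $n$-ary operations for $n\ge3$) arising from $\preceq$ have $X_1=0$, $X_2$ multiplication, $f_1=f^{\preceq}$, and satisfy, for all tensor products $M$ of nonzero homology classes of diagrams: (a) if $M$ is not viable then $\overline{f}_n(M)=0$, $X_n(M)=0$, and if $M$ has an idempotent mismatch then $f_n(M)=0$; (b) $X_n,f_n$ preserve H-data and have Maslov degrees $n-2,n-1$; (c) for $n\ge2$, if $(f_1X_n-U_n)(M)=0$ then $f_n(M)=0$; (d) for $n\ge2$ and $M$ viable with twisted H-data, $f_n(M)=A^*_{\preceq}((f_1X_n-U_n)(M))$. Here $U_n(a_1\otimes\cdots\otimes a_n)=\sum_{j=1}^{n-1}f_j(a_1\otimes\cdots\otimes a_j)f_{n-j}(a_{j+1}\otimes\cdots\otimes a_n)+\sum_{2\le j\le n-1,\,0\le k\le n-j}f_{n-j+1}(a_1\otimes\cdots\otimes a_k\otimes X_j(a_{k+1}\otimes\cdots\otimes a_{k+j})\otimes\cdots\otimes a_n)$, $X_n=[U_n]$, and the morphism relations amount to $\partial f_n=f_1X_n-U_n$. Such $X$, $f$ exist, and the $X_n$ and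 $\overline{f}_n$ are uniquely determined by $\preceq$. An operation tree for $M=M_1\otimes\cdots\otimes M_n$ is a rooted plane binary tree with $n$ leaves, ordered left to right and labelled $M_1,\dots,M_n$ (nonzero homology classes of diagrams), each non-leaf vertex being labelled by the tensor product of the labels of its two ordered children, such that every label is viable; so the root is labelled $M$. It is valid if no vertex label is singular. A valid operation tree is distributive if for every vertex $v$, with $k$ leaves at or below $v$ and label $M_v$, there are at least $k-2$ matched pairs at which $M_v$ is twisted or critical. *)

theory Defs
  imports Complex_Main "HOL-Library.Z2" "HOL-Library.Poly_Mapping" "HOL-Library.Set_Algebras"
begin

section \<open>Arc diagrams\<close>

text \<open>
  An interval carrying n places has the points 0, ..., n + 1 along it: 0 is its start (minus
  infinity), n + 1 its end (plus infinity), and 1, ..., n are its places.  The step from the point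
  (i, j) to the point (i, j + 1) is named by its starting point (i, j).  Matched pairs are
  identified with the values 1, ..., k of the matching.
\<close>

record 'i arc =
  intervals :: "'i set"
  nplaces :: "'i \<Rightarrow> nat"
  npairs :: nat
  matching :: "'i \<times> nat \<Rightarrow> nat"

type_synonym 'i pt = "'i \<times> nat"

definition points :: "'i arc \<Rightarrow> 'i pt set" where
  "points Z = {(i, j). i \<in> intervals Z \<and> j \<le> nplaces Z i + 1}"

definition places :: "'i arc \<Rightarrow> 'i pt set" where
  "places Z = {(i, j). i \<in> intervals Z \<and> 1 \<le> j \<and> j \<le> nplaces Z i}"

definition steps :: "'i arc \<Rightarrow> 'i pt set" where
  "steps Z = {(i, j). i \<in> intervals Z \<and> j \<le> nplaces Z i}"

definition pairs :: "'i arc \<Rightarrow> nat set" where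
  "pairs Z = {1..npairs Z}"

definition pair_places :: "'i arc \<Rightarrow> nat \<Rightarrow> 'i pt set" where
  "pair_places Z P = {p \<in> places Z. matching Z p = P}"

text \<open>
  Oriented surgery at a matched pair {p, q} joins the step ending at p to the step starting at q,
  and the step ending at q to the step starting at p.  The relation below is this partial successor
  function on steps; the circle components of the surgered manifold are its cycles.
\<close>

definition surgery_next :: "'i arc \<Rightarrow> ('i pt \<times> 'i pt) set" where
  "surgery_next Z = {((i, j), q). (i, Suc j) \<in> places Z \<and> q \<in> places Z \<and>
      q \<noteq> (i, Suc j) \<and> matching Z q = matching Z (i, Suc j)}"

definition arc_diagram :: "'i arc \<Rightarrow> bool" where
  "arc_diagram Z \<longleftrightarrow> finite (intervals Z) \<and> matching Z ` places Z \<subseteq> pairs Z \<and>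
     (\<forall>P\<in>pairs Z. card (pair_places Z P) = 2) \<and> acyclic (surgery_next Z)"

definition pt_le :: "'i pt \<Rightarrow> 'i pt \<Rightarrow> bool" where
  "pt_le x y \<longleftrightarrow> fst x = fst y \<and> snd x \<le> snd y"

definition pt_less :: "'i pt \<Rightarrow> 'i pt \<Rightarrow> bool" where
  "pt_less x y \<longleftrightarrow> fst x = fst y \<and> snd x < snd y"


section \<open>Strand diagrams\<close>

text \<open>
  The strand diagram (S, T, phi) is the graph of the bijection phi, with S and T its domain and
  range.
\<close>

type_synonym 'i sdiag = "('i pt \<times> 'i pt) set"

definition strand_diagrams :: "'i arc \<Rightarrow> 'i sdiag set" where
  "strand_diagrams Z = {\<phi>. \<phi> \<subseteq> points Z \<times> points Z \<and> single_valued \<phi> \<and>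
     single_valued (\<phi>\<inverse>) \<and> (\<forall>(x, y)\<in>\<phi>. pt_le x y)}"

definition crossings :: "'i sdiag \<Rightarrow> (('i pt \<times> 'i pt) \<times> ('i pt \<times> 'i pt)) set" where
  "crossings \<phi> = {((x, y), (x', y')). (x, y) \<in> \<phi> \<and> (x', y') \<in> \<phi> \<and> pt_less x x' \<and> pt_less y' y}"

definition inv_count :: "'i sdiag \<Rightarrow> nat" where
  "inv_count \<phi> = card (crossings \<phi>)"

fun resolve :: "'i sdiag \<Rightarrow> ('i pt \<times> 'i pt) \<times> ('i pt \<times> 'i pt) \<Rightarrow> 'i sdiag" where
  "resolve \<phi> ((x, y), (x', y')) = (\<phi> - {(x, y), (x', y')}) \<union> {(x, y'), (x', y)}"

text \<open>Formal sums of strand diagrams over the field with two elements.\<close>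

type_synonym 'i chain = "'i sdiag \<Rightarrow>\<^sub>0 bit"

definition basis :: "'i sdiag \<Rightarrow> 'i chain" where
  "basis \<phi> = Poly_Mapping.single \<phi> 1"

definition bd_basis :: "'i sdiag \<Rightarrow> 'i chain" where
  "bd_basis \<phi> =
     (\<Sum>c\<in>{c \<in> crossings \<phi>. inv_count (resolve \<phi> c) + 1 = inv_count \<phi>}. basis (resolve \<phi> c))"

definition bd :: "'i chain \<Rightarrow> 'i chain" where
  "bd x = (\<Sum>\<phi>\<in>Poly_Mapping.keys x. bd_basis \<phi>)"

definition mult_basis :: "'i sdiag \<Rightarrow> 'i sdiag \<Rightarrow> 'i chain" where
  "mult_basis \<phi> \<psi> =
     (if Range \<phi> = Domain \<psi> \<and> inv_count (\<phi> O \<psi>) = inv_count \<phi> + inv_count \<psi>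
      then basis (\<phi> O \<psi>) else 0)"

definition mult :: "'i chain \<Rightarrow> 'i chain \<Rightarrow> 'i chain" where
  "mult x y = (\<Sum>\<phi>\<in>Poly_Mapping.keys x. \<Sum>\<psi>\<in>Poly_Mapping.keys y. mult_basis \<phi> \<psi>)"

text \<open>The product of a nonempty list.\<close>

fun mult_list :: "'i chain list \<Rightarrow> 'i chain" where
  "mult_list [] = 0"
| "mult_list [x] = x"
| "mult_list (x # y # ys) = mult x (mult_list (y # ys))"

text \<open>The linear span over the field with two elements.\<close>

definition span2 :: "'a::comm_monoid_add set \<Rightarrow> 'a set" where
  "span2 B = {\<Sum>x\<in>C. x |C. finite C \<and> C \<subseteq> B}"


section \<open>The augmented strand algebra\<close>

definition sections :: "'i arc \<Rightarrow> nat set \<Rightarrow> 'i pt set set" where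
  "sections Z s = {S. S \<subseteq> points Z \<and> (\<forall>p \<in> S \<inter> places Z. matching Z p \<in> s) \<and>
     (\<forall>P\<in>s. \<exists>!p. p \<in> S \<inter> pair_places Z P)}"

definition idem :: "'i arc \<Rightarrow> nat set \<Rightarrow> 'i chain" where
  "idem Z s = (\<Sum>S\<in>sections Z s. basis (Id_on S))"

definition fill :: "'i arc \<Rightarrow> 'i sdiag \<Rightarrow> 'i chain" where
  "fill Z \<mu> = (\<Sum>U\<in>Pow (points Z - (Domain \<mu> \<union> Range \<mu>)). basis (\<mu> \<union> Id_on U))"

text \<open>
  A diagram is given as the triple (s, \<open>\<mu>\<close>, t), where \<open>\<mu>\<close> is the set of its moving strands; elt is
  the corresponding element of the strand algebra.
\<close>

type_synonym 'i dgm = "nat set \<times> 'i sdiag \<times> nat set"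

fun elt :: "'i arc \<Rightarrow> 'i dgm \<Rightarrow> 'i chain" where
  "elt Z (s, \<mu>, t) = mult (mult (idem Z s) (fill Z \<mu>)) (idem Z t)"

fun diagram :: "'i arc \<Rightarrow> 'i dgm \<Rightarrow> bool" where
  "diagram Z (s, \<mu>, t) \<longleftrightarrow> s \<subseteq> pairs Z \<and> t \<subseteq> pairs Z \<and> \<mu> \<in> strand_diagrams Z \<and>
     (\<forall>(x, y)\<in>\<mu>. x \<noteq> y) \<and> elt Z (s, \<mu>, t) \<noteq> 0"

definition strand_alg :: "'i arc \<Rightarrow> 'i chain set" where
  "strand_alg Z = span2 (elt Z ` {d. diagram Z d})"

text \<open>
  Homology classes are cosets of the boundaries; their sum is the elementwise sum of cosets, which
  is the operation + on sets, and their zero is the coset hzero (not the set {0}).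
\<close>

definition hclass :: "'i arc \<Rightarrow> 'i chain \<Rightarrow> 'i chain set" where
  "hclass Z x = x +o (bd ` strand_alg Z)"

definition homology :: "'i arc \<Rightarrow> 'i chain set set" where
  "homology Z = hclass Z ` {x \<in> strand_alg Z. bd x = 0}"

definition hzero :: "'i arc \<Rightarrow> 'i chain set" where
  "hzero Z = hclass Z 0"

text \<open>The nonzero homology classes of diagrams.\<close>

definition dgm_classes :: "'i arc \<Rightarrow> 'i chain set set" where
  "dgm_classes Z = {hclass Z (elt Z d) |d. diagram Z d \<and> bd (elt Z d) = 0} - {hzero Z}"


section \<open>H-data and Maslov grading\<close>

text \<open>An element of the relative first homology is given by its multiplicities on steps.\<close>

type_synonym 'i hdat = "('i pt \<Rightarrow> int) \<times> nat set \<times> nat set"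

fun hgrade :: "'i dgm \<Rightarrow> 'i pt \<Rightarrow> int" where
  "hgrade (s, \<mu>, t) (i, j) =
     int (card {(x, y) \<in> \<mu>. fst x = i \<and> snd x \<le> j \<and> j < snd y})"

fun hdata :: "'i dgm \<Rightarrow> 'i hdat" where
  "hdata (s, \<mu>, t) = (hgrade (s, \<mu>, t), s, t)"

definition alg_summand :: "'i arc \<Rightarrow> 'i hdat \<Rightarrow> 'i chain set" where
  "alg_summand Z g = span2 (elt Z ` {d. diagram Z d \<and> hdata d = g})"

definition avg_mult :: "('i pt \<Rightarrow> int) \<Rightarrow> 'i pt \<Rightarrow> rat" where
  "avg_mult h p = (of_int (h (fst p, snd p - 1)) + of_int (h p)) / 2"

definition m_pairing :: "'i arc \<Rightarrow> ('i pt \<Rightarrow> int) \<Rightarrow> ('i pt \<Rightarrow> int) \<Rightarrow> rat" where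
  "m_pairing Z h c = (\<Sum>p\<in>places Z. of_int (c p) * avg_mult h p)"

text \<open>Only the values of the boundary 0-chain at places are used, so j = 0 does not matter.\<close>

fun h_bdry :: "('i pt \<Rightarrow> int) \<Rightarrow> 'i pt \<Rightarrow> int" where
  "h_bdry h (i, j) = h (i, j - 1) - h (i, j)"

definition maslov_term :: "'i arc \<Rightarrow> ('i pt \<Rightarrow> int) \<Rightarrow> 'i sdiag \<Rightarrow> rat" where
  "maslov_term Z h \<phi> = of_nat (inv_count \<phi>) - m_pairing Z h (\<lambda>p. of_bool (p \<in> Domain \<phi>))"

text \<open>The value does not depend on the chosen term.\<close>

definition maslov :: "'i arc \<Rightarrow> 'i dgm \<Rightarrow> rat" where
  "maslov Z d = maslov_term Z (hgrade d) (SOME \<phi>. \<phi> \<in> Poly_Mapping.keys (elt Z d))"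

definition graded_summand :: "'i arc \<Rightarrow> 'i hdat \<Rightarrow> rat \<Rightarrow> 'i chain set" where
  "graded_summand Z g q = span2 (elt Z ` {d. diagram Z d \<and> hdata d = g \<and> maslov Z d = q})"

definition viable_h :: "'i arc \<Rightarrow> ('i pt \<Rightarrow> int) \<Rightarrow> bool" where
  "viable_h Z h \<longleftrightarrow> (\<forall>e\<in>steps Z. h e = 0 \<or> h e = 1)"


section \<open>Tight, twisted and crossed diagrams\<close>

text \<open>
  In the picture of a diagram, with dotted horizontal strands at both places of a pair, a crossing
  is a crossing of some term of the diagram.
\<close>

definition has_crossings :: "'i arc \<Rightarrow> 'i dgm \<Rightarrow> bool" where
  "has_crossings Z d \<longleftrightarrow> (\<exists>\<phi>\<in>Poly_Mapping.keys (elt Z d). crossings \<phi> \<noteq> {})"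

definition tight_dgm :: "'i arc \<Rightarrow> 'i dgm \<Rightarrow> bool" where
  "tight_dgm Z d \<longleftrightarrow> diagram Z d \<and> viable_h Z (hgrade d) \<and> \<not> has_crossings Z d \<and>
     hclass Z (elt Z d) \<noteq> hzero Z"

definition twisted_dgm :: "'i arc \<Rightarrow> 'i dgm \<Rightarrow> bool" where
  "twisted_dgm Z d \<longleftrightarrow> diagram Z d \<and> viable_h Z (hgrade d) \<and> \<not> has_crossings Z d \<and>
     hclass Z (elt Z d) = hzero Z"

definition twisted_hdata :: "'i arc \<Rightarrow> 'i hdat \<Rightarrow> bool" where
  "twisted_hdata Z g \<longleftrightarrow> (\<exists>d. twisted_dgm Z d \<and> hdata d = g)"

text \<open>
  The fragment at a matched pair has one interval for each place p of the pair, named p, carrying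
  the single place (p, 1).  Cutting a strand at the ends of the interval named (i, j) clamps its
  endpoints to the points 0, 1, 2 of that interval, representing positions before, at and after j.
\<close>

definition fragment :: "'i arc \<Rightarrow> nat \<Rightarrow> 'i pt arc" where
  "fragment Z P =
     \<lparr>intervals = pair_places Z P, nplaces = (\<lambda>_. 1), npairs = 1, matching = (\<lambda>_. 1)\<rparr>"

definition clamp :: "nat \<Rightarrow> nat \<Rightarrow> nat" where
  "clamp j x = (if x < j then 0 else if x = j then 1 else 2)"

definition cut_strands :: "'i arc \<Rightarrow> nat \<Rightarrow> 'i sdiag \<Rightarrow> 'i pt sdiag" where
  "cut_strands Z P \<mu> =
     {(((i, j), clamp j x), ((i, j), clamp j y)) |i j x y.
        (i, j) \<in> pair_places Z P \<and> ((i, x), (i, y)) \<in> \<mu> \<and> clamp j x \<noteq> clamp j y}"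

fun local_dgm :: "'i arc \<Rightarrow> nat \<Rightarrow> 'i dgm \<Rightarrow> 'i pt dgm" where
  "local_dgm Z P (s, \<mu>, t) =
     ((if P \<in> s then {1} else {}), cut_strands Z P \<mu>, (if P \<in> t then {1} else {}))"

definition crossed_at :: "'i arc \<Rightarrow> nat \<Rightarrow> 'i dgm \<Rightarrow> bool" where
  "crossed_at Z P d \<longleftrightarrow> has_crossings (fragment Z P) (local_dgm Z P d)"

definition covers_place :: "('i pt \<Rightarrow> int) \<Rightarrow> 'i pt \<Rightarrow> bool" where
  "covers_place h p \<longleftrightarrow> h (fst p, snd p - 1) \<noteq> 0 \<and> h p \<noteq> 0"

definition avoids_place :: "('i pt \<Rightarrow> int) \<Rightarrow> 'i pt \<Rightarrow> bool" where
  "avoids_place h p \<longleftrightarrow> h (fst p, snd p - 1) = 0 \<and> h p = 0"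

definition once_occupied_at :: "'i arc \<Rightarrow> ('i pt \<Rightarrow> int) \<Rightarrow> nat \<Rightarrow> 'i pt \<Rightarrow> bool" where
  "once_occupied_at Z h P p \<longleftrightarrow> p \<in> pair_places Z P \<and> covers_place h p \<and>
     (\<forall>q \<in> pair_places Z P - {p}. avoids_place h q)"

definition doubly_occupied :: "'i arc \<Rightarrow> ('i pt \<Rightarrow> int) \<Rightarrow> nat \<Rightarrow> bool" where
  "doubly_occupied Z h P \<longleftrightarrow> (\<forall>p\<in>pair_places Z P. covers_place h p)"

definition ideal_F :: "'i arc \<Rightarrow> 'i chain set" where
  "ideal_F Z = span2 (elt Z ` {d. diagram Z d \<and> (\<not> viable_h Z (hgrade d) \<or>
     (\<exists>P\<in>pairs Z. doubly_occupied Z (hgrade d) P \<and> crossed_at Z P d))})"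

text \<open>The class in the quotient of the strand algebra by F, whose zero is the coset F itself.\<close>

definition bar :: "'i arc \<Rightarrow> 'i chain \<Rightarrow> 'i chain set" where
  "bar Z x = x +o ideal_F Z"


section \<open>Tensor products of homology classes\<close>

text \<open>
  A tensor product of n homology classes is given as the list of its factors.  The data of a nonzero
  class of a diagram are read off from a tight diagram representing it; none of them depends on the
  choice of that diagram.
\<close>

definition tight_rep :: "'i arc \<Rightarrow> 'i chain set \<Rightarrow> 'i dgm" where
  "tight_rep Z c = (SOME d. tight_dgm Z d \<and> hclass Z (elt Z d) = c)"

definition cls_h :: "'i arc \<Rightarrow> 'i chain set \<Rightarrow> 'i pt \<Rightarrow> int" where
  "cls_h Z c = hgrade (tight_rep Z c)"

definition cls_s :: "'i arc \<Rightarrow> 'i chain set \<Rightarrow> nat set" where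
  "cls_s Z c = fst (tight_rep Z c)"

definition cls_t :: "'i arc \<Rightarrow> 'i chain set \<Rightarrow> nat set" where
  "cls_t Z c = snd (snd (tight_rep Z c))"

definition tensor_h :: "'i arc \<Rightarrow> 'i chain set list \<Rightarrow> 'i pt \<Rightarrow> int" where
  "tensor_h Z M e = (\<Sum>c\<leftarrow>M. cls_h Z c e)"

definition tensor_hdata :: "'i arc \<Rightarrow> 'i chain set list \<Rightarrow> 'i hdat" where
  "tensor_hdata Z M = (tensor_h Z M, cls_s Z (hd M), cls_t Z (last M))"

definition tensor_maslov :: "'i arc \<Rightarrow> 'i chain set list \<Rightarrow> rat" where
  "tensor_maslov Z M = (\<Sum>c\<leftarrow>M. maslov Z (tight_rep Z c)) +
     (\<Sum>(j, k) \<in> {(j, k). j < k \<and> k < length M}.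
        m_pairing Z (cls_h Z (M ! k)) (h_bdry (cls_h Z (M ! j))))"

definition mismatch :: "'i arc \<Rightarrow> 'i chain set list \<Rightarrow> bool" where
  "mismatch Z M \<longleftrightarrow> (\<exists>i. Suc i < length M \<and> cls_t Z (M ! i) \<noteq> cls_s Z (M ! Suc i))"

definition viable :: "'i arc \<Rightarrow> 'i chain set list \<Rightarrow> bool" where
  "viable Z M \<longleftrightarrow> \<not> mismatch Z M \<and> viable_h Z (tensor_h Z M)"

definition rep_product :: "'i arc \<Rightarrow> 'i chain set list \<Rightarrow> 'i chain" where
  "rep_product Z M = mult_list (map (\<lambda>c. elt Z (tight_rep Z c)) M)"

definition tight_tensor :: "'i arc \<Rightarrow> 'i chain set list \<Rightarrow> bool" where
  "tight_tensor Z M \<longleftrightarrow> viable Z M \<and> (\<exists>d. tight_dgm Z d \<and> rep_product Z M = elt Z d)"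

definition twisted_tensor :: "'i arc \<Rightarrow> 'i chain set list \<Rightarrow> bool" where
  "twisted_tensor Z M \<longleftrightarrow> viable Z M \<and> (\<exists>d. twisted_dgm Z d \<and> rep_product Z M = elt Z d)"

definition critical_tensor :: "'i arc \<Rightarrow> 'i chain set list \<Rightarrow> bool" where
  "critical_tensor Z M \<longleftrightarrow> viable Z M \<and> rep_product Z M = 0 \<and>
     alg_summand Z (tensor_hdata Z M) \<noteq> {0}"

definition singular_tensor :: "'i arc \<Rightarrow> 'i chain set list \<Rightarrow> bool" where
  "singular_tensor Z M \<longleftrightarrow> viable Z M \<and> alg_summand Z (tensor_hdata Z M) = {0}"

definition local_class :: "'i arc \<Rightarrow> nat \<Rightarrow> 'i chain set \<Rightarrow> 'i pt chain set" where
  "local_class Z P c =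
     hclass (fragment Z P) (elt (fragment Z P) (local_dgm Z P (tight_rep Z c)))"

definition twisted_at :: "'i arc \<Rightarrow> nat \<Rightarrow> 'i chain set list \<Rightarrow> bool" where
  "twisted_at Z P M \<longleftrightarrow> twisted_tensor (fragment Z P) (map (local_class Z P) M)"

definition critical_at :: "'i arc \<Rightarrow> nat \<Rightarrow> 'i chain set list \<Rightarrow> bool" where
  "critical_at Z P M \<longleftrightarrow> critical_tensor (fragment Z P) (map (local_class Z P) M)"


section \<open>Pair orderings\<close>

type_synonym 'i pair_ord = "nat rel \<times> (nat \<Rightarrow> 'i pt rel)"

fun pair_ordering :: "'i arc \<Rightarrow> 'i pair_ord \<Rightarrow> bool" where
  "pair_ordering Z (R, Q) \<longleftrightarrow> linear_order_on (pairs Z) R \<and>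
     (\<forall>P\<in>pairs Z. linear_order_on (pair_places Z P) (Q P))"

definition smaller_place :: "'i arc \<Rightarrow> 'i pair_ord \<Rightarrow> nat \<Rightarrow> 'i pt" where
  "smaller_place Z ord P =
     (THE p. p \<in> pair_places Z P \<and> (\<forall>q\<in>pair_places Z P. (p, q) \<in> snd ord P))"

text \<open>
  The diagrams in the image of the generators under the linear map determined by the pair ordering:
  each tight H-data has exactly one such tight diagram.
\<close>

fun standard_dgm :: "'i arc \<Rightarrow> 'i pair_ord \<Rightarrow> 'i dgm \<Rightarrow> bool" where
  "standard_dgm Z ord (s, \<mu>, t) \<longleftrightarrow> tight_dgm Z (s, \<mu>, t) \<and>
     (\<forall>P \<in> s \<inter> t. doubly_occupied Z (hgrade (s, \<mu>, t)) P \<longrightarrow>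
        smaller_place Z ord P \<in> Domain \<mu> \<and> smaller_place Z ord P \<in> Range \<mu>)"

definition astar_pair :: "'i arc \<Rightarrow> 'i pair_ord \<Rightarrow> 'i hdat \<Rightarrow> nat" where
  "astar_pair Z ord g = (case g of (h, s, t) \<Rightarrow>
     (let C = {P \<in> s \<inter> t. \<exists>p. once_occupied_at Z h P p}
      in THE P. P \<in> C \<and> (\<forall>P'\<in>C. (P, P') \<in> fst ord)))"

definition join_at :: "'i pt \<Rightarrow> 'i sdiag \<Rightarrow> 'i sdiag" where
  "join_at p \<mu> =
     {(x, y) \<in> \<mu>. x \<noteq> p \<and> y \<noteq> p} \<union> {(x, y). (x, p) \<in> \<mu> \<and> (p, y) \<in> \<mu>}"

text \<open>
  After joining, the pair P lies in both s and t but no moving strand begins or ends at it, so elt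
  supplies the dotted horizontal strands at both of its places.
\<close>

fun astar_dgm :: "'i arc \<Rightarrow> 'i pair_ord \<Rightarrow> 'i dgm \<Rightarrow> 'i chain" where
  "astar_dgm Z ord (s, \<mu>, t) =
     (let d = (s, \<mu>, t); P = astar_pair Z ord (hdata d);
          p = (THE p. once_occupied_at Z (hgrade d) P p)
      in if crossed_at Z P d then 0 else elt Z (s, join_at p \<mu>, t))"

text \<open>The diagrams occurring in the expansion of an element in the basis of diagrams.\<close>

definition dgm_support :: "'i arc \<Rightarrow> 'i chain \<Rightarrow> 'i dgm set" where
  "dgm_support Z x =
     (THE B. finite B \<and> B \<subseteq> {d. diagram Z d} \<and> x = (\<Sum>d\<in>B. elt Z d))"

definition astar :: "'i arc \<Rightarrow> 'i pair_ord \<Rightarrow> 'i chain \<Rightarrow> 'i chain" where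
  "astar Z ord x = (\<Sum>d\<in>dgm_support Z x. astar_dgm Z ord d)"


section \<open>A-infinity structures and morphisms\<close>

text \<open>
  A family of n-ary multilinear operations, for n at least 1, is a function on nonempty lists whose
  value on lists of length n is the n-ary operation.  Additivity is linearity over the field with
  two elements, and there are no signs.
\<close>

definition multiadditive ::
  "'i arc \<Rightarrow> ('i chain set list \<Rightarrow> 'b::plus) \<Rightarrow> bool" where
  "multiadditive Z F \<longleftrightarrow> (\<forall>xs\<in>lists (homology Z). \<forall>ys\<in>lists (homology Z).
     \<forall>a\<in>homology Z. \<forall>b\<in>homology Z.
       F (xs @ (a + b) # ys) = F (xs @ a # ys) + F (xs @ b # ys))"

definition insert_op :: "('a list \<Rightarrow> 'a) \<Rightarrow> nat \<Rightarrow> nat \<Rightarrow> 'a list \<Rightarrow> 'a list" where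
  "insert_op X k j M = take k M @ X (take j (drop k M)) # drop (k + j) M"

definition ainf_structure ::
  "'i arc \<Rightarrow> ('i chain set list \<Rightarrow> 'i chain set) \<Rightarrow> bool" where
  "ainf_structure Z X \<longleftrightarrow>
     (\<forall>M\<in>lists (homology Z). M \<noteq> [] \<longrightarrow> X M \<in> homology Z) \<and> multiadditive Z X \<and>
     (\<forall>M\<in>lists (homology Z). M \<noteq> [] \<longrightarrow>
        (\<Sum>(j, k) \<in> {(j, k). 1 \<le> j \<and> j + k \<le> length M}. X (insert_op X k j M)) = hzero Z)"

definition ainf_morphism ::
  "'i arc \<Rightarrow> ('i chain set list \<Rightarrow> 'i chain set) \<Rightarrow> ('i chain set list \<Rightarrow> 'i chain) \<Rightarrow> bool" where
  "ainf_morphism Z X f \<longleftrightarrow>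
     (\<forall>M\<in>lists (homology Z). M \<noteq> [] \<longrightarrow> f M \<in> strand_alg Z) \<and> multiadditive Z f \<and>
     (\<forall>M\<in>lists (homology Z). M \<noteq> [] \<longrightarrow>
        (\<Sum>(j, k) \<in> {(j, k). 1 \<le> j \<and> j + k \<le> length M}. f (insert_op X k j M)) =
        bd (f M) + (\<Sum>j = 1..<length M. mult (f (take j M)) (f (drop j M))))"

definition U_op :: "('i chain set list \<Rightarrow> 'i chain set) \<Rightarrow> ('i chain set list \<Rightarrow> 'i chain) \<Rightarrow>
    'i chain set list \<Rightarrow> 'i chain" where
  "U_op X f M =
     (\<Sum>j = 1..<length M. mult (f (take j M)) (f (drop j M))) +
     (\<Sum>(j, k) \<in> {(j, k). 2 \<le> j \<and> j + 1 \<le> length M \<and> j + k \<le> length M}. f (insert_op X k j M))"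

definition arises_from :: "'i arc \<Rightarrow> 'i pair_ord \<Rightarrow>
    ('i chain set list \<Rightarrow> 'i chain set) \<Rightarrow> ('i chain set list \<Rightarrow> 'i chain) \<Rightarrow> bool" where
  "arises_from Z ord X f \<longleftrightarrow>
     ainf_structure Z X \<and> ainf_morphism Z X f \<and>
     (\<forall>c\<in>homology Z. X [c] = hzero Z) \<and>
     (\<forall>x\<in>strand_alg Z. \<forall>y\<in>strand_alg Z. bd x = 0 \<longrightarrow> bd y = 0 \<longrightarrow>
        X [hclass Z x, hclass Z y] = hclass Z (mult x y)) \<and>
     (\<forall>d. standard_dgm Z ord d \<longrightarrow> f [hclass Z (elt Z d)] = elt Z d) \<and>
     (\<forall>M\<in>lists (homology Z). 2 \<le> length M \<longrightarrow> X M = hclass Z (U_op X f M)) \<and>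
     (\<forall>M\<in>lists (dgm_classes Z). M \<noteq> [] \<longrightarrow>
        (\<not> viable Z M \<longrightarrow> bar Z (f M) = ideal_F Z \<and> X M = hzero Z) \<and>
        (mismatch Z M \<longrightarrow> f M = 0) \<and>
        X M \<in> hclass Z ` {x \<in> graded_summand Z (tensor_hdata Z M)
                 (tensor_maslov Z M + of_nat (length M) - 2). bd x = 0} \<and>
        f M \<in> graded_summand Z (tensor_hdata Z M) (tensor_maslov Z M + of_nat (length M) - 1) \<and>
        (2 \<le> length M \<longrightarrow> f [X M] - U_op X f M = 0 \<longrightarrow> f M = 0) \<and>
        (2 \<le> length M \<longrightarrow> viable Z M \<longrightarrow> twisted_hdata Z (tensor_hdata Z M) \<longrightarrow>
           f M = astar Z ord (f [X M] - U_op X f M)))"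


section \<open>Operation trees\<close>

text \<open>The label of a vertex is the list of the leaves at or below it.\<close>

datatype 'a optree = Leaf 'a | Node "'a optree" "'a optree"

primrec label :: "'a optree \<Rightarrow> 'a list" where
  "label (Leaf c) = [c]"
| "label (Node l r) = label l @ label r"

primrec vertices :: "'a optree \<Rightarrow> 'a optree set" where
  "vertices (Leaf c) = {Leaf c}"
| "vertices (Node l r) = insert (Node l r) (vertices l \<union> vertices r)"

definition operation_tree :: "'i arc \<Rightarrow> 'i chain set list \<Rightarrow> 'i chain set optree \<Rightarrow> bool" where
  "operation_tree Z M T \<longleftrightarrow> label T = M \<and> set M \<subseteq> dgm_classes Z \<and>
     (\<forall>v\<in>vertices T. viable Z (label v))"

definition valid_tree :: "'i arc \<Rightarrow> 'i chain set optree \<Rightarrow> bool" where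
  "valid_tree Z T \<longleftrightarrow> (\<forall>v\<in>vertices T. \<not> singular_tensor Z (label v))"

definition distributive_tree :: "'i arc \<Rightarrow> 'i chain set optree \<Rightarrow> bool" where
  "distributive_tree Z T \<longleftrightarrow> (\<forall>v\<in>vertices T.
     length (label v) \<le>
       card {P \<in> pairs Z. twisted_at Z P (label v) \<or> critical_at Z P (label v)} + 2)"

end

theory Submission imports Defs begin

text \<open>
  A term of a viable diagram is determined, up to the choice of its dotted places, by its H-data and the
  set of places at which it is broken, i.e. where one strand ends and another begins.  The differential
  adds a break, so each summand is the cochain complex of a join of discrete sets, and the Maslov grading
  is minus the number of breaks plus a constant depending on h.  For a viable tensor product of tight classes the
  Maslov grading counts the same way the breaks that the product of the diagrams would have, and a pair
  with more such breaks than a term outside F is twisted or critical.  Since the Maslov degree of f (or X)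
  is n - 1 (or n - 2), this yields the n - 2 pairs at the root.

  A term of f applied to at least two classes is a value of A*, hence has a dotted strand at the
  pair selected by A*, and A* kills such terms.  So only the products f (M_1, ..., M_j) f (M_j+1, ..., M_n) in U
  contribute terms outside F; both factors are then outside F, and induction gives trees which are joined
  at the root.
\<close>

section \<open>Chains over the field with two elements\<close>

text \<open>Why an excess of breaks makes a pair twisted or critical: if the representatives have
  product 0 on the fragment, the pair is critical, since the term, cut to the fragment, shows that
  the local H-data is realized. Otherwise the local product breaks at a pair where the term has a
  dotted strand. As the term is outside F, this pair is not doubly occupied, hence once occupied; a
  join with a one-point factor is contractible, so the product vanishes in homology. The excess is
  at most 1: two breaks force a doubly occupied pair of both idempotents, and there a term outside F
  breaks as well. So degrees count pairs, and n - 2, the weaker of the two degrees, serves f and X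
  alike. Two obstacles shape the proof. Representatives are arbitrary choices, and at a doubly
  occupied pair only the number of breaks on the pair, not their position, is determined by the
  H-data. And a class in the list is not given with a tight representative; that it has one is
  deduced from f of the class lying outside F.\<close>

abbreviation keys :: "('a \<Rightarrow>\<^sub>0 bit) \<Rightarrow> 'a set" where
  "keys \<equiv> Poly_Mapping.keys"

abbreviation lookup :: "('a \<Rightarrow>\<^sub>0 bit) \<Rightarrow> 'a \<Rightarrow> bit" where
  "lookup \<equiv> Poly_Mapping.lookup"

declare add_bit_eq_xor [simp del] mult_bit_eq_and [simp del]

lemma lookup_bit: "lookup (x :: 'a \<Rightarrow>\<^sub>0 bit) a = of_bool (a \<in> keys x)"
proof (cases "a \<in> keys x")
  case True
  then have "lookup x a \<noteq> 0" unfolding in_keys_iff .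
  then have "lookup x a = 1" by (metis bit.exhaust)
  with True show ?thesis by simp
next
  case False
  then have "lookup x a = 0" unfolding in_keys_iff by blast
  with False show ?thesis by simp
qed

lemma chain_add_self [simp]: "(x :: 'a \<Rightarrow>\<^sub>0 bit) + x = 0"
  by (rule poly_mapping_eqI) (simp add: lookup_add)

lemma chain_add_self_left [simp]: "(x :: 'a \<Rightarrow>\<^sub>0 bit) + (x + y) = y"
  by (simp flip: add.assoc)

lemma chain_uminus [simp]: "- (x :: 'a \<Rightarrow>\<^sub>0 bit) = x"
  by (rule minus_unique) simp

lemma chain_minus [simp]: "(x :: 'a \<Rightarrow>\<^sub>0 bit) - y = x + y"
  by (simp only: diff_conv_add_uminus chain_uminus)

lemma chain_eqI: "keys x = keys y \<Longrightarrow> x = y" for x y :: "'a \<Rightarrow>\<^sub>0 bit"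
  by (rule poly_mapping_eqI) (simp add: lookup_bit)

text \<open>Over two elements a chain is its set of keys and addition is symmetric difference, so
  chains are handled through their supports throughout.\<close>

lemma keys_chain_add: "keys (x + y) = (keys x - keys y) \<union> (keys y - keys x)"
  for x y :: "'a \<Rightarrow>\<^sub>0 bit"
proof (rule set_eqI)
  fix a
  have "a \<in> keys (x + y) \<longleftrightarrow> lookup x a + lookup y a \<noteq> 0"
    by (simp add: in_keys_iff lookup_add)
  then show "a \<in> keys (x + y) \<longleftrightarrow> a \<in> (keys x - keys y) \<union> (keys y - keys x)"
    by (auto simp: lookup_bit)
qed

lemma lookup_sum_chain: "lookup (\<Sum>i\<in>I. x i) a = (\<Sum>i\<in>I. lookup (x i) a)"
  by (induction I rule: infinite_finite_induct) (auto simp: lookup_add)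

lemma keys_sumD: "a \<in> keys (\<Sum>i\<in>I. x i) \<Longrightarrow> \<exists>i\<in>I. a \<in> keys (x i)" for x :: "'i \<Rightarrow> 'a \<Rightarrow>\<^sub>0 bit"
  unfolding in_keys_iff lookup_sum_chain by (meson sum.neutral)

lemma keys_basis [simp]: "keys (basis \<phi>) = {\<phi>}"
  by (simp add: basis_def)

lemma keys_basis_sum: "finite A \<Longrightarrow> keys (\<Sum>\<phi>\<in>A. basis \<phi>) = A"
  by (induction A rule: finite_induct) (auto simp: keys_chain_add)

text \<open>Without overlap nothing can cancel modulo 2; this is how supports of sums of diagrams
  and of products are computed.\<close>

lemma keys_disjoint_sum:
  fixes x :: "'i \<Rightarrow> 'a \<Rightarrow>\<^sub>0 bit"
  assumes "finite I" and "\<And>i j. i \<in> I \<Longrightarrow> j \<in> I \<Longrightarrow> i \<noteq> j \<Longrightarrow> keys (x i) \<inter> keys (x j) = {}"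
  shows "keys (\<Sum>i\<in>I. x i) = (\<Union>i\<in>I. keys (x i))"
  using assms
proof (induction I rule: finite_induct)
  case (insert i I)
  then have IH: "keys (sum x I) = (\<Union>i\<in>I. keys (x i))" by blast
  have "keys (x i) \<inter> keys (x j) = {}" if "j \<in> I" for j
    using insert that by blast
  with IH have "keys (x i) \<inter> keys (sum x I) = {}" by blast
  then show ?case using insert IH by (auto simp: keys_chain_add)
qed simp

section \<open>Linear extension of maps on strand diagrams, and projections\<close>

definition lin :: "('a \<Rightarrow> 'b \<Rightarrow>\<^sub>0 bit) \<Rightarrow> ('a \<Rightarrow>\<^sub>0 bit) \<Rightarrow> 'b \<Rightarrow>\<^sub>0 bit" where
  "lin F x = (\<Sum>a\<in>keys x. F a)"

lemma lin_superset: "finite K \<Longrightarrow> keys x \<subseteq> K \<Longrightarrow> lin F x = (\<Sum>a\<in>K. if a \<in> keys x then F a else 0)"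
  unfolding lin_def by (rule sum.mono_neutral_cong_left) auto

text \<open>A key common to \<open>x\<close> and \<open>y\<close> drops out on the left and
  contributes \<open>F a + F a = 0\<close> on the right.\<close>

lemma lin_add: "lin F (x + y) = lin F x + lin F y"
proof -
  let ?K = "keys x \<union> keys y"
  have "lin F (x + y) = (\<Sum>a\<in>?K. if a \<in> keys (x + y) then F a else 0)"
    by (rule lin_superset) (auto simp: keys_chain_add)
  also have "\<dots> = (\<Sum>a\<in>?K. (if a \<in> keys x then F a else 0) + (if a \<in> keys y then F a else 0))"
    by (rule sum.cong) (auto simp: keys_chain_add)
  also have "\<dots> = lin F x + lin F y"
    by (simp add: sum.distrib lin_superset[of ?K])
  finally show ?thesis .
qed

lemma lin_0 [simp]: "lin F 0 = 0"
  by (simp add: lin_def)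

lemma lin_basis [simp]: "lin F (basis \<phi>) = F \<phi>"
  by (simp add: lin_def)

lemma lin_sum: "lin F (\<Sum>i\<in>I. x i) = (\<Sum>i\<in>I. lin F (x i))"
  by (induction I rule: infinite_finite_induct) (auto simp: lin_add)

lemma bd_lin: "bd = lin bd_basis"
  by (simp add: fun_eq_iff bd_def lin_def)

lemma bd_add: "bd (x + y) = bd x + bd y"
  by (simp add: bd_lin lin_add)

lemma bd_0 [simp]: "bd 0 = 0"
  by (simp add: bd_lin)

lemma mult_sum_left: "mult (\<Sum>i\<in>I. basis (a i)) y = (\<Sum>i\<in>I. mult (basis (a i)) y)"
proof -
  have "(\<lambda>x. mult x y) = lin (\<lambda>\<phi>. \<Sum>\<psi>\<in>keys y. mult_basis \<phi> \<psi>)"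
    by (simp add: fun_eq_iff mult_def lin_def)
  then have "mult x y = lin (\<lambda>\<phi>. \<Sum>\<psi>\<in>keys y. mult_basis \<phi> \<psi>) x" for x
    by (rule fun_cong)
  then show ?thesis by (simp add: lin_sum)
qed

lemma mult_sum_right: "mult (basis \<phi>) (\<Sum>i\<in>I. basis (b i)) = (\<Sum>i\<in>I. mult_basis \<phi> (b i))"
proof -
  have "mult (basis \<phi>) y = lin (mult_basis \<phi>) y" for y
    by (simp add: mult_def lin_def)
  then show ?thesis by (simp add: lin_sum)
qed

lemma keys_multD:
  assumes "\<chi> \<in> keys (mult x y)"
  obtains \<phi> \<psi> where "\<phi> \<in> keys x" "\<psi> \<in> keys y" "Range \<phi> = Domain \<psi>"
    "inv_count (\<phi> O \<psi>) = inv_count \<phi> + inv_count \<psi>" "\<chi> = \<phi> O \<psi>"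
proof -
  from assms obtain \<phi> where \<phi>: "\<phi> \<in> keys x" "\<chi> \<in> keys (\<Sum>\<psi>\<in>keys y. mult_basis \<phi> \<psi>)"
    unfolding mult_def by (blast dest: keys_sumD)
  then obtain \<psi> where "\<psi> \<in> keys y" "\<chi> \<in> keys (mult_basis \<phi> \<psi>)"
    by (blast dest: keys_sumD)
  with \<phi>(1) that show ?thesis by (auto simp: mult_basis_def split: if_splits)
qed

text \<open>Projection onto a set of strand diagrams; it isolates the part of an element with given
  H-data.\<close>

definition restr :: "'a set \<Rightarrow> ('a \<Rightarrow>\<^sub>0 bit) \<Rightarrow> 'a \<Rightarrow>\<^sub>0 bit" where
  "restr A x = Poly_Mapping.mapp (\<lambda>a c. if a \<in> A then c else 0) x"

lemma keys_restr [simp]: "keys (restr A x) = keys x \<inter> A"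
  by (auto simp: restr_def in_keys_iff lookup_mapp when_def split: if_splits)

lemma restr_add: "restr A (x + y) = restr A x + restr A y"
  by (rule chain_eqI) (auto simp: keys_chain_add)

lemma restr_0 [simp]: "restr A 0 = 0"
  by (rule chain_eqI) simp

lemma restr_sum: "restr A (\<Sum>i\<in>I. x i) = (\<Sum>i\<in>I. restr A (x i))"
  by (induction I rule: infinite_finite_induct) (auto simp: restr_add)

lemma restr_id: "keys x \<subseteq> A \<Longrightarrow> restr A x = x"
  by (rule chain_eqI) auto

lemma restr_disjoint: "keys x \<inter> A = {} \<Longrightarrow> restr A x = 0"
  by (rule chain_eqI) auto

text \<open>Lets a chain be prescribed by its support, as for the cone in the contraction of a
  pair.\<close>

lemma finite_chain_of:
  assumes "finite K"
  obtains x :: "'a \<Rightarrow>\<^sub>0 bit" where "keys x = K"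
proof -
  have "finite {a. (of_bool (a \<in> K) :: bit) \<noteq> 0}"
    using assms by simp
  then have "lookup (Abs_poly_mapping (\<lambda>a. of_bool (a \<in> K) :: bit)) = (\<lambda>a. of_bool (a \<in> K))"
    by (rule lookup_Abs_poly_mapping)
  then have "keys (Abs_poly_mapping (\<lambda>a. of_bool (a \<in> K) :: bit)) = K"
    by (auto simp: in_keys_iff)
  with that show ?thesis .
qed

section \<open>Thin families of strands\<close>

declare split_paired_All [simp del] split_paired_Ex [simp del]

definition cvr :: "'i pt \<times> 'i pt \<Rightarrow> 'i pt \<Rightarrow> bool" where
  "cvr \<sigma> e \<longleftrightarrow> fst (fst \<sigma>) = fst e \<and> snd (fst \<sigma>) \<le> snd e \<and> snd e < snd (snd \<sigma>)"

text \<open>The conditions on a strand diagram that do not refer to \<open>Z\<close>, so that single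
  terms of an arc diagram and of its fragments are treated alike.\<close>

definition strands :: "'i sdiag \<Rightarrow> bool" where
  "strands \<phi> \<longleftrightarrow> finite \<phi> \<and> single_valued \<phi> \<and> single_valued (\<phi>\<inverse>) \<and> (\<forall>(x, y)\<in>\<phi>. pt_le x y)"

definition hg :: "'i sdiag \<Rightarrow> 'i pt \<Rightarrow> int" where
  "hg \<phi> e = int (card {\<sigma>\<in>\<phi>. cvr \<sigma> e})"

definition mv :: "'i sdiag \<Rightarrow> 'i sdiag" where
  "mv \<phi> = {(x, y)\<in>\<phi>. x \<noteq> y}"

definition broken :: "'i sdiag \<Rightarrow> 'i pt set" where
  "broken \<phi> = {p. \<exists>x y. (x, p) \<in> \<phi> \<and> (p, y) \<in> \<phi> \<and> x \<noteq> p \<and> p \<noteq> y}"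

text \<open>Steps are named by their starting points: \<open>prv p\<close> is the step ending at
  \<open>p\<close>, and \<open>p\<close> itself the step beginning there. Subtraction stops at 0,
  hence the side conditions \<open>1 \<le> snd p\<close>.\<close>

abbreviation prv :: "'i pt \<Rightarrow> 'i pt" where
  "prv p \<equiv> (fst p, snd p - 1)"

text \<open>This is viability of the H-grading, stated for the strands of a term.\<close>

definition thin :: "'i sdiag \<Rightarrow> bool" where
  "thin \<phi> \<longleftrightarrow> strands \<phi> \<and> (\<forall>\<sigma>\<in>\<phi>. \<forall>\<tau>\<in>\<phi>. \<forall>e. cvr \<sigma> e \<longrightarrow> cvr \<tau> e \<longrightarrow> \<sigma> = \<tau>)"

definition stp :: "'i sdiag \<Rightarrow> 'i pt \<Rightarrow> bool" where
  "stp \<phi> e \<longleftrightarrow> (\<exists>\<sigma>\<in>\<phi>. cvr \<sigma> e)"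

lemma strandsD:
  assumes "strands \<phi>"
  shows "finite \<phi>" "(x, y) \<in> \<phi> \<Longrightarrow> (x, z) \<in> \<phi> \<Longrightarrow> y = z" "(x, z) \<in> \<phi> \<Longrightarrow> (y, z) \<in> \<phi> \<Longrightarrow> x = y"
    "(x, y) \<in> \<phi> \<Longrightarrow> fst x = fst y \<and> snd x \<le> snd y"
  using assms unfolding strands_def single_valued_def pt_le_def by blast+

lemma strands_moving:
  assumes "strands \<phi>" "(x, y) \<in> \<phi>" "x \<noteq> y"
  shows "fst x = fst y" "snd x < snd y"
  using strandsD(4)[OF assms(1,2)] assms(3) by (auto simp: prod_eq_iff)

lemma thin_strands: "thin \<phi> \<Longrightarrow> strands \<phi>"
  by (simp add: thin_def)

lemma thin_unique:
  "thin \<phi> \<Longrightarrow> (x, y) \<in> \<phi> \<Longrightarrow> (x', y') \<in> \<phi> \<Longrightarrow> cvr (x, y) e \<Longrightarrow> cvr (x', y') e \<Longrightarrow> x = x' \<and> y = y'"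
  unfolding thin_def by blast

lemma thin_hg:
  assumes "thin \<phi>"
  shows "hg \<phi> e = of_bool (stp \<phi> e)"
proof (cases "stp \<phi> e")
  case True
  then obtain \<sigma> where \<sigma>: "\<sigma> \<in> \<phi>" "cvr \<sigma> e" by (auto simp: stp_def)
  with assms have "{\<tau>\<in>\<phi>. cvr \<tau> e} = {\<sigma>}" unfolding thin_def by blast
  with True show ?thesis by (simp add: hg_def)
next
  case False
  then have "{\<tau>\<in>\<phi>. cvr \<tau> e} = {}" by (auto simp: stp_def)
  with False show ?thesis by (simp only: hg_def) simp
qed

lemma hg_thin:
  assumes "strands \<phi>" "\<And>e. hg \<phi> e \<le> 1"
  shows "thin \<phi>"
  unfolding thin_def
proof (intro conjI assms ballI allI impI)
  fix \<sigma> \<tau> e assume "\<sigma> \<in> \<phi>" "\<tau> \<in> \<phi>" "cvr \<sigma> e" "cvr \<tau> e"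
  moreover have "card {\<sigma>\<in>\<phi>. cvr \<sigma> e} \<le> 1" using assms(2)[of e] by (simp add: hg_def)
  moreover have "finite {\<sigma>\<in>\<phi>. cvr \<sigma> e}" using assms(1) by (simp add: strands_def)
  ultimately show "\<sigma> = \<tau>" using card_le_Suc0_iff_eq[of "{\<sigma>\<in>\<phi>. cvr \<sigma> e}"] by simp
qed

lemma hg_mv: "hg (mv \<phi>) = hg \<phi>"
proof
  fix e
  have "{\<sigma>\<in>mv \<phi>. cvr \<sigma> e} = {\<sigma>\<in>\<phi>. cvr \<sigma> e}" by (auto simp: mv_def cvr_def)
  then show "hg (mv \<phi>) e = hg \<phi> e" by (simp add: hg_def)
qed

lemma broken_mv: "broken (mv \<phi>) = broken \<phi>"
  by (auto simp: broken_def mv_def)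

lemma broken_iff: "p \<in> broken \<phi> \<longleftrightarrow> p \<in> Domain (mv \<phi>) \<and> p \<in> Range (mv \<phi>)"
  by (auto simp: broken_def mv_def)

lemma hgrade_hg: "hgrade (s, \<mu>, t) = hg \<mu>"
proof
  fix e :: "'a pt"
  obtain i j where "e = (i, j)" by fastforce
  moreover have "{(x, y) \<in> \<mu>. fst x = i \<and> snd x \<le> j \<and> j < snd y} = {\<sigma>\<in>\<mu>. cvr \<sigma> (i, j)}"
    by (auto simp: cvr_def)
  ultimately show "hgrade (s, \<mu>, t) e = hg \<mu> e" by (simp add: hg_def)
qed

lemma mvD:
  assumes "strands \<phi>" "(x, y) \<in> mv \<phi>"
  shows "(x, y) \<in> \<phi>" "fst x = fst y" "snd x < snd y"
  using assms strands_moving[of \<phi> x y] by (auto simp: mv_def)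

lemma start_stp:
  assumes "strands \<phi>" "p \<in> Domain (mv \<phi>)"
  shows "stp \<phi> p"
proof -
  from assms(2) obtain y where "(p, y) \<in> mv \<phi>" by blast
  note y = mvD[OF assms(1) this]
  then have "cvr (p, y) p" by (simp add: cvr_def)
  with y(1) show ?thesis unfolding stp_def by blast
qed

lemma end_stp:
  assumes "strands \<phi>" "p \<in> Range (mv \<phi>)"
  shows "stp \<phi> (prv p)" "1 \<le> snd p"
proof -
  from assms(2) obtain x where "(x, p) \<in> mv \<phi>" by blast
  note x = mvD[OF assms(1) this]
  then show "1 \<le> snd p" by linarith
  from x have "cvr (x, p) (prv p)" by (auto simp: cvr_def)
  with x(1) show "stp \<phi> (prv p)" unfolding stp_def by blast
qed

lemma stp_passing:
  assumes "strands \<phi>" "stp \<phi> p" "p \<notin> Domain (mv \<phi>)"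
  obtains x y where "(x, y) \<in> \<phi>" "pt_less x p" "pt_less p y"
proof -
  from assms(2) obtain x y where xy: "(x, y) \<in> \<phi>" "cvr (x, y) p" by (auto simp: stp_def)
  have "x \<noteq> p"
  proof
    assume "x = p"
    with xy have "(p, y) \<in> mv \<phi>" by (auto simp: mv_def cvr_def)
    with assms(3) show False by blast
  qed
  with xy strandsD(4)[OF assms(1) xy(1)] show ?thesis
    by (intro that[of x y]) (auto simp: cvr_def pt_less_def prod_eq_iff)
qed

lemma prv_passing:
  assumes "strands \<phi>" "stp \<phi> (prv p)" "1 \<le> snd p" "p \<notin> Range (mv \<phi>)"
  obtains x y where "(x, y) \<in> \<phi>" "pt_less x p" "pt_less p y"
proof -
  from assms(2) obtain x y where xy: "(x, y) \<in> \<phi>" "cvr (x, y) (prv p)" by (auto simp: stp_def)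
  note le = strandsD(4)[OF assms(1) xy(1)]
  have "y \<noteq> p"
  proof
    assume "y = p"
    with xy assms(3) have "(x, p) \<in> mv \<phi>" by (auto simp: mv_def cvr_def)
    with assms(4) show False by blast
  qed
  with xy le assms(3) show ?thesis
    by (intro that[of x y]) (auto simp: cvr_def pt_less_def prod_eq_iff)
qed

lemma passing_cvr:
  assumes "pt_less x p" "pt_less p y"
  shows "cvr (x, y) p" "cvr (x, y) (prv p)"
  using assms by (auto simp: cvr_def pt_less_def)

lemma passing_stp:
  assumes "(x, y) \<in> \<phi>" "pt_less x p" "pt_less p y"
  shows "stp \<phi> p" "stp \<phi> (prv p)"
  using assms(1) passing_cvr[OF assms(2,3)] unfolding stp_def by blast+

text \<open>A moving strand that starts or ends at \<open>p\<close> covers one of the two steps at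
  \<open>p\<close>, and the passing strand already covers both.\<close>

lemma passing_free:
  assumes "thin \<phi>" "(x, y) \<in> \<phi>" "pt_less x p" "pt_less p y"
  shows "p \<notin> Domain (mv \<phi>)" "p \<notin> Range (mv \<phi>)"
proof -
  note st = thin_strands[OF assms(1)]
  show "p \<notin> Domain (mv \<phi>)"
  proof
    assume "p \<in> Domain (mv \<phi>)"
    then obtain z where z: "(p, z) \<in> \<phi>" "p \<noteq> z" by (auto simp: mv_def)
    then have "cvr (p, z) p" using strands_moving[OF st z] by (simp add: cvr_def)
    from thin_unique[OF assms(1,2) z(1) passing_cvr(1)[OF assms(3,4)] this] assms(3) show False
      by (simp add: pt_less_def)
  qed
  show "p \<notin> Range (mv \<phi>)"
  proof
    assume "p \<in> Range (mv \<phi>)"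
    then obtain z where z: "(z, p) \<in> \<phi>" "z \<noteq> p" by (auto simp: mv_def)
    then have "cvr (z, p) (prv p)" using strands_moving[OF st z] by (auto simp: cvr_def)
    from thin_unique[OF assms(1,2) z(1) passing_cvr(2)[OF assms(3,4)] this] assms(4) show False
      by (simp add: pt_less_def)
  qed
qed

text \<open>Otherwise the strand covering the step before \<open>p\<close> would pass
  \<open>p\<close>, where another strand begins.\<close>

lemma start_prv_broken:
  assumes "thin \<phi>" "p \<in> Domain (mv \<phi>)" "stp \<phi> (prv p)" "1 \<le> snd p"
  shows "p \<in> broken \<phi>"
proof (rule ccontr)
  assume "p \<notin> broken \<phi>"
  with assms(2) have "p \<notin> Range (mv \<phi>)" by (simp add: broken_iff)
  with prv_passing[OF thin_strands] assms obtain x y where "(x, y) \<in> \<phi>" "pt_less x p" "pt_less p y"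
    by blast
  with passing_free[OF assms(1)] assms(2) show False by blast
qed

lemma end_stp_broken:
  assumes "thin \<phi>" "p \<in> Range (mv \<phi>)" "stp \<phi> p"
  shows "p \<in> broken \<phi>"
proof (rule ccontr)
  assume "p \<notin> broken \<phi>"
  with assms(2) have "p \<notin> Domain (mv \<phi>)" by (simp add: broken_iff)
  with stp_passing[OF thin_strands] assms obtain x y where "(x, y) \<in> \<phi>" "pt_less x p" "pt_less p y"
    by blast
  with passing_free[OF assms(1)] assms(2) show False by blast
qed

lemma horizontal_free:
  assumes "strands \<phi>" "(p, p) \<in> \<phi>"
  shows "p \<notin> Domain (mv \<phi>)" "p \<notin> Range (mv \<phi>)"
  using assms strandsD[OF assms(1)] by (auto simp: mv_def)

lemma horizontal_stp:
  assumes "strands \<phi>" "(p, p) \<in> \<phi>" "1 \<le> snd p"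
  shows "stp \<phi> (prv p) \<longleftrightarrow> stp \<phi> p"
proof
  assume "stp \<phi> (prv p)"
  with prv_passing[OF assms(1)] horizontal_free[OF assms(1,2)] assms(3) show "stp \<phi> p"
    by (metis passing_stp(1))
next
  assume "stp \<phi> p"
  with stp_passing[OF assms(1)] horizontal_free[OF assms(1,2)] show "stp \<phi> (prv p)"
    by (metis passing_stp(2))
qed

text \<open>Of two crossing strands one is nested inside the other; if the inner one moved, both
  would cover its first step.\<close>

lemma thin_crossings:
  assumes "thin \<phi>"
  shows "crossings \<phi> =
    {((x, y), (p, p)) |x y p. (x, y) \<in> \<phi> \<and> (p, p) \<in> \<phi> \<and> pt_less x p \<and> pt_less p y}"
proof -
  have "x' = y'" if "(x, y) \<in> \<phi>" "(x', y') \<in> \<phi>" "pt_less x x'" "pt_less y' y" for x y x' y'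
  proof (rule ccontr)
    assume ne: "x' \<noteq> y'"
    note * = strands_moving[OF thin_strands[OF assms] that(2) ne]
    have "x = x' \<and> y = y'"
      by (rule thin_unique[OF assms that(1,2), of x']) (use that * in \<open>auto simp: cvr_def pt_less_def\<close>)
    with that show False by (simp add: pt_less_def)
  qed
  then show ?thesis unfolding crossings_def by fast
qed

text \<open>Only one strand can pass a given horizontal strand, so a crossing is known from the
  place where it lies.\<close>

lemma thin_inv_count:
  assumes "thin \<phi>"
  shows "inv_count \<phi> = card {p. (p, p) \<in> \<phi> \<and> stp \<phi> p}"
proof -
  have "bij_betw (\<lambda>c. fst (snd c)) (crossings \<phi>) {p. (p, p) \<in> \<phi> \<and> stp \<phi> p}"
    unfolding bij_betw_def
  proof
    show "inj_on (\<lambda>c. fst (snd c)) (crossings \<phi>)"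
    proof (rule inj_onI)
      fix c c' assume "c \<in> crossings \<phi>" "c' \<in> crossings \<phi>" and eq: "fst (snd c) = fst (snd c')"
      then obtain x y p x' y' p' where c: "c = ((x, y), (p, p))" "c' = ((x', y'), (p', p'))"
        "(x, y) \<in> \<phi>" "pt_less x p" "pt_less p y" "(x', y') \<in> \<phi>" "pt_less x' p'" "pt_less p' y'"
        unfolding thin_crossings[OF assms] by blast
      then have "x = x' \<and> y = y'" using eq
        by (intro thin_unique[OF assms, of _ _ _ _ p]) (auto simp: passing_cvr)
      with c eq show "c = c'" by simp
    qed
    show "(\<lambda>c. fst (snd c)) ` crossings \<phi> = {p. (p, p) \<in> \<phi> \<and> stp \<phi> p}"
    proof safe
      fix p assume p: "(p, p) \<in> \<phi>" "stp \<phi> p"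
      then obtain x y where "(x, y) \<in> \<phi>" "pt_less x p" "pt_less p y"
        using stp_passing horizontal_free(1) thin_strands assms by metis
      with p have "((x, y), (p, p)) \<in> crossings \<phi>"
        unfolding thin_crossings[OF assms] by blast
      then show "p \<in> (\<lambda>c. fst (snd c)) ` crossings \<phi>" by force
    qed (auto simp: thin_crossings[OF assms] passing_stp)
  qed
  then show ?thesis unfolding inv_count_def by (rule bij_betw_same_card)
qed

lemma thin_crossings_empty:
  assumes "thin \<phi>"
  shows "crossings \<phi> = {} \<longleftrightarrow> (\<nexists>p. (p, p) \<in> \<phi> \<and> stp \<phi> p)"
proof -
  note st = thin_strands[OF assms]
  have "finite (crossings \<phi>)"
    by (rule finite_subset[of _ "\<phi> \<times> \<phi>"]) (use strandsD(1)[OF st] in \<open>auto simp: crossings_def\<close>)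
  moreover have "finite {p. (p, p) \<in> \<phi> \<and> stp \<phi> p}"
    by (rule finite_subset[of _ "Domain \<phi>"]) (use strandsD(1)[OF st] in \<open>auto intro: finite_Domain\<close>)
  ultimately show ?thesis
    using thin_inv_count[OF assms] unfolding inv_count_def by (metis (no_types, lifting) card_eq_0_iff empty_Collect_eq)
qed

text \<open>The covered steps form runs, which the breaks cut into strands. A start of \<phi> that
  \<psi> passes is covered on both sides, hence a break of \<phi> and so of \<psi>, which is absurd;
  and of two strands with the same start the shorter would end at a break inside the longer.\<close>

lemma mv_subset:
  assumes thin: "thin \<phi>" "thin \<psi>" and st: "stp \<phi> = stp \<psi>" and br: "broken \<phi> = broken \<psi>"
  shows "mv \<phi> \<subseteq> mv \<psi>"
proof clarify
  fix x y assume xy: "(x, y) \<in> mv \<phi>"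
  then have xy': "(x, y) \<in> \<phi>" "x \<noteq> y" by (auto simp: mv_def)
  note sphi = thin_strands[OF thin(1)] and spsi = thin_strands[OF thin(2)]
  note lt = strands_moving[OF sphi xy']
  have "stp \<psi> x" using start_stp[OF sphi DomainI[OF xy]] st by simp
  have "x \<in> Domain (mv \<psi>)"
  proof (rule ccontr)
    assume n: "x \<notin> Domain (mv \<psi>)"
    then obtain a b where ab: "(a, b) \<in> \<psi>" "pt_less a x" "pt_less x b"
      using stp_passing[OF spsi \<open>stp \<psi> x\<close>] by blast
    then have "stp \<phi> (prv x)" using passing_stp(2) st by metis
    moreover have "1 \<le> snd x" using ab(2) by (simp add: pt_less_def)
    ultimately have "x \<in> broken \<phi>" using start_prv_broken[OF thin(1)] xy by blast
    with br n show False by (simp add: broken_iff)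
  qed
  then obtain z where z: "(x, z) \<in> \<psi>" "x \<noteq> z" by (auto simp: mv_def)
  note ltz = strands_moving[OF spsi z]
  have "y = z"
  proof (rule ccontr)
    assume "y \<noteq> z"
    with lt ltz have "snd y \<noteq> snd z" by (auto simp: prod_eq_iff)
    then consider "snd y < snd z" | "snd z < snd y" by linarith
    then show False
    proof cases
      case 1
      then have pass: "pt_less x y" "pt_less y z" using lt ltz by (auto simp: pt_less_def)
      then have "stp \<phi> y" using passing_stp(1) z st by metis
      then have "y \<in> broken \<phi>" using end_stp_broken[OF thin(1)] xy by blast
      then have "y \<in> Domain (mv \<psi>)" using br by (simp add: broken_iff)
      with passing_free[OF thin(2) z(1) pass] show False by blast
    next
      case 2
      then have pass: "pt_less x z" "pt_less z y" using lt ltz by (auto simp: pt_less_def)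
      then have "stp \<psi> z" using passing_stp(1) xy' st by metis
      moreover have "z \<in> Range (mv \<psi>)" using z by (auto simp: mv_def)
      ultimately have "z \<in> broken \<psi>" using end_stp_broken[OF thin(2)] by blast
      then have "z \<in> Domain (mv \<phi>)" using br broken_iff[of z \<phi>] by simp
      with passing_free[OF thin(1) xy'(1) pass] show False by blast
    qed
  qed
  with z show "(x, y) \<in> mv \<psi>" by (simp add: mv_def)
qed

lemma mv_unique:
  "thin \<phi> \<Longrightarrow> thin \<psi> \<Longrightarrow> stp \<phi> = stp \<psi> \<Longrightarrow> broken \<phi> = broken \<psi> \<Longrightarrow> mv \<phi> = mv \<psi>"
  by (simp add: mv_subset subset_antisym)

section \<open>Diagrams and their terms\<close>

text \<open>Fragments at matched pairs satisfy these axioms as well, so that everything proved here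
  applies both to \<open>Z\<close> and to its fragments.\<close>

locale arc_frame =
  fixes Z :: "'i arc"
  assumes finite_intervals: "finite (intervals Z)"
    and matching_pairs: "matching Z ` places Z \<subseteq> pairs Z"
    and card_pair_places: "P \<in> pairs Z \<Longrightarrow> card (pair_places Z P) = 2"

lemma arc_diagram_frame: "arc_diagram Z \<Longrightarrow> arc_frame Z"
  by (simp add: arc_diagram_def arc_frame_def)

text \<open>The terms of a diagram, described without products. A term recovers its diagram through
  \<open>dg\<close>, so different diagrams have disjoint supports; this makes diagrams independent
  and turns spans of diagrams into conditions on supports.\<close>

fun dterms :: "'i arc \<Rightarrow> 'i dgm \<Rightarrow> 'i sdiag set" where
  "dterms Z (s, \<mu>, t) = {\<phi> \<in> strand_diagrams Z. mv \<phi> = \<mu> \<and> Domain \<phi> \<in> sections Z s \<and> Range \<phi> \<in> sections Z t}"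

definition dg :: "'i arc \<Rightarrow> 'i sdiag \<Rightarrow> 'i dgm" where
  "dg Z \<phi> = (matching Z ` (Domain \<phi> \<inter> places Z), mv \<phi>, matching Z ` (Range \<phi> \<inter> places Z))"

lemma sections_matching: "S \<in> sections Z s \<Longrightarrow> p \<in> S \<Longrightarrow> p \<in> places Z \<Longrightarrow> matching Z p \<in> s"
  unfolding sections_def by blast

lemma sections_ex:
  assumes "S \<in> sections Z s" "P \<in> s"
  obtains p where "p \<in> S" "p \<in> pair_places Z P"
  using assms unfolding sections_def by blast

lemma sections_unique:
  assumes "S \<in> sections Z s" "p \<in> S" "q \<in> S" "p \<in> pair_places Z P" "q \<in> pair_places Z P"
  shows "p = q"
proof -
  have "P \<in> s" using sections_matching[OF assms(1,2)] assms(4) by (auto simp: pair_places_def)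
  then have "\<exists>!p. p \<in> S \<inter> pair_places Z P" using assms(1) unfolding sections_def by blast
  with assms show ?thesis by blast
qed

lemma sections_pair: "S \<in> sections Z s \<Longrightarrow> p \<in> S \<Longrightarrow> p \<in> pair_places Z P \<Longrightarrow> P \<in> s"
  using sections_matching[of S Z s p] by (auto simp: pair_places_def)

lemma sections_image: "S \<in> sections Z s \<Longrightarrow> matching Z ` (S \<inter> places Z) = s"
proof
  assume S: "S \<in> sections Z s"
  show "matching Z ` (S \<inter> places Z) \<subseteq> s" using sections_matching[OF S] by blast
  show "s \<subseteq> matching Z ` (S \<inter> places Z)"
  proof
    fix P assume "P \<in> s"
    with S obtain p where "p \<in> S" "p \<in> pair_places Z P" by (rule sections_ex)
    then show "P \<in> matching Z ` (S \<inter> places Z)" by (auto simp: pair_places_def)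
  qed
qed

lemma sections_eq: "S \<in> sections Z s \<Longrightarrow> S \<in> sections Z s' \<Longrightarrow> s = s'"
  using sections_image by metis

lemma inv_count_Id_on [simp]: "inv_count (Id_on S) = 0"
proof -
  have "crossings (Id_on S) = {}" by (auto simp: crossings_def pt_less_def)
  then show ?thesis by (simp add: inv_count_def)
qed

lemma Id_on_comp: "Id_on S O \<phi> = \<phi>" if "S = Domain \<phi>" for \<phi> :: "'i sdiag"
  using that by auto

lemma comp_Id_on: "\<phi> O Id_on S = \<phi>" if "S = Range \<phi>" for \<phi> :: "'i sdiag"
  using that by auto

lemma mult_basis_Id_left: "mult_basis (Id_on S) \<phi> = (if S = Domain \<phi> then basis \<phi> else 0)"
  unfolding mult_basis_def by (auto simp: Id_on_comp)

lemma mult_basis_Id_right: "mult_basis \<phi> (Id_on S) = (if S = Range \<phi> then basis \<phi> else 0)"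
  unfolding mult_basis_def by (auto simp: comp_Id_on)

lemma mv_Un_Id: "mv (\<mu> \<union> Id_on U) = mv \<mu>"
  by (auto simp: mv_def)

lemma mv_decomp: "\<phi> = mv \<phi> \<union> Id_on {x. (x, x) \<in> \<phi>}"
  by (auto simp: mv_def)

lemma strand_diagrams_mv: "\<phi> \<in> strand_diagrams Z \<Longrightarrow> mv \<phi> \<in> strand_diagrams Z"
  unfolding strand_diagrams_def mv_def single_valued_def by blast

lemma mv_idem [simp]: "mv (mv \<phi>) = mv \<phi>"
  by (auto simp: mv_def)

context arc_frame
begin

lemma finite_points: "finite (points Z)"
proof -
  have "points Z = Sigma (intervals Z) (\<lambda>i. {..nplaces Z i + 1})"
    by (auto simp: points_def)
  then show ?thesis using finite_intervals by simp
qed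

lemma places_points: "places Z \<subseteq> points Z"
  by (auto simp: places_def points_def)

lemma finite_places: "finite (places Z)"
  using finite_points places_points by (rule rev_finite_subset)

lemma pair_placesE:
  assumes "p \<in> pair_places Z P"
  obtains q where "q \<in> pair_places Z P" "q \<noteq> p" "pair_places Z P = {p, q}"
proof -
  have "P \<in> pairs Z" using assms matching_pairs by (auto simp: pair_places_def)
  then obtain a b where "pair_places Z P = {a, b}" "a \<noteq> b"
    using card_pair_places by (meson card_2_iff)
  with assms that show ?thesis by (cases "p = a") auto
qed

lemma finite_pair_places: "finite (pair_places Z P)"
  by (rule finite_subset[OF _ finite_places]) (auto simp: pair_places_def)

lemma strand_diagrams_strands: "\<phi> \<in> strand_diagrams Z \<Longrightarrow> strands \<phi>"
  unfolding strand_diagrams_def strands_def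
  using finite_points by (auto intro: finite_subset)

lemma sections_finite: "finite (sections Z s)"
  by (rule finite_subset[of _ "Pow (points Z)"]) (auto simp: sections_def finite_points)

lemma finite_strand_diagrams: "finite (strand_diagrams Z)"
  by (rule finite_subset[of _ "Pow (points Z \<times> points Z)"])
    (auto simp: strand_diagrams_def finite_points)

lemma mult_idem_left:
  assumes "finite I"
  shows "mult (idem Z s) (\<Sum>i\<in>I. basis (b i)) = (\<Sum>i\<in>{i\<in>I. Domain (b i) \<in> sections Z s}. basis (b i))"
proof -
  have "mult (idem Z s) (\<Sum>i\<in>I. basis (b i)) = (\<Sum>S\<in>sections Z s. \<Sum>i\<in>I. mult_basis (Id_on S) (b i))"
    unfolding idem_def mult_sum_left mult_sum_right ..
  also have "\<dots> = (\<Sum>i\<in>I. \<Sum>S\<in>sections Z s. if S = Domain (b i) then basis (b i) else 0)"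
    unfolding mult_basis_Id_left by (rule sum.swap)
  also have "\<dots> = (\<Sum>i\<in>I. if Domain (b i) \<in> sections Z s then basis (b i) else 0)"
    by (rule sum.cong) (simp_all add: sections_finite)
  also have "\<dots> = (\<Sum>i\<in>{i\<in>I. Domain (b i) \<in> sections Z s}. basis (b i))"
    by (rule sum.inter_filter[OF assms, symmetric])
  finally show ?thesis .
qed

lemma mult_idem_right:
  assumes "finite I"
  shows "mult (\<Sum>i\<in>I. basis (b i)) (idem Z t) = (\<Sum>i\<in>{i\<in>I. Range (b i) \<in> sections Z t}. basis (b i))"
proof -
  have "mult (\<Sum>i\<in>I. basis (b i)) (idem Z t) = (\<Sum>i\<in>I. \<Sum>S\<in>sections Z t. mult_basis (b i) (Id_on S))"
    unfolding idem_def mult_sum_left mult_sum_right ..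
  also have "\<dots> = (\<Sum>i\<in>I. if Range (b i) \<in> sections Z t then basis (b i) else 0)"
    unfolding mult_basis_Id_right by (rule sum.cong) (simp_all add: sections_finite)
  also have "\<dots> = (\<Sum>i\<in>{i\<in>I. Range (b i) \<in> sections Z t}. basis (b i))"
    by (rule sum.inter_filter[OF assms, symmetric])
  finally show ?thesis .
qed

text \<open>Multiplication by idempotents only selects terms of \<open>fill\<close> by their domain
  and range. As \<open>U\<close> can be read off from \<open>\<mu> \<union> Id_on U\<close>, no two
  terms coincide and cancel.\<close>

lemma keys_elt:
  "keys (elt Z (s, \<mu>, t)) = {\<mu> \<union> Id_on U |U. U \<subseteq> points Z - (Domain \<mu> \<union> Range \<mu>) \<and>
     Domain \<mu> \<union> U \<in> sections Z s \<and> Range \<mu> \<union> U \<in> sections Z t}"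
proof -
  let ?W = "points Z - (Domain \<mu> \<union> Range \<mu>)"
  let ?b = "\<lambda>U. \<mu> \<union> Id_on U"
  have fin: "finite (Pow ?W)" using finite_points by simp
  let ?I = "{U\<in>Pow ?W. Domain (?b U) \<in> sections Z s}"
  let ?J = "{U\<in>?I. Range (?b U) \<in> sections Z t}"
  have "elt Z (s, \<mu>, t) = (\<Sum>U\<in>?J. basis (?b U))"
    using fin by (simp add: fill_def mult_idem_left mult_idem_right)
  also have "\<dots> = (\<Sum>\<phi>\<in>?b ` ?J. basis \<phi>)"
  proof -
    have "inj_on ?b (Pow ?W)"
    proof (rule inj_onI)
      fix U V assume UV: "U \<in> Pow ?W" "V \<in> Pow ?W" "?b U = ?b V"
      have "U' \<subseteq> V'" if "U' \<in> Pow ?W" "?b U' = ?b V'" for U' V'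
      proof
        fix x assume "x \<in> U'"
        then have "(x, x) \<in> ?b V'" using that(2) by blast
        moreover have "(x, x) \<notin> \<mu>" using \<open>x \<in> U'\<close> that(1) by blast
        ultimately show "x \<in> V'" by (auto simp: Id_on_iff)
      qed
      from this[of U V] this[of V U] UV show "U = V" by simp
    qed
    then have "inj_on ?b ?J" by (rule inj_on_subset) blast
    from sum.reindex[OF this, of basis] show ?thesis by simp
  qed
  finally have eq: "elt Z (s, \<mu>, t) = (\<Sum>\<phi>\<in>?b ` ?J. basis \<phi>)" .
  have "finite (?b ` ?J)" using fin by simp
  then have "keys (elt Z (s, \<mu>, t)) = ?b ` ?J" unfolding eq by (rule keys_basis_sum)
  also have "\<dots> = {\<mu> \<union> Id_on U |U. U \<subseteq> ?W \<and> Domain \<mu> \<union> U \<in> sections Z s \<and> Range \<mu> \<union> U \<in> sections Z t}"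
  proof -
    have "Domain (?b U) = Domain \<mu> \<union> U" "Range (?b U) = Range \<mu> \<union> U" for U by auto
    then show ?thesis by (simp only:) blast
  qed
  finally show ?thesis .
qed

lemma keys_elt_dterms:
  assumes "\<mu> \<in> strand_diagrams Z" "mv \<mu> = \<mu>"
  shows "keys (elt Z (s, \<mu>, t)) = dterms Z (s, \<mu>, t)"
proof
  show "keys (elt Z (s, \<mu>, t)) \<subseteq> dterms Z (s, \<mu>, t)"
  proof
    fix \<phi> assume "\<phi> \<in> keys (elt Z (s, \<mu>, t))"
    then obtain U where U: "\<phi> = \<mu> \<union> Id_on U" "U \<subseteq> points Z - (Domain \<mu> \<union> Range \<mu>)"
      "Domain \<mu> \<union> U \<in> sections Z s" "Range \<mu> \<union> U \<in> sections Z t" unfolding keys_elt by blast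
    have "\<phi> \<in> strand_diagrams Z"
      using assms(1) U(2) unfolding U(1) strand_diagrams_def single_valued_def
      by (auto simp: pt_le_def)
    with U assms show "\<phi> \<in> dterms Z (s, \<mu>, t)"
      by (simp add: mv_Un_Id Domain_Un_eq Range_Un_eq)
  qed
  show "dterms Z (s, \<mu>, t) \<subseteq> keys (elt Z (s, \<mu>, t))"
  proof
    fix \<phi> assume \<phi>: "\<phi> \<in> dterms Z (s, \<mu>, t)"
    then have st: "strands \<phi>" and mu: "mv \<phi> = \<mu>" by (auto intro: strand_diagrams_strands)
    let ?U = "{x. (x, x) \<in> \<phi>}"
    have eq: "\<phi> = \<mu> \<union> Id_on ?U" using mv_decomp[of \<phi>] mu by simp
    have "?U \<subseteq> points Z - (Domain \<mu> \<union> Range \<mu>)"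
    proof
      fix x assume "x \<in> ?U"
      then have x: "(x, x) \<in> \<phi>" by simp
      then have "x \<in> points Z" using \<phi> by (auto simp: strand_diagrams_def)
      with horizontal_free[OF st x] show "x \<in> points Z - (Domain \<mu> \<union> Range \<mu>)" by (simp add: mu)
    qed
    moreover have "Domain \<phi> = Domain \<mu> \<union> ?U" "Range \<phi> = Range \<mu> \<union> ?U"
      by (subst eq, simp add: Domain_Un_eq Range_Un_eq)+
    ultimately show "\<phi> \<in> keys (elt Z (s, \<mu>, t))"
      unfolding keys_elt using eq \<phi> by auto
  qed
qed

lemma diagram_iff:
  "diagram Z (s, \<mu>, t) \<longleftrightarrow> s \<subseteq> pairs Z \<and> t \<subseteq> pairs Z \<and> dterms Z (s, \<mu>, t) \<noteq> {}"
proof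
  assume d: "diagram Z (s, \<mu>, t)"
  then have "mv \<mu> = \<mu>" by (auto simp: mv_def)
  with d keys_elt_dterms[of \<mu> s t] show "s \<subseteq> pairs Z \<and> t \<subseteq> pairs Z \<and> dterms Z (s, \<mu>, t) \<noteq> {}"
    by (simp del: elt.simps dterms.simps) (metis keys_eq_empty)
next
  assume d: "s \<subseteq> pairs Z \<and> t \<subseteq> pairs Z \<and> dterms Z (s, \<mu>, t) \<noteq> {}"
  then obtain \<phi> where "\<phi> \<in> strand_diagrams Z" "mv \<phi> = \<mu>" by auto
  then have \<mu>: "\<mu> \<in> strand_diagrams Z" "mv \<mu> = \<mu>" using strand_diagrams_mv by auto
  with d have "elt Z (s, \<mu>, t) \<noteq> 0" by (metis keys_elt_dterms keys_zero)
  moreover have "\<forall>(x, y)\<in>\<mu>. x \<noteq> y" using \<mu>(2) by (auto simp: mv_def)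
  ultimately show "diagram Z (s, \<mu>, t)" using d \<mu> by (simp del: elt.simps)
qed

lemma keys_elt_diagram: "diagram Z d \<Longrightarrow> keys (elt Z d) = dterms Z d"
  by (cases d) (auto simp del: elt.simps dterms.simps simp: mv_def intro!: keys_elt_dterms)

lemma dterms_dg: "\<phi> \<in> dterms Z d \<Longrightarrow> dg Z \<phi> = d"
  by (cases d) (auto simp: dg_def sections_image)

lemma dterms_eq: "\<phi> \<in> dterms Z d \<Longrightarrow> \<phi> \<in> dterms Z d' \<Longrightarrow> d = d'"
  using dterms_dg by metis

lemma elt_sum_keys:
  assumes "finite D" "D \<subseteq> {d. diagram Z d}"
  shows "keys (\<Sum>d\<in>D. elt Z d) = (\<Union>d\<in>D. dterms Z d)"
proof -
  have k: "keys (elt Z d) = dterms Z d" if "d \<in> D" for d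
    using assms(2) keys_elt_diagram that by blast
  have "keys (\<Sum>d\<in>D. elt Z d) = (\<Union>d\<in>D. keys (elt Z d))"
    by (rule keys_disjoint_sum[OF assms(1)]) (use k dterms_eq in blast)
  also have "\<dots> = (\<Union>d\<in>D. dterms Z d)" using k by simp
  finally show ?thesis .
qed

lemma diagram_nonempty: "diagram Z d \<Longrightarrow> dterms Z d \<noteq> {}"
  using diagram_iff by (cases d) blast

lemma elt_inj: "inj_on (elt Z) {d. diagram Z d}"
proof (rule inj_onI)
  fix d d' assume "d \<in> {d. diagram Z d}" "d' \<in> {d. diagram Z d}" "elt Z d = elt Z d'"
  then have "dterms Z d = dterms Z d'" "dterms Z d \<noteq> {}"
    using keys_elt_diagram diagram_nonempty by (metis mem_Collect_eq)+
  then show "d = d'" using dterms_eq by blast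
qed

text \<open>Since supports of diagrams are disjoint, a sum of diagrams contains each of them
  entirely or not at all. Membership in a span thereby becomes a closure property of the support,
  which replaces explicit sums from here on.\<close>

lemma span_iff:
  "x \<in> span2 (elt Z ` {d. diagram Z d \<and> Q d}) \<longleftrightarrow>
     (\<forall>\<phi>\<in>keys x. \<exists>d. diagram Z d \<and> Q d \<and> \<phi> \<in> dterms Z d \<and> dterms Z d \<subseteq> keys x)"
proof
  assume "x \<in> span2 (elt Z ` {d. diagram Z d \<and> Q d})"
  then obtain C where C: "finite C" "C \<subseteq> elt Z ` {d. diagram Z d \<and> Q d}" "x = (\<Sum>c\<in>C. c)"
    unfolding span2_def by blast
  from finite_subset_image[OF C(1,2)] obtain D where
    D: "D \<subseteq> {d. diagram Z d \<and> Q d}" "finite D" "C = elt Z ` D" by blast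
  have "inj_on (elt Z) D" by (rule inj_on_subset[OF elt_inj]) (use D in blast)
  then have "x = (\<Sum>d\<in>D. elt Z d)" unfolding C(3) D(3) by (simp add: sum.reindex)
  then have "keys x = (\<Union>d\<in>D. dterms Z d)" using elt_sum_keys[OF D(2)] D(1) by auto
  with D(1) show "\<forall>\<phi>\<in>keys x. \<exists>d. diagram Z d \<and> Q d \<and> \<phi> \<in> dterms Z d \<and> dterms Z d \<subseteq> keys x"
    by blast
next
  assume x: "\<forall>\<phi>\<in>keys x. \<exists>d. diagram Z d \<and> Q d \<and> \<phi> \<in> dterms Z d \<and> dterms Z d \<subseteq> keys x"
  let ?D = "dg Z ` keys x"
  have D: "diagram Z (dg Z \<phi>) \<and> Q (dg Z \<phi>) \<and> \<phi> \<in> dterms Z (dg Z \<phi>) \<and> dterms Z (dg Z \<phi>) \<subseteq> keys x"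
    if "\<phi> \<in> keys x" for \<phi>
  proof -
    from bspec[OF x \<open>\<phi> \<in> keys x\<close>]
    obtain d where "diagram Z d" "Q d" "\<phi> \<in> dterms Z d" "dterms Z d \<subseteq> keys x" by (elim exE conjE)
    moreover from this have "dg Z \<phi> = d" by (simp add: dterms_dg)
    ultimately show ?thesis by simp
  qed
  have fin: "finite ?D" by simp
  have "keys x = (\<Union>d\<in>?D. dterms Z d)" using D by blast
  also have "\<dots> = keys (\<Sum>d\<in>?D. elt Z d)"
    by (rule elt_sum_keys[symmetric]) (use D in auto)
  finally have "x = (\<Sum>d\<in>?D. elt Z d)" by (rule chain_eqI)
  also have "\<dots> = (\<Sum>c\<in>elt Z ` ?D. c)"
  proof -
    have "inj_on (elt Z) ?D" by (rule inj_on_subset[OF elt_inj]) (use D in auto)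
    then show ?thesis by (simp add: sum.reindex)
  qed
  finally show "x \<in> span2 (elt Z ` {d. diagram Z d \<and> Q d})"
    unfolding span2_def using D fin by (intro CollectI exI[of _ "elt Z ` ?D"]) auto
qed

lemma strand_alg_iff:
  "x \<in> strand_alg Z \<longleftrightarrow> (\<forall>\<phi>\<in>keys x. \<exists>d. diagram Z d \<and> \<phi> \<in> dterms Z d \<and> dterms Z d \<subseteq> keys x)"
  using span_iff[of x "\<lambda>_. True"] by (simp add: strand_alg_def)

lemma strand_alg_dg:
  assumes "x \<in> strand_alg Z" "\<phi> \<in> keys x"
  shows "diagram Z (dg Z \<phi>)" "\<phi> \<in> dterms Z (dg Z \<phi>)" "dterms Z (dg Z \<phi>) \<subseteq> keys x"
proof -
  obtain d where "diagram Z d" "\<phi> \<in> dterms Z d" "dterms Z d \<subseteq> keys x"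
    using assms strand_alg_iff by blast
  moreover from this have "dg Z \<phi> = d" by (simp add: dterms_dg)
  ultimately show "diagram Z (dg Z \<phi>)" "\<phi> \<in> dterms Z (dg Z \<phi>)" "dterms Z (dg Z \<phi>) \<subseteq> keys x" by auto
qed

lemma span_iff':
  "x \<in> span2 (elt Z ` {d. diagram Z d \<and> Q d}) \<longleftrightarrow> x \<in> strand_alg Z \<and> (\<forall>\<phi>\<in>keys x. Q (dg Z \<phi>))"
proof
  assume x: "x \<in> span2 (elt Z ` {d. diagram Z d \<and> Q d})"
  have *: "diagram Z (dg Z \<phi>) \<and> Q (dg Z \<phi>) \<and> \<phi> \<in> dterms Z (dg Z \<phi>) \<and> dterms Z (dg Z \<phi>) \<subseteq> keys x"
    if "\<phi> \<in> keys x" for \<phi>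
  proof -
    from bspec[OF x[unfolded span_iff] \<open>\<phi> \<in> keys x\<close>]
    obtain d where "diagram Z d" "Q d" "\<phi> \<in> dterms Z d" "dterms Z d \<subseteq> keys x" by (elim exE conjE)
    moreover from this have "dg Z \<phi> = d" by (simp add: dterms_dg)
    ultimately show ?thesis by simp
  qed
  then have "x \<in> strand_alg Z" unfolding strand_alg_iff by blast
  with * show "x \<in> strand_alg Z \<and> (\<forall>\<phi>\<in>keys x. Q (dg Z \<phi>))" by simp
next
  assume x: "x \<in> strand_alg Z \<and> (\<forall>\<phi>\<in>keys x. Q (dg Z \<phi>))"
  show "x \<in> span2 (elt Z ` {d. diagram Z d \<and> Q d})"
    unfolding span_iff
  proof
    fix \<phi> assume "\<phi> \<in> keys x"
    with x strand_alg_dg[of x \<phi>]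
    show "\<exists>d. diagram Z d \<and> Q d \<and> \<phi> \<in> dterms Z d \<and> dterms Z d \<subseteq> keys x"
      by (intro exI[of _ "dg Z \<phi>"]) simp
  qed
qed

lemma strand_alg_0 [simp]: "0 \<in> strand_alg Z"
  by (simp add: strand_alg_iff)

text \<open>A diagram lies in a support entirely or not at all, so the symmetric difference of two
  supports is again a union of diagrams.\<close>

lemma strand_alg_add:
  assumes "x \<in> strand_alg Z" "y \<in> strand_alg Z"
  shows "x + y \<in> strand_alg Z"
  unfolding strand_alg_iff
proof
  have *: "\<exists>d. diagram Z d \<and> \<phi> \<in> dterms Z d \<and> dterms Z d \<subseteq> keys x - keys y"
    if "x \<in> strand_alg Z" "y \<in> strand_alg Z" "\<phi> \<in> keys x" "\<phi> \<notin> keys y" for x y \<phi>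
  proof (intro exI conjI)
    let ?d = "dg Z \<phi>"
    note d = strand_alg_dg[OF that(1,3)]
    show "diagram Z ?d" "\<phi> \<in> dterms Z ?d" using d by auto
    have "\<psi> \<notin> keys y" if "\<psi> \<in> dterms Z ?d" for \<psi>
      using strand_alg_dg(3)[OF \<open>y \<in> strand_alg Z\<close>, of \<psi>] dterms_dg[OF that] d(2) \<open>\<phi> \<notin> keys y\<close> by auto
    with d show "dterms Z ?d \<subseteq> keys x - keys y" by blast
  qed
  fix \<phi> assume "\<phi> \<in> keys (x + y)"
  then consider "\<phi> \<in> keys x" "\<phi> \<notin> keys y" | "\<phi> \<in> keys y" "\<phi> \<notin> keys x"
    by (auto simp: keys_chain_add)
  then show "\<exists>d. diagram Z d \<and> \<phi> \<in> dterms Z d \<and> dterms Z d \<subseteq> keys (x + y)"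
    unfolding keys_chain_add by cases (use *[of x y \<phi>] *[of y x \<phi>] assms in blast)+
qed

lemma elt_strand_alg: "diagram Z d \<Longrightarrow> elt Z d \<in> strand_alg Z"
  unfolding strand_alg_iff using keys_elt_diagram by auto

text \<open>\<open>dgm_support\<close> is a definite description; the disjointness of supports
  provides the uniqueness on which it rests.\<close>

lemma dgm_support_eq:
  assumes "x \<in> strand_alg Z"
  shows "dgm_support Z x = dg Z ` keys x"
  unfolding dgm_support_def
proof (rule the_equality)
  let ?D = "dg Z ` keys x"
  note D = strand_alg_dg[OF assms]
  have "keys x = (\<Union>d\<in>?D. dterms Z d)" using D by blast
  also have "\<dots> = keys (\<Sum>d\<in>?D. elt Z d)"
    by (rule elt_sum_keys[symmetric]) (use D in auto)
  finally have "x = (\<Sum>d\<in>?D. elt Z d)" by (rule chain_eqI)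
  with D show "finite ?D \<and> ?D \<subseteq> {d. diagram Z d} \<and> x = (\<Sum>d\<in>?D. elt Z d)" by auto
next
  fix B assume B: "finite B \<and> B \<subseteq> {d. diagram Z d} \<and> x = (\<Sum>d\<in>B. elt Z d)"
  then have k: "keys x = (\<Union>d\<in>B. dterms Z d)" using elt_sum_keys by auto
  have ne: "dterms Z d \<noteq> {}" if "d \<in> B" for d using diagram_nonempty B that by blast
  show "B = dg Z ` keys x"
  proof
    show "dg Z ` keys x \<subseteq> B" unfolding k using dterms_dg by auto
    show "B \<subseteq> dg Z ` keys x"
    proof
      fix d assume "d \<in> B"
      with ne obtain \<phi> where "\<phi> \<in> dterms Z d" by blast
      with \<open>d \<in> B\<close> dterms_dg show "d \<in> dg Z ` keys x" unfolding k by (metis UN_I imageI)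
    qed
  qed
qed

section \<open>Homology classes as cosets, and the quotient by F\<close>

lemma bd_group:
  assumes "b \<in> bd ` strand_alg Z" "c \<in> bd ` strand_alg Z"
  shows "b + c \<in> bd ` strand_alg Z"
  using assms bd_add strand_alg_add by (metis (no_types, lifting) image_iff)

lemma bd_group_0: "0 \<in> bd ` strand_alg Z"
  by (rule image_eqI[of _ _ 0]) simp_all

lemma hclass_eq_iff: "hclass Z x = hclass Z y \<longleftrightarrow> x + y \<in> bd ` strand_alg Z"
proof
  assume "hclass Z x = hclass Z y"
  moreover have "x \<in> hclass Z x"
    unfolding hclass_def elt_set_plus_def using bd_group_0 by force
  ultimately have "x \<in> hclass Z y" by simp
  then obtain b where "b \<in> bd ` strand_alg Z" "x = y + b"
    unfolding hclass_def elt_set_plus_def by blast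
  then show "x + y \<in> bd ` strand_alg Z" by (simp add: add.commute add.left_commute)
next
  have *: "hclass Z x \<subseteq> hclass Z y" if xy: "x + y \<in> bd ` strand_alg Z" for x y
  proof
    fix z assume "z \<in> hclass Z x"
    then obtain b where b: "b \<in> bd ` strand_alg Z" "z = x + b"
      unfolding hclass_def elt_set_plus_def by blast
    then have "z = y + ((x + y) + b)" by (simp add: add.assoc add.left_commute)
    with bd_group[OF xy b(1)] show "z \<in> hclass Z y"
      unfolding hclass_def elt_set_plus_def by blast
  qed
  assume "x + y \<in> bd ` strand_alg Z"
  with *[of x y] *[of y x] show "hclass Z x = hclass Z y" by (simp add: add.commute subset_antisym)
qed

lemma hclass_zero_iff: "hclass Z x = hzero Z \<longleftrightarrow> x \<in> bd ` strand_alg Z"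
  by (simp add: hzero_def hclass_eq_iff)

lemma hzero_eq: "hzero Z = bd ` strand_alg Z"
  by (auto simp: hzero_def hclass_def elt_set_plus_def)

text \<open>Additivity of \<open>f\<close> refers to the elementwise sum of cosets, so this equation
  is what makes \<open>f\<close> vanish when an entry is \<open>hzero Z\<close>.\<close>

lemma hzero_add: "hzero Z + hzero Z = hzero Z"
proof
  show "hzero Z + hzero Z \<subseteq> hzero Z"
    unfolding hzero_eq using bd_group by (auto simp: set_plus_def)
  show "hzero Z \<subseteq> hzero Z + hzero Z"
    unfolding hzero_eq set_plus_def using bd_group_0 by force
qed

lemma hzero_homology: "hzero Z \<in> homology Z"
  unfolding homology_def hzero_def by simp

lemma dgm_classes_homology: "dgm_classes Z \<subseteq> homology Z"
  unfolding dgm_classes_def homology_def using elt_strand_alg by blast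

lemma ideal_F_iff:
  "x \<in> ideal_F Z \<longleftrightarrow> x \<in> strand_alg Z \<and> (\<forall>\<phi>\<in>keys x. \<not> viable_h Z (hgrade (dg Z \<phi>)) \<or>
     (\<exists>P\<in>pairs Z. doubly_occupied Z (hgrade (dg Z \<phi>)) P \<and> crossed_at Z P (dg Z \<phi>)))"
  unfolding ideal_F_def by (rule span_iff')

lemma bar_eq_iff: "x \<in> strand_alg Z \<Longrightarrow> bar Z x = ideal_F Z \<longleftrightarrow> x \<in> ideal_F Z"
proof
  assume "bar Z x = ideal_F Z"
  moreover have "0 \<in> ideal_F Z" by (simp add: ideal_F_iff)
  then have "x \<in> bar Z x" unfolding bar_def elt_set_plus_def by force
  ultimately show "x \<in> ideal_F Z" by simp
next
  have add: "a + b \<in> ideal_F Z" if "a \<in> ideal_F Z" "b \<in> ideal_F Z" for a b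
    using that strand_alg_add unfolding ideal_F_iff by (auto simp: keys_chain_add)
  assume x: "x \<in> ideal_F Z"
  show "bar Z x = ideal_F Z"
  proof
    show "bar Z x \<subseteq> ideal_F Z" unfolding bar_def elt_set_plus_def using add[OF x] by blast
    show "ideal_F Z \<subseteq> bar Z x"
    proof
      fix y assume "y \<in> ideal_F Z"
      then have "x + y \<in> ideal_F Z" using add x by blast
      moreover have "y = x + (x + y)" by simp
      ultimately show "y \<in> bar Z x" unfolding bar_def elt_set_plus_def by blast
    qed
  qed
qed

end

section \<open>Resolving and joining\<close>

definition tm :: "'i arc \<Rightarrow> ('i pt \<Rightarrow> int) \<Rightarrow> nat set \<Rightarrow> nat set \<Rightarrow> 'i sdiag set" where
  "tm Z h s t = {\<phi> \<in> strand_diagrams Z. hg \<phi> = h \<and> Domain \<phi> \<in> sections Z s \<and> Range \<phi> \<in> sections Z t}"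

text \<open>Inverse to resolving a crossing with a horizontal strand at \<open>p\<close>: the two
  strands that meet at the break are joined, and the horizontal strand returns.\<close>

definition unbrk :: "'i pt \<Rightarrow> 'i sdiag \<Rightarrow> 'i sdiag" where
  "unbrk p \<psi> = join_at p \<psi> \<union> {(p, p)}"

lemma hg_sum: "finite \<phi> \<Longrightarrow> hg \<phi> e = (\<Sum>\<sigma>\<in>\<phi>. of_bool (cvr \<sigma> e))"
  unfolding hg_def by (simp add: sum.If_cases Int_def of_bool_def)

text \<open>Resolving a crossing and healing a break both replace two strands by two others that
  cover the same steps equally often.\<close>

lemma hg_exchange:
  assumes "finite R" "\<sigma> \<notin> R" "\<tau> \<notin> R" "\<sigma>' \<notin> R" "\<tau>' \<notin> R" "\<sigma> \<noteq> \<tau>" "\<sigma>' \<noteq> \<tau>'"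
    and "\<And>e. (of_bool (cvr \<sigma> e) :: int) + of_bool (cvr \<tau> e) = of_bool (cvr \<sigma>' e) + of_bool (cvr \<tau>' e)"
  shows "hg (insert \<sigma> (insert \<tau> R)) = hg (insert \<sigma>' (insert \<tau>' R))"
proof
  fix e
  show "hg (insert \<sigma> (insert \<tau> R)) e = hg (insert \<sigma>' (insert \<tau>' R)) e"
    using assms(1-7) assms(8)[of e] by (simp add: hg_sum del: sum_of_bool_eq)
qed

lemma resolve_strands:
  assumes "\<phi> \<in> strand_diagrams Z" "strands \<phi>" "c \<in> crossings \<phi>"
  shows "resolve \<phi> c \<in> strand_diagrams Z" "Domain (resolve \<phi> c) = Domain \<phi>"
    "Range (resolve \<phi> c) = Range \<phi>" "hg (resolve \<phi> c) = hg \<phi>"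
proof -
  from assms(3) obtain x y x' y' where c: "c = ((x, y), (x', y'))" "(x, y) \<in> \<phi>" "(x', y') \<in> \<phi>"
    "pt_less x x'" "pt_less y' y" by (auto simp: crossings_def)
  define R where "R = \<phi> - {(x, y), (x', y')}"
  note st = strandsD[OF assms(2)]
  have ne: "x \<noteq> x'" "y \<noteq> y'" using c by (auto simp: pt_less_def)
  have phi: "\<phi> = insert (x, y) (insert (x', y') R)" using c unfolding R_def by blast
  have res: "resolve \<phi> c = insert (x, y') (insert (x', y) R)" unfolding c(1) R_def by auto
  have R: "x \<notin> Domain R" "x' \<notin> Domain R" "y \<notin> Range R" "y' \<notin> Range R"
    using st(2,3) c unfolding R_def by blast+
  have le: "pt_le x y" "pt_le x' y'" using st(4)[OF c(2)] st(4)[OF c(3)] by (auto simp: pt_le_def)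
  have le': "pt_le x y'" "pt_le x' y" using le c(4,5) by (auto simp: pt_le_def pt_less_def)
  show "Domain (resolve \<phi> c) = Domain \<phi>" "Range (resolve \<phi> c) = Range \<phi>"
  proof -
    have "Domain (insert (x, y') (insert (x', y) R)) = Domain (insert (x, y) (insert (x', y') R))"
      "Range (insert (x, y') (insert (x', y) R)) = Range (insert (x, y) (insert (x', y') R))" by auto
    then show "Domain (resolve \<phi> c) = Domain \<phi>" "Range (resolve \<phi> c) = Range \<phi>"
      by (simp_all only: res phi[symmetric])
  qed
  have "single_valued R" "single_valued (R\<inverse>)"
    using assms(2) unfolding R_def strands_def single_valued_def by blast+
  then have "single_valued (resolve \<phi> c)" "single_valued ((resolve \<phi> c)\<inverse>)"
    using R ne unfolding res single_valued_def by blast+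
  moreover have "resolve \<phi> c \<subseteq> points Z \<times> points Z"
    using assms(1) c(2,3) unfolding res R_def strand_diagrams_def by blast
  moreover have "\<forall>(x, y)\<in>resolve \<phi> c. pt_le x y"
    using assms(1) le' unfolding res R_def strand_diagrams_def by blast
  ultimately show "resolve \<phi> c \<in> strand_diagrams Z"
    by (simp add: strand_diagrams_def)
  have "hg (insert (x, y') (insert (x', y) R)) = hg (insert (x, y) (insert (x', y') R))"
  proof (rule hg_exchange)
    show "finite R" using st(1) by (simp add: R_def)
    show "(of_bool (cvr (x, y') e) :: int) + of_bool (cvr (x', y) e)
        = of_bool (cvr (x, y) e) + of_bool (cvr (x', y') e)" for e
      using c(4,5) le by (auto simp: cvr_def pt_less_def pt_le_def)
  qed (use R ne in \<open>auto simp: R_def\<close>)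
  then show "hg (resolve \<phi> c) = hg \<phi>" by (simp only: res phi[symmetric])
qed

lemma join_at_eq:
  assumes "strands \<psi>" "(a, p) \<in> \<psi>" "(p, b) \<in> \<psi>"
  shows "join_at p \<psi> = insert (a, b) (\<psi> - {(a, p), (p, b)})"
proof -
  note st = strandsD[OF assms(1)]
  have "\<sigma> \<in> join_at p \<psi> \<longleftrightarrow> \<sigma> \<in> insert (a, b) (\<psi> - {(a, p), (p, b)})" if "a \<noteq> p" "b \<noteq> p" for \<sigma>
  proof -
    obtain x y where "\<sigma> = (x, y)" by fastforce
    with st(2,3) assms(2,3) that show ?thesis unfolding join_at_def by blast
  qed
  moreover have "\<sigma> \<in> join_at p \<psi> \<longleftrightarrow> \<sigma> \<in> insert (a, b) (\<psi> - {(a, p), (p, b)})" if "a = p \<or> b = p" for \<sigma>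
  proof -
    have ab: "a = p" "b = p" using that st(2,3) assms(2,3) by blast+
    obtain x y where "\<sigma> = (x, y)" by fastforce
    with st(2,3) assms(2,3) ab show ?thesis unfolding join_at_def by blast
  qed
  ultimately show ?thesis by blast
qed

lemma unbrk_eq:
  assumes "strands \<psi>" "(a, p) \<in> \<psi>" "(p, b) \<in> \<psi>"
  shows "unbrk p \<psi> = insert (a, b) (insert (p, p) (\<psi> - {(a, p), (p, b)}))"
  using join_at_eq[OF assms] by (auto simp: unbrk_def)

lemma brokenE:
  assumes "p \<in> broken \<psi>" "strands \<psi>"
  obtains a b where "(a, p) \<in> \<psi>" "(p, b) \<in> \<psi>" "a \<noteq> p" "b \<noteq> p" "pt_less a p" "pt_less p b"
proof -
  from assms(1) obtain a b where ab: "(a, p) \<in> \<psi>" "(p, b) \<in> \<psi>" "a \<noteq> p" "p \<noteq> b"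
    by (auto simp: broken_def)
  from strands_moving[OF assms(2) ab(1,3)] strands_moving[OF assms(2) ab(2,4)] ab that
  show ?thesis by (simp add: pt_less_def)
qed

lemma unbrk_strands:
  assumes "\<psi> \<in> strand_diagrams Z" "strands \<psi>" "p \<in> broken \<psi>"
  shows "unbrk p \<psi> \<in> strand_diagrams Z" "Domain (unbrk p \<psi>) = Domain \<psi>" "Range (unbrk p \<psi>) = Range \<psi>"
    "hg (unbrk p \<psi>) = hg \<psi>" "broken (unbrk p \<psi>) = broken \<psi> - {p}" "(p, p) \<in> unbrk p \<psi>"
proof -
  from assms(3,2) obtain a b where ab: "(a, p) \<in> \<psi>" "(p, b) \<in> \<psi>" "a \<noteq> p" "b \<noteq> p" "pt_less a p" "pt_less p b"
    by (rule brokenE)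
  define R where "R = \<psi> - {(a, p), (p, b)}"
  note st = strandsD[OF assms(2)]
  have ne: "a \<noteq> b" using ab by (auto simp: pt_less_def)
  have psi: "\<psi> = insert (a, p) (insert (p, b) R)" using ab unfolding R_def by blast
  have un: "unbrk p \<psi> = insert (a, b) (insert (p, p) R)"
    using unbrk_eq[OF assms(2) ab(1,2)] by (simp add: R_def)
  have R: "a \<notin> Domain R" "p \<notin> Domain R" "p \<notin> Range R" "b \<notin> Range R"
    using st(2,3) ab unfolding R_def by blast+
  have le': "pt_le a b" "pt_le p p" using ab by (auto simp: pt_le_def pt_less_def)
  show "Domain (unbrk p \<psi>) = Domain \<psi>" "Range (unbrk p \<psi>) = Range \<psi>"
  proof -
    have "Domain (insert (a, b) (insert (p, p) R)) = Domain (insert (a, p) (insert (p, b) R))"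
      "Range (insert (a, b) (insert (p, p) R)) = Range (insert (a, p) (insert (p, b) R))" by auto
    then show "Domain (unbrk p \<psi>) = Domain \<psi>" "Range (unbrk p \<psi>) = Range \<psi>"
      by (simp_all only: un psi[symmetric])
  qed
  have "single_valued R" "single_valued (R\<inverse>)"
    using assms(2) unfolding R_def strands_def single_valued_def by blast+
  then have "single_valued (unbrk p \<psi>)" "single_valued ((unbrk p \<psi>)\<inverse>)"
    using R ab unfolding un single_valued_def by blast+
  moreover have "unbrk p \<psi> \<subseteq> points Z \<times> points Z"
    using assms(1) ab unfolding un R_def strand_diagrams_def by blast
  moreover have "\<forall>(x, y)\<in>unbrk p \<psi>. pt_le x y"
    using assms(1) le' unfolding un R_def strand_diagrams_def by blast
  ultimately show "unbrk p \<psi> \<in> strand_diagrams Z"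
    by (simp add: strand_diagrams_def)
  have "hg (insert (a, b) (insert (p, p) R)) = hg (insert (a, p) (insert (p, b) R))"
  proof (rule hg_exchange)
    show "finite R" using st(1) by (simp add: R_def)
    show "(of_bool (cvr (a, b) e) :: int) + of_bool (cvr (p, p) e)
        = of_bool (cvr (a, p) e) + of_bool (cvr (p, b) e)" for e
      using ab by (auto simp: cvr_def pt_less_def)
  qed (use R ne ab in \<open>auto simp: R_def\<close>)
  then show "hg (unbrk p \<psi>) = hg \<psi>" by (simp only: un psi[symmetric])
  have "mv (insert (a, p) (insert (p, b) R)) = insert (a, p) (insert (p, b) (mv R))"
    unfolding mv_def using ab by auto
  then have m1: "mv \<psi> = insert (a, p) (insert (p, b) (mv R))" by (simp only: psi[symmetric])
  have m2: "mv (unbrk p \<psi>) = insert (a, b) (mv R)"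
    unfolding un mv_def using ne by auto
  have "p \<notin> Domain (mv R)" "p \<notin> Range (mv R)" using R by (auto simp: mv_def)
  then have "Domain (mv (unbrk p \<psi>)) = Domain (mv \<psi>) - {p}" "Range (mv (unbrk p \<psi>)) = Range (mv \<psi>) - {p}"
    unfolding m1 m2 using ab by auto
  then show "broken (unbrk p \<psi>) = broken \<psi> - {p}" by (auto simp: broken_iff)
  show "(p, p) \<in> unbrk p \<psi>" by (simp add: unbrk_def)
qed

lemma unbrk_resolve:
  assumes "strands \<phi>" "(a, b) \<in> \<phi>" "(p, p) \<in> \<phi>" "pt_less a p" "pt_less p b" "strands \<psi>"
    and \<psi>: "\<psi> = resolve \<phi> ((a, b), (p, p))"
  shows "unbrk p \<psi> = \<phi>" "(a, p) \<in> \<psi>" "(p, b) \<in> \<psi>" "p \<in> broken \<psi>"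
proof -
  note st = strandsD[OF assms(1)]
  have ne: "a \<noteq> p" "b \<noteq> p" using assms(4,5) by (auto simp: pt_less_def)
  show mem: "(a, p) \<in> \<psi>" "(p, b) \<in> \<psi>" unfolding \<psi> by auto
  then show "p \<in> broken \<psi>" using ne unfolding broken_def by blast
  have "(a, p) \<notin> \<phi>" "(p, b) \<notin> \<phi>" using st(2) assms(2,3) ne by blast+
  then show "unbrk p \<psi> = \<phi>" unfolding unbrk_eq[OF assms(6) mem] unfolding \<psi> using assms(2,3) by auto
qed

lemma resolve_unbrk:
  assumes "strands \<psi>" "(a, p) \<in> \<psi>" "(p, b) \<in> \<psi>" "pt_less a p" "pt_less p b"
  shows "resolve (unbrk p \<psi>) ((a, b), (p, p)) = \<psi>" "((a, b), (p, p)) \<in> crossings (unbrk p \<psi>)"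
proof -
  note st = strandsD[OF assms(1)]
  have ne: "a \<noteq> p" "b \<noteq> p" using assms(4,5) by (auto simp: pt_less_def)
  have "(a, b) \<notin> \<psi>" "(p, p) \<notin> \<psi>" using st(2) assms(2,3) ne by blast+
  then show "resolve (unbrk p \<psi>) ((a, b), (p, p)) = \<psi>"
    unfolding unbrk_eq[OF assms(1-3)] using assms(2,3) by auto
  show "((a, b), (p, p)) \<in> crossings (unbrk p \<psi>)"
    unfolding unbrk_eq[OF assms(1-3)] crossings_def using assms(4,5) by auto
qed

context arc_frame
begin

lemma dterms_tm: "\<phi> \<in> dterms Z (s, \<mu>, t) \<Longrightarrow> \<phi> \<in> tm Z (hg \<mu>) s t"
  by (auto simp: tm_def hg_mv)

lemma tm_dg:
  assumes "\<phi> \<in> tm Z h s t"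
  shows "dg Z \<phi> = (s, mv \<phi>, t)" "\<phi> \<in> dterms Z (dg Z \<phi>)" "hdata (dg Z \<phi>) = (h, s, t)"
    "s \<subseteq> pairs Z \<Longrightarrow> t \<subseteq> pairs Z \<Longrightarrow> diagram Z (dg Z \<phi>)"
proof -
  show dg: "dg Z \<phi> = (s, mv \<phi>, t)"
    using assms by (auto simp: tm_def dg_def sections_image)
  then show "\<phi> \<in> dterms Z (dg Z \<phi>)" using assms by (auto simp: tm_def)
  then show "s \<subseteq> pairs Z \<Longrightarrow> t \<subseteq> pairs Z \<Longrightarrow> diagram Z (dg Z \<phi>)" unfolding dg diagram_iff by blast
  show "hdata (dg Z \<phi>) = (h, s, t)" using assms unfolding dg by (simp add: tm_def hgrade_hg hg_mv)
qed

lemma tm_hdata: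
  assumes "diagram Z d" "\<phi> \<in> dterms Z d"
  shows "hdata d = (h, s, t) \<longleftrightarrow> \<phi> \<in> tm Z h s t"
proof -
  obtain s' \<mu> t' where d: "d = (s', \<mu>, t')" using prod_cases3 by blast
  have "\<phi> \<in> tm Z (hg \<mu>) s' t'" using assms(2) unfolding d by (rule dterms_tm)
  then show ?thesis unfolding d
    by (auto simp: hgrade_hg tm_def dest: sections_eq)
qed

lemma finite_tm: "finite (tm Z h s t)"
  by (rule finite_subset[OF _ finite_strand_diagrams]) (auto simp: tm_def)

lemma tm_strands: "\<phi> \<in> tm Z h s t \<Longrightarrow> strands \<phi>"
  by (auto simp: tm_def intro: strand_diagrams_strands)

lemma resolve_tm: "\<phi> \<in> tm Z h s t \<Longrightarrow> c \<in> crossings \<phi> \<Longrightarrow> resolve \<phi> c \<in> tm Z h s t"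
  using resolve_strands[of \<phi> Z c] tm_strands[of \<phi> h s t] by (simp add: tm_def)

lemma unbrk_tm: "\<psi> \<in> tm Z h s t \<Longrightarrow> p \<in> broken \<psi> \<Longrightarrow> unbrk p \<psi> \<in> tm Z h s t"
  using unbrk_strands[of \<psi> Z p] tm_strands[of \<psi> h s t] by (simp add: tm_def)

text \<open>\<open>viable_h\<close> speaks of the steps of \<open>Z\<close> only, but strands
  between points of \<open>Z\<close> cover no others.\<close>

lemma hg_viable: "\<phi> \<in> strand_diagrams Z \<Longrightarrow> viable_h Z (hg \<phi>) \<longleftrightarrow> (\<forall>e. hg \<phi> e \<le> 1)"
proof
  assume \<phi>: "\<phi> \<in> strand_diagrams Z" and v: "viable_h Z (hg \<phi>)"
  show "\<forall>e. hg \<phi> e \<le> 1"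
  proof
    fix e show "hg \<phi> e \<le> 1"
    proof (cases "e \<in> steps Z")
      case True with v show ?thesis by (auto simp: viable_h_def)
    next
      case False
      have "\<not> cvr \<sigma> e" if "\<sigma> \<in> \<phi>" for \<sigma>
      proof
        assume c: "cvr \<sigma> e"
        have s: "fst \<sigma> \<in> points Z" "snd \<sigma> \<in> points Z" "pt_le (fst \<sigma>) (snd \<sigma>)"
          using \<phi> that unfolding strand_diagrams_def by (cases \<sigma>, auto)+
        from False c s show False
          by (cases \<sigma>; cases e) (auto simp: cvr_def steps_def points_def pt_le_def)
      qed
      then have "{\<sigma>\<in>\<phi>. cvr \<sigma> e} = {}" by blast
      then have "hg \<phi> e = 0" unfolding hg_def by (simp only: card.empty)
      then show ?thesis by simp
    qed
  qed
next
  assume v: "\<forall>e. hg \<phi> e \<le> 1"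
  show "viable_h Z (hg \<phi>)" unfolding viable_h_def
  proof
    fix e
    have "0 \<le> hg \<phi> e" by (simp add: hg_def)
    then show "hg \<phi> e = 0 \<or> hg \<phi> e = 1" using v[rule_format, of e] by linarith
  qed
qed

end

section \<open>The summand of viable H-data\<close>

locale viable_frame = arc_frame Z for Z :: "'i arc" +
  fixes h :: "'i pt \<Rightarrow> int" and s t :: "nat set"
  assumes h_le: "h e \<le> 1" and s_pairs: "s \<subseteq> pairs Z" and t_pairs: "t \<subseteq> pairs Z"
begin

abbreviation T :: "'i sdiag set" where "T \<equiv> tm Z h s t"

text \<open>The pairs at which a term of this H-data can break or be crossed. Each contributes one
  factor of the join, the discrete set of those of its places that \<open>h\<close> covers on both
  sides.\<close>

definition occ :: "nat set" where
  "occ = {P \<in> s \<inter> t. \<exists>p\<in>pair_places Z P. covers_place h p}"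

lemma T_facts:
  assumes "\<phi> \<in> T"
  shows "\<phi> \<in> strand_diagrams Z" "strands \<phi>" "thin \<phi>" "hg \<phi> = h" "stp \<phi> e \<longleftrightarrow> h e \<noteq> 0"
    "Domain \<phi> \<in> sections Z s" "Range \<phi> \<in> sections Z t"
proof -
  show A: "\<phi> \<in> strand_diagrams Z" "hg \<phi> = h" "Domain \<phi> \<in> sections Z s" "Range \<phi> \<in> sections Z t"
    using assms by (auto simp: tm_def)
  show B: "strands \<phi>" using assms by (rule tm_strands)
  show C: "thin \<phi>" by (rule hg_thin[OF B]) (simp add: A h_le)
  show "stp \<phi> e \<longleftrightarrow> h e \<noteq> 0" using thin_hg[OF C, of e] A by simp
qed

lemma T_covers: "\<phi> \<in> T \<Longrightarrow> covers_place h p \<longleftrightarrow> stp \<phi> (prv p) \<and> stp \<phi> p"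
  by (simp add: covers_place_def T_facts(5))

lemma mv_Domain_subset: "Domain (mv \<phi>) \<subseteq> Domain \<phi>" "Range (mv \<phi>) \<subseteq> Range \<phi>"
  by (auto simp: mv_def)

lemma broken_facts:
  assumes "\<phi> \<in> T" "p \<in> broken \<phi>"
  shows "p \<in> places Z" "covers_place h p" "p \<in> Domain \<phi>" "p \<in> Range \<phi>" "matching Z p \<in> occ" "(p, p) \<notin> \<phi>"
    "p \<in> pair_places Z (matching Z p)"
proof -
  note f = T_facts[OF assms(1)]
  from assms(2) f(2) obtain a b where ab: "(a, p) \<in> \<phi>" "(p, b) \<in> \<phi>" "a \<noteq> p" "b \<noteq> p"
    "pt_less a p" "pt_less p b" by (rule brokenE)
  have "b \<in> points Z" "p \<in> points Z" using ab f(1) by (auto simp: strand_diagrams_def)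
  with ab show pl: "p \<in> places Z"
    by (cases b; cases p) (auto simp: pt_less_def points_def places_def)
  show cov: "covers_place h p"
    using start_stp[OF f(2)] end_stp[OF f(2)] assms(2) T_covers[OF assms(1)] by (auto simp: broken_iff)
  show dr: "p \<in> Domain \<phi>" "p \<in> Range \<phi>" using ab by auto
  show "(p, p) \<notin> \<phi>" using strandsD(2)[OF f(2) ab(2)] ab(4) by blast
  show pp: "p \<in> pair_places Z (matching Z p)" using pl by (simp add: pair_places_def)
  show "matching Z p \<in> occ"
    using sections_pair[OF f(6) dr(1) pp] sections_pair[OF f(7) dr(2) pp] pp cov by (auto simp: occ_def)
qed

text \<open>A break lies in the domain and in the range, and each of these contains at most one
  place of the pair.\<close>

lemma broken_pair_unique:
  assumes "\<phi> \<in> T" "p \<in> broken \<phi>" "q \<in> Domain \<phi> \<or> q \<in> Range \<phi>" "p \<in> pair_places Z P" "q \<in> pair_places Z P"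
  shows "p = q"
  using assms broken_facts[OF assms(1,2)] T_facts(6,7)[OF assms(1)] sections_unique by metis



text \<open>Suppose that strands move off the place \<open>a\<close> of the domain and onto the
  place \<open>b\<close> of the range. Neither is \<open>p\<close>, because a strand that starts or
  ends at a covered place makes a break there. So both are the twin of \<open>p\<close>, which is
  then a break itself.\<close>

lemma dotted:
  assumes "\<phi> \<in> T" "P \<in> s" "P \<in> t" "p \<in> pair_places Z P" "covers_place h p" "broken \<phi> \<inter> pair_places Z P = {}"
  obtains r where "r \<in> pair_places Z P" "(r, r) \<in> \<phi>"
proof -
  note f = T_facts[OF assms(1)]
  have snd_ge: "1 \<le> snd r" if "r \<in> pair_places Z P" for r
    using that by (cases r) (auto simp: pair_places_def places_def)
  obtain a where a: "a \<in> Domain \<phi>" "a \<in> pair_places Z P" using f(6) assms(2) by (rule sections_ex)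
  obtain b where b: "b \<in> Range \<phi>" "b \<in> pair_places Z P" using f(7) assms(3) by (rule sections_ex)
  have "(a, a) \<in> \<phi> \<or> (b, b) \<in> \<phi>"
  proof (rule ccontr)
    assume "\<not> ?thesis"
    then have mvs: "a \<in> Domain (mv \<phi>)" "b \<in> Range (mv \<phi>)" using a b unfolding mv_def by auto
    have "a \<notin> broken \<phi>" "b \<notin> broken \<phi>" using assms(6) a b by auto
    moreover have "p \<noteq> a"
      using start_prv_broken[OF f(3) mvs(1)] assms(5) T_covers[OF assms(1)] snd_ge[OF a(2)] calculation by blast
    moreover have "p \<noteq> b"
      using end_stp_broken[OF f(3) mvs(2)] assms(5) T_covers[OF assms(1)] calculation by blast
    ultimately have "a = b" using a b assms(4) by (metis pair_placesE insertE singletonD)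
    with mvs \<open>a \<notin> broken \<phi>\<close> show False by (simp add: broken_iff)
  qed
  with that a b show thesis by blast
qed

text \<open>Exchanging the dotted strand for the one at the twin place changes neither the moving
  strands nor the sets of pairs at both ends.\<close>

lemma horizontal_swap:
  assumes "\<phi> \<in> T" "(p, p) \<in> \<phi>" "p \<in> pair_places Z P" "q \<in> pair_places Z P"
  obtains \<psi> where "\<psi> \<in> T" "(q, q) \<in> \<psi>" "mv \<psi> = mv \<phi>"
proof (cases "p = q")
  case True
  with assms that show ?thesis by blast
next
  case False
  note f = T_facts[OF assms(1)]
  note st = strandsD[OF f(2)]
  let ?\<psi> = "insert (q, q) (\<phi> - {(p, p)})"
  have p: "p \<in> Domain \<phi>" "p \<in> Range \<phi>" using assms(2) by auto
  have q: "q \<notin> Domain \<phi>" "q \<notin> Range \<phi>"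
    using sections_unique[OF f(6) p(1) _ assms(3,4)] sections_unique[OF f(7) p(2) _ assms(3,4)] False by blast+
  have "q \<in> points Z" using assms(4) places_points by (auto simp: pair_places_def)
  have m: "mv ?\<psi> = mv \<phi>" by (auto simp: mv_def)
  have sd: "?\<psi> \<in> strand_diagrams Z"
  proof -
    have "single_valued ?\<psi>" "single_valued (?\<psi>\<inverse>)"
      using st(2,3) q unfolding single_valued_def by blast+
    moreover have "?\<psi> \<subseteq> points Z \<times> points Z" using f(1) \<open>q \<in> points Z\<close> unfolding strand_diagrams_def by blast
    moreover have "\<forall>(x, y)\<in>?\<psi>. pt_le x y" using f(1) unfolding strand_diagrams_def by (auto simp: pt_le_def)
    ultimately show ?thesis by (simp add: strand_diagrams_def)
  qed
  have dom: "Domain ?\<psi> = insert q (Domain \<phi> - {p})" "Range ?\<psi> = insert q (Range \<phi> - {p})"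
    using st(2,3) assms(2) by blast+
  have sec: "insert q (S - {p}) \<in> sections Z u" if S: "S \<in> sections Z u" "p \<in> S" for S u
  proof -
    have "P \<in> u" using sections_pair[OF S assms(3)] .
    have pl: "\<forall>r \<in> insert q (S - {p}) \<inter> places Z. matching Z r \<in> u"
      using S(1) assms(4) \<open>P \<in> u\<close> by (auto simp: sections_def pair_places_def)
    have "\<exists>!r. r \<in> insert q (S - {p}) \<inter> pair_places Z P'" if "P' \<in> u" for P'
    proof (cases "P' = P")
      case True
      show ?thesis
      proof
        show "q \<in> insert q (S - {p}) \<inter> pair_places Z P'" using True assms(4) by simp
        fix r assume "r \<in> insert q (S - {p}) \<inter> pair_places Z P'"
        then show "r = q" using sections_unique[OF S(1) _ S(2) _ assms(3)] True by blast
      qed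
    next
      case False
      then have "p \<notin> pair_places Z P'" "q \<notin> pair_places Z P'" using assms(3,4) by (auto simp: pair_places_def)
      moreover have "\<exists>!r. r \<in> S \<inter> pair_places Z P'" using S(1) that by (simp add: sections_def)
      moreover have "insert q (S - {p}) \<inter> pair_places Z P' = S \<inter> pair_places Z P'"
        using calculation(1,2) by blast
      ultimately show ?thesis by simp
    qed
    then have ex: "\<forall>P'\<in>u. \<exists>!r. r \<in> insert q (S - {p}) \<inter> pair_places Z P'" by (rule ballI)
    have "insert q (S - {p}) \<subseteq> points Z" using S(1) \<open>q \<in> points Z\<close> by (auto simp: sections_def)
    then show ?thesis unfolding sections_def by (intro CollectI conjI pl ex)
  qed
  have "hg ?\<psi> = h" using hg_mv[of ?\<psi>] hg_mv[of \<phi>] f(4) m by simp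
  moreover have "Domain ?\<psi> \<in> sections Z s" "Range ?\<psi> \<in> sections Z t"
    unfolding dom using sec[OF f(6) p(1)] sec[OF f(7) p(2)] .
  ultimately have "?\<psi> \<in> T" unfolding tm_def using sd by (intro CollectI conjI)
  with that m show ?thesis by blast
qed

lemma T_crossing:
  assumes "\<phi> \<in> T" "(p, p) \<in> \<phi>" "covers_place h p"
  obtains a b where "(a, b) \<in> \<phi>" "pt_less a p" "pt_less p b" "((a, b), (p, p)) \<in> crossings \<phi>"
proof -
  note f = T_facts[OF assms(1)]
  from horizontal_free[OF f(2) assms(2)] assms(3) stp_passing[OF f(2)] T_covers[OF assms(1)]
  obtain a b where "(a, b) \<in> \<phi>" "pt_less a p" "pt_less p b" by blast
  with assms(2) that show ?thesis by (auto simp: crossings_def)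
qed

lemma T_break:
  assumes "\<phi> \<in> T" "(p, p) \<in> \<phi>" "covers_place h p"
  obtains \<psi> where "\<psi> \<in> T" "p \<in> broken \<psi>" "broken \<psi> = insert p (broken \<phi>)"
proof -
  note f = T_facts[OF assms(1)]
  obtain a b where ab: "(a, b) \<in> \<phi>" "pt_less a p" "pt_less p b" "((a, b), (p, p)) \<in> crossings \<phi>"
    using assms by (rule T_crossing)
  let ?\<psi> = "resolve \<phi> ((a, b), (p, p))"
  have T: "?\<psi> \<in> T" using assms(1) ab(4) by (rule resolve_tm)
  note un = unbrk_resolve[OF f(2) ab(1) assms(2) ab(2,3) T_facts(2)[OF T] refl]
  have "broken \<phi> = broken ?\<psi> - {p}"
    using unbrk_strands(5)[OF T_facts(1,2)[OF T] un(4)] un(1) by simp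
  with T un(4) that show ?thesis by blast
qed

section \<open>The differential as a coboundary operator on sets of breaks\<close>

lemma T_crossings:
  assumes "\<phi> \<in> T" "c \<in> crossings \<phi>"
  obtains a b p where "c = ((a, b), (p, p))" "(a, b) \<in> \<phi>" "(p, p) \<in> \<phi>" "pt_less a p" "pt_less p b"
  using assms thin_crossings[OF T_facts(3)[OF assms(1)]] by auto

text \<open>Crossings correspond to horizontal strands on covered steps, and a resolution removes
  exactly the one at \<open>p\<close>. So every resolution lowers the number of crossings by exactly
  1 and the filter in \<open>bd_basis\<close> selects them all.\<close>

lemma T_bd_basis:
  assumes "\<phi> \<in> T"
  shows "bd_basis \<phi> = (\<Sum>c\<in>crossings \<phi>. basis (resolve \<phi> c))"
proof -
  note f = T_facts[OF assms]
  have "inv_count (resolve \<phi> c) + 1 = inv_count \<phi>" if c: "c \<in> crossings \<phi>" for c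
  proof -
    obtain a b p where abp: "c = ((a, b), (p, p))" "(a, b) \<in> \<phi>" "(p, p) \<in> \<phi>" "pt_less a p" "pt_less p b"
      using assms c by (rule T_crossings)
    have T: "resolve \<phi> c \<in> T" using assms c by (rule resolve_tm)
    have ne: "a \<noteq> p" "b \<noteq> p" using abp by (auto simp: pt_less_def)
    let ?H = "{q. (q, q) \<in> \<phi> \<and> stp \<phi> q}"
    have eq: "{q. (q, q) \<in> resolve \<phi> c \<and> stp (resolve \<phi> c) q} = ?H - {p}"
      unfolding T_facts(5)[OF T] f(5) using abp ne by (auto simp: pt_less_def)
    have pH: "p \<in> ?H" using abp passing_stp by blast
    have fin: "finite ?H"
      by (rule finite_subset[of _ "Domain \<phi>"]) (use strandsD(1)[OF f(2)] in \<open>auto intro: finite_Domain\<close>)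
    show ?thesis
      unfolding thin_inv_count[OF f(3)] thin_inv_count[OF T_facts(3)[OF T]] eq
      using card_Suc_Diff1[OF fin pH] by (simp only: Suc_eq_plus1)
  qed
  then have "{c \<in> crossings \<phi>. inv_count (resolve \<phi> c) + 1 = inv_count \<phi>} = crossings \<phi>" by blast
  then show ?thesis by (simp add: bd_basis_def)
qed

lemma lookup_basis: "lookup (basis \<chi>) \<psi> = of_bool (\<chi> = \<psi>)"
  by (auto simp: basis_def lookup_single when_def)

lemma finite_broken:
  assumes "\<phi> \<in> T" shows "finite (broken \<phi>)"
  by (rule finite_subset[OF _ finite_places]) (use broken_facts(1)[OF assms] in blast)

lemma finite_crossings: "strands \<phi> \<Longrightarrow> finite (crossings \<phi>)"
  by (rule finite_subset[of _ "\<phi> \<times> \<phi>"]) (auto simp: crossings_def dest: strandsD(1))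

lemma keys_bd:
  assumes "keys x \<subseteq> T"
  shows "keys (bd x) \<subseteq> T"
proof
  fix \<psi> assume "\<psi> \<in> keys (bd x)"
  then obtain \<phi> where \<phi>: "\<phi> \<in> keys x" "\<psi> \<in> keys (bd_basis \<phi>)"
    unfolding bd_def by (blast dest: keys_sumD)
  then have T: "\<phi> \<in> T" using assms by blast
  have "\<exists>c\<in>crossings \<phi>. \<psi> \<in> keys (basis (resolve \<phi> c))"
    by (rule keys_sumD) (use \<phi>(2) T_bd_basis[OF T] in simp)
  then obtain c where "c \<in> crossings \<phi>" "\<psi> = resolve \<phi> c" by (auto simp del: resolve.simps)
  with T show "\<psi> \<in> T" by (simp add: resolve_tm)
qed

text \<open>The pairs of a term and a crossing that resolve to \<psi> correspond to the breaks of
  \<psi>: a crossing goes to the place of its horizontal strand, a break to the term in which it is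
  healed.\<close>

lemma lookup_bd:
  assumes "keys x \<subseteq> T" "\<psi> \<in> T"
  shows "lookup (bd x) \<psi> = (\<Sum>p\<in>broken \<psi>. lookup x (unbrk p \<psi>))"
proof -
  note f = T_facts[OF assms(2)]
  let ?A = "SIGMA \<phi>:keys x. crossings \<phi>"
  let ?B = "{c\<in>?A. resolve (fst c) (snd c) = \<psi>}"
  let ?C = "{p\<in>broken \<psi>. unbrk p \<psi> \<in> keys x}"
  have finA: "finite ?A"
    by (rule finite_SigmaI) (use assms T_facts(2) finite_crossings in \<open>auto\<close>)
  have "lookup (bd x) \<psi> = (\<Sum>\<phi>\<in>keys x. \<Sum>c\<in>crossings \<phi>. lookup (basis (resolve \<phi> c)) \<psi>)"
    unfolding bd_def lookup_sum_chain
    by (rule sum.cong) (use assms(1) T_bd_basis in \<open>auto simp: lookup_sum_chain\<close>)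
  also have "\<dots> = (\<Sum>c\<in>?A. of_bool (resolve (fst c) (snd c) = \<psi>))"
    using assms T_facts(2) finite_crossings
    by (subst sum.Sigma) (auto simp: lookup_basis intro!: sum.cong)
  also have "\<dots> = (\<Sum>c\<in>?B. 1)"
    using finA by (intro sum.mono_neutral_cong_right) auto
  also have "\<dots> = (\<Sum>p\<in>?C. 1)"
  proof (rule sum.reindex_cong[symmetric])
    let ?f = "\<lambda>c. fst (snd (snd c))"
    have key: "\<exists>p. unbrk p \<psi> = fst c \<and> p = ?f c \<and> p \<in> broken \<psi> \<and>
        (\<exists>a b. snd c = ((a, b), (p, p)) \<and> (a, p) \<in> \<psi> \<and> (p, b) \<in> \<psi>)" if "c \<in> ?B" for c
    proof -
      obtain \<phi> d where c: "c = (\<phi>, d)" by fastforce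
      with that have cB: "\<phi> \<in> keys x" "d \<in> crossings \<phi>" "\<psi> = resolve \<phi> d" by auto
      then have T: "\<phi> \<in> T" using assms by blast
      obtain a b p where abp: "d = ((a, b), (p, p))" "(a, b) \<in> \<phi>" "(p, p) \<in> \<phi>" "pt_less a p" "pt_less p b"
        using T cB(2) by (rule T_crossings)
      note un = unbrk_resolve[OF T_facts(2)[OF T] abp(2-5) f(2) cB(3)[unfolded abp(1)]]
      show ?thesis unfolding c using un abp by (intro exI[of _ p]) auto
    qed
    show "inj_on ?f ?B"
    proof (rule inj_onI)
      fix c c' assume cc: "c \<in> ?B" "c' \<in> ?B" and eq: "?f c = ?f c'"
      from key[OF cc(1)] obtain p a b where 1: "unbrk p \<psi> = fst c" "p = ?f c"
        "snd c = ((a, b), (p, p))" "(a, p) \<in> \<psi>" "(p, b) \<in> \<psi>" by blast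
      from key[OF cc(2)] obtain p' a' b' where 2: "unbrk p' \<psi> = fst c'" "p' = ?f c'"
        "snd c' = ((a', b'), (p', p'))" "(a', p') \<in> \<psi>" "(p', b') \<in> \<psi>" by blast
      have "p = p'" using 1(2) 2(2) eq by simp
      then have ab: "a = a'" "b = b'" using strandsD(2,3)[OF f(2)] 1 2 by blast+
      show "c = c'"
      proof (rule prod_eqI)
        show "fst c = fst c'" using 1(1) 2(1) \<open>p = p'\<close> by metis
        show "snd c = snd c'" unfolding 1(3) 2(3) ab \<open>p = p'\<close> ..
      qed
    qed
    show "?C = ?f ` ?B"
    proof
      show "?C \<subseteq> ?f ` ?B"
      proof
        fix p assume p: "p \<in> ?C"
        then have "p \<in> broken \<psi>" by blast
        then obtain a b where ab: "(a, p) \<in> \<psi>" "(p, b) \<in> \<psi>" "a \<noteq> p" "b \<noteq> p" "pt_less a p" "pt_less p b"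
          using f(2) by (rule brokenE)
        note r = resolve_unbrk[OF f(2) ab(1,2,5,6)]
        have "(unbrk p \<psi>, ((a, b), (p, p))) \<in> ?B" using r p by simp
        then show "p \<in> ?f ` ?B" by (rule rev_image_eqI) simp
      qed
      show "?f ` ?B \<subseteq> ?C"
      proof
        fix p assume "p \<in> ?f ` ?B"
        then obtain c where c: "c \<in> ?B" "p = ?f c" by blast
        from key[OF c(1)] c(2) have "unbrk p \<psi> = fst c" "p \<in> broken \<psi>" by auto
        with c(1) show "p \<in> ?C" by auto
      qed
    qed
  qed simp
  also have "\<dots> = (\<Sum>p\<in>broken \<psi>. of_bool (unbrk p \<psi> \<in> keys x))"
    using finite_broken[OF assms(2)] by (intro sum.mono_neutral_cong_left) auto
  finally show ?thesis by (simp add: lookup_bit)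
qed

text \<open>With \<open>h\<close> fixed the breaks determine the moving strands and so, given
  \<open>s\<close> and \<open>t\<close>, the diagram. An element of the summand is therefore a
  function on sets of breaks.\<close>

lemma summand_iff:
  "x \<in> alg_summand Z (h, s, t) \<longleftrightarrow>
     keys x \<subseteq> T \<and> (\<forall>\<phi>\<in>keys x. \<forall>\<psi>\<in>T. broken \<psi> = broken \<phi> \<longrightarrow> \<psi> \<in> keys x)"
proof
  assume x: "x \<in> alg_summand Z (h, s, t)"
  then have x': "x \<in> strand_alg Z" "\<And>\<phi>. \<phi> \<in> keys x \<Longrightarrow> hdata (dg Z \<phi>) = (h, s, t)"
    unfolding alg_summand_def span_iff' by blast+
  note d = strand_alg_dg[OF x'(1)]
  have T: "\<phi> \<in> T" if "\<phi> \<in> keys x" for \<phi>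
    using tm_hdata[OF d(1,2)[OF that]] x'(2)[OF that] by blast
  moreover have "\<psi> \<in> keys x" if "\<phi> \<in> keys x" "\<psi> \<in> T" "broken \<psi> = broken \<phi>" for \<phi> \<psi>
  proof -
    note Tp = T[OF that(1)]
    have "mv \<psi> = mv \<phi>"
      using T_facts[OF Tp] T_facts[OF that(2)] that(3) by (intro mv_unique) auto
    then have "dg Z \<psi> = dg Z \<phi>" using tm_dg(1)[OF Tp] tm_dg(1)[OF that(2)] by simp
    with tm_dg(2)[OF that(2)] d(3)[OF that(1)] show ?thesis by auto
  qed
  ultimately show "keys x \<subseteq> T \<and> (\<forall>\<phi>\<in>keys x. \<forall>\<psi>\<in>T. broken \<psi> = broken \<phi> \<longrightarrow> \<psi> \<in> keys x)" by blast
next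
  assume x: "keys x \<subseteq> T \<and> (\<forall>\<phi>\<in>keys x. \<forall>\<psi>\<in>T. broken \<psi> = broken \<phi> \<longrightarrow> \<psi> \<in> keys x)"
  have "diagram Z (dg Z \<phi>) \<and> hdata (dg Z \<phi>) = (h, s, t) \<and> \<phi> \<in> dterms Z (dg Z \<phi>) \<and> dterms Z (dg Z \<phi>) \<subseteq> keys x"
    if k: "\<phi> \<in> keys x" for \<phi>
  proof -
    have T: "\<phi> \<in> T" using x k by blast
    note d = tm_dg[OF T]
    have "\<psi> \<in> keys x" if "\<psi> \<in> dterms Z (dg Z \<phi>)" for \<psi>
    proof -
      have "\<psi> \<in> T" using tm_hdata[OF d(4)[OF s_pairs t_pairs] that] d(3) by blast
      moreover have "mv \<psi> = mv \<phi>" using that unfolding d(1) by simp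
      then have "broken \<psi> = broken \<phi>" using broken_mv by metis
      ultimately show ?thesis using x k by blast
    qed
    with d s_pairs t_pairs show ?thesis by blast
  qed
  then show "x \<in> alg_summand Z (h, s, t)"
    unfolding alg_summand_def span_iff by (metis (no_types, lifting))
qed

lemma summandD:
  assumes "x \<in> alg_summand Z (h, s, t)"
  shows "keys x \<subseteq> T" "\<And>\<phi>. \<phi> \<in> T \<Longrightarrow> \<phi> \<in> keys x \<longleftrightarrow> (\<exists>\<psi>\<in>keys x. broken \<psi> = broken \<phi>)"
  using assms unfolding summand_iff by (auto 0 4)

text \<open>On such functions this is the simplicial coboundary modulo 2.\<close>

lemma lookup_bd_summand:
  assumes "x \<in> alg_summand Z (h, s, t)" "\<psi> \<in> T"
  shows "lookup (bd x) \<psi> = (\<Sum>p\<in>broken \<psi>. of_bool (\<exists>\<phi>\<in>keys x. broken \<phi> = broken \<psi> - {p}))"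
  unfolding lookup_bd[OF summandD(1)[OF assms(1)] assms(2)]
proof (rule sum.cong[OF refl])
  fix p assume p: "p \<in> broken \<psi>"
  note f = T_facts[OF assms(2)]
  show "lookup x (unbrk p \<psi>) = of_bool (\<exists>\<phi>\<in>keys x. broken \<phi> = broken \<psi> - {p})"
    using summandD(2)[OF assms(1) unbrk_tm[OF assms(2) p]] unbrk_strands(5)[OF f(1,2) p]
    by (simp add: lookup_bit)
qed

lemma bd_summand:
  assumes "x \<in> alg_summand Z (h, s, t)"
  shows "bd x \<in> alg_summand Z (h, s, t)"
  unfolding summand_iff
proof (intro conjI ballI impI)
  show sub: "keys (bd x) \<subseteq> T" using keys_bd summandD(1)[OF assms] by blast
  fix \<phi> \<psi> assume \<phi>: "\<phi> \<in> keys (bd x)" and \<psi>: "\<psi> \<in> T" "broken \<psi> = broken \<phi>"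
  have "\<phi> \<in> T" using \<phi> sub by blast
  have "lookup (bd x) \<psi> = lookup (bd x) \<phi>"
    unfolding lookup_bd_summand[OF assms \<psi>(1)] lookup_bd_summand[OF assms \<open>\<phi> \<in> T\<close>] \<psi>(2) ..
  with \<phi> show "\<psi> \<in> keys (bd x)" by (simp add: lookup_bit)
qed

text \<open>Every unordered pair is counted twice; this is the cancellation behind
  \<open>bd_bd\<close>.\<close>

lemma sum_symmetric_bit:
  fixes g :: "'a \<Rightarrow> 'a \<Rightarrow> bit"
  assumes "finite B" "\<And>p q. g p q = g q p"
  shows "(\<Sum>p\<in>B. \<Sum>q\<in>B - {p}. g p q) = 0"
  using assms(1)
proof (induction B rule: finite_induct)
  case (insert b B)
  have "(\<Sum>p\<in>insert b B. \<Sum>q\<in>insert b B - {p}. g p q)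
      = (\<Sum>q\<in>B. g b q) + (\<Sum>p\<in>B. \<Sum>q\<in>insert b (B - {p}). g p q)"
    using insert by (simp add: insert_Diff_if) (intro sum.cong refl; auto)
  also have "\<dots> = (\<Sum>q\<in>B. g b q) + (\<Sum>p\<in>B. g p b + (\<Sum>q\<in>B - {p}. g p q))"
    using insert by simp
  also have "\<dots> = (\<Sum>q\<in>B. g b q) + (\<Sum>p\<in>B. g b p)"
    using insert.IH assms(2) by (simp add: sum.distrib)
  finally show ?case by simp
qed simp

lemma bd_bd:
  assumes "x \<in> alg_summand Z (h, s, t)"
  shows "bd (bd x) = 0"
proof (rule poly_mapping_eqI)
  fix \<psi>
  show "lookup (bd (bd x)) \<psi> = lookup 0 \<psi>"
  proof (cases "\<psi> \<in> T")
    case True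
    note f = T_facts[OF True]
    let ?c = "\<lambda>B. of_bool (\<exists>\<phi>\<in>keys x. broken \<phi> = B) :: bit"
    have "lookup (bd (bd x)) \<psi> = (\<Sum>p\<in>broken \<psi>. lookup (bd x) (unbrk p \<psi>))"
      using lookup_bd[OF summandD(1)[OF bd_summand[OF assms]] True] .
    also have "\<dots> = (\<Sum>p\<in>broken \<psi>. \<Sum>q\<in>broken \<psi> - {p}. ?c (broken \<psi> - {p} - {q}))"
      using lookup_bd_summand[OF assms unbrk_tm[OF True]] unbrk_strands(5)[OF f(1,2)]
      by (intro sum.cong refl) simp
    also have "\<dots> = 0"
      by (rule sum_symmetric_bit[OF finite_broken[OF True]]) (simp add: Diff_insert2[symmetric] Diff_insert[symmetric] insert_commute)
    finally show ?thesis by simp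
  next
    case False
    then show ?thesis using keys_bd[OF keys_bd[OF summandD(1)[OF assms]]]
      by (auto simp: lookup_bit)
  qed
qed

end

section \<open>Homology of a viable summand\<close>

context viable_frame
begin

lemma covered_pair:
  assumes "\<phi> \<in> T" "P \<in> occ" "p \<in> pair_places Z P" "covers_place h p" "broken \<phi> \<inter> pair_places Z P = {}"
  obtains \<psi> where "\<psi> \<in> T" "(p, p) \<in> \<psi>" "mv \<psi> = mv \<phi>"
proof -
  have P: "P \<in> s" "P \<in> t" using assms(2) by (auto simp: occ_def)
  obtain r where r: "r \<in> pair_places Z P" "(r, r) \<in> \<phi>"
    using assms(1) P assms(3-5) by (rule dotted)
  show thesis by (rule horizontal_swap[OF assms(1) r(2,1) assms(3) that])
qed

text \<open>The dotted strand of the unbroken pair is moved to \<open>p\<close> and its crossing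
  resolved. So any covered place of a pair that is still unbroken may be added to a set of breaks,
  which is what makes these sets a join.\<close>

lemma covered_break:
  assumes "\<phi> \<in> T" "P \<in> occ" "p \<in> pair_places Z P" "covers_place h p" "broken \<phi> \<inter> pair_places Z P = {}"
  obtains \<psi> where "\<psi> \<in> T" "broken \<psi> = insert p (broken \<phi>)"
proof -
  obtain \<chi> where \<chi>: "\<chi> \<in> T" "(p, p) \<in> \<chi>" "mv \<chi> = mv \<phi>"
    using assms by (rule covered_pair)
  have "broken \<chi> = broken \<phi>" using \<chi>(3) broken_mv by metis
  with T_break[OF \<chi>(1,2) assms(4)] that show thesis by auto
qed

text \<open>
  In terms of the broken places, the differential of a viable summand is the coboundary of a join of
  discrete sets; coning off the place p contracts onto the chains broken elsewhere in its pair.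
\<close>

lemma contract_pair:
  assumes x: "x \<in> alg_summand Z (h, s, t)" "bd x = 0"
    and P: "P \<in> occ" "p \<in> pair_places Z P" "covers_place h p"
  obtains y where "y \<in> alg_summand Z (h, s, t)"
    "\<And>\<psi>. \<psi> \<in> keys (x + bd y) \<Longrightarrow> \<exists>q\<in>pair_places Z P. q \<noteq> p \<and> q \<in> broken \<psi>"
    "\<And>\<psi>. \<psi> \<in> keys (x + bd y) \<Longrightarrow> \<exists>\<phi>\<in>keys x. broken \<phi> \<inter> pair_places Z P \<noteq> {} \<and>
       broken \<phi> - pair_places Z P = broken \<psi> - pair_places Z P"
proof -
  let ?A = "pair_places Z P"
  define c where "c B = (\<exists>\<phi>\<in>keys x. broken \<phi> = B)" for B
  \<comment> \<open>The cone: its value on a set of breaks \<open>B\<close> that misses the pair is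
    the value of \<open>x\<close> on \<open>insert p B\<close>, and it is 0 on all other
    sets.\<close>
  let ?K = "{\<phi>\<in>T. broken \<phi> \<inter> ?A = {} \<and> c (insert p (broken \<phi>))}"
  have "finite ?K" using finite_tm by simp
  then obtain y :: "'i chain" where y: "keys y = ?K" by (rule finite_chain_of)
  have ys: "y \<in> alg_summand Z (h, s, t)" unfolding summand_iff y by auto
  have xk: "\<phi> \<in> keys x \<longleftrightarrow> c (broken \<phi>)" if "\<phi> \<in> T" for \<phi>
    using summandD(2)[OF x(1) that] by (simp add: c_def)
  have main: "(\<exists>q\<in>?A. q \<noteq> p \<and> q \<in> broken \<psi>) \<and>
      (\<exists>\<phi>\<in>keys x. broken \<phi> \<inter> ?A \<noteq> {} \<and> broken \<phi> - ?A = broken \<psi> - ?A)"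
    if k: "\<psi> \<in> keys (x + bd y)" for \<psi>
  proof -
    have T: "\<psi> \<in> T"
      using k keys_bd[OF summandD(1)[OF ys]] summandD(1)[OF x(1)] by (auto simp: keys_chain_add)
    note f = T_facts[OF T]
    let ?B = "broken \<psi>"
    have ly: "lookup y (unbrk r \<psi>) = of_bool ((?B - {r}) \<inter> ?A = {} \<and> c (insert p (?B - {r})))" if "r \<in> ?B" for r
      using unbrk_tm[OF T that] unbrk_strands(5)[OF f(1,2) that] by (simp add: lookup_bit y)
    have lbd: "lookup (bd y) \<psi> = (\<Sum>r\<in>?B. of_bool ((?B - {r}) \<inter> ?A = {} \<and> c (insert p (?B - {r}))))"
      unfolding lookup_bd[OF summandD(1)[OF ys] T] by (rule sum.cong) (simp_all add: ly)
    have nz: "lookup x \<psi> + lookup (bd y) \<psi> \<noteq> 0"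
      using k by (simp add: in_keys_iff lookup_add)
    show ?thesis
    proof (cases "?B \<inter> ?A = {}")
      case True
      then obtain \<omega> where \<omega>: "\<omega> \<in> T" "broken \<omega> = insert p ?B"
        using covered_break[OF T P] by blast
      have p: "p \<notin> ?B" using True P(2) by blast
      \<comment> \<open>The cycle condition for \<open>x\<close>, read at the set of breaks
        \<open>insert p ?B\<close>, says that the coefficients of \<psi> in \<open>x\<close> and
        \<open>bd y\<close> agree.\<close>
      have "0 = lookup (bd x) \<omega>" by (simp add: x(2))
      also have "\<dots> = (\<Sum>r\<in>insert p ?B. of_bool (c (insert p ?B - {r})))"
        unfolding lookup_bd_summand[OF x(1) \<omega>(1)] \<omega>(2) c_def ..
      also have "\<dots> = of_bool (c ?B) + (\<Sum>r\<in>?B. of_bool (c (insert p ?B - {r})))"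
        using finite_broken[OF T] p by simp
      also have "(\<Sum>r\<in>?B. of_bool (c (insert p ?B - {r})) :: bit) = lookup (bd y) \<psi>"
        unfolding lbd
      proof (rule sum.cong[OF refl])
        fix r assume "r \<in> ?B"
        then have "insert p ?B - {r} = insert p (?B - {r})" using p by blast
        moreover have "(?B - {r}) \<inter> ?A = {}" using True by blast
        ultimately show "(of_bool (c (insert p ?B - {r})) :: bit) =
          of_bool ((?B - {r}) \<inter> ?A = {} \<and> c (insert p (?B - {r})))" by simp
      qed
      finally have "lookup x \<psi> + lookup (bd y) \<psi> = 0" by (simp add: lookup_bit xk[OF T])
      with nz show ?thesis by blast
    next
      case False
      then obtain q where q: "q \<in> ?B" "q \<in> ?A" by blast
      have uq: "r = q" if "r \<in> ?B" "r \<in> ?A" for r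
        using broken_pair_unique[OF T that(1) _ that(2) q(2)] broken_facts(3)[OF T q(1)] by blast
      have lb: "lookup (bd y) \<psi> = of_bool (c (insert p (?B - {q})))"
      proof -
        have "lookup (bd y) \<psi> = (\<Sum>r\<in>?B. if r = q then of_bool (c (insert p (?B - {q}))) else 0)"
          unfolding lbd
        proof (rule sum.cong[OF refl])
          fix r assume r: "r \<in> ?B"
          have "(?B - {q}) \<inter> ?A = {}" using uq by blast
          moreover have "r \<noteq> q \<Longrightarrow> (?B - {r}) \<inter> ?A \<noteq> {}" using q by blast
          ultimately show "of_bool ((?B - {r}) \<inter> ?A = {} \<and> c (insert p (?B - {r}))) =
            (if r = q then of_bool (c (insert p (?B - {q}))) else 0 :: bit)" by (cases "r = q") simp_all
        qed
        then show ?thesis using q(1) finite_broken[OF T] by simp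
      qed
      have qp: "q \<noteq> p"
      proof
        assume "q = p"
        then have "insert p (?B - {q}) = ?B" using q(1) by blast
        with nz lb show False by (simp add: lookup_bit xk[OF T])
      qed
      have "c ?B \<or> c (insert p (?B - {q}))"
        using nz lb by (auto simp: lookup_bit xk[OF T])
      then have "\<exists>\<phi>\<in>keys x. broken \<phi> \<inter> ?A \<noteq> {} \<and> broken \<phi> - ?A = ?B - ?A"
      proof
        assume "c ?B"
        then obtain \<phi> where "\<phi> \<in> keys x" "broken \<phi> = ?B" unfolding c_def by blast
        with q show ?thesis by blast
      next
        assume "c (insert p (?B - {q}))"
        then obtain \<phi> where "\<phi> \<in> keys x" "broken \<phi> = insert p (?B - {q})" unfolding c_def by blast
        with q P(2) show ?thesis by (intro bexI[of _ \<phi>]) auto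
      qed
      with qp q show ?thesis by blast
    qed
  qed
  show thesis by (rule that[OF ys]) (use main in blast)+
qed

lemma finite_occ: "finite occ"
  by (rule finite_subset[of _ "pairs Z"]) (use s_pairs in \<open>auto simp: occ_def pairs_def\<close>)

text \<open>One pair after the other is contracted, and a contraction at \<open>P\<close> leaves the
  breaks at the other pairs in place. The last clause refers back to the original chain: a term of
  \<open>x\<close> itself, not only of a homologous chain, is wanted that breaks at all pairs of
  \<open>occ\<close>.\<close>

lemma contract_pairs:
  assumes x: "x \<in> alg_summand Z (h, s, t)" "bd x = 0"
    and p: "\<forall>P\<in>occ. p P \<in> pair_places Z P \<and> covers_place h (p P)"
    and F: "finite F" "F \<subseteq> occ"
  shows "\<exists>y\<in>alg_summand Z (h, s, t). \<forall>\<psi>\<in>keys (x + bd y).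
    (\<forall>P\<in>F. \<exists>q\<in>pair_places Z P. q \<noteq> p P \<and> q \<in> broken \<psi>) \<and>
    (\<exists>\<phi>\<in>keys x. \<forall>P\<in>occ. broken \<psi> \<inter> pair_places Z P \<noteq> {} \<longrightarrow> broken \<phi> \<inter> pair_places Z P \<noteq> {})"
  using F
proof (induction F rule: finite_induct)
  case empty
  have "0 \<in> alg_summand Z (h, s, t)" by (simp add: summand_iff)
  then show ?case by (intro bexI[of _ 0]) auto
next
  case (insert P F)
  then obtain y where y: "y \<in> alg_summand Z (h, s, t)" and IH: "\<forall>\<psi>\<in>keys (x + bd y).
    (\<forall>P\<in>F. \<exists>q\<in>pair_places Z P. q \<noteq> p P \<and> q \<in> broken \<psi>) \<and>
    (\<exists>\<phi>\<in>keys x. \<forall>P\<in>occ. broken \<psi> \<inter> pair_places Z P \<noteq> {} \<longrightarrow> broken \<phi> \<inter> pair_places Z P \<noteq> {})"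
    by blast
  have P: "P \<in> occ" using insert by blast
  have add: "u + v \<in> alg_summand Z (h, s, t)" if "u \<in> alg_summand Z (h, s, t)" "v \<in> alg_summand Z (h, s, t)" for u v
    using that strand_alg_add unfolding alg_summand_def span_iff' by (auto simp: keys_chain_add)
  let ?x = "x + bd y"
  have xs: "?x \<in> alg_summand Z (h, s, t)" using add[OF x(1) bd_summand[OF y]] .
  have bx: "bd ?x = 0" by (simp add: bd_add x(2) bd_bd[OF y])
  obtain z where z: "z \<in> alg_summand Z (h, s, t)"
    "\<And>\<psi>. \<psi> \<in> keys (?x + bd z) \<Longrightarrow> \<exists>q\<in>pair_places Z P. q \<noteq> p P \<and> q \<in> broken \<psi>"
    "\<And>\<psi>. \<psi> \<in> keys (?x + bd z) \<Longrightarrow> \<exists>\<phi>\<in>keys ?x. broken \<phi> \<inter> pair_places Z P \<noteq> {} \<and>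
       broken \<phi> - pair_places Z P = broken \<psi> - pair_places Z P"
    using contract_pair[OF xs bx P] bspec[OF p P] by blast
  have eq: "x + bd (y + z) = ?x + bd z" by (simp add: bd_add add.assoc)
  have "(\<forall>P\<in>insert P F. \<exists>q\<in>pair_places Z P. q \<noteq> p P \<and> q \<in> broken \<psi>) \<and>
    (\<exists>\<phi>\<in>keys x. \<forall>P\<in>occ. broken \<psi> \<inter> pair_places Z P \<noteq> {} \<longrightarrow> broken \<phi> \<inter> pair_places Z P \<noteq> {})"
    if k: "\<psi> \<in> keys (x + bd (y + z))" for \<psi>
  proof -
    note k' = k[unfolded eq]
    obtain \<phi> where \<phi>: "\<phi> \<in> keys ?x" "broken \<phi> \<inter> pair_places Z P \<noteq> {}"
      "broken \<phi> - pair_places Z P = broken \<psi> - pair_places Z P" using z(3)[OF k'] by blast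
    have disj: "pair_places Z P \<inter> pair_places Z P' = {}" if "P' \<noteq> P" for P'
      using that by (auto simp: pair_places_def)
    have same: "broken \<phi> \<inter> pair_places Z P' = broken \<psi> \<inter> pair_places Z P'" if "P' \<noteq> P" for P'
      using \<phi>(3) disj[OF that] by blast
    have 1: "\<exists>q\<in>pair_places Z P'. q \<noteq> p P' \<and> q \<in> broken \<psi>" if "P' \<in> insert P F" for P'
    proof (cases "P' = P")
      case True with z(2)[OF k'] show ?thesis by simp
    next
      case False
      then obtain q where "q \<in> pair_places Z P'" "q \<noteq> p P'" "q \<in> broken \<phi>"
        using IH \<phi>(1) \<open>P' \<in> insert P F\<close> by blast
      with same[OF False] show ?thesis by blast
    qed
    obtain \<phi>' where \<phi>': "\<phi>' \<in> keys x"
      "\<forall>P\<in>occ. broken \<phi> \<inter> pair_places Z P \<noteq> {} \<longrightarrow> broken \<phi>' \<inter> pair_places Z P \<noteq> {}"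
      using IH \<phi>(1) by blast
    have "broken \<phi>' \<inter> pair_places Z P' \<noteq> {}" if "P' \<in> occ" "broken \<psi> \<inter> pair_places Z P' \<noteq> {}" for P'
      using \<phi>'(2) that \<phi>(2) same[of P'] by (cases "P' = P") auto
    with 1 \<phi>'(1) show ?thesis by blast
  qed
  with add[OF y z(1)] show ?case by blast
qed

lemma crossings_pair:
  assumes "\<phi> \<in> T"
  shows "crossings \<phi> = {} \<longleftrightarrow> (\<nexists>p. (p, p) \<in> \<phi> \<and> covers_place h p \<and> p \<in> places Z)"
proof -
  note f = T_facts[OF assms]
  have "covers_place h p \<and> p \<in> places Z" if p: "(p, p) \<in> \<phi>" "stp \<phi> p" for p
  proof -
    obtain a b where ab: "(a, b) \<in> \<phi>" "pt_less a p" "pt_less p b"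
      using stp_passing[OF f(2) p(2)] horizontal_free[OF f(2) p(1)] by blast
    have "b \<in> points Z" using ab f(1) by (auto simp: strand_diagrams_def)
    with ab have "p \<in> places Z"
      by (cases b; cases p) (auto simp: pt_less_def points_def places_def)
    with passing_stp[OF ab] show ?thesis using T_covers[OF assms] by blast
  qed
  moreover have "stp \<phi> p" if "covers_place h p" for p using T_covers[OF assms] that by blast
  ultimately show ?thesis using thin_crossings_empty[OF f(3)] by blast
qed

lemma occI:
  assumes "\<phi> \<in> T" "(r, r) \<in> \<phi>" "r \<in> pair_places Z P" "p \<in> pair_places Z P" "covers_place h p"
  shows "P \<in> occ" "broken \<phi> \<inter> pair_places Z P = {}"
proof -
  note f = T_facts[OF assms(1)]
  have r: "r \<in> Domain \<phi>" "r \<in> Range \<phi>" using assms(2) by auto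
  show "P \<in> occ"
    using sections_pair[OF f(6) r(1) assms(3)] sections_pair[OF f(7) r(2) assms(3)] assms(4,5)
    by (auto simp: occ_def)
  show "broken \<phi> \<inter> pair_places Z P = {}"
  proof (rule ccontr)
    assume "\<not> ?thesis"
    then obtain q where q: "q \<in> broken \<phi>" "q \<in> pair_places Z P" by blast
    have "q = r" using broken_pair_unique[OF assms(1) q(1) _ q(2) assms(3)] r by blast
    with broken_facts(6)[OF assms(1) q(1)] assms(2) show False by simp
  qed
qed

lemma dterms_T:
  assumes "\<phi> \<in> T"
  shows "dterms Z (dg Z \<phi>) = {\<psi>\<in>T. mv \<psi> = mv \<phi>}"
proof -
  have "hg \<psi> = h" if "mv \<psi> = mv \<phi>" for \<psi>
    using hg_mv[of \<psi>] hg_mv[of \<phi>] T_facts(4)[OF assms] that by simp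
  then show ?thesis unfolding tm_dg(1)[OF assms] by (auto simp: tm_def)
qed

text \<open>An unbroken pair of \<open>occ\<close> carries a dotted strand, which in some term sits
  at a place covered by \<open>h\<close> and is crossed there.\<close>

lemma has_crossings_iff:
  assumes "\<phi> \<in> T"
  shows "has_crossings Z (dg Z \<phi>) \<longleftrightarrow> (\<exists>P\<in>occ. broken \<phi> \<inter> pair_places Z P = {})"
proof -
  have keys: "keys (elt Z (dg Z \<phi>)) = {\<psi>\<in>T. mv \<psi> = mv \<phi>}"
    using keys_elt_diagram[OF tm_dg(4)[OF assms s_pairs t_pairs]] dterms_T[OF assms] by simp
  have br: "broken \<psi> = broken \<phi>" if "mv \<psi> = mv \<phi>" for \<psi> using broken_mv that by metis
  show ?thesis
  proof
    assume "has_crossings Z (dg Z \<phi>)"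
    then obtain \<psi> where \<psi>: "\<psi> \<in> T" "mv \<psi> = mv \<phi>" "crossings \<psi> \<noteq> {}"
      unfolding has_crossings_def keys by blast
    then obtain p where p: "(p, p) \<in> \<psi>" "covers_place h p" "p \<in> places Z"
      using crossings_pair by blast
    then have pp: "p \<in> pair_places Z (matching Z p)" by (simp add: pair_places_def)
    from occI[OF \<psi>(1) p(1) pp pp p(2)] br[OF \<psi>(2)]
    show "\<exists>P\<in>occ. broken \<phi> \<inter> pair_places Z P = {}" by auto
  next
    assume "\<exists>P\<in>occ. broken \<phi> \<inter> pair_places Z P = {}"
    then obtain P p where P: "P \<in> occ" "broken \<phi> \<inter> pair_places Z P = {}"
      "p \<in> pair_places Z P" "covers_place h p" by (auto simp: occ_def)
    obtain \<psi> where \<psi>: "\<psi> \<in> T" "(p, p) \<in> \<psi>" "mv \<psi> = mv \<phi>"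
      by (rule covered_pair[OF assms P(1,3,4,2)])
    moreover have "p \<in> places Z" using P(3) by (simp add: pair_places_def)
    ultimately have "crossings \<psi> \<noteq> {}" using crossings_pair P(4) by blast
    with \<psi> show "has_crossings Z (dg Z \<phi>)" unfolding has_crossings_def keys by blast
  qed
qed

lemma once_occupied_occ:
  assumes "P \<in> s" "P \<in> t" "once_occupied_at Z h P p"
  shows "P \<in> occ" "p \<in> pair_places Z P" "covers_place h p"
    "q \<in> pair_places Z P \<Longrightarrow> covers_place h q \<Longrightarrow> q = p"
  using assms unfolding once_occupied_at_def occ_def covers_place_def avoids_place_def by blast+

text \<open>After contraction at all pairs of \<open>occ\<close>, a term must break at the place of
  each pair that was not chosen. Only one set of breaks remains, so what is left is a single
  uncrossed diagram. A once occupied pair has no second covered place, hence cannot occur if the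
  class is nonzero.\<close>

lemma homology_viable:
  assumes x: "x \<in> alg_summand Z (h, s, t)" "bd x = 0" and nz: "x \<notin> bd ` strand_alg Z"
  obtains \<psi> where "\<psi> \<in> T" "\<not> has_crossings Z (dg Z \<psi>)" "hclass Z (elt Z (dg Z \<psi>)) = hclass Z x"
    "bd (elt Z (dg Z \<psi>)) = 0" "\<And>P p. P \<in> s \<Longrightarrow> P \<in> t \<Longrightarrow> \<not> once_occupied_at Z h P p"
    "\<exists>\<phi>\<in>keys x. \<forall>P\<in>occ. broken \<phi> \<inter> pair_places Z P \<noteq> {}"
proof -
  define p where "p P = (SOME p. p \<in> pair_places Z P \<and> covers_place h p)" for P
  have p: "p P \<in> pair_places Z P \<and> covers_place h (p P)" if "P \<in> occ" for P
  proof -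
    have "\<exists>q. q \<in> pair_places Z P \<and> covers_place h q" using that by (auto simp: occ_def)
    then show ?thesis unfolding p_def by (rule someI_ex)
  qed
  have "\<forall>P\<in>occ. p P \<in> pair_places Z P \<and> covers_place h (p P)" using p by simp
  from contract_pairs[OF x this finite_occ subset_refl] obtain y where y: "y \<in> alg_summand Z (h, s, t)"
    and y': "\<forall>\<psi>\<in>keys (x + bd y). (\<forall>P\<in>occ. \<exists>q\<in>pair_places Z P. q \<noteq> p P \<and> q \<in> broken \<psi>) \<and>
    (\<exists>\<phi>\<in>keys x. \<forall>P\<in>occ. broken \<psi> \<inter> pair_places Z P \<noteq> {} \<longrightarrow> broken \<phi> \<inter> pair_places Z P \<noteq> {})"
    by (elim bexE)
  have ya: "y \<in> strand_alg Z" using y unfolding alg_summand_def span_iff' by blast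
  have "x + bd y \<noteq> 0"
  proof
    assume "x + bd y = 0"
    then have "x + (x + bd y) = x + 0" by (rule arg_cong)
    then have "x = bd y" by simp
    with ya nz show False by blast
  qed
  then obtain \<psi> where \<psi>: "\<psi> \<in> keys (x + bd y)" by fastforce
  have sub: "keys (x + bd y) \<subseteq> T"
    using summandD(1)[OF x(1)] keys_bd[OF summandD(1)[OF y]] by (auto simp: keys_chain_add)
  have T: "\<psi> \<in> T" using \<psi> sub by blast
  have meets: "\<forall>P\<in>occ. \<exists>q\<in>pair_places Z P. q \<noteq> p P \<and> q \<in> broken \<chi>" if "\<chi> \<in> keys (x + bd y)" for \<chi>
    using y' that by blast
  have subset: "broken \<chi> \<subseteq> broken \<psi>'" if \<chi>: "\<chi> \<in> keys (x + bd y)" "\<psi>' \<in> keys (x + bd y)" for \<chi> \<psi>'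
  proof
    fix r assume r: "r \<in> broken \<chi>"
    have T\<chi>: "\<chi> \<in> T" using \<chi> sub by blast
    note b = broken_facts[OF T\<chi> r]
    let ?P = "matching Z r"
    obtain q where q: "q \<in> pair_places Z ?P" "q \<noteq> p ?P" "q \<in> broken \<psi>'" using meets[OF \<chi>(2)] b(5) by blast
    obtain q' where q': "q' \<in> pair_places Z ?P" "q' \<noteq> p ?P" "q' \<in> broken \<chi>" using meets[OF \<chi>(1)] b(5) by blast
    have "r = q'" using broken_pair_unique[OF T\<chi> r _ b(7) q'(1)] broken_facts(3)[OF T\<chi> q'(3)] by blast
    moreover obtain q0 where "pair_places Z ?P = {p ?P, q0}"
      using pair_placesE[of "p ?P" ?P] p[OF b(5)] by blast
    ultimately have "r = q" using q q' by blast
    with q show "r \<in> broken \<psi>'" by simp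
  qed
  have as: "x + bd y \<in> alg_summand Z (h, s, t)"
    using x(1) bd_summand[OF y] strand_alg_add unfolding alg_summand_def span_iff' by (auto simp: keys_chain_add)
  have "keys (x + bd y) = keys (elt Z (dg Z \<psi>))"
  proof -
    have "keys (x + bd y) = {\<chi>\<in>T. broken \<chi> = broken \<psi>}"
      using sub subset[OF \<psi>] subset[OF _ \<psi>] summandD(2)[OF as] \<psi> by blast
    also have "\<dots> = {\<chi>\<in>T. mv \<chi> = mv \<psi>}"
    proof (intro Collect_cong conj_cong refl iffI)
      fix \<chi> assume "\<chi> \<in> T" "broken \<chi> = broken \<psi>"
      with T_facts[OF T] T_facts[of \<chi>] show "mv \<chi> = mv \<psi>" by (intro mv_unique) auto
    next
      fix \<chi> assume "mv \<chi> = mv \<psi>" then show "broken \<chi> = broken \<psi>" using broken_mv by metis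
    qed
    also have "\<dots> = dterms Z (dg Z \<psi>)" using dterms_T[OF T] by simp
    finally show ?thesis using keys_elt_diagram[OF tm_dg(4)[OF T s_pairs t_pairs]] by simp
  qed
  then have eq: "elt Z (dg Z \<psi>) = x + bd y" by (intro chain_eqI) simp
  show thesis
  proof (rule that[OF T])
    have ne: "broken \<psi> \<inter> pair_places Z P \<noteq> {}" if "P \<in> occ" for P
      using bspec[OF meets[OF \<psi>] that] by blast
    then show "\<not> has_crossings Z (dg Z \<psi>)" unfolding has_crossings_iff[OF T] by blast
    show "hclass Z (elt Z (dg Z \<psi>)) = hclass Z x"
      unfolding hclass_eq_iff eq using ya by (simp add: add.commute)
    show "bd (elt Z (dg Z \<psi>)) = 0" unfolding eq by (simp add: bd_add x(2) bd_bd[OF y])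
    show "\<exists>\<phi>\<in>keys x. \<forall>P\<in>occ. broken \<phi> \<inter> pair_places Z P \<noteq> {}"
    proof -
      from bspec[OF y' \<psi>] obtain \<phi> where "\<phi> \<in> keys x"
        "\<forall>P\<in>occ. broken \<psi> \<inter> pair_places Z P \<noteq> {} \<longrightarrow> broken \<phi> \<inter> pair_places Z P \<noteq> {}"
        by (elim conjE bexE)
      with ne show ?thesis by blast
    qed
    fix P q assume P: "P \<in> s" "P \<in> t"
    show "\<not> once_occupied_at Z h P q"
    proof
      assume o: "once_occupied_at Z h P q"
      note oo = once_occupied_occ[OF P o]
      obtain r where r: "r \<in> pair_places Z P" "r \<noteq> p P" "r \<in> broken \<psi>" using meets[OF \<psi>] oo(1) by blast
      have "p P = q" "r = q" using oo(4) p[OF oo(1)] r broken_facts(2)[OF T r(3)] by blast+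
      with r show False by simp
    qed
  qed
qed

lemma homology_once_occupied:
  assumes "x \<in> alg_summand Z (h, s, t)" "bd x = 0" "P \<in> s" "P \<in> t" "once_occupied_at Z h P p"
  shows "x \<in> bd ` strand_alg Z"
proof (rule ccontr)
  assume "x \<notin> bd ` strand_alg Z"
  from homology_viable[OF assms(1,2) this] assms(3-5) show False by blast
qed

text \<open>A term with the largest number of breaks will do: at an unbroken pair of
  \<open>occ\<close> one more could be added.\<close>

lemma exists_uncrossed:
  assumes "\<phi> \<in> T"
  obtains \<psi> where "\<psi> \<in> T" "\<forall>P\<in>occ. broken \<psi> \<inter> pair_places Z P \<noteq> {}"
proof -
  have "\<exists>\<psi>. \<psi> \<in> T \<and> (\<forall>\<chi>. \<chi> \<in> T \<longrightarrow> card (broken \<chi>) \<le> card (broken \<psi>))"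
  proof (rule ex_has_greatest_nat[of "\<lambda>\<psi>. \<psi> \<in> T" \<phi> "\<lambda>\<psi>. card (broken \<psi>)" "Suc (card (places Z))", OF assms])
    show "\<forall>\<chi>. \<chi> \<in> T \<longrightarrow> card (broken \<chi>) < Suc (card (places Z))"
    proof (intro allI impI)
      fix \<chi> assume "\<chi> \<in> T"
      then have "broken \<chi> \<subseteq> places Z" using broken_facts(1) by blast
      with card_mono[OF finite_places] show "card (broken \<chi>) < Suc (card (places Z))"
        by (simp add: less_Suc_eq_le)
    qed
  qed
  then obtain \<psi> where \<psi>: "\<psi> \<in> T" "\<And>\<chi>. \<chi> \<in> T \<Longrightarrow> card (broken \<chi>) \<le> card (broken \<psi>)" by blast
  have "broken \<psi> \<inter> pair_places Z P \<noteq> {}" if P: "P \<in> occ" for P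
  proof
    assume e: "broken \<psi> \<inter> pair_places Z P = {}"
    from P obtain p where p: "p \<in> pair_places Z P" "covers_place h p" by (auto simp: occ_def)
    obtain \<chi> where "\<chi> \<in> T" "broken \<chi> = insert p (broken \<psi>)"
      using covered_break[OF \<psi>(1) P p e] by blast
    with \<psi>(2)[of \<chi>] finite_broken[OF \<psi>(1)] e p(1) show False by (auto simp: card_insert_if split: if_splits)
  qed
  with \<psi>(1) that show thesis by blast
qed

lemma uncrossed_bd:
  assumes "\<psi> \<in> T" "\<forall>P\<in>occ. broken \<psi> \<inter> pair_places Z P \<noteq> {}"
  shows "bd (elt Z (dg Z \<psi>)) = 0" "elt Z (dg Z \<psi>) \<in> alg_summand Z (h, s, t)"
proof -
  note d = tm_dg[OF assms(1)]
  note dia = d(4)[OF s_pairs t_pairs]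
  show "elt Z (dg Z \<psi>) \<in> alg_summand Z (h, s, t)"
    unfolding alg_summand_def span_iff' using elt_strand_alg[OF dia] keys_elt_diagram[OF dia] d(3) dterms_dg
    by auto
  have "crossings \<chi> = {}" if "\<chi> \<in> keys (elt Z (dg Z \<psi>))" for \<chi>
    using assms(2) has_crossings_iff[OF assms(1)] that unfolding has_crossings_def by blast
  then show "bd (elt Z (dg Z \<psi>)) = 0" by (simp add: bd_def bd_basis_def)
qed

text \<open>An uncrossed diagram exists, and the once occupied pair makes the summand acyclic.
  Twistedness is the condition under which \<open>f\<close> is given by
  \<open>astar\<close>.\<close>

lemma twisted_hdataI:
  assumes "\<phi> \<in> T" "P \<in> s" "P \<in> t" "once_occupied_at Z h P p"
  shows "twisted_hdata Z (h, s, t)"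
proof -
  obtain \<psi> where \<psi>: "\<psi> \<in> T" "\<forall>P\<in>occ. broken \<psi> \<inter> pair_places Z P \<noteq> {}"
    using assms(1) by (rule exists_uncrossed)
  note d = tm_dg[OF \<psi>(1)]
  note u = uncrossed_bd[OF \<psi>]
  have "\<not> has_crossings Z (dg Z \<psi>)" using \<psi> has_crossings_iff by blast
  moreover have "hclass Z (elt Z (dg Z \<psi>)) = hzero Z"
    unfolding hclass_zero_iff by (rule homology_once_occupied[OF u(2,1) assms(2-4)])
  moreover have "viable_h Z (hgrade (dg Z \<psi>))"
    using T_facts(1,4)[OF \<psi>(1)] hg_viable[of \<psi>] h_le unfolding d(1) hgrade_hg hg_mv by simp
  ultimately have "twisted_dgm Z (dg Z \<psi>)"
    using d(4)[OF s_pairs t_pairs] by (simp add: twisted_dgm_def)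
  with d(3) show ?thesis unfolding twisted_hdata_def by blast
qed

end

section \<open>Products and the Maslov grading\<close>

lemma stp_not_start:
  assumes "strands \<phi>" "stp \<phi> p" "p \<notin> Domain (mv \<phi>)"
  shows "stp \<phi> (prv p)"
proof -
  from assms obtain a b where "(a, b) \<in> \<phi>" "pt_less a p" "pt_less p b" by (rule stp_passing)
  then show ?thesis by (rule passing_stp)
qed

lemma stp_not_end:
  assumes "strands \<phi>" "stp \<phi> (prv p)" "1 \<le> snd p" "p \<notin> Range (mv \<phi>)"
  shows "stp \<phi> p"
proof -
  from assms obtain a b where "(a, b) \<in> \<phi>" "pt_less a p" "pt_less p b" by (rule prv_passing)
  then show ?thesis by (rule passing_stp)
qed

definition nx :: "'i sdiag \<Rightarrow> 'i pt \<Rightarrow> 'i pt" where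
  "nx \<psi> y = (THE z. (y, z) \<in> \<psi>)"

lemma nx_eq: "strands \<psi> \<Longrightarrow> (y, z) \<in> \<psi> \<Longrightarrow> nx \<psi> y = z"
  unfolding nx_def using strandsD(2) by blast

text \<open>A strand of the composite is a strand of \<phi> followed by one of \<psi>. All three
  gradings are therefore written as sums over the strands of \<phi>, and compared strand by
  strand.\<close>

lemma hg_comp:
  assumes "strands \<phi>" "strands \<psi>" "strands (\<phi> O \<psi>)" "Range \<phi> = Domain \<psi>"
  shows "hg (\<phi> O \<psi>) e = hg \<phi> e + hg \<psi> e"
proof -
  let ?f = "\<lambda>\<sigma>. (fst \<sigma>, nx \<psi> (snd \<sigma>))" and ?g = "\<lambda>\<sigma>. (snd \<sigma>, nx \<psi> (snd \<sigma>))"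
  note s = strandsD[OF assms(1)] and s' = strandsD[OF assms(2)]
  have n: "(y, nx \<psi> y) \<in> \<psi>" if "(x, y) \<in> \<phi>" for x y
  proof -
    have "y \<in> Domain \<psi>" using that assms(4) by blast
    then obtain z where "(y, z) \<in> \<psi>" by blast
    with nx_eq[OF assms(2) this] show ?thesis by simp
  qed
  have "inj_on ?f \<phi>"
  proof (rule inj_onI)
    fix \<sigma> \<tau> assume "\<sigma> \<in> \<phi>" "\<tau> \<in> \<phi>" "?f \<sigma> = ?f \<tau>"
    moreover obtain x y x' y' where "\<sigma> = (x, y)" "\<tau> = (x', y')" by fastforce
    ultimately show "\<sigma> = \<tau>" using s(2) by auto
  qed
  moreover have "?f ` \<phi> = \<phi> O \<psi>"
  proof
    show "?f ` \<phi> \<subseteq> \<phi> O \<psi>"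
    proof
      fix \<tau> assume "\<tau> \<in> ?f ` \<phi>"
      then obtain x y where "(x, y) \<in> \<phi>" "\<tau> = (x, nx \<psi> y)" by auto
      with n show "\<tau> \<in> \<phi> O \<psi>" by blast
    qed
    show "\<phi> O \<psi> \<subseteq> ?f ` \<phi>"
    proof
      fix \<sigma> assume "\<sigma> \<in> \<phi> O \<psi>"
      then obtain x y z where "\<sigma> = (x, z)" "(x, y) \<in> \<phi>" "(y, z) \<in> \<psi>" by blast
      moreover from this have "nx \<psi> y = z" using nx_eq[OF assms(2)] by blast
      ultimately show "\<sigma> \<in> ?f ` \<phi>" by force
    qed
  qed
  ultimately have 1: "hg (\<phi> O \<psi>) e = (\<Sum>\<sigma>\<in>\<phi>. of_bool (cvr (?f \<sigma>) e))"
    using hg_sum[OF strandsD(1)[OF assms(3)]] sum.reindex[of ?f \<phi> "\<lambda>\<sigma>. of_bool (cvr \<sigma> e) :: int"] by simp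
  have "inj_on ?g \<phi>"
  proof (rule inj_onI)
    fix \<sigma> \<tau> assume "\<sigma> \<in> \<phi>" "\<tau> \<in> \<phi>" "?g \<sigma> = ?g \<tau>"
    moreover obtain x y x' y' where "\<sigma> = (x, y)" "\<tau> = (x', y')" by fastforce
    ultimately show "\<sigma> = \<tau>" using s(3) by auto
  qed
  moreover have "?g ` \<phi> = \<psi>"
  proof
    show "?g ` \<phi> \<subseteq> \<psi>"
    proof
      fix \<tau> assume "\<tau> \<in> ?g ` \<phi>"
      then obtain x y where "(x, y) \<in> \<phi>" "\<tau> = (y, nx \<psi> y)" by auto
      with n show "\<tau> \<in> \<psi>" by blast
    qed
    show "\<psi> \<subseteq> ?g ` \<phi>"
    proof
      fix \<sigma> assume "\<sigma> \<in> \<psi>"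
      then obtain y z where yz: "\<sigma> = (y, z)" "(y, z) \<in> \<psi>" by (cases \<sigma>) auto
      then have "y \<in> Range \<phi>" using assms(4) by blast
      then obtain x where "(x, y) \<in> \<phi>" by blast
      moreover have "nx \<psi> y = z" using nx_eq[OF assms(2) yz(2)] .
      ultimately show "\<sigma> \<in> ?g ` \<phi>" using yz by force
    qed
  qed
  ultimately have 2: "hg \<psi> e = (\<Sum>\<sigma>\<in>\<phi>. of_bool (cvr (?g \<sigma>) e))"
    using hg_sum[OF s'(1)] sum.reindex[of ?g \<phi> "\<lambda>\<sigma>. of_bool (cvr \<sigma> e) :: int"] by simp
  have "of_bool (cvr (?f \<sigma>) e) = (of_bool (cvr \<sigma> e) :: int) + of_bool (cvr (?g \<sigma>) e)" if "\<sigma> \<in> \<phi>" for \<sigma>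
  proof -
    obtain x y where xy: "\<sigma> = (x, y)" by fastforce
    from s(4)[OF that[unfolded xy]] s'(4)[OF n[OF that[unfolded xy]]] show ?thesis
      unfolding xy by (auto simp: cvr_def)
  qed
  then show ?thesis unfolding 1 2 hg_sum[OF s(1)] by (simp add: sum.distrib del: sum_of_bool_eq)
qed

lemma comp_strand_diagrams:
  assumes "\<phi> \<in> strand_diagrams Z" "\<psi> \<in> strand_diagrams Z"
  shows "\<phi> O \<psi> \<in> strand_diagrams Z"
proof -
  have "single_valued (\<phi> O \<psi>)" "single_valued ((\<phi> O \<psi>)\<inverse>)"
    using assms by (auto simp: strand_diagrams_def converse_relcomp intro: single_valued_relcomp)
  moreover have "pt_le x z" if "(x, z) \<in> \<phi> O \<psi>" for x z
  proof -
    from that obtain y where "(x, y) \<in> \<phi>" "(y, z) \<in> \<psi>" by blast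
    with assms have "pt_le x y" "pt_le y z" unfolding strand_diagrams_def by blast+
    then show ?thesis by (simp add: pt_le_def)
  qed
  moreover have "\<phi> O \<psi> \<subseteq> points Z \<times> points Z" using assms unfolding strand_diagrams_def by blast
  ultimately show ?thesis unfolding strand_diagrams_def by blast
qed

lemma comp_Domain_Range:
  assumes "Range \<phi> = Domain \<psi>"
  shows "Domain (\<phi> O \<psi>) = Domain \<phi>" "Range (\<phi> O \<psi>) = Range \<psi>"
  using assms by blast+

text \<open>A new break arises when \<phi> first moves a strand off \<open>p\<close> and \<psi>
  later moves another strand onto \<open>p\<close>. In the opposite order the strand that arrives at
  \<open>p\<close> in \<phi> continues in \<psi> and passes \<open>p\<close>.\<close>

lemma broken_comp_iff:
  assumes thin: "thin \<phi>" "thin \<psi>" and comp: "Range \<phi> = Domain \<psi>"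
    and disj: "\<And>e. \<not> (stp \<phi> e \<and> stp \<psi> e)" and p1: "1 \<le> snd p"
  shows "p \<in> broken (\<phi> O \<psi>) \<longleftrightarrow> p \<in> broken \<phi> \<or> p \<in> broken \<psi> \<or> stp \<phi> p \<and> stp \<psi> (prv p)"
proof -
  note s = thin_strands[OF thin(1)] and s' = thin_strands[OF thin(2)]
  have \<phi>e: "snd x \<le> snd y \<and> fst x = fst y" if "(x, y) \<in> \<phi>" for x y using strandsD(4)[OF s that] by simp
  have \<psi>e: "snd x \<le> snd y \<and> fst x = fst y" if "(x, y) \<in> \<psi>" for x y using strandsD(4)[OF s' that] by simp
  have st\<phi>: "stp \<phi> e" if "(x, y) \<in> \<phi>" "fst x = fst e" "snd x \<le> snd e" "snd e < snd y" for x y e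
    using that unfolding stp_def cvr_def by (intro bexI[of _ "(x, y)"]) auto
  have st\<psi>: "stp \<psi> e" if "(x, y) \<in> \<psi>" "fst x = fst e" "snd x \<le> snd e" "snd e < snd y" for x y e
    using that unfolding stp_def cvr_def by (intro bexI[of _ "(x, y)"]) auto
  show ?thesis
  proof
    assume "p \<in> broken (\<phi> O \<psi>)"
    then obtain x z where xz: "(x, p) \<in> \<phi> O \<psi>" "(p, z) \<in> \<phi> O \<psi>" "x \<noteq> p" "p \<noteq> z"
      unfolding broken_def by blast
    from xz obtain y w where yw: "(x, y) \<in> \<phi>" "(y, p) \<in> \<psi>" "(p, w) \<in> \<phi>" "(w, z) \<in> \<psi>" by blast
    show "p \<in> broken \<phi> \<or> p \<in> broken \<psi> \<or> stp \<phi> p \<and> stp \<psi> (prv p)"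
    proof (cases "y = p")
      case True
      then have "w \<noteq> p" using strandsD(3)[OF s, of x p p] yw xz(3) by blast
      with yw True xz(3) have "p \<in> broken \<phi>" unfolding broken_def by blast
      then show ?thesis by blast
    next
      case False
      show ?thesis
      proof (cases "w = p")
        case True
        with yw False xz(4) have "p \<in> broken \<psi>" unfolding broken_def by blast
        then show ?thesis by blast
      next
        case w: False
        have "p \<in> Domain (mv \<phi>)" "p \<in> Range (mv \<psi>)" using yw(2,3) w False unfolding mv_def by blast+
        then have "stp \<phi> p" "stp \<psi> (prv p)" using start_stp[OF s] end_stp[OF s'] by blast+
        then show ?thesis by blast
      qed
    qed
  next
    assume "p \<in> broken \<phi> \<or> p \<in> broken \<psi> \<or> stp \<phi> p \<and> stp \<psi> (prv p)"
    then consider "p \<in> broken \<phi>" | "p \<in> broken \<psi>" | "stp \<phi> p" "stp \<psi> (prv p)" "p \<notin> broken \<phi>" "p \<notin> broken \<psi>"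
      by blast
    then show "p \<in> broken (\<phi> O \<psi>)"
    proof cases
      case 1
      then obtain x y where xy: "(x, p) \<in> \<phi>" "(p, y) \<in> \<phi>" "x \<noteq> p" "y \<noteq> p" "pt_less x p" "pt_less p y"
        using s by (rule brokenE)
      have "p \<in> Domain \<psi>" "y \<in> Domain \<psi>" using xy comp by blast+
      then obtain z w where zw: "(p, z) \<in> \<psi>" "(y, w) \<in> \<psi>" by blast
      have "stp \<phi> p" using xy(2,6) by (intro st\<phi>[of p y p]) (auto simp: pt_less_def)
      then have "\<not> stp \<psi> p" using disj by blast
      then have "p \<notin> Domain (mv \<psi>)" using start_stp[OF s'] by blast
      then have "z = p" using zw(1) unfolding mv_def by blast
      moreover have "w \<noteq> p" using \<psi>e[OF zw(2)] xy(6) by (auto simp: pt_less_def)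
      ultimately show ?thesis using xy zw unfolding broken_def by blast
    next
      case 2
      then obtain x y where xy: "(x, p) \<in> \<psi>" "(p, y) \<in> \<psi>" "x \<noteq> p" "y \<noteq> p" "pt_less x p" "pt_less p y"
        using s' by (rule brokenE)
      have "p \<in> Range \<phi>" "x \<in> Range \<phi>" using xy comp by blast+
      then obtain z w where zw: "(z, p) \<in> \<phi>" "(w, x) \<in> \<phi>" by blast
      have "stp \<psi> (prv p)" using xy(1,5) by (intro st\<psi>[of x p "prv p"]) (auto simp: pt_less_def)
      then have "\<not> stp \<phi> (prv p)" using disj by blast
      then have "p \<notin> Range (mv \<phi>)" using end_stp[OF s] by blast
      then have "z = p" using zw(1) unfolding mv_def by blast
      moreover have "w \<noteq> p" using \<phi>e[OF zw(2)] xy(5) by (auto simp: pt_less_def)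
      ultimately show ?thesis using xy zw unfolding broken_def by blast
    next
      case 3
      have "\<not> stp \<phi> (prv p)" "\<not> stp \<psi> p" using 3 disj by blast+
      have "p \<in> Domain (mv \<phi>)" using stp_not_start[OF s 3(1)] \<open>\<not> stp \<phi> (prv p)\<close> by blast
      moreover have "p \<in> Range (mv \<psi>)" using stp_not_end[OF s' 3(2) p1] \<open>\<not> stp \<psi> p\<close> by blast
      ultimately obtain y x where xy: "(p, y) \<in> \<phi>" "y \<noteq> p" "(x, p) \<in> \<psi>" "x \<noteq> p" by (auto simp: mv_def)
      have "y \<in> Domain \<psi>" "x \<in> Range \<phi>" using xy comp by blast+
      then obtain z w where zw: "(y, z) \<in> \<psi>" "(w, x) \<in> \<phi>" by blast
      have "snd p < snd y" "snd x < snd p"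
        using strands_moving[OF s xy(1)] strands_moving[OF s' xy(3)] xy by auto
      then have "z \<noteq> p" "w \<noteq> p" using \<psi>e[OF zw(1)] \<phi>e[OF zw(2)] by auto
      with xy zw show ?thesis unfolding broken_def by blast
    qed
  qed
qed

lemma broken_comp:
  assumes thin: "thin \<phi>" "thin \<psi>" and comp: "Range \<phi> = Domain \<psi>"
    and le: "\<And>e. hg \<phi> e + hg \<psi> e \<le> 1" and p1: "1 \<le> snd p"
  shows "(of_bool (p \<in> broken (\<phi> O \<psi>)) :: int) =
    of_bool (p \<in> broken \<phi>) + hg \<phi> p * hg \<psi> (prv p) + of_bool (p \<in> broken \<psi>)"
proof -
  note s = thin_strands[OF thin(1)] and s' = thin_strands[OF thin(2)]
  have disj: "\<not> (stp \<phi> e \<and> stp \<psi> e)" for e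
    using le[of e] unfolding thin_hg[OF thin(1)] thin_hg[OF thin(2)] by auto
  have b: "stp \<phi> p \<and> stp \<phi> (prv p)" if "p \<in> broken \<phi>"
    using start_stp[OF s] end_stp[OF s] that by (simp add: broken_iff)
  have b': "stp \<psi> p \<and> stp \<psi> (prv p)" if "p \<in> broken \<psi>"
    using start_stp[OF s'] end_stp[OF s'] that by (simp add: broken_iff)
  show ?thesis
    unfolding broken_comp_iff[OF thin comp disj p1] thin_hg[OF thin(1)] thin_hg[OF thin(2)]
    using b b' disj[of p] disj[of "prv p"] by (auto simp: of_bool_def)
qed

text \<open>
  The number of breaks at p in a product: a single factor breaks there, or the step after p is
  covered by an earlier factor than the step before p.
\<close>

fun breaks :: "'i pt \<Rightarrow> 'i dgm list \<Rightarrow> int" where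
  "breaks p [] = 0"
| "breaks p (d # ds) = of_bool (p \<in> broken (fst (snd d))) +
     hgrade d p * (\<Sum>d'\<leftarrow>ds. hgrade d' (prv p)) + breaks p ds"

lemma hgrade_nonneg: "0 \<le> hgrade d e"
  by (cases d) (simp add: hgrade_hg hg_def)

lemma sum_hgrade_nonneg: "0 \<le> (\<Sum>d\<leftarrow>ds. hgrade d e)"
  by (induction ds) (auto simp: hgrade_nonneg)

context arc_frame
begin

lemma diagram_tm:
  assumes "diagram Z d" "\<phi> \<in> dterms Z d"
  shows "\<phi> \<in> tm Z (hgrade d) (fst d) (snd (snd d))" "mv \<phi> = fst (snd d)"
proof -
  obtain s \<mu> t where d: "d = (s, \<mu>, t)" using prod_cases3 by blast
  show "\<phi> \<in> tm Z (hgrade d) (fst d) (snd (snd d))"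
    using dterms_tm[of \<phi> s \<mu> t] assms(2) unfolding d hgrade_hg by (simp del: dterms.simps)
  show "mv \<phi> = fst (snd d)" using assms(2) unfolding d by simp
qed

lemma diagram_pairs: "diagram Z d \<Longrightarrow> fst d \<subseteq> pairs Z \<and> snd (snd d) \<subseteq> pairs Z"
  by (cases d) auto

lemma viable_frameI:
  assumes "\<And>e. h e \<le> 1" "s \<subseteq> pairs Z" "t \<subseteq> pairs Z"
  shows "viable_frame Z h s t"
  using assms arc_frame_axioms by (simp add: viable_frame_def viable_frame_axioms_def)

text \<open>Splitting off the first factor matches the recursion of \<open>breaks\<close>. The count
  does not mention the term, so all terms of a product have the same breaks and hence the same
  moving strands.\<close>

lemma product_keys:
  assumes "ds \<noteq> []" "\<forall>d\<in>set ds. diagram Z d" "\<And>e. (\<Sum>d\<leftarrow>ds. hgrade d e) \<le> 1"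
    "\<phi> \<in> keys (mult_list (map (elt Z) ds))"
  shows "\<phi> \<in> tm Z (\<lambda>e. \<Sum>d\<leftarrow>ds. hgrade d e) (fst (hd ds)) (snd (snd (last ds)))"
    "1 \<le> snd p \<Longrightarrow> of_bool (p \<in> broken \<phi>) = breaks p ds"
proof -
  have "\<phi> \<in> tm Z (\<lambda>e. \<Sum>d\<leftarrow>ds. hgrade d e) (fst (hd ds)) (snd (snd (last ds))) \<and>
    (\<forall>p. 1 \<le> snd p \<longrightarrow> of_bool (p \<in> broken \<phi>) = breaks p ds)"
    using assms
  proof (induction ds arbitrary: \<phi> rule: induct_list012)
    case (2 d)
    then have d: "diagram Z d" "\<phi> \<in> dterms Z d" using keys_elt_diagram by auto
    have "broken \<phi> = broken (fst (snd d))" using diagram_tm(2)[OF d] broken_mv by metis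
    with diagram_tm(1)[OF d] show ?case by simp
  next
    case (3 d d' ds)
    let ?ds = "d' # ds"
    have dd: "diagram Z d" "\<forall>d\<in>set ?ds. diagram Z d" using 3(4) by auto
    have le: "hgrade d e + (\<Sum>d\<leftarrow>?ds. hgrade d e) \<le> 1" for e using 3(5)[of e] by simp
    have le1: "hgrade d e \<le> 1" "(\<Sum>d\<leftarrow>?ds. hgrade d e) \<le> 1" for e
      using le[of e] hgrade_nonneg[of d e] sum_hgrade_nonneg[of e ?ds] by linarith+
    have "\<phi> \<in> keys (mult (elt Z d) (mult_list (map (elt Z) ?ds)))" using 3(6) by simp
    then obtain \<chi> \<psi> where c: "\<chi> \<in> keys (elt Z d)" "\<psi> \<in> keys (mult_list (map (elt Z) ?ds))"
      "Range \<chi> = Domain \<psi>" "\<phi> = \<chi> O \<psi>" by (rule keys_multD)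
    have \<chi>: "\<chi> \<in> dterms Z d" using c(1) keys_elt_diagram[OF dd(1)] by simp
    note \<chi>T = diagram_tm[OF dd(1) \<chi>]
    from 3(2)[OF _ dd(2) le1(2) c(2)] have \<psi>:
      "\<psi> \<in> tm Z (\<lambda>e. \<Sum>d\<leftarrow>?ds. hgrade d e) (fst (hd ?ds)) (snd (snd (last ?ds)))"
      "\<And>p. 1 \<le> snd p \<Longrightarrow> of_bool (p \<in> broken \<psi>) = breaks p ?ds" by auto
    have st: "strands \<chi>" "strands \<psi>" using tm_strands \<chi>T(1) \<psi>(1) by auto
    have hg: "hg \<chi> = hgrade d" "hg \<psi> = (\<lambda>e. \<Sum>d\<leftarrow>?ds. hgrade d e)" using \<chi>T(1) \<psi>(1) by (auto simp: tm_def)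
    have thin: "thin \<chi>" "thin \<psi>" using hg_thin[OF st(1)] hg_thin[OF st(2)] le1 hg by auto
    have sd: "\<phi> \<in> strand_diagrams Z"
      unfolding c(4) by (rule comp_strand_diagrams) (use \<chi>T(1) \<psi>(1) in \<open>auto simp: tm_def\<close>)
    then have "strands \<phi>" by (rule strand_diagrams_strands)
    have "hg \<phi> e = hgrade d e + (\<Sum>d\<leftarrow>?ds. hgrade d e)" for e
      using hg_comp[OF st \<open>strands \<phi>\<close>[unfolded c(4)] c(3), of e] unfolding c(4) hg .
    then have "\<phi> \<in> tm Z (\<lambda>e. \<Sum>d\<leftarrow>d # ?ds. hgrade d e) (fst (hd (d # ?ds))) (snd (snd (last (d # ?ds))))"
      unfolding tm_def using sd \<chi>T(1) \<psi>(1) comp_Domain_Range[OF c(3)] c(4) by (auto simp: tm_def)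
    moreover have "of_bool (p \<in> broken \<phi>) = breaks p (d # ?ds)" if p: "1 \<le> snd p" for p
    proof -
      have "broken \<chi> = broken (fst (snd d))" using \<chi>T(2) broken_mv by metis
      moreover have "(of_bool (p \<in> broken \<phi>) :: int) =
        of_bool (p \<in> broken \<chi>) + hg \<chi> p * hg \<psi> (prv p) + of_bool (p \<in> broken \<psi>)"
        unfolding c(4) by (rule broken_comp[OF thin c(3) _ p]) (use le hg in simp)
      ultimately show ?thesis using \<psi>(2)[OF p] hg by simp
    qed
    ultimately show ?case by blast
  qed simp
  then show "\<phi> \<in> tm Z (\<lambda>e. \<Sum>d\<leftarrow>ds. hgrade d e) (fst (hd ds)) (snd (snd (last ds)))"
    "1 \<le> snd p \<Longrightarrow> of_bool (p \<in> broken \<phi>) = breaks p ds" by blast+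
qed

end

text \<open>The share of a place in the Maslov grading when there are \<open>k\<close> breaks. A
  strand starting where a covered run begins costs 1/2 and one starting at a break costs 1; a
  horizontal strand on covered steps also costs 1 but is repaid by its crossing.\<close>

definition local_maslov :: "('i pt \<Rightarrow> int) \<Rightarrow> 'i pt \<Rightarrow> int \<Rightarrow> rat" where
  "local_maslov h p k = - (of_bool (h p = 1 \<and> h (prv p) = 0) / 2 + of_int k)"

lemma (in arc_frame) place_snd: "p \<in> places Z \<Longrightarrow> 1 \<le> snd p"
  by (auto simp: places_def)

lemma (in viable_frame) maslov_term_local:
  assumes "\<phi> \<in> T"
  shows "maslov_term Z h \<phi> = (\<Sum>p\<in>places Z. local_maslov h p (of_bool (p \<in> broken \<phi>)))"
proof -
  note f = T_facts[OF assms]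
  let ?H = "{p. (p, p) \<in> \<phi> \<and> stp \<phi> p}"
  have sub: "?H \<subseteq> places Z"
  proof
    fix p assume p: "p \<in> ?H"
    then obtain a b where ab: "(a, b) \<in> \<phi>" "pt_less a p" "pt_less p b"
      using stp_passing[OF f(2)] horizontal_free[OF f(2)] by blast
    have "b \<in> points Z" using ab f(1) by (auto simp: strand_diagrams_def)
    with ab show "p \<in> places Z"
      by (cases b; cases p) (auto simp: pt_less_def points_def places_def)
  qed
  have "(of_nat (inv_count \<phi>) :: rat) = of_nat (card ?H)" by (simp add: thin_inv_count[OF f(3)])
  also have "\<dots> = (\<Sum>p\<in>places Z. of_bool (p \<in> ?H))"
  proof -
    have "places Z \<inter> ?H = ?H" using sub by blast
    then show ?thesis using finite_places by (simp only: sum_of_bool_eq Collect_mem_eq)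
  qed
  finally have inv: "(of_nat (inv_count \<phi>) :: rat) = (\<Sum>p\<in>places Z. of_bool (p \<in> ?H))" .
  have "of_bool (p \<in> ?H) - of_int (of_bool (p \<in> Domain \<phi>)) * avg_mult h p
      = local_maslov h p (of_bool (p \<in> broken \<phi>))" if p: "p \<in> places Z" for p
  proof -
    note p1 = place_snd[OF p]
    have h: "h e = of_bool (stp \<phi> e)" for e using thin_hg[OF f(3), of e] f(4) by simp
    show ?thesis
    proof (cases "(p, p) \<in> \<phi>")
      case True
      with horizontal_stp[OF f(2) True p1] horizontal_free[OF f(2) True] show ?thesis
        by (auto simp: h avg_mult_def local_maslov_def broken_iff of_bool_def)
    next
      case False
      show ?thesis
      proof (cases "p \<in> Domain \<phi>")
        case True
        then have m: "p \<in> Domain (mv \<phi>)" using False by (auto simp: mv_def)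
        have "stp \<phi> p" using start_stp[OF f(2) m] .
        moreover have "p \<in> broken \<phi> \<longleftrightarrow> stp \<phi> (prv p)"
          using start_prv_broken[OF f(3) m _ p1] end_stp[OF f(2)] broken_iff by blast
        ultimately show ?thesis using True False
          by (auto simp: h avg_mult_def local_maslov_def of_bool_def)
      next
        case nd: False
        then have "p \<notin> Domain (mv \<phi>)" by (auto simp: mv_def)
        moreover from this have "stp \<phi> p \<Longrightarrow> stp \<phi> (prv p)"
          using stp_not_start[OF f(2)] by blast
        ultimately show ?thesis using nd False
          by (auto simp: h local_maslov_def broken_iff of_bool_def)
      qed
    qed
  qed
  then show ?thesis
    unfolding maslov_term_def inv m_pairing_def by (simp add: sum_subtractf[symmetric])
qed

lemma (in arc_frame) maslov_local:
  assumes d: "diagram Z d" and le: "\<And>e. hgrade d e \<le> 1"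
  shows "maslov Z d = (\<Sum>p\<in>places Z. local_maslov (hgrade d) p (of_bool (p \<in> broken (fst (snd d)))))"
proof -
  interpret V: viable_frame Z "hgrade d" "fst d" "snd (snd d)"
    by (rule viable_frameI) (use le diagram_pairs[OF d] in auto)
  let ?\<phi> = "SOME \<phi>. \<phi> \<in> keys (elt Z d)"
  have "\<exists>\<phi>. \<phi> \<in> keys (elt Z d)" using keys_elt_diagram[OF d] diagram_nonempty[OF d] by blast
  then have "?\<phi> \<in> keys (elt Z d)" by (rule someI_ex)
  then have \<phi>: "?\<phi> \<in> dterms Z d" using keys_elt_diagram[OF d] by simp
  note t = diagram_tm[OF d \<phi>]
  have "broken ?\<phi> = broken (fst (snd d))" using t(2) broken_mv by metis
  then show ?thesis unfolding maslov_def V.maslov_term_local[OF t(1)] by simp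
qed

text \<open>The pairs involving the first factor are split off, so that the correction terms of the
  tensor grading follow the recursion on the list.\<close>

lemma sum_pairs_Cons:
  fixes F :: "'a \<Rightarrow> 'a \<Rightarrow> rat"
  shows "(\<Sum>(j, k) \<in> {(j, k). j < k \<and> k < length (x # xs)}. F ((x # xs) ! j) ((x # xs) ! k)) =
    (\<Sum>y\<leftarrow>xs. F x y) + (\<Sum>(j, k) \<in> {(j, k). j < k \<and> k < length xs}. F (xs ! j) (xs ! k))"
proof -
  let ?A = "{(j, k). j < k \<and> k < length xs}"
  let ?G = "\<lambda>(j, k). F ((x # xs) ! j) ((x # xs) ! k)"
  have eq: "{(j, k). j < k \<and> k < length (x # xs)} = (\<lambda>k. (0, Suc k)) ` {..<length xs} \<union> (\<lambda>(j, k). (Suc j, Suc k)) ` ?A"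
    (is "?L = ?B \<union> ?C")
  proof
    show "?L \<subseteq> ?B \<union> ?C"
    proof (rule subrelI)
      fix j k assume "(j, k) \<in> ?L"
      then have jk: "j < k" "k < Suc (length xs)" by auto
      then obtain k' where k: "k = Suc k'" by (cases k) auto
      show "(j, k) \<in> ?B \<union> ?C"
      proof (cases j)
        case 0 with jk k show ?thesis by auto
      next
        case (Suc j')
        then have "(j', k') \<in> ?A" using jk k by auto
        then have "(Suc j', Suc k') \<in> ?C" by force
        then show ?thesis using Suc k by simp
      qed
    qed
  qed auto
  have finA: "finite ?A" by (rule finite_subset[of _ "{..<length xs} \<times> {..<length xs}"]) auto
  have "sum ?G (?B \<union> ?C) = sum ?G ?B + sum ?G ?C"
    by (rule sum.union_disjoint) (use finA in auto)
  also have "sum ?G ?B = (\<Sum>k<length xs. F x (xs ! k))"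
    by (subst sum.reindex) (auto simp: inj_on_def)
  also have "\<dots> = (\<Sum>y\<leftarrow>xs. F x y)" by (simp add: sum_list_sum_nth atLeast0LessThan)
  also have "sum ?G ?C = (\<Sum>(j, k) \<in> ?A. F (xs ! j) (xs ! k))"
    by (subst sum.reindex) (auto simp: inj_on_def intro!: sum.cong)
  finally show ?thesis unfolding eq .
qed

definition list_maslov :: "'i arc \<Rightarrow> 'i dgm list \<Rightarrow> rat" where
  "list_maslov Z ds = (\<Sum>d\<leftarrow>ds. maslov Z d) +
     (\<Sum>(j, k) \<in> {(j, k). j < k \<and> k < length ds}. m_pairing Z (hgrade (ds ! k)) (h_bdry (hgrade (ds ! j))))"

lemma tensor_maslov_list: "tensor_maslov Z M = list_maslov Z (map (tight_rep Z) M)"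
  unfolding tensor_maslov_def list_maslov_def cls_h_def
  by (intro arg_cong2[of _ _ _ _ "(+)"] sum.cong) (auto simp: comp_def)

lemma h_bdry_eq: "h_bdry h p = h (prv p) - h p"
  by (cases p) simp

text \<open>If an earlier factor covers the step after \<open>p\<close> and a later one the step
  before, the correction term is -1/2 and together with the 1/2 lost at the start in the earlier
  factor accounts for one break. In the opposite order the correction +1/2 cancels the loss in the
  later factor, as the run no longer begins at \<open>p\<close>.\<close>

lemma (in arc_frame) list_maslov_local:
  assumes "\<forall>d\<in>set ds. diagram Z d" "\<And>e. (\<Sum>d\<leftarrow>ds. hgrade d e) \<le> 1"
  shows "list_maslov Z ds = (\<Sum>p\<in>places Z. local_maslov (\<lambda>e. \<Sum>d\<leftarrow>ds. hgrade d e) p (breaks p ds))"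
  using assms
proof (induction ds)
  case Nil
  have e: "{(j::nat, k::nat). j < k \<and> k < 0} = {}" by auto
  show ?case by (simp add: list_maslov_def local_maslov_def e)
next
  case (Cons d ds)
  let ?H = "\<lambda>e. \<Sum>d\<leftarrow>ds. hgrade d e"
  have le: "hgrade d e + ?H e \<le> 1" for e using Cons.prems(2)[of e] by simp
  have le1: "hgrade d e \<le> 1" "?H e \<le> 1" for e
    using le[of e] hgrade_nonneg[of d e] sum_hgrade_nonneg[of e ds] by linarith+
  have IH: "list_maslov Z ds = (\<Sum>p\<in>places Z. local_maslov ?H p (breaks p ds))"
    by (rule Cons.IH) (use Cons.prems(1) le1 in auto)
  have dd: "diagram Z d" using Cons.prems(1) by simp
  have pair: "(\<Sum>d'\<leftarrow>ds. m_pairing Z (hgrade d') (h_bdry (hgrade d))) =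
    (\<Sum>p\<in>places Z. of_int (hgrade d (prv p) - hgrade d p) * (of_int (?H (prv p)) + of_int (?H p)) / 2)"
  proof (induction ds)
    case (Cons d' ds)
    have "(\<Sum>d'\<leftarrow>d' # ds. m_pairing Z (hgrade d') (h_bdry (hgrade d))) =
      m_pairing Z (hgrade d') (h_bdry (hgrade d)) + (\<Sum>p\<in>places Z. of_int (hgrade d (prv p) - hgrade d p) *
        (of_int (\<Sum>d\<leftarrow>ds. hgrade d (prv p)) + of_int (\<Sum>d\<leftarrow>ds. hgrade d p)) / 2)"
      using Cons by simp
    also have "\<dots> = (\<Sum>p\<in>places Z. of_int (hgrade d (prv p) - hgrade d p) *
        (of_int (\<Sum>d\<leftarrow>d' # ds. hgrade d (prv p)) + of_int (\<Sum>d\<leftarrow>d' # ds. hgrade d p)) / 2)"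
      unfolding m_pairing_def h_bdry_eq avg_mult_def sum.distrib[symmetric]
      by (rule sum.cong) (simp_all add: field_simps)
    finally show ?case .
  qed (simp add: m_pairing_def)
  have "list_maslov Z (d # ds) = maslov Z d + (\<Sum>d'\<leftarrow>ds. m_pairing Z (hgrade d') (h_bdry (hgrade d))) + list_maslov Z ds"
    unfolding list_maslov_def
    using sum_pairs_Cons[of "\<lambda>x y. m_pairing Z (hgrade y) (h_bdry (hgrade x))" d ds] by simp
  also have "\<dots> = (\<Sum>p\<in>places Z. local_maslov (hgrade d) p (of_bool (p \<in> broken (fst (snd d)))) +
      of_int (hgrade d (prv p) - hgrade d p) * (of_int (?H (prv p)) + of_int (?H p)) / 2 +
      local_maslov ?H p (breaks p ds))"
    unfolding maslov_local[OF dd le1(1)] pair IH by (simp add: sum.distrib)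
  also have "\<dots> = (\<Sum>p\<in>places Z. local_maslov (\<lambda>e. \<Sum>d\<leftarrow>d # ds. hgrade d e) p (breaks p (d # ds)))"
  proof (rule sum.cong[OF refl])
    fix p
    \<comment> \<open>The multiplicities of \<open>d\<close> and of the remaining factors on the two
      steps at \<open>p\<close> are all 0 or 1, so the identity at \<open>p\<close> is a finite
      check.\<close>
    have z: "x = 0 \<or> x = 1" if "0 \<le> x" "x \<le> 1" for x :: int using that by linarith
    have "hgrade d p = 0 \<or> hgrade d p = 1" "hgrade d (prv p) = 0 \<or> hgrade d (prv p) = 1"
      "?H p = 0 \<or> ?H p = 1" "?H (prv p) = 0 \<or> ?H (prv p) = 1"
      by (rule z[OF hgrade_nonneg le1(1)] z[OF sum_hgrade_nonneg le1(2)])+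
    with le[of p] le[of "prv p"]
    show "local_maslov (hgrade d) p (of_bool (p \<in> broken (fst (snd d)))) +
      of_int (hgrade d (prv p) - hgrade d p) * (of_int (?H (prv p)) + of_int (?H p)) / 2 +
      local_maslov ?H p (breaks p ds) =
      local_maslov (\<lambda>e. \<Sum>d\<leftarrow>d # ds. hgrade d e) p (breaks p (d # ds))"
      unfolding local_maslov_def by (elim disjE) simp_all
  qed
  finally show ?case .
qed

section \<open>Boundaries and H-data\<close>

context viable_frame
begin

text \<open>A resolution changes neither domain nor range nor \<open>hg\<close>, so the differential
  never leads from one summand into another.\<close>

lemma restr_T:
  assumes "y \<in> strand_alg Z"
  shows "restr T y \<in> alg_summand Z (h, s, t)" "bd (restr T y) = restr T (bd y)"
proof -
  have "restr T y \<in> strand_alg Z"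
    unfolding strand_alg_iff
  proof
    fix \<phi> assume "\<phi> \<in> keys (restr T y)"
    then have k: "\<phi> \<in> keys y" "\<phi> \<in> T" by auto
    note d = strand_alg_dg[OF assms k(1)]
    have "dterms Z (dg Z \<phi>) \<subseteq> T" unfolding dterms_T[OF k(2)] by blast
    with d show "\<exists>d. diagram Z d \<and> \<phi> \<in> dterms Z d \<and> dterms Z d \<subseteq> keys (restr T y)"
      by (intro exI[of _ "dg Z \<phi>"]) auto
  qed
  then show "restr T y \<in> alg_summand Z (h, s, t)"
    unfolding alg_summand_def span_iff' using tm_dg(3) by auto
  have "restr T (bd_basis \<phi>) = (if \<phi> \<in> T then bd_basis \<phi> else 0)" if k: "\<phi> \<in> keys y" for \<phi>
  proof (cases "\<phi> \<in> T")
    case True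
    have "keys (bd (basis \<phi>)) \<subseteq> T" by (rule keys_bd) (simp add: True)
    then have "keys (bd_basis \<phi>) \<subseteq> T" by (simp add: bd_lin)
    with True show ?thesis by (simp add: restr_id)
  next
    case False
    have sd: "\<phi> \<in> strand_diagrams Z" using strand_alg_dg(2)[OF assms k] by (simp add: dg_def)
    have "\<psi> \<notin> T" if "\<psi> \<in> keys (bd_basis \<phi>)" for \<psi>
    proof
      assume T: "\<psi> \<in> T"
      from that obtain c where c: "c \<in> crossings \<phi>" "\<psi> = resolve \<phi> c"
        unfolding bd_basis_def by (force dest: keys_sumD simp del: resolve.simps)
      from resolve_strands[OF sd strand_diagrams_strands[OF sd] c(1)] T c(2) sd have "\<phi> \<in> T"
        by (simp add: tm_def)
      with False show False by blast
    qed
    with False show ?thesis by (auto intro: restr_disjoint)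
  qed
  then have "restr T (bd y) = (\<Sum>\<phi>\<in>keys y. if \<phi> \<in> T then bd_basis \<phi> else 0)"
    unfolding bd_def restr_sum by (rule sum.cong[OF refl])
  also have "\<dots> = bd (restr T y)"
    unfolding bd_def by (simp add: sum.inter_restrict)
  finally show "bd (restr T y) = restr T (bd y)" ..
qed

text \<open>Projection to the summand removes \<open>z\<close>. For \<open>z = 0\<close> this
  provides a primitive with the same H-data; for \<open>z\<close> with other H-data it shows that
  equal nonzero classes have equal H-data.\<close>

lemma boundary_summand:
  assumes "x \<in> alg_summand Z (h, s, t)" "z \<in> strand_alg Z" "keys z \<inter> T = {}" "hclass Z x = hclass Z z"
  shows "\<exists>y\<in>alg_summand Z (h, s, t). x = bd y"
proof -
  from assms(4) obtain y where y: "y \<in> strand_alg Z" "x + z = bd y" unfolding hclass_eq_iff by blast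
  have "restr T (x + z) = x"
    unfolding restr_add using restr_id[OF summandD(1)[OF assms(1)]] restr_disjoint[OF assms(3)] by simp
  with restr_T[OF y(1)] y(2) show ?thesis by metis
qed

text \<open>The primitive contains an unbroken term, and its boundary then contains terms broken at
  every covered place of \<open>P\<close>. This is a single uncrossed diagram only if
  \<open>P\<close> has just one covered place. The bound on \<open>occ\<close> fits fragments, which
  have one pair, and idempotents, for which \<open>occ\<close> is empty.\<close>

lemma uncrossed_not_boundary:
  assumes \<psi>: "\<psi> \<in> T" "\<not> has_crossings Z (dg Z \<psi>)" and y: "y \<in> alg_summand Z (h, s, t)"
    "elt Z (dg Z \<psi>) = bd y" and occ: "occ \<subseteq> {P}"
  shows "\<exists>p. once_occupied_at Z h P p \<and> P \<in> occ"
proof -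
  have keys: "keys (bd y) = {\<chi>\<in>T. mv \<chi> = mv \<psi>}"
    using keys_elt_diagram[OF tm_dg(4)[OF \<psi>(1) s_pairs t_pairs]] dterms_T[OF \<psi>(1)] y(2) by simp
  define c where "c B = (\<exists>\<phi>\<in>keys y. broken \<phi> = B)" for B
  have "lookup (bd y) \<psi> \<noteq> 0" using keys \<psi>(1) by (simp add: lookup_bit)
  then have "(\<Sum>p\<in>broken \<psi>. of_bool (c (broken \<psi> - {p}))) \<noteq> (0::bit)"
    unfolding lookup_bd_summand[OF y(1) \<psi>(1)] c_def .
  then have "\<exists>p\<in>broken \<psi>. c (broken \<psi> - {p})"
    by (rule contrapos_np) (simp add: sum.neutral)
  then obtain p where p: "p \<in> broken \<psi>" "c (broken \<psi> - {p})" by blast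
  note b = broken_facts[OF \<psi>(1) p(1)]
  have P: "matching Z p = P" "P \<in> occ" using b(5) occ by auto
  then have pP: "p \<in> pair_places Z P" using b(7) by simp
  have br: "broken \<psi> = {p}"
  proof -
    have "r = p" if "r \<in> broken \<psi>" for r
    proof -
      note b' = broken_facts[OF \<psi>(1) that]
      have "r \<in> pair_places Z P" using b'(5,7) occ by auto
      then show ?thesis using broken_pair_unique[OF \<psi>(1) that _ _ pP] b(3) by blast
    qed
    with p(1) show ?thesis by blast
  qed
  then have "c {}" using p(2) by simp
  then obtain \<phi> where \<phi>: "\<phi> \<in> keys y" "broken \<phi> = {}" unfolding c_def by blast
  then have \<phi>T: "\<phi> \<in> T" using summandD(1)[OF y(1)] by blast
  have "avoids_place h q" if q: "q \<in> pair_places Z P" "q \<noteq> p" for q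
  proof -
    have ncov: "\<not> covers_place h q"
    proof
      assume cov: "covers_place h q"
      obtain \<omega> where \<omega>: "\<omega> \<in> T" "broken \<omega> = insert q (broken \<phi>)"
        using covered_break[OF \<phi>T P(2) q(1) cov] \<phi>(2) by blast
      then have b\<omega>: "broken \<omega> = {q}" using \<phi>(2) by simp
      have "lookup (bd y) \<omega> = of_bool (c {})"
        unfolding lookup_bd_summand[OF y(1) \<omega>(1)] b\<omega> c_def by simp
      then have "\<omega> \<in> keys (bd y)" using \<open>c {}\<close> by (simp add: lookup_bit split: if_splits)
      then have "mv \<omega> = mv \<psi>" unfolding keys by blast
      then have "broken \<omega> = broken \<psi>" using broken_mv by metis
      with b\<omega> br q(2) show False by simp
    qed
    note f = T_facts[OF \<psi>(1)]
    \<comment> \<open>The break \<open>p\<close> is the only place of the pair in the domain and in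
      the range. So no strand starts or ends at \<open>q\<close>, and the two steps at
      \<open>q\<close> are both covered or both not.\<close>
    have "q \<notin> Domain \<psi>" "q \<notin> Range \<psi>"
      using broken_pair_unique[OF \<psi>(1) p(1) _ pP q(1)] q(2) by blast+
    then have nm: "q \<notin> Domain (mv \<psi>)" "q \<notin> Range (mv \<psi>)" by (auto simp: mv_def)
    have q1: "1 \<le> snd q" using q(1) place_snd by (auto simp: pair_places_def)
    have "stp \<psi> q \<longleftrightarrow> stp \<psi> (prv q)"
      using stp_not_start[OF f(2) _ nm(1)] stp_not_end[OF f(2) _ q1 nm(2)] by blast
    with ncov show ?thesis unfolding covers_place_def avoids_place_def f(5) by blast
  qed
  with pP b(2) P(2) show ?thesis unfolding once_occupied_at_def by blast
qed

end

context arc_frame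
begin

lemma diagram_frame:
  assumes "diagram Z d" "viable_h Z (hgrade d)"
  shows "viable_frame Z (hgrade d) (fst d) (snd (snd d))"
proof (rule viable_frameI)
  obtain \<phi> where \<phi>: "\<phi> \<in> dterms Z d" using diagram_nonempty[OF assms(1)] by blast
  then have "\<phi> \<in> strand_diagrams Z" "hg \<phi> = hgrade d" using diagram_tm[OF assms(1) \<phi>] by (auto simp: tm_def)
  then show "hgrade d e \<le> 1" for e using hg_viable[of \<phi>] assms(2) by simp
qed (use diagram_pairs[OF assms(1)] in auto)

lemma diagram_dg:
  assumes "diagram Z d"
  obtains \<phi> where "\<phi> \<in> tm Z (hgrade d) (fst d) (snd (snd d))" "dg Z \<phi> = d" "\<phi> \<in> dterms Z d"
proof -
  obtain \<phi> where \<phi>: "\<phi> \<in> dterms Z d" using diagram_nonempty[OF assms(1)] by blast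
  from that[OF diagram_tm(1)[OF assms \<phi>] dterms_dg[OF \<phi>] \<phi>] show thesis .
qed

lemma uncrossed_cycle: "diagram Z d \<Longrightarrow> \<not> has_crossings Z d \<Longrightarrow> bd (elt Z d) = 0"
  unfolding has_crossings_def by (simp add: bd_def bd_basis_def)

lemma elt_summand: "diagram Z d \<Longrightarrow> elt Z d \<in> alg_summand Z (hdata d)"
  unfolding alg_summand_def span_iff' using elt_strand_alg keys_elt_diagram dterms_dg by auto

lemma hdata_eq: "hdata d = (hgrade d, fst d, snd (snd d))"
  by (cases d) simp

lemma tight_not_once_occupied:
  assumes "tight_dgm Z d" "P \<in> fst d" "P \<in> snd (snd d)"
  shows "\<not> once_occupied_at Z (hgrade d) P p"
proof
  assume o: "once_occupied_at Z (hgrade d) P p"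
  have d: "diagram Z d" "viable_h Z (hgrade d)" "\<not> has_crossings Z d" "hclass Z (elt Z d) \<noteq> hzero Z"
    using assms(1) by (auto simp: tight_dgm_def)
  interpret V: viable_frame Z "hgrade d" "fst d" "snd (snd d)" using d(1,2) by (rule diagram_frame)
  have "elt Z d \<in> bd ` strand_alg Z"
    using V.homology_once_occupied[OF _ uncrossed_cycle[OF d(1,3)] assms(2,3) o] elt_summand[OF d(1)]
    unfolding hdata_eq by blast
  with d(4) show False unfolding hclass_zero_iff by contradiction
qed

text \<open>The chosen representative need not be \<open>d\<close>, but homologous elements with
  different H-data would be boundaries, so the H-data is that of \<open>d\<close>.\<close>

lemma tight_rep_facts:
  assumes "tight_dgm Z d" "hclass Z (elt Z d) = c"
  shows "tight_dgm Z (tight_rep Z c)" "hclass Z (elt Z (tight_rep Z c)) = c"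
    "hdata (tight_rep Z c) = hdata d"
proof -
  have "tight_dgm Z (tight_rep Z c) \<and> hclass Z (elt Z (tight_rep Z c)) = c"
    unfolding tight_rep_def by (rule someI[of _ d]) (use assms in simp)
  then show r: "tight_dgm Z (tight_rep Z c)" "hclass Z (elt Z (tight_rep Z c)) = c" by auto
  let ?r = "tight_rep Z c"
  have d: "diagram Z d" "viable_h Z (hgrade d)" "hclass Z (elt Z d) \<noteq> hzero Z" "diagram Z ?r"
    using assms(1) r(1) by (auto simp: tight_dgm_def)
  interpret V: viable_frame Z "hgrade d" "fst d" "snd (snd d)" using d(1,2) by (rule diagram_frame)
  show "hdata ?r = hdata d"
  proof (rule ccontr)
    assume ne: "hdata ?r \<noteq> hdata d"
    have "\<phi> \<notin> V.T" if "\<phi> \<in> keys (elt Z ?r)" for \<phi>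
      using tm_hdata[OF d(4)] that keys_elt_diagram[OF d(4)] ne unfolding hdata_eq[of d] by blast
    then have "keys (elt Z ?r) \<inter> V.T = {}" by blast
    from V.boundary_summand[OF _ elt_strand_alg[OF d(4)] this] elt_summand[OF d(1)] assms(2) r(2)
    obtain y where "y \<in> alg_summand Z (hdata d)" "elt Z d = bd y" unfolding hdata_eq by metis
    then have "elt Z d \<in> bd ` strand_alg Z" unfolding alg_summand_def span_iff' by blast
    with d(3) show False unfolding hclass_zero_iff by contradiction
  qed
qed

end

section \<open>Fragments\<close>

definition loc_h :: "'i arc \<Rightarrow> nat \<Rightarrow> ('i pt \<Rightarrow> int) \<Rightarrow> 'i pt pt \<Rightarrow> int" where
  "loc_h Z P h e = (if fst e \<in> pair_places Z P then
     if snd e = 0 then h (prv (fst e)) else if snd e = 1 then h (fst e) else 0 else 0)"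

definition loc_s :: "nat \<Rightarrow> nat set \<Rightarrow> nat set" where
  "loc_s P s = (if P \<in> s then {1} else {})"

definition passes :: "'i sdiag \<Rightarrow> 'i pt \<Rightarrow> bool" where
  "passes \<phi> p \<longleftrightarrow> (\<exists>x y. (x, y) \<in> \<phi> \<and> pt_less x p \<and> pt_less p y)"

text \<open>\<open>cut_strands\<close> keeps only strands that move within the fragment, so the
  horizontal strands at the pair are put back; the result is a term of the local diagram.\<close>

definition loc_term :: "'i arc \<Rightarrow> nat \<Rightarrow> 'i sdiag \<Rightarrow> 'i pt sdiag" where
  "loc_term Z P \<phi> = cut_strands Z P (mv \<phi>) \<union> {((p, 1), (p, 1)) |p. p \<in> pair_places Z P \<and> (p, p) \<in> \<phi>}"

lemma local_dgm_eq: "local_dgm Z P (s, \<mu>, t) = (loc_s P s, cut_strands Z P \<mu>, loc_s P t)"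
  by (simp add: loc_s_def)

lemma clamp_simps [simp]:
  "x < j \<Longrightarrow> clamp j x = 0" "clamp j j = 1" "j < x \<Longrightarrow> clamp j x = 2"
  by (auto simp: clamp_def)

lemma clamp_cases: obtains "x < j" "clamp j x = 0" | "x = j" "clamp j x = 1" | "j < x" "clamp j x = 2"
  by (metis clamp_simps linorder_less_linear)

lemma passes_stp:
  assumes "thin \<phi>" "passes \<phi> p"
  shows "p \<notin> Domain (mv \<phi>)" "p \<notin> Range (mv \<phi>)"
  using assms passing_free[OF assms(1)] unfolding passes_def by blast+

lemma stp_iff:
  assumes "strands \<phi>"
  shows "stp \<phi> p \<longleftrightarrow> p \<in> Domain (mv \<phi>) \<or> passes \<phi> p"
proof
  assume "stp \<phi> p"
  show "p \<in> Domain (mv \<phi>) \<or> passes \<phi> p"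
  proof (rule disjCI)
    assume "\<not> passes \<phi> p"
    then show "p \<in> Domain (mv \<phi>)"
      using stp_passing[OF assms \<open>stp \<phi> p\<close>] unfolding passes_def by blast
  qed
next
  assume "p \<in> Domain (mv \<phi>) \<or> passes \<phi> p"
  then show "stp \<phi> p" using start_stp[OF assms] passing_stp(1) unfolding passes_def by blast
qed

lemma stp_prv_iff:
  assumes "strands \<phi>" "1 \<le> snd p"
  shows "stp \<phi> (prv p) \<longleftrightarrow> p \<in> Range (mv \<phi>) \<or> passes \<phi> p"
proof
  assume "stp \<phi> (prv p)"
  show "p \<in> Range (mv \<phi>) \<or> passes \<phi> p"
  proof (rule disjCI)
    assume "\<not> passes \<phi> p"
    then show "p \<in> Range (mv \<phi>)"
      using prv_passing[OF assms(1) \<open>stp \<phi> (prv p)\<close> assms(2)] unfolding passes_def by blast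
  qed
next
  assume "p \<in> Range (mv \<phi>) \<or> passes \<phi> p"
  then show "stp \<phi> (prv p)" using end_stp[OF assms(1)] passing_stp(2) unfolding passes_def by blast
qed

text \<open>After clamping, a strand ends at the place, starts at it or passes it; strands that stay
  on one side of the place disappear.\<close>

lemma cut_iff:
  assumes "strands \<phi>"
  shows "\<sigma> \<in> cut_strands Z P (mv \<phi>) \<longleftrightarrow> (\<exists>p\<in>pair_places Z P.
    \<sigma> = ((p, 0), (p, 1)) \<and> p \<in> Range (mv \<phi>) \<or> \<sigma> = ((p, 1), (p, 2)) \<and> p \<in> Domain (mv \<phi>) \<or>
    \<sigma> = ((p, 0), (p, 2)) \<and> passes \<phi> p)"
proof
  assume "\<sigma> \<in> cut_strands Z P (mv \<phi>)"
  then obtain i j x y where c: "\<sigma> = (((i, j), clamp j x), ((i, j), clamp j y))"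
    "(i, j) \<in> pair_places Z P" "((i, x), (i, y)) \<in> mv \<phi>" "clamp j x \<noteq> clamp j y"
    unfolding cut_strands_def by blast
  have lt: "x < y" using mvD(3)[OF assms c(3)] by simp
  have "\<sigma> = (((i, j), 0), ((i, j), 1)) \<and> (i, j) \<in> Range (mv \<phi>) \<or>
    \<sigma> = (((i, j), 1), ((i, j), 2)) \<and> (i, j) \<in> Domain (mv \<phi>) \<or> \<sigma> = (((i, j), 0), ((i, j), 2)) \<and> passes \<phi> (i, j)"
  proof (cases rule: clamp_cases[of x j])
    case x: 1
    show ?thesis
    proof (cases rule: clamp_cases[of y j])
      case 1 with x c show ?thesis by simp
    next
      case 2 with x c show ?thesis by auto
    next
      case 3
      have "passes \<phi> (i, j)" unfolding passes_def
        using mvD(1)[OF assms c(3)] x 3 by (intro exI[of _ "(i, x)"] exI[of _ "(i, y)"]) (simp add: pt_less_def)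
      with x 3 c show ?thesis by simp
    qed
  next
    case x: 2
    with lt have "clamp j y = 2" by simp
    with x c show ?thesis by auto
  next
    case 3
    with lt have "clamp j y = 2" by simp
    with 3 c show ?thesis by simp
  qed
  with c(2) show "\<exists>p\<in>pair_places Z P.
    \<sigma> = ((p, 0), (p, 1)) \<and> p \<in> Range (mv \<phi>) \<or> \<sigma> = ((p, 1), (p, 2)) \<and> p \<in> Domain (mv \<phi>) \<or>
    \<sigma> = ((p, 0), (p, 2)) \<and> passes \<phi> p" by blast
next
  assume "\<exists>p\<in>pair_places Z P.
    \<sigma> = ((p, 0), (p, 1)) \<and> p \<in> Range (mv \<phi>) \<or> \<sigma> = ((p, 1), (p, 2)) \<and> p \<in> Domain (mv \<phi>) \<or>
    \<sigma> = ((p, 0), (p, 2)) \<and> passes \<phi> p"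
  then obtain p where p: "p \<in> pair_places Z P" and
    c: "\<sigma> = ((p, 0), (p, 1)) \<and> p \<in> Range (mv \<phi>) \<or> \<sigma> = ((p, 1), (p, 2)) \<and> p \<in> Domain (mv \<phi>) \<or>
    \<sigma> = ((p, 0), (p, 2)) \<and> passes \<phi> p" by blast
  have cut: "((p, clamp (snd p) (snd x)), (p, clamp (snd p) (snd y))) \<in> cut_strands Z P (mv \<phi>)"
    if xy: "(x, y) \<in> mv \<phi>" "fst x = fst p" "clamp (snd p) (snd x) \<noteq> clamp (snd p) (snd y)" for x y
  proof -
    have "x = (fst p, snd x)" "y = (fst p, snd y)" using mvD(2)[OF assms xy(1)] xy(2) by (simp_all add: prod_eq_iff)
    with xy(1) have "((fst p, snd x), (fst p, snd y)) \<in> mv \<phi>" by metis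
    with p xy(3) show ?thesis unfolding cut_strands_def
      by (intro CollectI exI[of _ "fst p"] exI[of _ "snd p"] exI[of _ "snd x"] exI[of _ "snd y"]) simp
  qed
  from c show "\<sigma> \<in> cut_strands Z P (mv \<phi>)"
  proof (elim disjE conjE)
    assume \<sigma>: "\<sigma> = ((p, 0), (p, 1))" and "p \<in> Range (mv \<phi>)"
    then obtain x where x: "(x, p) \<in> mv \<phi>" by blast
    from cut[OF x] mvD[OF assms x] show ?thesis unfolding \<sigma> by simp
  next
    assume \<sigma>: "\<sigma> = ((p, 1), (p, 2))" and "p \<in> Domain (mv \<phi>)"
    then obtain x where x: "(p, x) \<in> mv \<phi>" by blast
    from cut[OF x] mvD[OF assms x] show ?thesis unfolding \<sigma> by simp
  next
    assume \<sigma>: "\<sigma> = ((p, 0), (p, 2))" and "passes \<phi> p"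
    then obtain x y where xy: "(x, y) \<in> \<phi>" "pt_less x p" "pt_less p y" unfolding passes_def by blast
    then have "(x, y) \<in> mv \<phi>" by (auto simp: mv_def pt_less_def)
    from cut[OF this] xy(2,3) show ?thesis unfolding \<sigma> by (simp add: pt_less_def)
  qed
qed

lemma loc_term_iff:
  assumes "strands \<phi>"
  shows "\<sigma> \<in> loc_term Z P \<phi> \<longleftrightarrow> (\<exists>p\<in>pair_places Z P.
    \<sigma> = ((p, 0), (p, 1)) \<and> p \<in> Range (mv \<phi>) \<or> \<sigma> = ((p, 1), (p, 2)) \<and> p \<in> Domain (mv \<phi>) \<or>
    \<sigma> = ((p, 0), (p, 2)) \<and> passes \<phi> p \<or> \<sigma> = ((p, 1), (p, 1)) \<and> (p, p) \<in> \<phi>)"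
  unfolding loc_term_def Un_iff cut_iff[OF assms] by blast

lemma mv_loc_term:
  assumes "strands \<phi>"
  shows "mv (loc_term Z P \<phi>) = cut_strands Z P (mv \<phi>)"
proof -
  have "\<sigma> \<in> mv (loc_term Z P \<phi>) \<longleftrightarrow> \<sigma> \<in> loc_term Z P \<phi> \<and> fst \<sigma> \<noteq> snd \<sigma>" for \<sigma>
    by (auto simp: mv_def)
  moreover have "fst \<sigma> \<noteq> snd \<sigma>" if "\<sigma> \<in> cut_strands Z P (mv \<phi>)" for \<sigma>
    using that unfolding cut_strands_def by auto
  ultimately show ?thesis unfolding loc_term_def by auto
qed

lemma fragment_simps:
  "points (fragment Z P) = {(p, k). p \<in> pair_places Z P \<and> k \<le> 2}"
  "places (fragment Z P) = {(p, k). p \<in> pair_places Z P \<and> k = 1}"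
  "pairs (fragment Z P) = {1}" "matching (fragment Z P) q = 1"
  "pair_places (fragment Z P) Q = (if Q = 1 then {(p, k). p \<in> pair_places Z P \<and> k = 1} else {})"
  by (auto simp: points_def places_def pairs_def pair_places_def fragment_def)

lemma (in arc_frame) fragment_frame:
  assumes "P \<in> pairs Z"
  shows "arc_frame (fragment Z P)"
proof
  show "finite (intervals (fragment Z P))" by (simp add: fragment_def finite_pair_places)
  show "matching (fragment Z P) ` places (fragment Z P) \<subseteq> pairs (fragment Z P)"
    by (auto simp: fragment_simps)
  fix Q assume "Q \<in> pairs (fragment Z P)"
  then have "pair_places (fragment Z P) Q = (\<lambda>p. (p, 1)) ` pair_places Z P" by (auto simp: fragment_simps)
  then show "card (pair_places (fragment Z P) Q) = 2"
    using card_pair_places[OF assms] by (simp add: card_image inj_on_def)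
qed

context viable_frame
begin

lemma fragment_viable:
  assumes "P \<in> pairs Z"
  shows "viable_frame (fragment Z P) (loc_h Z P h) (loc_s P s) (loc_s P t)"
proof -
  interpret F: arc_frame "fragment Z P" using assms by (rule fragment_frame)
  show ?thesis by (rule F.viable_frameI) (auto simp: loc_h_def h_le loc_s_def fragment_simps)
qed

lemma Domain_mv: "Domain \<phi> = Domain (mv \<phi>) \<union> {p. (p, p) \<in> \<phi>}" "Range \<phi> = Range (mv \<phi>) \<union> {p. (p, p) \<in> \<phi>}"
  for \<phi> :: "'i sdiag"
  unfolding mv_def by blast+

text \<open>Cutting creates endpoints only at the interval ends 0 and 2 of the fragment, and a
  section may contain any of these. At the places themselves starts, ends and horizontal strands are
  kept, and with them the breaks.\<close>

lemma loc_term_tm: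
  assumes "\<phi> \<in> T"
  shows "loc_term Z P \<phi> \<in> tm (fragment Z P) (loc_h Z P h) (loc_s P s) (loc_s P t)"
    "p \<in> pair_places Z P \<Longrightarrow> (p, 1) \<in> broken (loc_term Z P \<phi>) \<longleftrightarrow> p \<in> broken \<phi>"
proof -
  let ?l = "loc_term Z P \<phi>"
  note f = T_facts[OF assms] and li = loc_term_iff[OF T_facts(2)[OF assms]]
  note ps = passes_stp[OF f(3)] and hf = horizontal_free[OF f(2)]
  define D R H where "D p = (p \<in> Domain (mv \<phi>))" and "R p = (p \<in> Range (mv \<phi>))" and "H p = ((p, p) \<in> \<phi>)" for p
  note li' = li[folded D_def R_def H_def]
  have ex: "\<not> (passes \<phi> p \<and> D p)" "\<not> (passes \<phi> p \<and> R p)" "\<not> (H p \<and> D p)" "\<not> (H p \<and> R p)" for p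
    unfolding D_def R_def H_def using ps hf by blast+
  have sub: "?l \<subseteq> points (fragment Z P) \<times> points (fragment Z P)"
    unfolding fragment_simps using li by auto
  have sv: "single_valued ?l" "single_valued (?l\<inverse>)"
    unfolding single_valued_def converse_iff li' using ex by auto
  have le: "pt_le x y" if "(x, y) \<in> ?l" for x y using that unfolding li by (auto simp: pt_le_def)
  have sd: "?l \<in> strand_diagrams (fragment Z P)"
    unfolding strand_diagrams_def using sub sv le by blast
  have "finite ?l"
    unfolding loc_term_def
  proof (rule finite_subset)
    let ?A = "(\<lambda>p. (p, 0)) ` pair_places Z P \<union> (\<lambda>p. (p, 1)) ` pair_places Z P \<union> (\<lambda>p. (p, 2::nat)) ` pair_places Z P"
    show "cut_strands Z P (mv \<phi>) \<union> {((p, 1), (p, 1)) |p. p \<in> pair_places Z P \<and> (p, p) \<in> \<phi>} \<subseteq> ?A \<times> ?A"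
      unfolding loc_term_def[symmetric] using li by auto
    show "finite (?A \<times> ?A)" using finite_pair_places by simp
  qed
  with sv le have st: "strands ?l" unfolding strands_def by blast
  have covd: "fst e \<in> pair_places Z P \<and> (\<sigma> = ((fst e, 0), (fst e, 1)) \<and> R (fst e) \<and> snd e = 0 \<or>
    \<sigma> = ((fst e, 1), (fst e, 2)) \<and> D (fst e) \<and> snd e = 1 \<or>
    \<sigma> = ((fst e, 0), (fst e, 2)) \<and> passes \<phi> (fst e) \<and> (snd e = 0 \<or> snd e = 1))"
    if "\<sigma> \<in> ?l" "cvr \<sigma> e" for \<sigma> e
    using that unfolding li' cvr_def by (elim bexE disjE conjE) auto
  have thin: "thin ?l"
    unfolding thin_def
  proof (intro conjI st ballI allI impI)
    fix \<sigma> \<tau> e assume "\<sigma> \<in> ?l" "\<tau> \<in> ?l" "cvr \<sigma> e" "cvr \<tau> e"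
    with covd[of \<sigma> e] covd[of \<tau> e] show "\<sigma> = \<tau>" using ex[of "fst e"] by (metis zero_neq_one)
  qed
  have pl: "1 \<le> snd p" if "p \<in> pair_places Z P" for p
    using that place_snd by (auto simp: pair_places_def)
  have stp: "stp ?l e \<longleftrightarrow> fst e \<in> pair_places Z P \<and>
    (snd e = 0 \<and> stp \<phi> (prv (fst e)) \<or> snd e = 1 \<and> stp \<phi> (fst e))" for e
  proof -
    have "stp ?l e \<longleftrightarrow> (\<exists>p\<in>pair_places Z P. p = fst e \<and> (snd e = 0 \<and> (p \<in> Range (mv \<phi>) \<or> passes \<phi> p) \<or>
      snd e = 1 \<and> (p \<in> Domain (mv \<phi>) \<or> passes \<phi> p)))"
    proof
      assume "stp ?l e"
      then obtain \<sigma> where "\<sigma> \<in> ?l" "cvr \<sigma> e" unfolding stp_def by blast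
      then show "\<exists>p\<in>pair_places Z P. p = fst e \<and> (snd e = 0 \<and> (p \<in> Range (mv \<phi>) \<or> passes \<phi> p) \<or>
      snd e = 1 \<and> (p \<in> Domain (mv \<phi>) \<or> passes \<phi> p))"
        using covd[of \<sigma> e] unfolding D_def R_def by blast
    next
      have I: "stp ?l e" if "\<sigma> \<in> ?l" "cvr \<sigma> e" for \<sigma> using that unfolding stp_def by blast
      assume "\<exists>p\<in>pair_places Z P. p = fst e \<and> (snd e = 0 \<and> (p \<in> Range (mv \<phi>) \<or> passes \<phi> p) \<or>
      snd e = 1 \<and> (p \<in> Domain (mv \<phi>) \<or> passes \<phi> p))"
      then obtain p where p: "p \<in> pair_places Z P" "p = fst e" and
        c: "snd e = 0 \<and> (p \<in> Range (mv \<phi>) \<or> passes \<phi> p) \<or> snd e = 1 \<and> (p \<in> Domain (mv \<phi>) \<or> passes \<phi> p)"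
        by blast
      from c show "stp ?l e"
      proof (elim disjE conjE)
        assume "snd e = 0" "p \<in> Range (mv \<phi>)"
        then show ?thesis using p by (intro I[of "((p, 0), (p, 1))"]) (auto simp: li cvr_def)
      next
        assume "snd e = 0" "passes \<phi> p"
        then show ?thesis using p by (intro I[of "((p, 0), (p, 2))"]) (auto simp: li cvr_def)
      next
        assume "snd e = 1" "p \<in> Domain (mv \<phi>)"
        then show ?thesis using p by (intro I[of "((p, 1), (p, 2))"]) (auto simp: li cvr_def)
      next
        assume "snd e = 1" "passes \<phi> p"
        then show ?thesis using p by (intro I[of "((p, 0), (p, 2))"]) (auto simp: li cvr_def)
      qed
    qed
    then show ?thesis using stp_iff[OF f(2), of "fst e"] stp_prv_iff[OF f(2) pl, of "fst e"] by blast
  qed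
  have hg: "hg ?l = loc_h Z P h"
  proof
    fix e
    have h: "h e = of_bool (stp \<phi> e)" for e using thin_hg[OF f(3), of e] f(4) by simp
    show "hg ?l e = loc_h Z P h e"
      unfolding thin_hg[OF thin] stp loc_h_def h by auto
  qed
  have dom: "(p, 1) \<in> Domain ?l \<longleftrightarrow> p \<in> Domain \<phi>" "(p, 1) \<in> Range ?l \<longleftrightarrow> p \<in> Range \<phi>"
    if "p \<in> pair_places Z P" for p
    unfolding Domain_iff Range_iff li Domain_mv[of \<phi>] using that by auto
  have sec: "S' \<in> sections (fragment Z P) (loc_s P u)"
    if S: "S \<in> sections Z u" and S': "\<And>p. p \<in> pair_places Z P \<Longrightarrow> (p, 1) \<in> S' \<longleftrightarrow> p \<in> S"
      "S' \<subseteq> points (fragment Z P)" for S S' u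
  proof -
    have 1: "P \<in> u" if "p \<in> pair_places Z P" "(p, 1) \<in> S'" for p
      using S'(1) that sections_pair[OF S] by blast
    have 2: "\<exists>!q. q \<in> S' \<inter> pair_places (fragment Z P) 1" if P: "P \<in> u"
    proof -
      obtain p where p: "p \<in> S" "p \<in> pair_places Z P" using S P by (rule sections_ex)
      show ?thesis
      proof
        show "(p, 1) \<in> S' \<inter> pair_places (fragment Z P) 1" using p S'(1) by (simp add: fragment_simps)
        fix q assume "q \<in> S' \<inter> pair_places (fragment Z P) 1"
        then obtain p' where "q = (p', 1)" "p' \<in> pair_places Z P" "p' \<in> S" using S'(1) by (auto simp: fragment_simps)
        with sections_unique[OF S _ p(1) _ p(2)] show "q = (p, 1)" by blast
      qed
    qed
    have "\<forall>q \<in> S' \<inter> places (fragment Z P). matching (fragment Z P) q \<in> loc_s P u"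
      using 1 by (auto simp: fragment_simps loc_s_def)
    moreover have "\<forall>Q\<in>loc_s P u. \<exists>!q. q \<in> S' \<inter> pair_places (fragment Z P) Q"
    proof
      fix Q assume "Q \<in> loc_s P u"
      then have "Q = 1" "P \<in> u" by (auto simp: loc_s_def split: if_splits)
      with 2 show "\<exists>!q. q \<in> S' \<inter> pair_places (fragment Z P) Q" by blast
    qed
    ultimately show ?thesis unfolding sections_def using S'(2) by (intro CollectI conjI)
  qed
  have "Domain ?l \<subseteq> points (fragment Z P)" "Range ?l \<subseteq> points (fragment Z P)" using sub by blast+
  then have "Domain ?l \<in> sections (fragment Z P) (loc_s P s)" "Range ?l \<in> sections (fragment Z P) (loc_s P t)"
    using sec[OF f(6) dom(1)] sec[OF f(7) dom(2)] by blast+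
  with sd hg show "?l \<in> tm (fragment Z P) (loc_h Z P h) (loc_s P s) (loc_s P t)"
    unfolding tm_def by blast
  have "(p, 1) \<in> Domain (mv ?l) \<longleftrightarrow> p \<in> Domain (mv \<phi>)" "(p, 1) \<in> Range (mv ?l) \<longleftrightarrow> p \<in> Range (mv \<phi>)"
    if "p \<in> pair_places Z P" for p
    unfolding mv_loc_term[OF f(2)] Domain_iff[of _ "cut_strands Z P (mv \<phi>)"]
      Range_iff[of _ "cut_strands Z P (mv \<phi>)"] cut_iff[OF f(2)] using that by auto
  then show "p \<in> pair_places Z P \<Longrightarrow> (p, 1) \<in> broken ?l \<longleftrightarrow> p \<in> broken \<phi>"
    unfolding broken_iff by blast
qed

lemma loc_term_dg:
  assumes "\<phi> \<in> T" "P \<in> pairs Z"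
  shows "dg (fragment Z P) (loc_term Z P \<phi>) = local_dgm Z P (dg Z \<phi>)"
proof -
  interpret F: viable_frame "fragment Z P" "loc_h Z P h" "loc_s P s" "loc_s P t"
    using assms(2) by (rule fragment_viable)
  show ?thesis
    unfolding F.tm_dg(1)[OF loc_term_tm(1)[OF assms(1)]] tm_dg(1)[OF assms(1)] local_dgm_eq
      mv_loc_term[OF T_facts(2)[OF assms(1)]] ..
qed

lemma covers_loc:
  "p \<in> pair_places Z P \<Longrightarrow> covers_place (loc_h Z P h) (p, 1) \<longleftrightarrow> covers_place h p"
  "p \<in> pair_places Z P \<Longrightarrow> avoids_place (loc_h Z P h) (p, 1) \<longleftrightarrow> avoids_place h p"
  by (auto simp: covers_place_def avoids_place_def loc_h_def)

lemma occ_loc: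
  assumes "P \<in> pairs Z"
  shows "viable_frame.occ (fragment Z P) (loc_h Z P h) (loc_s P s) (loc_s P t) = (if P \<in> occ then {1} else {})"
proof -
  interpret F: viable_frame "fragment Z P" "loc_h Z P h" "loc_s P s" "loc_s P t"
    using assms by (rule fragment_viable)
  have "Q \<in> F.occ \<longleftrightarrow> Q = 1 \<and> P \<in> occ" for Q
    unfolding F.occ_def occ_def using covers_loc(1) by (auto simp: loc_s_def fragment_simps)
  then show ?thesis by auto
qed

lemma once_occupied_loc:
  assumes "p \<in> pair_places Z P"
  shows "once_occupied_at (fragment Z P) (loc_h Z P h) 1 (p, 1) \<longleftrightarrow> once_occupied_at Z h P p"
proof -
  have pp: "pair_places (fragment Z P) 1 - {(p, 1)} = (\<lambda>q. (q, 1)) ` (pair_places Z P - {p})"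
    by (auto simp: fragment_simps)
  have "(\<forall>q\<in>pair_places Z P - {p}. avoids_place (loc_h Z P h) (q, 1)) \<longleftrightarrow>
    (\<forall>q\<in>pair_places Z P - {p}. avoids_place h q)"
    by (rule ball_cong) (use covers_loc(2) in blast)+
  then show ?thesis
    unfolding once_occupied_at_def pp ball_simps using assms covers_loc(1)[OF assms]
    by (simp add: fragment_simps)
qed

lemma crossed_at_iff:
  assumes "\<phi> \<in> T" "P \<in> pairs Z"
  shows "crossed_at Z P (dg Z \<phi>) \<longleftrightarrow> P \<in> occ \<and> broken \<phi> \<inter> pair_places Z P = {}"
proof -
  interpret F: viable_frame "fragment Z P" "loc_h Z P h" "loc_s P s" "loc_s P t"
    using assms(2) by (rule fragment_viable)
  note l = loc_term_tm[OF assms(1), where P = P]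
  have "broken (loc_term Z P \<phi>) \<inter> pair_places (fragment Z P) 1 = {} \<longleftrightarrow> broken \<phi> \<inter> pair_places Z P = {}"
    using l(2) by (auto simp: fragment_simps)
  then show ?thesis
    unfolding crossed_at_def loc_term_dg[OF assms, symmetric] F.has_crossings_iff[OF l(1)] occ_loc[OF assms(2)]
    by auto
qed

end

context arc_frame
begin

text \<open>The local diagram is uncrossed and \<open>occ\<close> of the fragment has at most one
  element. If the diagram were a boundary, the pair would be once occupied and in both idempotents,
  which tightness of \<open>d\<close> excludes.\<close>

lemma tight_local:
  assumes "tight_dgm Z d" "P \<in> pairs Z"
  shows "tight_dgm (fragment Z P) (local_dgm Z P d)"
    "hdata (local_dgm Z P d) = (loc_h Z P (hgrade d), loc_s P (fst d), loc_s P (snd (snd d)))"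
proof -
  have d: "diagram Z d" "viable_h Z (hgrade d)" "\<not> has_crossings Z d"
    using assms(1) by (auto simp: tight_dgm_def)
  interpret V: viable_frame Z "hgrade d" "fst d" "snd (snd d)" using d(1,2) by (rule diagram_frame)
  interpret F: viable_frame "fragment Z P" "loc_h Z P (hgrade d)" "loc_s P (fst d)" "loc_s P (snd (snd d))"
    using assms(2) by (rule V.fragment_viable)
  obtain \<phi> where \<phi>: "\<phi> \<in> V.T" "dg Z \<phi> = d" using diagram_dg[OF d(1)] by blast
  let ?l = "loc_term Z P \<phi>"
  note l = V.loc_term_tm[OF \<phi>(1), where P = P]
  have dl: "dg (fragment Z P) ?l = local_dgm Z P d" using V.loc_term_dg[OF \<phi>(1) assms(2)] \<phi>(2) by simp
  note t = F.tm_dg[OF l(1), unfolded dl]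
  show hd: "hdata (local_dgm Z P d) = (loc_h Z P (hgrade d), loc_s P (fst d), loc_s P (snd (snd d)))"
    by (rule t(3))
  have dia: "diagram (fragment Z P) (local_dgm Z P d)" using t(4) F.s_pairs F.t_pairs by blast
  have hgl: "hgrade (local_dgm Z P d) = hg ?l"
    using hd F.hdata_eq[of "local_dgm Z P d"] F.T_facts(4)[OF l(1)] by (simp del: local_dgm.simps)
  have via: "viable_h (fragment Z P) (hgrade (local_dgm Z P d))"
    using F.hg_viable[OF F.T_facts(1)[OF l(1)]] F.h_le unfolding hgl F.T_facts(4)[OF l(1)] by blast
  have nc: "\<not> has_crossings (fragment Z P) (local_dgm Z P d)"
    using V.crossed_at_iff[OF \<phi>(1) assms(2)] V.has_crossings_iff[OF \<phi>(1)] d(3) \<phi>(2)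
    unfolding crossed_at_def by auto
  have "hclass (fragment Z P) (elt (fragment Z P) (local_dgm Z P d)) \<noteq> hzero (fragment Z P)"
  proof
    assume "hclass (fragment Z P) (elt (fragment Z P) (local_dgm Z P d)) = hzero (fragment Z P)"
    then obtain y where y: "y \<in> alg_summand (fragment Z P) (hdata (local_dgm Z P d))"
      "elt (fragment Z P) (local_dgm Z P d) = bd y"
      using F.boundary_summand[OF _ F.strand_alg_0] F.elt_summand[OF dia] unfolding hzero_def hd by auto
    have "F.occ \<subseteq> {1}" using V.occ_loc[OF assms(2)] by auto
    with F.uncrossed_not_boundary[OF l(1), unfolded dl, OF nc, of y 1] y hd
    obtain q where q: "once_occupied_at (fragment Z P) (loc_h Z P (hgrade d)) 1 q" "1 \<in> F.occ" by auto
    then obtain p where "q = (p, 1)" "p \<in> pair_places Z P"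
      unfolding once_occupied_at_def by (auto simp: fragment_simps)
    with q V.once_occupied_loc have "once_occupied_at Z (hgrade d) P p" by simp
    moreover have "P \<in> V.occ" using q(2) V.occ_loc[OF assms(2)] by (auto split: if_splits)
    ultimately show False using tight_not_once_occupied[OF assms(1)] unfolding V.occ_def by blast
  qed
  with dia via nc show "tight_dgm (fragment Z P) (local_dgm Z P d)" by (simp add: tight_dgm_def)
qed

end

section \<open>Products of diagrams without horizontal places\<close>

text \<open>The domain of a composite determines \<phi>, and the range of \<phi> then determines
  \<psi>. So different pairs of factors give different composites and nothing cancels.\<close>

lemma keys_mult:
  assumes x: "inj_on Domain (keys x)" and y: "inj_on Domain (keys y)"
  shows "keys (mult x y) = {\<phi> O \<psi> |\<phi> \<psi>. \<phi> \<in> keys x \<and> \<psi> \<in> keys y \<and> Range \<phi> = Domain \<psi> \<and>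
    inv_count (\<phi> O \<psi>) = inv_count \<phi> + inv_count \<psi>}"
proof -
  have dom: "Domain \<chi> = Domain \<phi> \<and> Range \<phi> = Domain \<psi>" if "\<chi> \<in> keys (mult_basis \<phi> \<psi>)" for \<chi> \<phi> \<psi> :: "'a sdiag"
    using that comp_Domain_Range(1)[of \<phi> \<psi>] by (auto simp: mult_basis_def split: if_splits)
  have inner: "keys (\<Sum>\<psi>\<in>keys y. mult_basis \<phi> \<psi>) = (\<Union>\<psi>\<in>keys y. keys (mult_basis \<phi> \<psi>))" for \<phi>
  proof (rule keys_disjoint_sum)
    fix \<psi> \<psi>' assume "\<psi> \<in> keys y" "\<psi>' \<in> keys y" "\<psi> \<noteq> \<psi>'"
    then have "Domain \<psi> \<noteq> Domain \<psi>'" using y by (auto simp: inj_on_def)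
    then show "keys (mult_basis \<phi> \<psi>) \<inter> keys (mult_basis \<phi> \<psi>') = {}" using dom by (metis disjoint_iff)
  qed simp
  have "keys (mult x y) = (\<Union>\<phi>\<in>keys x. keys (\<Sum>\<psi>\<in>keys y. mult_basis \<phi> \<psi>))"
    unfolding mult_def
  proof (rule keys_disjoint_sum)
    fix \<phi> \<phi>' assume "\<phi> \<in> keys x" "\<phi>' \<in> keys x" "\<phi> \<noteq> \<phi>'"
    then have "Domain \<phi> \<noteq> Domain \<phi>'" using x by (auto simp: inj_on_def)
    then show "keys (\<Sum>\<psi>\<in>keys y. mult_basis \<phi> \<psi>) \<inter> keys (\<Sum>\<psi>\<in>keys y. mult_basis \<phi>' \<psi>) = {}"
      unfolding inner using dom by blast
  qed simp
  also have "\<dots> = (\<Union>\<phi>\<in>keys x. \<Union>\<psi>\<in>keys y. keys (mult_basis \<phi> \<psi>))" unfolding inner ..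
  also have "\<dots> = {\<phi> O \<psi> |\<phi> \<psi>. \<phi> \<in> keys x \<and> \<psi> \<in> keys y \<and> Range \<phi> = Domain \<psi> \<and>
    inv_count (\<phi> O \<psi>) = inv_count \<phi> + inv_count \<psi>}"
  proof -
    have K: "\<chi> \<in> keys (mult_basis \<phi> \<psi>) \<longleftrightarrow> \<chi> = \<phi> O \<psi> \<and> Range \<phi> = Domain \<psi> \<and>
      inv_count (\<phi> O \<psi>) = inv_count \<phi> + inv_count \<psi>" for \<chi> \<phi> \<psi> :: "'a sdiag"
      by (simp add: mult_basis_def)
    show ?thesis
    proof (intro set_eqI iffI)
      fix \<chi> assume "\<chi> \<in> (\<Union>\<phi>\<in>keys x. \<Union>\<psi>\<in>keys y. keys (mult_basis \<phi> \<psi>))"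
      then obtain \<phi> \<psi> where "\<phi> \<in> keys x" "\<psi> \<in> keys y" "\<chi> \<in> keys (mult_basis \<phi> \<psi>)" by (elim UN_E)
      then show "\<chi> \<in> {\<phi> O \<psi> |\<phi> \<psi>. \<phi> \<in> keys x \<and> \<psi> \<in> keys y \<and> Range \<phi> = Domain \<psi> \<and>
        inv_count (\<phi> O \<psi>) = inv_count \<phi> + inv_count \<psi>}"
        unfolding K by (intro CollectI exI[of _ \<phi>] exI[of _ \<psi>]) simp
    next
      fix \<chi> assume "\<chi> \<in> {\<phi> O \<psi> |\<phi> \<psi>. \<phi> \<in> keys x \<and> \<psi> \<in> keys y \<and> Range \<phi> = Domain \<psi> \<and>
        inv_count (\<phi> O \<psi>) = inv_count \<phi> + inv_count \<psi>}"
      then obtain \<phi> \<psi> where \<chi>: "\<chi> = \<phi> O \<psi>" "\<phi> \<in> keys x" "\<psi> \<in> keys y" "Range \<phi> = Domain \<psi>"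
        "inv_count (\<phi> O \<psi>) = inv_count \<phi> + inv_count \<psi>" by (elim CollectE exE conjE)
      then have "\<chi> \<in> keys (mult_basis \<phi> \<psi>)" unfolding K by simp
      with \<chi>(2,3) show "\<chi> \<in> (\<Union>\<phi>\<in>keys x. \<Union>\<psi>\<in>keys y. keys (mult_basis \<phi> \<psi>))" by (intro UN_I)
    qed
  qed
  finally show ?thesis .
qed

lemma inj_Domain_mult:
  assumes x: "inj_on Domain (keys x)" and y: "inj_on Domain (keys y)"
  shows "inj_on Domain (keys (mult x y))"
proof (rule inj_onI)
  fix \<chi> \<chi>' assume k: "\<chi> \<in> keys (mult x y)" "\<chi>' \<in> keys (mult x y)" and eq: "Domain \<chi> = Domain \<chi>'"
  obtain \<phi> \<psi> where 1: "\<phi> \<in> keys x" "\<psi> \<in> keys y" "Range \<phi> = Domain \<psi>" "\<chi> = \<phi> O \<psi>"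
    using k(1) by (rule keys_multD)
  obtain \<phi>' \<psi>' where 2: "\<phi>' \<in> keys x" "\<psi>' \<in> keys y" "Range \<phi>' = Domain \<psi>'" "\<chi>' = \<phi>' O \<psi>'"
    using k(2) by (rule keys_multD)
  have "Domain \<phi> = Domain \<phi>'" using comp_Domain_Range(1)[OF 1(3)] comp_Domain_Range(1)[OF 2(3)] 1(4) 2(4) eq by simp
  then have "\<phi> = \<phi>'" using inj_onD[OF x _ 1(1) 2(1)] by blast
  then have "\<psi> = \<psi>'" using inj_onD[OF y _ 1(2) 2(2)] 1(3) 2(3) by metis
  with \<open>\<phi> = \<phi>'\<close> 1 2 show "\<chi> = \<chi>'" by simp
qed

definition ends :: "'i arc \<Rightarrow> 'i pt set" where
  "ends Z = points Z - places Z"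

text \<open>A diagram sums over all choices of horizontal strands at interval ends. To recognize a
  product as one diagram, it must be known that products keep this freedom.\<close>

definition end_closed :: "'i arc \<Rightarrow> 'i chain \<Rightarrow> bool" where
  "end_closed Z x \<longleftrightarrow> keys x \<subseteq> strand_diagrams Z \<and> (\<forall>\<phi>\<in>keys x. \<forall>e\<in>ends Z.
     (e \<notin> Domain \<phi> \<longrightarrow> e \<notin> Range \<phi> \<longrightarrow> insert (e, e) \<phi> \<in> keys x) \<and>
     ((e, e) \<in> \<phi> \<longrightarrow> \<phi> - {(e, e)} \<in> keys x))"

lemma ends_extreme:
  assumes "e \<in> ends Z"
  shows "snd e = 0 \<or> (\<forall>x\<in>points Z. fst x = fst e \<longrightarrow> snd x \<le> snd e)"
  using assms by (cases e) (auto simp: ends_def points_def places_def)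

text \<open>No strand passes an end of an interval, so a horizontal strand there meets no
  other.\<close>

lemma inv_count_end:
  assumes "e \<in> ends Z" "\<phi> \<in> strand_diagrams Z"
  shows "inv_count (insert (e, e) \<phi>) = inv_count \<phi>"
proof -
  have no: "\<not> (pt_less x e \<and> pt_less e y)" "\<not> (pt_less e x \<and> pt_less y e)" if "(x, y) \<in> \<phi>" for x y
  proof -
    have "y \<in> points Z" "pt_le x y" using that assms(2) unfolding strand_diagrams_def by blast+
    then show "\<not> (pt_less x e \<and> pt_less e y)" "\<not> (pt_less e x \<and> pt_less y e)"
      using ends_extreme[OF assms(1)] by (auto simp: pt_less_def pt_le_def)
  qed
  have "c \<in> crossings (insert (e, e) \<phi>) \<longleftrightarrow> c \<in> crossings \<phi>" for c
  proof -
    obtain x y x' y' where c: "c = ((x, y), (x', y'))" by (metis prod.collapse)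
    have "\<not> pt_less e e" by (simp add: pt_less_def)
    then show ?thesis unfolding c crossings_def mem_Collect_eq prod.case insert_iff prod.inject
      using no(1)[of x y] no(2)[of x' y'] by (cases "x = e \<and> y = e"; cases "x' = e \<and> y' = e"; auto)
  qed
  then have "crossings (insert (e, e) \<phi>) = crossings \<phi>" by (rule set_eqI)
  then show ?thesis by (simp add: inv_count_def)
qed

lemma strand_diagrams_insert_end:
  assumes "e \<in> ends Z" "\<phi> \<in> strand_diagrams Z" "e \<notin> Domain \<phi>" "e \<notin> Range \<phi>"
  shows "insert (e, e) \<phi> \<in> strand_diagrams Z"
  using assms unfolding strand_diagrams_def single_valued_def ends_def by (auto simp: pt_le_def)

lemma strand_diagrams_remove: "\<phi> \<in> strand_diagrams Z \<Longrightarrow> \<phi> - A \<in> strand_diagrams Z"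
  unfolding strand_diagrams_def single_valued_def by blast

lemma sections_ends:
  assumes "e \<in> ends Z" "S \<in> sections Z s"
  shows "insert e S \<in> sections Z s" "S - {e} \<in> sections Z s"
proof -
  have e: "e \<in> points Z" "e \<notin> places Z" "e \<notin> pair_places Z P" for P
    using assms(1) by (auto simp: ends_def pair_places_def)
  have eq: "insert e S \<inter> A = S \<inter> A" "(S - {e}) \<inter> A = S \<inter> A" if "e \<notin> A" for A using that by auto
  show "insert e S \<in> sections Z s" "S - {e} \<in> sections Z s"
    using assms(2) e(1) unfolding sections_def mem_Collect_eq eq[OF e(2)] eq[OF e(3)] by auto
qed

context arc_frame
begin

lemma inj_Domain_elt:
  assumes "diagram Z d"
  shows "inj_on Domain (keys (elt Z d))"
proof (rule inj_onI)
  fix \<phi> \<psi> assume k: "\<phi> \<in> keys (elt Z d)" "\<psi> \<in> keys (elt Z d)" "Domain \<phi> = Domain \<psi>"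
  have k': "\<phi> \<in> dterms Z d" "\<psi> \<in> dterms Z d" using k keys_elt_diagram[OF assms] by auto
  note m = diagram_tm[OF assms k'(1)] diagram_tm[OF assms k'(2)]
  have hor: "{x. (x, x) \<in> \<chi>} = Domain \<chi> - Domain (mv \<chi>)" if "strands \<chi>" for \<chi>
    using horizontal_free(1)[OF that] unfolding mv_def by blast
  show "\<phi> = \<psi>"
    using mv_decomp[of \<phi>] mv_decomp[of \<psi>] hor[OF tm_strands[OF m(1)]] hor[OF tm_strands[OF m(3)]] m(2,4) k(3)
    by simp
qed

lemma end_closed_elt:
  assumes "diagram Z d"
  shows "end_closed Z (elt Z d)"
  unfolding end_closed_def keys_elt_diagram[OF assms]
proof (intro conjI ballI impI)
  obtain s \<mu> t where d: "d = (s, \<mu>, t)" using prod_cases3 by blast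
  show "dterms Z d \<subseteq> strand_diagrams Z" unfolding d by auto
  fix \<phi> e assume \<phi>: "\<phi> \<in> dterms Z d" and e: "e \<in> ends Z"
  have f: "\<phi> \<in> strand_diagrams Z" "mv \<phi> = \<mu>" "Domain \<phi> \<in> sections Z s" "Range \<phi> \<in> sections Z t"
    using \<phi> unfolding d by auto
  have m: "mv (insert (e, e) \<phi>) = \<mu>" "mv (\<phi> - {(e, e)}) = \<mu>" using f(2) by (auto simp: mv_def)
  {
    assume "e \<notin> Domain \<phi>" "e \<notin> Range \<phi>"
    then show "insert (e, e) \<phi> \<in> dterms Z d"
      using strand_diagrams_insert_end[OF e f(1)] sections_ends(1)[OF e] f m unfolding d by simp
  next
    assume h: "(e, e) \<in> \<phi>"
    have "Domain (\<phi> - {(e, e)}) = Domain \<phi> - {e}" "Range (\<phi> - {(e, e)}) = Range \<phi> - {e}"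
      using strandsD(2,3)[OF strand_diagrams_strands[OF f(1)]] h by blast+
    then show "\<phi> - {(e, e)} \<in> dterms Z d"
      using strand_diagrams_remove[OF f(1)] sections_ends(2)[OF e] f m unfolding d by simp
  }
qed

lemma end_closed_mult:
  assumes x: "end_closed Z x" "inj_on Domain (keys x)" and y: "end_closed Z y" "inj_on Domain (keys y)"
  shows "end_closed Z (mult x y)"
  unfolding end_closed_def
proof (intro conjI ballI impI)
  show "keys (mult x y) \<subseteq> strand_diagrams Z"
  proof
    fix \<chi> assume "\<chi> \<in> keys (mult x y)"
    then obtain \<phi> \<psi> where "\<phi> \<in> keys x" "\<psi> \<in> keys y" "\<chi> = \<phi> O \<psi>" by (auto elim: keys_multD)
    moreover from this have "\<phi> \<in> strand_diagrams Z" "\<psi> \<in> strand_diagrams Z"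
      using x(1) y(1) unfolding end_closed_def by blast+
    ultimately show "\<chi> \<in> strand_diagrams Z" by (simp add: comp_strand_diagrams)
  qed
  fix \<chi> e assume "\<chi> \<in> keys (mult x y)" and e: "e \<in> ends Z"
  then obtain \<phi> \<psi> where k: "\<phi> \<in> keys x" "\<psi> \<in> keys y" "Range \<phi> = Domain \<psi>"
    "inv_count (\<phi> O \<psi>) = inv_count \<phi> + inv_count \<psi>" "\<chi> = \<phi> O \<psi>" by (auto elim: keys_multD)
  have sd: "\<phi> \<in> strand_diagrams Z" "\<psi> \<in> strand_diagrams Z" "\<phi> O \<psi> \<in> strand_diagrams Z"
  proof -
    show sd: "\<phi> \<in> strand_diagrams Z" "\<psi> \<in> strand_diagrams Z"
      using k(1,2) x(1) y(1) unfolding end_closed_def by blast+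
    show "\<phi> O \<psi> \<in> strand_diagrams Z" using sd by (rule comp_strand_diagrams)
  qed
  note st = strand_diagrams_strands[OF sd(1)] strand_diagrams_strands[OF sd(2)]
  have le: "snd a \<le> snd b" "fst a = fst b" "a \<in> points Z" "b \<in> points Z" if "(a, b) \<in> \<phi> \<union> \<psi>" for a b
    using that sd(1,2) unfolding strand_diagrams_def pt_le_def by blast+
  have I: "\<phi>' O \<psi>' \<in> keys (mult x y)" if "\<phi>' \<in> keys x" "\<psi>' \<in> keys y" "Range \<phi>' = Domain \<psi>'"
    "inv_count (\<phi>' O \<psi>') = inv_count \<phi>' + inv_count \<psi>'" for \<phi>' \<psi>'
    unfolding keys_mult[OF x(2) y(2)] using that by blast
  {
    assume "e \<notin> Domain \<chi>" "e \<notin> Range \<chi>"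
    then have ne': "e \<notin> Domain \<phi>" "e \<notin> Range \<psi>" using comp_Domain_Range[OF k(3)] k(5) by auto
    \<comment> \<open>At the start of an interval the strand of \<phi> that reaches \<open>e\<close>
      is horizontal; at the end of an interval the strand of \<psi> that leaves \<open>e\<close>
      is.\<close>
    have mid: "e \<notin> Range \<phi>"
    proof
      assume "e \<in> Range \<phi>"
      then obtain a b where ab: "(a, e) \<in> \<phi>" "(e, b) \<in> \<psi>" using k(3) by blast
      from le[of a e] le[of e b] ab ends_extreme[OF e] have "a = e \<or> b = e"
        by (auto simp: prod_eq_iff)
      with ab ne' show False by blast
    qed
    have x': "insert (e, e) \<phi> \<in> keys x" "insert (e, e) \<psi> \<in> keys y"
      using x(1) y(1) k e ne' mid unfolding end_closed_def by auto
    have comp: "insert (e, e) \<phi> O insert (e, e) \<psi> = insert (e, e) (\<phi> O \<psi>)"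
      using mid k(3) by blast
    show "insert (e, e) \<chi> \<in> keys (mult x y)"
      unfolding k(5) comp[symmetric]
      by (rule I[OF x']) (use k(3,4) in \<open>auto simp: comp inv_count_end[OF e sd(1)] inv_count_end[OF e sd(2)] inv_count_end[OF e sd(3)]\<close>)
  next
    assume "(e, e) \<in> \<chi>"
    then obtain b where b: "(e, b) \<in> \<phi>" "(b, e) \<in> \<psi>" unfolding k(5) by blast
    with le[of e b] le[of b e] have "b = e" by (auto simp: prod_eq_iff)
    with b have h: "(e, e) \<in> \<phi>" "(e, e) \<in> \<psi>" by auto
    have x': "\<phi> - {(e, e)} \<in> keys x" "\<psi> - {(e, e)} \<in> keys y"
      using x(1) y(1) k e h unfolding end_closed_def by auto
    have uq: "(e, b) \<in> \<phi> \<Longrightarrow> b = e" "(b, e) \<in> \<phi> \<Longrightarrow> b = e" "(e, b) \<in> \<psi> \<Longrightarrow> b = e" "(b, e) \<in> \<psi> \<Longrightarrow> b = e" for b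
      using strandsD(2,3)[OF st(1)] strandsD(2,3)[OF st(2)] h by blast+
    have comp: "(\<phi> - {(e, e)}) O (\<psi> - {(e, e)}) = \<phi> O \<psi> - {(e, e)}" using uq by blast
    have rd: "Range (\<phi> - {(e, e)}) = Domain (\<psi> - {(e, e)})" using uq k(3) by blast
    have ins: "insert (e, e) (\<phi> - {(e, e)}) = \<phi>" "insert (e, e) (\<psi> - {(e, e)}) = \<psi>"
      "insert (e, e) (\<phi> O \<psi> - {(e, e)}) = \<phi> O \<psi>" using h by blast+
    have inv: "inv_count (\<phi> - {(e, e)}) = inv_count \<phi>" "inv_count (\<psi> - {(e, e)}) = inv_count \<psi>"
      "inv_count (\<phi> O \<psi> - {(e, e)}) = inv_count (\<phi> O \<psi>)"
      using inv_count_end[OF e strand_diagrams_remove[OF sd(1), of "{(e, e)}"]]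
        inv_count_end[OF e strand_diagrams_remove[OF sd(2), of "{(e, e)}"]]
        inv_count_end[OF e strand_diagrams_remove[OF sd(3), of "{(e, e)}"]] unfolding ins by simp_all
    show "\<chi> - {(e, e)} \<in> keys (mult x y)"
      unfolding k(5) comp[symmetric] by (rule I[OF x' rd]) (simp add: comp inv k(4))
  }
qed

lemma product_end_closed:
  assumes "ds \<noteq> []" "\<forall>d\<in>set ds. diagram Z d"
  shows "end_closed Z (mult_list (map (elt Z) ds)) \<and> inj_on Domain (keys (mult_list (map (elt Z) ds)))"
  using assms
proof (induction ds rule: induct_list012)
  case (2 d) then show ?case using end_closed_elt inj_Domain_elt by simp
next
  case (3 d d' ds)
  then have IH: "end_closed Z (mult_list (map (elt Z) (d' # ds)))" "inj_on Domain (keys (mult_list (map (elt Z) (d' # ds))))"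
    by simp_all
  have d: "diagram Z d" using 3 by simp
  show ?case
    using end_closed_mult[OF end_closed_elt[OF d] inj_Domain_elt[OF d] IH] inj_Domain_mult[OF inj_Domain_elt[OF d] IH(2)]
    by simp
qed simp

lemma end_closed_remove:
  assumes "end_closed Z x" "finite U" "U \<subseteq> ends Z"
  shows "\<phi> \<in> keys x \<Longrightarrow> Id_on U \<subseteq> \<phi> \<Longrightarrow> \<phi> - Id_on U \<in> keys x"
  using assms(2,3)
proof (induction U arbitrary: \<phi> rule: finite_induct)
  case (insert e U)
  then have "(e, e) \<in> \<phi>" "e \<in> ends Z" by auto
  then have "\<phi> - {(e, e)} \<in> keys x" using assms(1) insert.prems(1) unfolding end_closed_def by blast
  moreover have "Id_on U \<subseteq> \<phi> - {(e, e)}" using insert.prems(2) insert.hyps(2) by auto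
  ultimately have "\<phi> - {(e, e)} - Id_on U \<in> keys x" using insert.IH insert.prems(3) by blast
  moreover have "\<phi> - {(e, e)} - Id_on U = \<phi> - Id_on (insert e U)" by auto
  ultimately show ?case by simp
qed simp

lemma end_closed_add:
  assumes "end_closed Z x" "finite U" "U \<subseteq> ends Z" "U \<inter> (Domain \<mu> \<union> Range \<mu>) = {}" "\<mu> \<in> keys x"
  shows "\<mu> \<union> Id_on U \<in> keys x"
  using assms(2-4)
proof (induction U rule: finite_induct)
  case (insert e U)
  then have "\<mu> \<union> Id_on U \<in> keys x" by blast
  moreover have "e \<notin> Domain (\<mu> \<union> Id_on U)" "e \<notin> Range (\<mu> \<union> Id_on U)" "e \<in> ends Z" using insert by auto
  ultimately have "insert (e, e) (\<mu> \<union> Id_on U) \<in> keys x" using assms(1) unfolding end_closed_def by blast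
  moreover have "insert (e, e) (\<mu> \<union> Id_on U) = \<mu> \<union> Id_on (insert e U)" by auto
  ultimately show ?case by simp
qed (use assms in simp)

text \<open>All terms of the product share their breaks, hence their moving strands, with \<chi>.
  The horizontal strands of any term with these moving strands lie at interval ends, and there
  \<open>end_closed\<close> supplies every choice.\<close>

lemma product_elt:
  assumes ds: "ds \<noteq> []" "\<forall>d\<in>set ds. diagram Z d" "\<And>e. (\<Sum>d\<leftarrow>ds. hgrade d e) \<le> 1"
    and \<chi>: "\<chi> \<in> keys (mult_list (map (elt Z) ds))" and hor: "\<And>p. p \<in> places Z \<Longrightarrow> (p, p) \<notin> \<chi>"
  shows "mult_list (map (elt Z) ds) = elt Z (dg Z \<chi>)"
proof (rule chain_eqI)
  let ?x = "mult_list (map (elt Z) ds)"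
  let ?h = "\<lambda>e. \<Sum>d\<leftarrow>ds. hgrade d e" and ?s = "fst (hd ds)" and ?t = "snd (snd (last ds))"
  have st: "?s \<subseteq> pairs Z" "?t \<subseteq> pairs Z" using ds(1,2) diagram_pairs by auto
  interpret V: viable_frame Z ?h ?s ?t using ds(3) st by (rule viable_frameI)
  note pk = product_keys[OF ds]
  note ec = product_end_closed[OF ds(1,2)]
  have \<chi>T: "\<chi> \<in> V.T" using \<chi> by (rule pk)
  have keys: "keys (elt Z (dg Z \<chi>)) = {\<omega>\<in>V.T. mv \<omega> = mv \<chi>}"
    using keys_elt_diagram[OF tm_dg(4)[OF \<chi>T st]] V.dterms_T[OF \<chi>T] by simp
  \<comment> \<open>At a pair of the left idempotent \<chi> has the start of a moving strand, which
    \<omega> shares; so \<omega> has no room for a horizontal strand at that pair.\<close>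
  have hor_ends: "{x. (x, x) \<in> \<omega>} \<subseteq> ends Z" if \<omega>: "\<omega> \<in> V.T" "mv \<omega> = mv \<chi>" for \<omega>
  proof
    fix p assume "p \<in> {x. (x, x) \<in> \<omega>}"
    then have p: "(p, p) \<in> \<omega>" by simp
    then have pt: "p \<in> points Z" "p \<in> Domain \<omega>" using V.T_facts(1)[OF \<omega>(1)] by (auto simp: strand_diagrams_def)
    have "p \<notin> places Z"
    proof
      assume "p \<in> places Z"
      then have pp: "p \<in> pair_places Z (matching Z p)" by (simp add: pair_places_def)
      have "matching Z p \<in> ?s" using sections_pair[OF V.T_facts(6)[OF \<omega>(1)] pt(2) pp] .
      with V.T_facts(6)[OF \<chi>T] obtain r where r: "r \<in> Domain \<chi>" "r \<in> pair_places Z (matching Z p)"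
        by (rule sections_ex)
      then have "(r, r) \<notin> \<chi>" using hor by (auto simp: pair_places_def)
      with r(1) have "r \<in> Domain (mv \<chi>)" unfolding mv_def by blast
      then have m: "r \<in> Domain (mv \<omega>)" by (simp add: \<omega>(2))
      then have "r \<in> Domain \<omega>" by (auto simp: mv_def)
      then have "r = p" using sections_unique[OF V.T_facts(6)[OF \<omega>(1)] _ pt(2) r(2) pp] by blast
      with m horizontal_free(1)[OF V.T_facts(2)[OF \<omega>(1)] p] show False by simp
    qed
    with pt show "p \<in> ends Z" by (simp add: ends_def)
  qed
  have fin: "finite {x. (x, x) \<in> \<omega>}" if "\<omega> \<in> V.T" for \<omega>
    by (rule finite_subset[of _ "Domain \<omega>"]) (use strandsD(1)[OF V.T_facts(2)[OF that]] in \<open>auto intro: finite_Domain\<close>)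
  show "keys ?x = keys (elt Z (dg Z \<chi>))"
  proof
    show "keys ?x \<subseteq> keys (elt Z (dg Z \<chi>))"
    proof
      fix \<omega> assume \<omega>: "\<omega> \<in> keys ?x"
      then have \<omega>T: "\<omega> \<in> V.T" by (rule pk)
      have "p \<in> broken \<omega> \<longleftrightarrow> p \<in> broken \<chi>" for p
      proof (cases "1 \<le> snd p")
        case True
        have "(of_bool (p \<in> broken \<omega>) :: int) = of_bool (p \<in> broken \<chi>)"
          unfolding pk(2)[OF \<omega> True] pk(2)[OF \<chi> True] ..
        then show ?thesis by (simp only: of_bool_eq_iff)
      next
        case False
        then show ?thesis using V.broken_facts(1)[OF \<omega>T] V.broken_facts(1)[OF \<chi>T] place_snd by blast
      qed
      then have "broken \<omega> = broken \<chi>" by blast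
      then have "mv \<omega> = mv \<chi>" using V.T_facts[OF \<omega>T] V.T_facts[OF \<chi>T] by (intro mv_unique) auto
      with \<omega>T show "\<omega> \<in> keys (elt Z (dg Z \<chi>))" unfolding keys by blast
    qed
    have "mv \<chi> = \<chi> - Id_on {x. (x, x) \<in> \<chi>}" by (auto simp: mv_def)
    moreover have "\<chi> - Id_on {x. (x, x) \<in> \<chi>} \<in> keys ?x"
      by (rule end_closed_remove[OF _ fin[OF \<chi>T] hor_ends[OF \<chi>T refl] \<chi>]) (use ec in auto)
    ultimately have mk: "mv \<chi> \<in> keys ?x" by simp
    show "keys (elt Z (dg Z \<chi>)) \<subseteq> keys ?x"
    proof
      fix \<omega> assume "\<omega> \<in> keys (elt Z (dg Z \<chi>))"
      then have \<omega>: "\<omega> \<in> V.T" "mv \<omega> = mv \<chi>" unfolding keys by auto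
      have "{x. (x, x) \<in> \<omega>} \<inter> (Domain (mv \<chi>) \<union> Range (mv \<chi>)) = {}"
        using horizontal_free[OF V.T_facts(2)[OF \<omega>(1)]] unfolding \<omega>(2) by blast
      then have "mv \<chi> \<union> Id_on {x. (x, x) \<in> \<omega>} \<in> keys ?x"
        using end_closed_add[OF _ fin[OF \<omega>(1)] hor_ends[OF \<omega>] _ mk] ec by blast
      then show "\<omega> \<in> keys ?x" using mv_decomp[of \<omega>] \<omega>(2) by simp
    qed
  qed
qed

end

section \<open>Bounds for the number of breaks\<close>

text \<open>The count seen from the last factor, for the mirror image of the argument about the left
  idempotent.\<close>

lemma breaks_snoc:
  "breaks p (ds @ [d]) = breaks p ds + (\<Sum>d'\<leftarrow>ds. hgrade d' p) * hgrade d (prv p) + of_bool (p \<in> broken (fst (snd d)))"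
  by (induction ds) (simp_all add: algebra_simps)

context arc_frame
begin

definition good :: "'i dgm \<Rightarrow> bool" where
  "good d \<longleftrightarrow> diagram Z d \<and> (\<forall>e. hgrade d e \<le> 1)"

lemma good_cases:
  assumes "good d"
  obtains \<phi> where "viable_frame Z (hgrade d) (fst d) (snd (snd d))" "\<phi> \<in> tm Z (hgrade d) (fst d) (snd (snd d))"
    "broken (fst (snd d)) = broken \<phi>" "dg Z \<phi> = d"
proof -
  have d: "diagram Z d" using assms by (simp add: good_def)
  obtain \<phi> where \<phi>: "\<phi> \<in> tm Z (hgrade d) (fst d) (snd (snd d))" "dg Z \<phi> = d" "\<phi> \<in> dterms Z d"
    using d by (rule diagram_dg)
  have "broken (fst (snd d)) = broken \<phi>" using diagram_tm(2)[OF d \<phi>(3)] broken_mv by metis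
  with that viable_frameI[of "hgrade d"] \<phi> diagram_pairs[OF d] assms show thesis by (auto simp: good_def)
qed

lemma good_broken:
  assumes "good d" "p \<in> broken (fst (snd d))"
  shows "hgrade d p = 1" "hgrade d (prv p) = 1"
proof -
  obtain \<phi> where V: "viable_frame Z (hgrade d) (fst d) (snd (snd d))" and
    \<phi>: "\<phi> \<in> tm Z (hgrade d) (fst d) (snd (snd d))" "broken (fst (snd d)) = broken \<phi>"
    using assms(1) by (rule good_cases)
  interpret V: viable_frame Z "hgrade d" "fst d" "snd (snd d)" by (rule V)
  have "covers_place (hgrade d) p" using V.broken_facts(2)[OF \<phi>(1)] assms(2) \<phi>(2) by simp
  with V.h_le[of p] V.h_le[of "prv p"] hgrade_nonneg[of d p] hgrade_nonneg[of d "prv p"]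
  show "hgrade d p = 1" "hgrade d (prv p) = 1" unfolding covers_place_def by linarith+
qed

text \<open>Every break at \<open>p\<close> uses a factor covering the step before \<open>p\<close>
  and a factor, possibly the same, covering the step after it.\<close>

lemma breaks_bounds:
  assumes "\<forall>d\<in>set ds. good d"
  shows "0 \<le> breaks p ds" "breaks p ds \<le> (\<Sum>d\<leftarrow>ds. hgrade d (prv p)) * (\<Sum>d\<leftarrow>ds. hgrade d p)"
proof -
  have "0 \<le> breaks p ds \<and> breaks p ds \<le> (\<Sum>d\<leftarrow>ds. hgrade d (prv p)) * (\<Sum>d\<leftarrow>ds. hgrade d p)"
    using assms
  proof (induction ds)
    case (Cons d ds)
    let ?a = "hgrade d (prv p)" and ?b = "hgrade d p"
    let ?A = "\<Sum>d\<leftarrow>ds. hgrade d (prv p)" and ?B = "\<Sum>d\<leftarrow>ds. hgrade d p"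
    have IH: "0 \<le> breaks p ds" "breaks p ds \<le> ?A * ?B" using Cons by auto
    have nn: "0 \<le> ?a" "0 \<le> ?b" "0 \<le> ?A" "0 \<le> ?B" by (simp_all add: hgrade_nonneg sum_hgrade_nonneg)
    have "of_bool (p \<in> broken (fst (snd d))) \<le> ?a * ?b"
      using good_broken[of d p] Cons.prems nn by auto
    moreover have "0 \<le> ?b * ?A" "0 \<le> ?a * ?B" using nn by simp_all
    moreover have "(?a + ?A) * (?b + ?B) = ?a * ?b + ?b * ?A + ?a * ?B + ?A * ?B" by (simp add: algebra_simps)
    moreover have "(0::int) \<le> of_bool (p \<in> broken (fst (snd d)))" by simp
    ultimately show ?case
      using IH by (simp only: breaks.simps list.map sum_list.Cons) (intro conjI; linarith)
  qed simp
  then show "0 \<le> breaks p ds" "breaks p ds \<le> (\<Sum>d\<leftarrow>ds. hgrade d (prv p)) * (\<Sum>d\<leftarrow>ds. hgrade d p)" by auto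
qed

text \<open>No strand starts at a place of \<open>P\<close>. So a strand covering the step after
  \<open>p\<close> comes from the step before it, and \<open>P\<close> can enter the right
  idempotent only through a strand that arrives there.\<close>

lemma not_start:
  assumes "good d" "P \<notin> fst d" "p \<in> pair_places Z P"
  shows "p \<notin> broken (fst (snd d))" "hgrade d p = 1 \<Longrightarrow> hgrade d (prv p) = 1"
    "(\<And>q. q \<in> pair_places Z P \<Longrightarrow> hgrade d (prv q) = 0) \<Longrightarrow> P \<notin> snd (snd d)"
proof -
  obtain \<phi> where V: "viable_frame Z (hgrade d) (fst d) (snd (snd d))" and
    \<phi>: "\<phi> \<in> tm Z (hgrade d) (fst d) (snd (snd d))" "broken (fst (snd d)) = broken \<phi>"
    using assms(1) by (rule good_cases)
  interpret V: viable_frame Z "hgrade d" "fst d" "snd (snd d)" by (rule V)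
  note f = V.T_facts[OF \<phi>(1)]
  have nd: "q \<notin> Domain \<phi>" if "q \<in> pair_places Z P" for q using sections_pair[OF f(6) _ that] assms(2) by blast
  have nm: "q \<notin> Domain (mv \<phi>)" if "q \<in> pair_places Z P" for q using nd[OF that] by (auto simp: mv_def)
  show "p \<notin> broken (fst (snd d))" using nm[OF assms(3)] \<phi>(2) by (simp add: broken_iff)
  have "hgrade d (prv p) = 1" if "stp \<phi> (prv p)"
    using that f(5) V.h_le[of "prv p"] hgrade_nonneg[of d "prv p"] by (metis antisym_conv int_one_le_iff_zero_less order_le_less)
  then show "hgrade d p = 1 \<Longrightarrow> hgrade d (prv p) = 1"
    using stp_not_start[OF f(2) _ nm[OF assms(3)]] f(5)[of p] by simp
  assume z: "\<And>q. q \<in> pair_places Z P \<Longrightarrow> hgrade d (prv q) = 0"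
  show "P \<notin> snd (snd d)"
  proof
    assume "P \<in> snd (snd d)"
    with f(7) obtain q where q: "q \<in> Range \<phi>" "q \<in> pair_places Z P" by (rule sections_ex)
    have "\<not> stp \<phi> (prv q)" using z[OF q(2)] f(5)[of "prv q"] by simp
    then have "q \<notin> Range (mv \<phi>)" using end_stp(1)[OF f(2)] by blast
    then have "(q, q) \<in> \<phi>" using q(1) unfolding mv_def by blast
    with nd[OF q(2)] show False by blast
  qed
qed

lemma not_end:
  assumes "good d" "P \<notin> snd (snd d)" "p \<in> pair_places Z P"
  shows "p \<notin> broken (fst (snd d))" "hgrade d (prv p) = 1 \<Longrightarrow> hgrade d p = 1"
    "(\<And>q. q \<in> pair_places Z P \<Longrightarrow> hgrade d q = 0) \<Longrightarrow> P \<notin> fst d"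
proof -
  obtain \<phi> where V: "viable_frame Z (hgrade d) (fst d) (snd (snd d))" and
    \<phi>: "\<phi> \<in> tm Z (hgrade d) (fst d) (snd (snd d))" "broken (fst (snd d)) = broken \<phi>"
    using assms(1) by (rule good_cases)
  interpret V: viable_frame Z "hgrade d" "fst d" "snd (snd d)" by (rule V)
  note f = V.T_facts[OF \<phi>(1)]
  have p1: "1 \<le> snd p" using assms(3) place_snd by (auto simp: pair_places_def)
  have nd: "q \<notin> Range \<phi>" if "q \<in> pair_places Z P" for q using sections_pair[OF f(7) _ that] assms(2) by blast
  have nm: "q \<notin> Range (mv \<phi>)" if "q \<in> pair_places Z P" for q using nd[OF that] by (auto simp: mv_def)
  show "p \<notin> broken (fst (snd d))" using nm[OF assms(3)] \<phi>(2) by (simp add: broken_iff)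
  have "hgrade d p = 1" if "stp \<phi> p"
    using that f(5) V.h_le[of p] hgrade_nonneg[of d p] by (metis antisym_conv int_one_le_iff_zero_less order_le_less)
  then show "hgrade d (prv p) = 1 \<Longrightarrow> hgrade d p = 1"
    using stp_not_end[OF f(2) _ p1 nm[OF assms(3)]] f(5)[of "prv p"] by simp
  assume z: "\<And>q. q \<in> pair_places Z P \<Longrightarrow> hgrade d q = 0"
  show "P \<notin> fst d"
  proof
    assume "P \<in> fst d"
    with f(6) obtain q where q: "q \<in> Domain \<phi>" "q \<in> pair_places Z P" by (rule sections_ex)
    have "\<not> stp \<phi> q" using z[OF q(2)] f(5)[of q] by simp
    then have "q \<notin> Domain (mv \<phi>)" using start_stp[OF f(2)] by blast
    then have "(q, q) \<in> \<phi>" using q(1) unfolding mv_def by blast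
    with nd[OF q(2)] show False by blast
  qed
qed

abbreviation chain :: "'i dgm list \<Rightarrow> bool" where
  "chain \<equiv> successively (\<lambda>d d'. snd (snd d) = fst d')"

lemma zero_one: "0 \<le> x \<Longrightarrow> x \<le> 1 \<Longrightarrow> x \<noteq> 0 \<Longrightarrow> x = 1" for x :: int by linarith

text \<open>Consider the first factor that covers a step leading into some place \<open>p\<close> of
  \<open>P\<close>. Up to its start \<open>P\<close> belongs to no idempotent and no step after its
  places is covered, so there is no break; this factor itself does not break at \<open>p\<close>,
  and afterwards the step before \<open>p\<close> cannot be covered again.\<close>

lemma unbroken_start:
  assumes "ds \<noteq> []" "\<forall>d\<in>set ds. good d" "chain ds" "\<And>e. (\<Sum>d\<leftarrow>ds. hgrade d e) \<le> 1"
    "P \<notin> fst (hd ds)" "P \<in> pairs Z"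
  shows "\<exists>p\<in>pair_places Z P. breaks p ds = 0"
  using assms(1-5)
proof (induction ds)
  case (Cons d ds)
  have g: "good d" and gs: "\<forall>d\<in>set ds. good d" and P: "P \<notin> fst d" using Cons.prems by auto
  have le: "hgrade d e + (\<Sum>d\<leftarrow>ds. hgrade d e) \<le> 1" for e using Cons.prems(4)[of e] by simp
  note ns = not_start[OF g P]
  show ?case
  proof (cases "\<exists>p\<in>pair_places Z P. hgrade d (prv p) \<noteq> 0")
    case True
    then obtain p where p: "p \<in> pair_places Z P" "hgrade d (prv p) \<noteq> 0" by blast
    then have "(\<Sum>d\<leftarrow>ds. hgrade d (prv p)) = 0"
      using le[of "prv p"] hgrade_nonneg[of d "prv p"] sum_hgrade_nonneg[of "prv p" ds] by linarith
    with breaks_bounds[OF gs, of p] ns(1)[OF p(1)] p(1) show ?thesis by (intro bexI[of _ p]) auto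
  next
    case False
    then have z: "hgrade d (prv q) = 0" if "q \<in> pair_places Z P" for q using that by blast
    obtain q where q: "q \<in> pair_places Z P" using card_pair_places[OF assms(6)] by fastforce
    have Pt: "P \<notin> snd (snd d)" by (rule ns(3)[OF q z])
    have z': "hgrade d p = 0" if "p \<in> pair_places Z P" for p
      using ns(2)[OF that] z[OF that] zero_one[OF hgrade_nonneg] g unfolding good_def by fastforce
    show ?thesis
    proof (cases "ds = []")
      case True with ns(1)[OF q] q show ?thesis by (intro bexI[of _ q]) auto
    next
      case ne: False
      have "chain ds" "snd (snd d) = fst (hd ds)" using Cons.prems(3) ne by (auto simp: successively_Cons)
      moreover have "(\<Sum>d\<leftarrow>ds. hgrade d e) \<le> 1" for e using le[of e] hgrade_nonneg[of d e] by linarith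
      ultimately obtain p where "p \<in> pair_places Z P" "breaks p ds = 0" using Cons.IH[OF ne gs] Pt by auto
      with ns(1) z' show ?thesis by (intro bexI[of _ p]) auto
    qed
  qed
qed simp

lemma unbroken_end:
  assumes "ds \<noteq> []" "\<forall>d\<in>set ds. good d" "chain ds" "\<And>e. (\<Sum>d\<leftarrow>ds. hgrade d e) \<le> 1"
    "P \<notin> snd (snd (last ds))" "P \<in> pairs Z"
  shows "\<exists>p\<in>pair_places Z P. breaks p ds = 0"
  using assms(1-5)
proof (induction ds rule: rev_induct)
  case (snoc d ds)
  have g: "good d" and gs: "\<forall>d\<in>set ds. good d" and P: "P \<notin> snd (snd d)" using snoc.prems by auto
  have le: "hgrade d e + (\<Sum>d\<leftarrow>ds. hgrade d e) \<le> 1" for e using snoc.prems(4)[of e] by simp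
  note ns = not_end[OF g P]
  show ?case
  proof (cases "\<exists>p\<in>pair_places Z P. hgrade d p \<noteq> 0")
    case True
    then obtain p where p: "p \<in> pair_places Z P" "hgrade d p \<noteq> 0" by blast
    then have "(\<Sum>d\<leftarrow>ds. hgrade d p) = 0"
      using le[of p] hgrade_nonneg[of d p] sum_hgrade_nonneg[of p ds] by linarith
    with breaks_bounds[OF gs, of p] ns(1)[OF p(1)] p(1) show ?thesis by (intro bexI[of _ p]) (auto simp: breaks_snoc)
  next
    case False
    then have z: "hgrade d q = 0" if "q \<in> pair_places Z P" for q using that by blast
    obtain q where q: "q \<in> pair_places Z P" using card_pair_places[OF assms(6)] by fastforce
    have Pt: "P \<notin> fst d" by (rule ns(3)[OF q z])
    have z': "hgrade d (prv p) = 0" if "p \<in> pair_places Z P" for p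
      using ns(2)[OF that] z[OF that] zero_one[OF hgrade_nonneg] g unfolding good_def by fastforce
    show ?thesis
    proof (cases "ds = []")
      case True with ns(1)[OF q] q show ?thesis by (intro bexI[of _ q]) auto
    next
      case ne: False
      have "chain ds" "snd (snd (last ds)) = fst d" using snoc.prems(3) ne by (auto simp: successively_append_iff)
      moreover have "(\<Sum>d\<leftarrow>ds. hgrade d e) \<le> 1" for e using le[of e] hgrade_nonneg[of d e] by linarith
      ultimately obtain p where "p \<in> pair_places Z P" "breaks p ds = 0" using snoc.IH[OF ne gs] Pt by auto
      with ns(1) z' show ?thesis by (intro bexI[of _ p]) (auto simp: breaks_snoc)
    qed
  qed
qed simp

end

section \<open>Counting twisted and critical pairs\<close>

context viable_frame
begin

lemma sum_broken:
  assumes "\<phi> \<in> T"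
  shows "(\<Sum>p\<in>pair_places Z P. of_bool (p \<in> broken \<phi>) :: int) = of_bool (broken \<phi> \<inter> pair_places Z P \<noteq> {})"
proof (cases "broken \<phi> \<inter> pair_places Z P = {}")
  case True
  then have "of_bool (p \<in> broken \<phi>) = (0::int)" if "p \<in> pair_places Z P" for p using that by auto
  then show ?thesis using True by simp
next
  case False
  then obtain q where q: "q \<in> broken \<phi>" "q \<in> pair_places Z P" by blast
  have "p \<in> broken \<phi> \<longleftrightarrow> p = q" if "p \<in> pair_places Z P" for p
    using broken_pair_unique[OF assms _ _ that q(2)] broken_facts(3)[OF assms q(1)] q(1) by blast
  then have "(\<Sum>p\<in>pair_places Z P. of_bool (p \<in> broken \<phi>) :: int) = (\<Sum>p\<in>pair_places Z P. if p = q then 1 else 0)"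
    by (intro sum.cong) auto
  then show ?thesis using q False finite_pair_places by simp
qed

lemma sum_broken_uncrossed:
  assumes "\<phi> \<in> T" "\<not> has_crossings Z (dg Z \<phi>)"
  shows "(\<Sum>p\<in>pair_places Z P. of_bool (p \<in> broken \<phi>) :: int) = of_bool (P \<in> occ)"
proof -
  have "broken \<phi> \<inter> pair_places Z P \<noteq> {} \<longleftrightarrow> P \<in> occ"
  proof
    assume "broken \<phi> \<inter> pair_places Z P \<noteq> {}"
    then obtain q where "q \<in> broken \<phi>" "q \<in> pair_places Z P" by blast
    with broken_facts(5)[OF assms(1), of q] show "P \<in> occ" by (simp add: pair_places_def)
  next
    assume "P \<in> occ" with assms(2) show "broken \<phi> \<inter> pair_places Z P \<noteq> {}"
      unfolding has_crossings_iff[OF assms(1)] by blast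
  qed
  then show ?thesis unfolding sum_broken[OF assms(1)] by simp
qed

text \<open>The pair carries a dotted strand, so no moving strand starts or ends at the twin of the
  covered place. The two steps at the twin are thus both covered or both not, and the former would
  make the pair doubly occupied.\<close>

lemma unbroken_once_occupied:
  assumes "\<phi> \<in> T" "P \<in> occ" "broken \<phi> \<inter> pair_places Z P = {}" "\<not> doubly_occupied Z h P"
  shows "\<exists>p. once_occupied_at Z h P p"
proof -
  note f = T_facts[OF assms(1)]
  obtain p where p: "p \<in> pair_places Z P" "covers_place h p" using assms(2) by (auto simp: occ_def)
  obtain q where q: "q \<in> pair_places Z P" "q \<noteq> p" "pair_places Z P = {p, q}" using p(1) by (rule pair_placesE)
  have ncov: "\<not> covers_place h q" using assms(4) p q(3) unfolding doubly_occupied_def by auto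
  obtain r where r: "r \<in> pair_places Z P" "(r, r) \<in> \<phi>"
    using dotted[OF assms(1) _ _ p assms(3)] assms(2) by (auto simp: occ_def)
  have rd: "r \<in> Domain \<phi>" "r \<in> Range \<phi>" using r(2) by auto
  have nm: "q \<notin> Domain (mv \<phi>)"
  proof
    assume m: "q \<in> Domain (mv \<phi>)"
    then have "q \<in> Domain \<phi>" by (auto simp: mv_def)
    then have "q = r" using sections_unique[OF f(6) _ rd(1) q(1) r(1)] by blast
    with m horizontal_free(1)[OF f(2) r(2)] show False by simp
  qed
  have nm': "q \<notin> Range (mv \<phi>)"
  proof
    assume m: "q \<in> Range (mv \<phi>)"
    then have "q \<in> Range \<phi>" by (auto simp: mv_def)
    then have "q = r" using sections_unique[OF f(7) _ rd(2) q(1) r(1)] by blast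
    with m horizontal_free(2)[OF f(2) r(2)] show False by simp
  qed
  have q1: "1 \<le> snd q" using q(1) place_snd by (auto simp: pair_places_def)
  have "stp \<phi> q \<longleftrightarrow> stp \<phi> (prv q)"
    using stp_not_start[OF f(2) _ nm] stp_not_end[OF f(2) _ q1 nm'] by blast
  then have "avoids_place h q" using ncov unfolding covers_place_def avoids_place_def f(5) by blast
  with p q have "once_occupied_at Z h P p" unfolding once_occupied_at_def by auto
  then show ?thesis by blast
qed

end

context arc_frame
begin

lemma tight_good: "tight_dgm Z d \<Longrightarrow> good d"
  using diagram_frame[of d] viable_frame.h_le unfolding good_def tight_dgm_def by blast

text \<open>At a doubly occupied pair tight diagrams with the same H-data may break at either place;
  the number of breaks on the pair is what the H-data determines.\<close>

lemma tight_sum_broken: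
  assumes "tight_dgm Z d"
  shows "(\<Sum>p\<in>pair_places Z P. of_bool (p \<in> broken (fst (snd d))) :: int) =
    of_bool (P \<in> viable_frame.occ Z (hgrade d) (fst d) (snd (snd d)))"
proof -
  obtain \<phi> where V: "viable_frame Z (hgrade d) (fst d) (snd (snd d))" and
    \<phi>: "\<phi> \<in> tm Z (hgrade d) (fst d) (snd (snd d))" "broken (fst (snd d)) = broken \<phi>" "dg Z \<phi> = d"
    using tight_good[OF assms] by (rule good_cases)
  interpret V: viable_frame Z "hgrade d" "fst d" "snd (snd d)" by (rule V)
  have "\<not> has_crossings Z (dg Z \<phi>)" using assms \<phi>(3) by (simp add: tight_dgm_def)
  from V.sum_broken_uncrossed[OF \<phi>(1) this] show ?thesis unfolding \<phi>(2) .
qed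

section \<open>Comparison of a tensor product with its restrictions to fragments\<close>

lemma local_rep:
  assumes "tight_dgm Z (tight_rep Z c)" "P \<in> pairs Z"
  shows "tight_dgm (fragment Z P) (tight_rep (fragment Z P) (local_class Z P c))"
    "hdata (tight_rep (fragment Z P) (local_class Z P c)) = (loc_h Z P (cls_h Z c), loc_s P (cls_s Z c), loc_s P (cls_t Z c))"
proof -
  interpret F: arc_frame "fragment Z P" using assms(2) by (rule fragment_frame)
  note l = tight_local[OF assms]
  note r = F.tight_rep_facts[OF l(1) refl]
  show "tight_dgm (fragment Z P) (tight_rep (fragment Z P) (local_class Z P c))"
    unfolding local_class_def by (rule r(1))
  show "hdata (tight_rep (fragment Z P) (local_class Z P c)) = (loc_h Z P (cls_h Z c), loc_s P (cls_s Z c), loc_s P (cls_t Z c))"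
    unfolding local_class_def r(3) l(2) cls_h_def cls_s_def cls_t_def ..
qed

lemma local_rep_data:
  assumes "tight_dgm Z (tight_rep Z c)" "P \<in> pairs Z"
  defines "r \<equiv> tight_rep (fragment Z P) (local_class Z P c)"
  shows "hgrade r = loc_h Z P (cls_h Z c)" "fst r = loc_s P (cls_s Z c)" "snd (snd r) = loc_s P (cls_t Z c)"
  using local_rep(2)[OF assms(1,2)] hdata_eq[of r] unfolding r_def by simp_all

text \<open>The tight representatives on the fragment are chosen independently of those on
  \<open>Z\<close>. The mixed terms of \<open>breaks\<close> depend on multiplicities only, and the
  breaks of single factors agree after summation over the pair.\<close>

lemma local_breaks:
  assumes "\<forall>c\<in>set M. tight_dgm Z (tight_rep Z c)" "P \<in> pairs Z"
  shows "(\<Sum>p\<in>pair_places Z P. breaks (p, 1) (map (\<lambda>c. tight_rep (fragment Z P) (local_class Z P c)) M)) =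
    (\<Sum>p\<in>pair_places Z P. breaks p (map (tight_rep Z) M))"
  using assms(1)
proof (induction M)
  case (Cons c M)
  let ?R = "\<lambda>c. tight_rep (fragment Z P) (local_class Z P c)"
  interpret F: arc_frame "fragment Z P" using assms(2) by (rule fragment_frame)
  have c: "tight_dgm Z (tight_rep Z c)" using Cons.prems by simp
  have hR: "hgrade (?R c') (p, k) =
    (if k = 0 then hgrade (tight_rep Z c') (prv p) else if k = 1 then hgrade (tight_rep Z c') p else 0)"
    if c': "c' \<in> set (c # M)" and p: "p \<in> pair_places Z P" for c' p k
  proof -
    have "tight_dgm Z (tight_rep Z c')" using Cons.prems c' by blast
    from local_rep_data(1)[OF this assms(2)] p show ?thesis by (simp add: loc_h_def cls_h_def)
  qed
  have sum: "(\<Sum>d\<leftarrow>map ?R M. hgrade d (p, 0)) = (\<Sum>d\<leftarrow>map (tight_rep Z) M. hgrade d (prv p))"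
    if "p \<in> pair_places Z P" for p
    using hR[OF _ that, of _ 0] by (intro arg_cong[of _ _ sum_list]) simp
  have split: "(\<Sum>p\<in>pair_places Z P. breaks (p, 1) (map ?R (c # M))) =
    (\<Sum>p\<in>pair_places Z P. of_bool ((p, 1) \<in> broken (fst (snd (?R c))))) +
    (\<Sum>p\<in>pair_places Z P. hgrade (tight_rep Z c) p * (\<Sum>d\<leftarrow>map (tight_rep Z) M. hgrade d (prv p))) +
    (\<Sum>p\<in>pair_places Z P. breaks (p, 1) (map ?R M))"
  proof -
    have "breaks (p, 1) (map ?R (c # M)) = of_bool ((p, 1) \<in> broken (fst (snd (?R c)))) +
      hgrade (tight_rep Z c) p * (\<Sum>d\<leftarrow>map (tight_rep Z) M. hgrade d (prv p)) + breaks (p, 1) (map ?R M)"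
      if "p \<in> pair_places Z P" for p
      using sum[OF that] hR[of c p 1] that by (simp del: map_map)
    then show ?thesis by (simp add: sum.distrib del: breaks.simps map_map list.map sum_of_bool_eq)
  qed
  have "(\<Sum>p\<in>pair_places Z P. of_bool ((p, 1) \<in> broken (fst (snd (?R c))))) = (\<Sum>q\<in>pair_places (fragment Z P) 1. of_bool (q \<in> broken (fst (snd (?R c)))) :: int)"
  proof (rule sum.reindex_cong[symmetric])
    show "pair_places (fragment Z P) 1 = (\<lambda>p. (p, 1)) ` pair_places Z P" by (auto simp: fragment_simps)
  qed (auto simp: inj_on_def)
  also have "\<dots> = of_bool (1 \<in> viable_frame.occ (fragment Z P) (hgrade (?R c)) (fst (?R c)) (snd (snd (?R c))))"
    by (rule F.tight_sum_broken[OF local_rep(1)[OF c assms(2)]])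
  also have "\<dots> = of_bool (P \<in> viable_frame.occ Z (cls_h Z c) (cls_s Z c) (cls_t Z c))"
  proof -
    interpret V: viable_frame Z "cls_h Z c" "cls_s Z c" "cls_t Z c"
      unfolding cls_h_def cls_s_def cls_t_def by (rule diagram_frame) (use c in \<open>auto simp: tight_dgm_def\<close>)
    show ?thesis unfolding local_rep_data[OF c assms(2)] V.occ_loc[OF assms(2)] by simp
  qed
  also have "\<dots> = (\<Sum>p\<in>pair_places Z P. of_bool (p \<in> broken (fst (snd (tight_rep Z c)))))"
    unfolding tight_sum_broken[OF c] cls_h_def cls_s_def cls_t_def ..
  finally show ?case
    unfolding split using Cons by (simp add: sum.distrib del: sum_of_bool_eq)
qed simp

lemma tensor_h_eq: "tensor_h Z M = (\<lambda>e. \<Sum>d\<leftarrow>map (tight_rep Z) M. hgrade d e)"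
  by (simp add: fun_eq_iff tensor_h_def cls_h_def comp_def)

lemma tensor_ends: "M \<noteq> [] \<Longrightarrow> cls_s Z (hd M) = fst (hd (map (tight_rep Z) M))"
  "M \<noteq> [] \<Longrightarrow> cls_t Z (last M) = snd (snd (last (map (tight_rep Z) M)))"
  by (simp_all add: cls_s_def cls_t_def hd_map last_map)

lemma mismatch_chain: "\<not> mismatch Z M \<longleftrightarrow> chain (map (tight_rep Z) M)"
  unfolding mismatch_def successively_conv_nth by (auto simp: cls_s_def cls_t_def)

end

context viable_frame
begin

lemma bad_pair:
  assumes M: "M \<noteq> []" "\<forall>c\<in>set M. tight_dgm Z (tight_rep Z c)" "\<not> mismatch Z M"
    and data: "h = tensor_h Z M" "s = cls_s Z (hd M)" "t = cls_t Z (last M)"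
    and \<phi>: "\<phi> \<in> T" "\<And>P. P \<in> occ \<Longrightarrow> doubly_occupied Z h P \<Longrightarrow> broken \<phi> \<inter> pair_places Z P \<noteq> {}"
    and P: "P \<in> pairs Z"
    and gt: "(\<Sum>p\<in>pair_places Z P. breaks p (map (tight_rep Z) M)) > (\<Sum>p\<in>pair_places Z P. of_bool (p \<in> broken \<phi>))"
  shows "twisted_at Z P M \<or> critical_at Z P M"
proof -
  let ?F = "fragment Z P" and ?L = "map (local_class Z P) M"
  let ?R = "\<lambda>c. tight_rep ?F (local_class Z P c)"
  interpret F: viable_frame ?F "loc_h Z P h" "loc_s P s" "loc_s P t" using P by (rule fragment_viable)
  have R: "tight_dgm ?F (?R c)" "hgrade (?R c) = loc_h Z P (cls_h Z c)" "fst (?R c) = loc_s P (cls_s Z c)"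
    "snd (snd (?R c)) = loc_s P (cls_t Z c)" if "c \<in> set M" for c
    using local_rep(1) local_rep_data M(2) P that by blast+
  have mm: "\<not> mismatch ?F ?L"
  proof
    assume "mismatch ?F ?L"
    then obtain i where i: "Suc i < length M" "cls_t ?F (?L ! i) \<noteq> cls_s ?F (?L ! Suc i)" unfolding mismatch_def length_map by (elim exE conjE)
    then have "cls_t Z (M ! i) = cls_s Z (M ! Suc i)" using M(3) unfolding mismatch_def by blast
    moreover have "cls_t ?F (?L ! i) = loc_s P (cls_t Z (M ! i))" "cls_s ?F (?L ! Suc i) = loc_s P (cls_s Z (M ! Suc i))"
      using R(3,4)[of "M ! i"] R(3,4)[of "M ! Suc i"] i(1) by (simp_all add: cls_t_def cls_s_def)
    ultimately show False using i(2) by simp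
  qed
  have th: "tensor_h ?F ?L = loc_h Z P h"
  proof
    fix e
    have "(\<Sum>c\<leftarrow>M. cls_h ?F (local_class Z P c) e) = (\<Sum>c\<leftarrow>M. loc_h Z P (cls_h Z c) e)"
      using R(2) by (intro arg_cong[of _ _ sum_list] map_cong) (simp_all add: cls_h_def)
    also have "\<dots> = loc_h Z P h e"
      unfolding data(1) by (auto simp: loc_h_def tensor_h_def)
    finally show "tensor_h ?F ?L e = loc_h Z P h e" by (simp add: tensor_h_def comp_def)
  qed
  have td: "tensor_hdata ?F ?L = (loc_h Z P h, loc_s P s, loc_s P t)"
    unfolding tensor_hdata_def th using R(3)[of "hd M"] R(4)[of "last M"] M(1) data(2,3)
    by (simp add: hd_map last_map cls_s_def cls_t_def)
  note l = loc_term_tm[OF \<phi>(1), where P = P]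
  have via: "viable ?F ?L"
    unfolding viable_def th using mm F.hg_viable[OF F.T_facts(1)[OF l(1)]] F.h_le F.T_facts(4)[OF l(1)] by auto
  have rp: "rep_product ?F ?L = mult_list (map (elt ?F) (map ?R M))"
    by (simp add: rep_product_def comp_def)
  have ds: "map ?R M \<noteq> []" "\<forall>d\<in>set (map ?R M). diagram ?F d" using M(1) R(1) by (auto simp: tight_dgm_def)
  have hs: "(\<Sum>d\<leftarrow>map ?R M. hgrade d e) = loc_h Z P h e" for e
    using fun_cong[OF th, of e] by (simp add: tensor_h_def cls_h_def comp_def)
  have fl: "fst (hd (map ?R M)) = loc_s P s" "snd (snd (last (map ?R M))) = loc_s P t"
    using R(3)[of "hd M"] R(4)[of "last M"] M(1) data(2,3) by (simp_all add: hd_map last_map)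
  show ?thesis
  proof (cases "rep_product ?F ?L = 0")
    case True
    \<comment> \<open>The cut of \<phi> witnesses that the local H-data is not singular.\<close>
    have "elt ?F (dg ?F (loc_term Z P \<phi>)) \<in> alg_summand ?F (tensor_hdata ?F ?L)"
      unfolding td using F.elt_summand[OF F.tm_dg(4)[OF l(1) F.s_pairs F.t_pairs]] F.tm_dg(3)[OF l(1)] by simp
    moreover have "elt ?F (dg ?F (loc_term Z P \<phi>)) \<noteq> 0"
      using F.keys_elt_diagram[OF F.tm_dg(4)[OF l(1) F.s_pairs F.t_pairs]] F.tm_dg(2)[OF l(1)] by auto
    ultimately have "critical_tensor ?F ?L" unfolding critical_tensor_def using via True by blast
    then show ?thesis by (simp add: critical_at_def)
  next
    case False
    then obtain \<chi> where \<chi>: "\<chi> \<in> keys (mult_list (map (elt ?F) (map ?R M)))" unfolding rp by fastforce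
    have le: "(\<Sum>d\<leftarrow>map ?R M. hgrade d e) \<le> 1" for e using hs F.h_le by simp
    note pk = F.product_keys[OF ds le \<chi>]
    have \<chi>T: "\<chi> \<in> F.T" using pk(1) unfolding hs fl .
    have "(\<Sum>q\<in>pair_places ?F 1. of_bool (q \<in> broken \<chi>)) = (\<Sum>p\<in>pair_places Z P. breaks (p, 1) (map ?R M))"
    proof (rule sum.reindex_cong)
      show "pair_places ?F 1 = (\<lambda>p. (p, 1)) ` pair_places Z P" by (auto simp: fragment_simps)
      show "of_bool ((p, 1) \<in> broken \<chi>) = breaks (p, 1) (map ?R M)" for p by (rule pk(2)) simp
    qed (auto simp: inj_on_def)
    \<comment> \<open>Each of the two terms breaks at most once at the pair, so the excess means
      that \<chi> breaks there and \<phi> does not.\<close>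
    then have eq: "(of_bool (broken \<chi> \<inter> pair_places ?F 1 \<noteq> {}) :: int) > of_bool (broken \<phi> \<inter> pair_places Z P \<noteq> {})"
      using gt unfolding local_breaks[OF M(2) P] F.sum_broken[OF \<chi>T] sum_broken[OF \<phi>(1)] by simp
    then have \<phi>0: "broken \<phi> \<inter> pair_places Z P = {}" and ne: "broken \<chi> \<inter> pair_places ?F 1 \<noteq> {}"
      by (auto simp: of_bool_def split: if_splits)
    from ne obtain q where q: "q \<in> broken \<chi>" "q \<in> pair_places ?F 1" by blast
    have "matching ?F q \<in> F.occ" using F.broken_facts(5)[OF \<chi>T q(1)] .
    then have P_occ: "P \<in> occ" using occ_loc[OF P] by (auto split: if_splits)
    then have "\<not> doubly_occupied Z h P" using \<phi>(2) \<phi>0 by blast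
    then obtain p where p: "once_occupied_at Z h P p"
      using unbroken_once_occupied[OF \<phi>(1) P_occ \<phi>0] by blast
    have pP: "p \<in> pair_places Z P" using p by (simp add: once_occupied_at_def)
    have once: "once_occupied_at ?F (loc_h Z P h) 1 (p, 1)" using once_occupied_loc[OF pP] p by simp
    have 1: "1 \<in> loc_s P s" "1 \<in> loc_s P t" using P_occ by (auto simp: occ_def loc_s_def)
    \<comment> \<open>The break \<open>q\<close> uses up the pair, so \<chi> has no horizontal
      strand at a place and the local product is a single diagram.\<close>
    have hor: "(r, r) \<notin> \<chi>" if "r \<in> places ?F" for r
    proof
      assume r: "(r, r) \<in> \<chi>"
      have "r \<in> pair_places ?F 1" using that by (auto simp: fragment_simps)
      then have "q = r" using F.broken_pair_unique[OF \<chi>T q(1) _ q(2)] r by blast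
      with F.broken_facts(6)[OF \<chi>T q(1)] r show False by simp
    qed
    have prod: "rep_product ?F ?L = elt ?F (dg ?F \<chi>)"
      unfolding rp by (rule F.product_elt[OF ds le \<chi> hor])
    note d = F.tm_dg[OF \<chi>T]
    have dia: "diagram ?F (dg ?F \<chi>)" by (rule d(4)[OF F.s_pairs F.t_pairs])
    have "F.occ = {1}" using occ_loc[OF P] P_occ by simp
    then have nc: "\<not> has_crossings ?F (dg ?F \<chi>)" unfolding F.has_crossings_iff[OF \<chi>T] using ne by simp
    have "elt ?F (dg ?F \<chi>) \<in> alg_summand ?F (loc_h Z P h, loc_s P s, loc_s P t)"
      using F.elt_summand[OF dia] d(3) by simp
    from F.homology_once_occupied[OF this F.uncrossed_cycle[OF dia nc] 1 once]
    have "hclass ?F (elt ?F (dg ?F \<chi>)) = hzero ?F" unfolding F.hclass_zero_iff .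
    moreover have "viable_h ?F (hgrade (dg ?F \<chi>))"
      using F.hg_viable[OF F.T_facts(1)[OF \<chi>T]] F.h_le F.T_facts(4)[OF \<chi>T] unfolding d(1) hgrade_hg hg_mv by simp
    ultimately have "twisted_dgm ?F (dg ?F \<chi>)" unfolding twisted_dgm_def using dia nc by blast
    then have "twisted_tensor ?F ?L" unfolding twisted_tensor_def using via prod by blast
    then show ?thesis by (simp add: twisted_at_def)
  qed
qed

lemma breaks_pair:
  assumes M: "M \<noteq> []" "\<forall>c\<in>set M. tight_dgm Z (tight_rep Z c)" "\<not> mismatch Z M"
    and data: "h = tensor_h Z M" "s = cls_s Z (hd M)" "t = cls_t Z (last M)"
    and \<phi>: "\<phi> \<in> T" "\<And>P. P \<in> occ \<Longrightarrow> doubly_occupied Z h P \<Longrightarrow> broken \<phi> \<inter> pair_places Z P \<noteq> {}"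
    and P: "P \<in> pairs Z"
  shows "(\<Sum>p\<in>pair_places Z P. breaks p (map (tight_rep Z) M)) \<le> (\<Sum>p\<in>pair_places Z P. of_bool (p \<in> broken \<phi>)) + 1"
proof -
  let ?ds = "map (tight_rep Z) M"
  have ne: "?ds \<noteq> []" and good: "\<forall>d\<in>set ?ds. good d" and ch: "chain ?ds"
    using M tight_good mismatch_chain by auto
  have hh: "(\<Sum>d\<leftarrow>?ds. hgrade d e) = h e" for e unfolding data(1) tensor_h_eq ..
  have le: "(\<Sum>d\<leftarrow>?ds. hgrade d e) \<le> 1" for e unfolding hh by (rule h_le)
  obtain p q where pq: "pair_places Z P = {p, q}" "p \<noteq> q" using card_pair_places[OF P] by (meson card_2_iff)
  have h0: "0 \<le> h e" for e using sum_hgrade_nonneg[of e ?ds] hh by simp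
  have b: "0 \<le> breaks r ?ds" "breaks r ?ds \<le> h (prv r) * h r" for r
    using breaks_bounds[OF good, of r] unfolding hh by auto
  have b1: "breaks r ?ds \<le> 1" for r
  proof -
    have "h (prv r) * h r \<le> 1 * 1" by (rule mult_mono) (simp_all add: h_le h0)
    with b(2)[of r] show ?thesis by linarith
  qed
  have cov: "covers_place h r" if "breaks r ?ds \<noteq> 0" for r
    using b[of r] that unfolding covers_place_def by (metis antisym mult_eq_0_iff)
  show ?thesis
  proof (cases "breaks p ?ds \<noteq> 0 \<and> breaks q ?ds \<noteq> 0")
    case False
    have "0 \<le> (\<Sum>p\<in>pair_places Z P. of_bool (p \<in> broken \<phi>) :: int)" by (rule sum_nonneg) simp
    moreover have "breaks p ?ds + breaks q ?ds \<le> 1" using False b1[of p] b1[of q] by linarith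
    ultimately show ?thesis using pq by simp
  next
    case True
    have all: "breaks r ?ds \<noteq> 0" if "r \<in> pair_places Z P" for r using True that pq(1) by auto
    \<comment> \<open>A pair missing from an outer idempotent would have a place without breaks, but
      here both places have one.\<close>
    have Ps: "P \<in> s" using unbroken_start[OF ne good ch le _ P] all unfolding data(2) tensor_ends(1)[OF M(1)] by blast
    have Pt: "P \<in> t" using unbroken_end[OF ne good ch le _ P] all unfolding data(3) tensor_ends(2)[OF M(1)] by blast
    have "doubly_occupied Z h P" unfolding doubly_occupied_def using all cov by blast
    moreover have "P \<in> occ" unfolding occ_def using Ps Pt cov[OF all] pq(1) by blast
    ultimately have "broken \<phi> \<inter> pair_places Z P \<noteq> {}" using \<phi>(2) by blast
    then have "(\<Sum>p\<in>pair_places Z P. of_bool (p \<in> broken \<phi>)) = (1::int)" unfolding sum_broken[OF \<phi>(1)] by simp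
    then show ?thesis using pq b1[of p] b1[of q] by simp
  qed
qed

text \<open>Both gradings are local sums for the same \<open>h\<close>, so their difference is the
  total excess of breaks of \<open>M\<close> over those of \<phi>. Grouped by pairs, it is at most 1
  at twisted or critical pairs and at most 0 elsewhere.\<close>

lemma maslov_count:
  assumes M: "M \<noteq> []" "\<forall>c\<in>set M. tight_dgm Z (tight_rep Z c)" "\<not> mismatch Z M"
    and data: "h = tensor_h Z M" "s = cls_s Z (hd M)" "t = cls_t Z (last M)"
    and \<phi>: "\<phi> \<in> T" "\<And>P. P \<in> occ \<Longrightarrow> doubly_occupied Z h P \<Longrightarrow> broken \<phi> \<inter> pair_places Z P \<noteq> {}"
  shows "maslov Z (dg Z \<phi>) - tensor_maslov Z M \<le> of_nat (card {P \<in> pairs Z. twisted_at Z P M \<or> critical_at Z P M})"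
proof -
  let ?ds = "map (tight_rep Z) M"
  let ?b = "\<lambda>p. breaks p ?ds - of_bool (p \<in> broken \<phi>)"
  have hh: "(\<lambda>e. \<Sum>d\<leftarrow>?ds. hgrade d e) = h" unfolding data(1) tensor_h_eq ..
  note d = tm_dg[OF \<phi>(1)]
  have hd: "hgrade (dg Z \<phi>) = h" using d(3) hdata_eq[of "dg Z \<phi>"] by simp
  have "maslov Z (dg Z \<phi>) = (\<Sum>p\<in>places Z. local_maslov h p (of_bool (p \<in> broken \<phi>)))"
    using maslov_local[OF d(4)[OF s_pairs t_pairs]] h_le unfolding hd unfolding d(1) by (simp add: broken_mv)
  moreover have "tensor_maslov Z M = (\<Sum>p\<in>places Z. local_maslov h p (breaks p ?ds))"
    unfolding tensor_maslov_list hh[symmetric]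
  proof (rule list_maslov_local)
    show "\<forall>d\<in>set ?ds. diagram Z d" using M(2) by (simp add: tight_dgm_def)
    show "(\<Sum>d\<leftarrow>?ds. hgrade d e) \<le> 1" for e using fun_cong[OF hh, of e] h_le[of e] by simp
  qed
  ultimately have "maslov Z (dg Z \<phi>) - tensor_maslov Z M = of_int (\<Sum>p\<in>places Z. ?b p)"
    by (simp add: sum_subtractf[symmetric] local_maslov_def)
  also have "(\<Sum>p\<in>places Z. ?b p) = (\<Sum>P\<in>pairs Z. \<Sum>p\<in>pair_places Z P. ?b p)"
  proof -
    have "places Z = (\<Union>P\<in>pairs Z. pair_places Z P)" using matching_pairs by (auto simp: pair_places_def)
    moreover have "finite (pairs Z)" by (simp add: pairs_def)
    ultimately show ?thesis
      using sum.UNION_disjoint[of "pairs Z" "pair_places Z" ?b] finite_pair_places by (auto simp: pair_places_def)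
  qed
  also have "\<dots> \<le> (\<Sum>P\<in>pairs Z. of_bool (twisted_at Z P M \<or> critical_at Z P M))"
  proof (rule sum_mono)
    fix P assume P: "P \<in> pairs Z"
    note bp = bad_pair[OF M data \<phi> P] and le = breaks_pair[OF M data \<phi> P]
    show "(\<Sum>p\<in>pair_places Z P. ?b p) \<le> of_bool (twisted_at Z P M \<or> critical_at Z P M)"
    proof (cases "(\<Sum>p\<in>pair_places Z P. breaks p ?ds) > (\<Sum>p\<in>pair_places Z P. of_bool (p \<in> broken \<phi>))")
      case True
      then show ?thesis using bp le by (simp add: sum_subtractf)
    next
      case False
      then have "(\<Sum>p\<in>pair_places Z P. ?b p) \<le> 0" unfolding sum_subtractf by linarith
      then show ?thesis by (rule order_trans) simp
    qed
  qed
  also have "\<dots> = int (card {P \<in> pairs Z. twisted_at Z P M \<or> critical_at Z P M})"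
  proof -
    have "finite (pairs Z)" by (simp add: pairs_def)
    then show ?thesis by (simp only: sum_of_bool_eq Int_def mem_Collect_eq)
  qed
  finally show ?thesis by simp
qed

end

section \<open>The ideal F\<close>

text \<open>A condition on a single term, free of idempotents, so that it can be followed through
  compositions. A horizontal strand at a doubly occupied pair is always crossed, so its absence is
  the absence of crossings there.\<close>

definition nonF :: "'i arc \<Rightarrow> 'i sdiag \<Rightarrow> bool" where
  "nonF Z \<phi> \<longleftrightarrow> viable_h Z (hg \<phi>) \<and>
     \<not> (\<exists>P\<in>pairs Z. doubly_occupied Z (hg \<phi>) P \<and> (\<exists>p\<in>pair_places Z P. (p, p) \<in> \<phi>))"

context viable_frame
begin

lemma T_viable: "\<phi> \<in> T \<Longrightarrow> viable_h Z h"
  using hg_viable[OF T_facts(1)] T_facts(4) h_le by metis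

lemma horizontal_pair_iff:
  assumes "\<phi> \<in> T" "doubly_occupied Z h P" "P \<in> pairs Z"
  shows "(\<exists>p\<in>pair_places Z P. (p, p) \<in> \<phi>) \<longleftrightarrow> P \<in> occ \<and> broken \<phi> \<inter> pair_places Z P = {}"
proof
  assume "\<exists>p\<in>pair_places Z P. (p, p) \<in> \<phi>"
  then obtain p where p: "p \<in> pair_places Z P" "(p, p) \<in> \<phi>" by blast
  then have "covers_place h p" using assms(2) by (simp add: doubly_occupied_def)
  from occI[OF assms(1) p(2,1,1) this] show "P \<in> occ \<and> broken \<phi> \<inter> pair_places Z P = {}" by blast
next
  assume o: "P \<in> occ \<and> broken \<phi> \<inter> pair_places Z P = {}"
  then obtain p where p: "p \<in> pair_places Z P" "covers_place h p" "P \<in> s" "P \<in> t" by (auto simp: occ_def)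
  from dotted[OF assms(1) p(3,4,1,2)] o show "\<exists>p\<in>pair_places Z P. (p, p) \<in> \<phi>" by blast
qed

lemma nonF_iff:
  assumes "\<phi> \<in> T"
  shows "nonF Z \<phi> \<longleftrightarrow> (\<forall>P\<in>occ. doubly_occupied Z h P \<longrightarrow> broken \<phi> \<inter> pair_places Z P \<noteq> {})"
proof -
  have "occ \<subseteq> pairs Z" using s_pairs by (auto simp: occ_def)
  then show ?thesis
    unfolding nonF_def T_facts(4)[OF assms] using horizontal_pair_iff[OF assms] T_viable[OF assms] by blast
qed

end

context arc_frame
begin

lemma term_viable_frame:
  assumes "\<phi> \<in> tm Z h s t" "viable_h Z h" "s \<subseteq> pairs Z" "t \<subseteq> pairs Z"
  shows "viable_frame Z h s t"
proof (rule viable_frameI[OF _ assms(3,4)])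
  show "h e \<le> 1" for e using hg_viable[of \<phi>] assms(1,2) by (simp add: tm_def)
qed

lemma not_ideal_F:
  assumes "x \<in> strand_alg Z"
  shows "x \<notin> ideal_F Z \<longleftrightarrow> (\<exists>\<phi>\<in>keys x. nonF Z \<phi>)"
proof -
  have "nonF Z \<phi> \<longleftrightarrow> \<not> (\<not> viable_h Z (hgrade (dg Z \<phi>)) \<or>
     (\<exists>P\<in>pairs Z. doubly_occupied Z (hgrade (dg Z \<phi>)) P \<and> crossed_at Z P (dg Z \<phi>)))" if k: "\<phi> \<in> keys x" for \<phi>
  proof -
    note d = strand_alg_dg[OF assms k]
    have hd: "hgrade (dg Z \<phi>) = hg \<phi>" by (simp add: dg_def hgrade_hg hg_mv)
    note \<phi> = diagram_tm(1)[OF d(1,2), unfolded hd]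
    show ?thesis
    proof (cases "viable_h Z (hg \<phi>)")
      case True
      interpret V: viable_frame Z "hg \<phi>" "fst (dg Z \<phi>)" "snd (snd (dg Z \<phi>))"
        by (rule term_viable_frame[OF \<phi> True]) (use diagram_pairs[OF d(1)] in auto)
      have "(\<exists>p\<in>pair_places Z P. (p, p) \<in> \<phi>) \<longleftrightarrow> crossed_at Z P (dg Z \<phi>)"
        if "doubly_occupied Z (hg \<phi>) P" "P \<in> pairs Z" for P
        unfolding V.horizontal_pair_iff[OF \<phi> that] V.crossed_at_iff[OF \<phi> that(2)] ..
      then show ?thesis unfolding nonF_def hd using True by blast
    next
      case False then show ?thesis unfolding nonF_def hd by blast
    qed
  qed
  then show ?thesis unfolding ideal_F_iff using assms by blast
qed

text \<open>Suppose that one factor has a horizontal strand at a covered place \<open>p\<close>.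
  Both steps at \<open>p\<close> are used up, so the other factor has no moving strand starting or
  ending there. It is horizontal at \<open>p\<close> too, the product inherits the strand, and the
  pair remains doubly occupied.\<close>

lemma nonF_factors:
  assumes "\<phi> \<in> strand_diagrams Z" "\<psi> \<in> strand_diagrams Z" "Range \<phi> = Domain \<psi>" "nonF Z (\<phi> O \<psi>)"
  shows "nonF Z \<phi>" "nonF Z \<psi>"
proof -
  have sd: "\<phi> O \<psi> \<in> strand_diagrams Z" using assms(1,2) by (rule comp_strand_diagrams)
  note st = strand_diagrams_strands[OF assms(1)] strand_diagrams_strands[OF assms(2)] strand_diagrams_strands[OF sd]
  have hg: "hg (\<phi> O \<psi>) e = hg \<phi> e + hg \<psi> e" for e by (rule hg_comp[OF st assms(3)])
  have nn: "0 \<le> hg \<phi> e" "0 \<le> hg \<psi> e" for e by (simp_all add: hg_def)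
  have le: "hg \<phi> e + hg \<psi> e \<le> 1" for e
    using assms(4) hg_viable[OF sd] hg[of e] unfolding nonF_def by metis
  have le1: "hg \<phi> e \<le> 1" "hg \<psi> e \<le> 1" for e using le[of e] nn[of e] by linarith+
  note thin = hg_thin[OF st(1) le1(1)] hg_thin[OF st(2) le1(2)]
  have disj: "\<not> (stp \<phi> e \<and> stp \<psi> e)" for e
    using le[of e] unfolding thin_hg[OF thin(1)] thin_hg[OF thin(2)] by auto
  have no: "\<not> (P \<in> pairs Z \<and> doubly_occupied Z (hg (\<phi> O \<psi>)) P \<and> p \<in> pair_places Z P \<and> (p, p) \<in> \<phi> O \<psi>)" for P p
    using assms(4) unfolding nonF_def by blast
  have dbl: "doubly_occupied Z (hg (\<phi> O \<psi>)) P" if "doubly_occupied Z (hg \<phi>) P \<or> doubly_occupied Z (hg \<psi>) P" for P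
  proof -
    have "hg (\<phi> O \<psi>) e \<noteq> 0" if "hg \<phi> e \<noteq> 0 \<or> hg \<psi> e \<noteq> 0" for e using that hg[of e] nn[of e] by linarith
    with that show ?thesis unfolding doubly_occupied_def covers_place_def by blast
  qed
  show "nonF Z \<phi>"
    unfolding nonF_def
  proof (intro conjI notI)
    show "viable_h Z (hg \<phi>)" using hg_viable[OF assms(1)] le1 by blast
    assume "\<exists>P\<in>pairs Z. doubly_occupied Z (hg \<phi>) P \<and> (\<exists>p\<in>pair_places Z P. (p, p) \<in> \<phi>)"
    then obtain P p where p: "P \<in> pairs Z" "doubly_occupied Z (hg \<phi>) P" "p \<in> pair_places Z P" "(p, p) \<in> \<phi>" by blast
    then have "stp \<phi> p" unfolding doubly_occupied_def covers_place_def thin_hg[OF thin(1)] by auto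
    then have "p \<notin> Domain (mv \<psi>)" using disj start_stp[OF st(2)] by blast
    moreover have "p \<in> Domain \<psi>" using p(4) assms(3) by blast
    ultimately have "(p, p) \<in> \<psi>" unfolding mv_def by blast
    with p(4) have "(p, p) \<in> \<phi> O \<psi>" by blast
    with no p dbl show False by blast
  qed
  show "nonF Z \<psi>"
    unfolding nonF_def
  proof (intro conjI notI)
    show "viable_h Z (hg \<psi>)" using hg_viable[OF assms(2)] le1 by blast
    assume "\<exists>P\<in>pairs Z. doubly_occupied Z (hg \<psi>) P \<and> (\<exists>p\<in>pair_places Z P. (p, p) \<in> \<psi>)"
    then obtain P p where p: "P \<in> pairs Z" "doubly_occupied Z (hg \<psi>) P" "p \<in> pair_places Z P" "(p, p) \<in> \<psi>" by blast
    then have "stp \<psi> (prv p)" unfolding doubly_occupied_def covers_place_def thin_hg[OF thin(2)] by auto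
    then have "p \<notin> Range (mv \<phi>)" using disj end_stp(1)[OF st(1)] by blast
    moreover have "p \<in> Range \<phi>" using p(4) assms(3) by blast
    ultimately have "(p, p) \<in> \<phi>" unfolding mv_def by blast
    with p(4) have "(p, p) \<in> \<phi> O \<psi>" by blast
    with no p dbl show False by blast
  qed
qed

lemma graded_summandD:
  assumes "x \<in> graded_summand Z g q"
  shows "x \<in> alg_summand Z g" "\<phi> \<in> keys x \<Longrightarrow> maslov Z (dg Z \<phi>) = q" "x \<in> strand_alg Z"
  using assms unfolding graded_summand_def alg_summand_def span_iff' by auto

lemma alg_summand_tm:
  assumes "x \<in> alg_summand Z (h, s, t)" "\<phi> \<in> keys x"
  shows "\<phi> \<in> tm Z h s t" "s \<subseteq> pairs Z" "t \<subseteq> pairs Z"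
proof -
  have x: "x \<in> strand_alg Z" "hdata (dg Z \<phi>) = (h, s, t)" using assms unfolding alg_summand_def span_iff' by auto
  note d = strand_alg_dg[OF x(1) assms(2)]
  show "\<phi> \<in> tm Z h s t" using tm_hdata[OF d(1,2)] x(2) by blast
  show "s \<subseteq> pairs Z" "t \<subseteq> pairs Z" using diagram_pairs[OF d(1)] x(2) hdata_eq[of "dg Z \<phi>"] by auto
qed

lemma tm_data_eq: "\<phi> \<in> tm Z h s t \<Longrightarrow> \<phi> \<in> tm Z h' s' t' \<Longrightarrow> h = h' \<and> s = s' \<and> t = t'"
  unfolding tm_def using sections_eq by blast

lemma idem_elt: "elt Z (t, {}, t) = idem Z t"
proof (rule chain_eqI)
  have "idem Z t = (\<Sum>\<phi>\<in>Id_on ` sections Z t. basis \<phi>)"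
    unfolding idem_def by (rule sum.reindex_cong[of Id_on, symmetric]) (auto simp: inj_on_def dest: arg_cong[of _ _ Domain])
  moreover have "finite (Id_on ` sections Z t)" using sections_finite by (rule finite_imageI)
  ultimately have "keys (idem Z t) = Id_on ` sections Z t" by (simp only: keys_basis_sum)
  moreover have "keys (elt Z (t, {}, t)) = Id_on ` sections Z t"
    unfolding keys_elt by (auto simp: sections_def)
  ultimately show "keys (elt Z (t, {}, t)) = keys (idem Z t)" by simp
qed

text \<open>Nothing is covered, so \<open>occ\<close> is empty and the diagram, being uncrossed, is
  not a boundary. Products with idempotents will relate a class to the value of \<open>f\<close> on
  it.\<close>

lemma idem_tight:
  assumes "t \<subseteq> pairs Z" "S \<in> sections Z t"
  shows "tight_dgm Z (t, {}, t)"
proof -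
  have sd: "Id_on S \<in> strand_diagrams Z"
    using assms(2) unfolding strand_diagrams_def sections_def single_valued_def by (auto simp: pt_le_def)
  have "mv (Id_on S) = {}" by (auto simp: mv_def)
  then have dt: "Id_on S \<in> dterms Z (t, {}, t)" using sd assms(2) by simp
  then have dia: "diagram Z (t, {}, t)" unfolding diagram_iff using assms(1) by blast
  have hg0: "hgrade (t, {}, t) = (\<lambda>_. 0)" by (simp add: fun_eq_iff hgrade_hg hg_def)
  have via: "viable_h Z (hgrade (t, {}, t))" unfolding hg0 by (simp add: viable_h_def)
  have nc: "\<not> has_crossings Z (t, {}, t)"
  proof -
    have "crossings \<phi> = {}" if k: "\<phi> \<in> keys (elt Z (t, {}, t))" for \<phi>
    proof -
      obtain U where "\<phi> = Id_on U" using k[unfolded keys_elt] by auto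
      then show ?thesis by (auto simp: crossings_def pt_less_def)
    qed
    then show ?thesis unfolding has_crossings_def by blast
  qed
  interpret V: viable_frame Z "\<lambda>_. 0" t t using diagram_frame[OF dia via] unfolding hg0 by simp
  have T: "Id_on S \<in> V.T" using diagram_tm(1)[OF dia dt] unfolding hg0 by simp
  have dg: "dg Z (Id_on S) = (t, {}, t)" using dterms_dg[OF dt] .
  have occ: "V.occ = {}" unfolding V.occ_def covers_place_def by simp
  have "hclass Z (elt Z (t, {}, t)) \<noteq> hzero Z"
  proof
    assume z: "hclass Z (elt Z (t, {}, t)) = hzero Z"
    have s: "elt Z (t, {}, t) \<in> alg_summand Z (\<lambda>_. 0, t, t)"
      using elt_summand[OF dia] unfolding hdata_eq hg0 by simp
    from V.boundary_summand[OF s strand_alg_0] z obtain y where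
      "y \<in> alg_summand Z (\<lambda>_. 0, t, t)" "elt Z (t, {}, t) = bd y" unfolding hzero_def by auto
    from V.uncrossed_not_boundary[OF T, unfolded dg, OF nc this, of 0] occ show False by simp
  qed
  with dia via nc show ?thesis by (simp add: tight_dgm_def)
qed

end

lemma linear_order_least:
  assumes "linear_order_on A R" "finite C" "C \<noteq> {}" "C \<subseteq> A"
  shows "\<exists>!m. m \<in> C \<and> (\<forall>c\<in>C. (m, c) \<in> R)"
proof -
  have refl: "(a, a) \<in> R" if "a \<in> A" for a
    using assms(1) that by (auto simp: linear_order_on_def partial_order_on_def preorder_on_def refl_on_def)
  have trans: "(a, b) \<in> R \<Longrightarrow> (b, c) \<in> R \<Longrightarrow> (a, c) \<in> R" for a b c
    using assms(1) by (auto simp: linear_order_on_def partial_order_on_def preorder_on_def dest: transD)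
  have anti: "(a, b) \<in> R \<Longrightarrow> (b, a) \<in> R \<Longrightarrow> a = b" for a b
    using assms(1) by (auto simp: linear_order_on_def partial_order_on_def dest: antisymD)
  have total: "(a, b) \<in> R \<or> (b, a) \<in> R" if "a \<in> A" "b \<in> A" for a b
    using assms(1) that refl[of a] unfolding linear_order_on_def total_on_def by metis
  have "\<exists>m. m \<in> C \<and> (\<forall>c\<in>C. (m, c) \<in> R)"
    using assms(2-4)
  proof (induction C rule: finite_ne_induct)
    case (singleton x) then show ?case using refl by auto
  next
    case (insert x C)
    then obtain m where m: "m \<in> C" "\<forall>c\<in>C. (m, c) \<in> R" by auto
    show ?case
    proof (cases "(m, x) \<in> R")
      case True with m show ?thesis by auto
    next
      case False
      then have "(x, m) \<in> R" using total[of m x] m insert.prems by auto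
      then have "\<forall>c\<in>insert x C. (x, c) \<in> R" using m trans refl insert.prems by blast
      then show ?thesis by blast
    qed
  qed
  then show ?thesis using anti by blast
qed

section \<open>Operations arising from a pair ordering\<close>

locale ainf_frame = arc_frame Z for Z :: "'i arc" +
  fixes ord :: "'i pair_ord" and X :: "'i chain set list \<Rightarrow> 'i chain set" and f :: "'i chain set list \<Rightarrow> 'i chain"
  assumes ord: "pair_ordering Z ord" and arises: "arises_from Z ord X f"
begin

abbreviation H :: "'i chain set set" where "H \<equiv> homology Z"

lemma arises_conj:
  "(\<forall>M\<in>lists H. M \<noteq> [] \<longrightarrow> f M \<in> strand_alg Z) \<and> multiadditive Z f \<and> (\<forall>c\<in>H. X [c] = hzero Z) \<and>
  (\<forall>M\<in>lists H. M \<noteq> [] \<longrightarrow>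
        (\<Sum>(j, k) \<in> {(j, k). 1 \<le> j \<and> j + k \<le> length M}. f (insert_op X k j M)) =
        bd (f M) + (\<Sum>j = 1..<length M. mult (f (take j M)) (f (drop j M)))) \<and>
  (\<forall>x\<in>strand_alg Z. \<forall>y\<in>strand_alg Z. bd x = 0 \<longrightarrow> bd y = 0 \<longrightarrow>
        X [hclass Z x, hclass Z y] = hclass Z (mult x y)) \<and>
  (\<forall>d. standard_dgm Z ord d \<longrightarrow> f [hclass Z (elt Z d)] = elt Z d) \<and>
  (\<forall>M\<in>lists H. 2 \<le> length M \<longrightarrow> X M = hclass Z (U_op X f M))"
  using arises unfolding arises_from_def ainf_structure_def ainf_morphism_def by (elim conjE) (intro conjI)

lemmas arises_conjuncts = arises_conj[THEN conjunct1]
  arises_conj[THEN conjunct2, THEN conjunct1]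
  arises_conj[THEN conjunct2, THEN conjunct2, THEN conjunct1]
  arises_conj[THEN conjunct2, THEN conjunct2, THEN conjunct2, THEN conjunct1]
  arises_conj[THEN conjunct2, THEN conjunct2, THEN conjunct2, THEN conjunct2, THEN conjunct1]
  arises_conj[THEN conjunct2, THEN conjunct2, THEN conjunct2, THEN conjunct2, THEN conjunct2, THEN conjunct1]
  arises_conj[THEN conjunct2, THEN conjunct2, THEN conjunct2, THEN conjunct2, THEN conjunct2, THEN conjunct2]

lemma f_strand_alg: "M \<in> lists H \<Longrightarrow> M \<noteq> [] \<Longrightarrow> f M \<in> strand_alg Z"
  by (rule mp[OF bspec[OF arises_conjuncts(1)]])

lemma X_single: "c \<in> H \<Longrightarrow> X [c] = hzero Z"
  by (rule bspec[OF arises_conjuncts(3)])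

lemma X_pair: "x \<in> strand_alg Z \<Longrightarrow> y \<in> strand_alg Z \<Longrightarrow> bd x = 0 \<Longrightarrow> bd y = 0 \<Longrightarrow>
    X [hclass Z x, hclass Z y] = hclass Z (mult x y)"
  by (rule mp[OF mp[OF bspec[OF bspec[OF arises_conjuncts(5)]]]])

lemma f_standard: "standard_dgm Z ord d \<Longrightarrow> f [hclass Z (elt Z d)] = elt Z d"
  by (rule mp[OF spec[OF arises_conjuncts(6)]])

lemma X_U: "M \<in> lists H \<Longrightarrow> 2 \<le> length M \<Longrightarrow> X M = hclass Z (U_op X f M)"
  by (rule mp[OF bspec[OF arises_conjuncts(7)]])

lemma dgm_lists: "M \<in> lists (dgm_classes Z) \<Longrightarrow> M \<in> lists H"
  using dgm_classes_homology by blast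

lemma arises_dgm:
  assumes "M \<in> lists (dgm_classes Z)" "M \<noteq> []"
  shows "\<not> viable Z M \<Longrightarrow> bar Z (f M) = ideal_F Z" "\<not> viable Z M \<Longrightarrow> X M = hzero Z"
    "X M \<in> hclass Z ` {x \<in> graded_summand Z (tensor_hdata Z M)
                 (tensor_maslov Z M + of_nat (length M) - 2). bd x = 0}"
    "f M \<in> graded_summand Z (tensor_hdata Z M) (tensor_maslov Z M + of_nat (length M) - 1)"
    "2 \<le> length M \<Longrightarrow> f [X M] - U_op X f M = 0 \<Longrightarrow> f M = 0"
    "2 \<le> length M \<Longrightarrow> viable Z M \<Longrightarrow> twisted_hdata Z (tensor_hdata Z M) \<Longrightarrow>
      f M = astar Z ord (f [X M] - U_op X f M)"
proof -
  have "\<forall>M\<in>lists (dgm_classes Z). M \<noteq> [] \<longrightarrow>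
        (\<not> viable Z M \<longrightarrow> bar Z (f M) = ideal_F Z \<and> X M = hzero Z) \<and>
        (mismatch Z M \<longrightarrow> f M = 0) \<and>
        X M \<in> hclass Z ` {x \<in> graded_summand Z (tensor_hdata Z M)
                 (tensor_maslov Z M + of_nat (length M) - 2). bd x = 0} \<and>
        f M \<in> graded_summand Z (tensor_hdata Z M) (tensor_maslov Z M + of_nat (length M) - 1) \<and>
        (2 \<le> length M \<longrightarrow> f [X M] - U_op X f M = 0 \<longrightarrow> f M = 0) \<and>
        (2 \<le> length M \<longrightarrow> viable Z M \<longrightarrow> twisted_hdata Z (tensor_hdata Z M) \<longrightarrow>
           f M = astar Z ord (f [X M] - U_op X f M))"
    using arises unfolding arises_from_def by (elim conjE)
  from mp[OF bspec[OF this assms(1)] assms(2)]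
  show "\<not> viable Z M \<Longrightarrow> bar Z (f M) = ideal_F Z" "\<not> viable Z M \<Longrightarrow> X M = hzero Z"
    "X M \<in> hclass Z ` {x \<in> graded_summand Z (tensor_hdata Z M)
                 (tensor_maslov Z M + of_nat (length M) - 2). bd x = 0}"
    "f M \<in> graded_summand Z (tensor_hdata Z M) (tensor_maslov Z M + of_nat (length M) - 1)"
    "2 \<le> length M \<Longrightarrow> f [X M] - U_op X f M = 0 \<Longrightarrow> f M = 0"
    "2 \<le> length M \<Longrightarrow> viable Z M \<Longrightarrow> twisted_hdata Z (tensor_hdata Z M) \<Longrightarrow>
      f M = astar Z ord (f [X M] - U_op X f M)"
    by simp_all
qed

text \<open>The coset \<open>hzero Z\<close> is its own double, so by additivity the value equals
  twice itself, which is 0.\<close>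

lemma f_hzero:
  assumes "xs \<in> lists H" "ys \<in> lists H"
  shows "f (xs @ hzero Z # ys) = 0"
proof -
  have "f (xs @ (hzero Z + hzero Z) # ys) = f (xs @ hzero Z # ys) + f (xs @ hzero Z # ys)"
    by (rule bspec[OF bspec[OF bspec[OF bspec[OF arises_conjuncts(2)[unfolded multiadditive_def] assms(1)]
      assms(2)] hzero_homology] hzero_homology])
  then show ?thesis by (simp add: hzero_add)
qed

lemma lists_sub: "M \<in> lists A \<Longrightarrow> take k M \<in> lists A" "M \<in> lists A \<Longrightarrow> drop k M \<in> lists A"
  by (auto dest: in_set_takeD in_set_dropD)

lemma morphism:
  assumes "M \<in> lists H" "M \<noteq> []"
  shows "(\<Sum>(j, k) \<in> {(j, k). 1 \<le> j \<and> j + k \<le> length M}. f (insert_op X k j M)) =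
        bd (f M) + (\<Sum>j = 1..<length M. mult (f (take j M)) (f (drop j M)))"
  by (rule mp[OF bspec[OF arises_conjuncts(4) assms(1)] assms(2)])

text \<open>In the morphism relation the summand with \<open>j = length M\<close> is
  \<open>f [X M]\<close>, those with \<open>j = 1\<close> vanish because X is zero on single
  classes, and the others together with the products form \<open>U_op X f M\<close>.\<close>

lemma bd_f:
  assumes M: "M \<in> lists H" "2 \<le> length M"
  shows "bd (f M) = f [X M] + U_op X f M"
proof -
  let ?n = "length M"
  let ?g = "\<lambda>(j, k). f (insert_op X k j M)"
  let ?S = "{(j, k). 1 \<le> j \<and> j + k \<le> ?n}" and ?A = "(\<lambda>k. (1::nat, k)) ` {..<?n}"
    and ?B = "{(j, k). 2 \<le> j \<and> j + 1 \<le> ?n \<and> j + k \<le> ?n}"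
  have S: "?S = {(?n, 0)} \<union> (?A \<union> ?B)"
  proof
    show "?S \<subseteq> {(?n, 0)} \<union> (?A \<union> ?B)"
    proof (rule subrelI)
      fix j k assume "(j, k) \<in> ?S"
      then show "(j, k) \<in> {(?n, 0)} \<union> (?A \<union> ?B)" by (cases "j = 1"; cases "j = ?n") auto
    qed
    show "{(?n, 0)} \<union> (?A \<union> ?B) \<subseteq> ?S" using M(2) by auto
  qed
  have ne: "M \<noteq> []" using M(2) by auto
  have finB: "finite ?B" by (rule finite_subset[of _ "{..?n} \<times> {..?n}"]) auto
  have "sum ?g ({(?n, 0)} \<union> (?A \<union> ?B)) = ?g (?n, 0) + (sum ?g ?A + sum ?g ?B)"
  proof -
    have "sum ?g ({(?n, 0)} \<union> (?A \<union> ?B)) = sum ?g {(?n, 0)} + sum ?g (?A \<union> ?B)"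
      by (rule sum.union_disjoint) (use finB M(2) in auto)
    also have "sum ?g (?A \<union> ?B) = sum ?g ?A + sum ?g ?B"
      by (rule sum.union_disjoint) (use finB in auto)
    finally show ?thesis by simp
  qed
  moreover have "?g (?n, 0) = f [X M]" by (simp add: insert_op_def)
  moreover have "sum ?g ?A = 0"
  proof (rule sum.neutral, rule ballI)
    fix x assume "x \<in> ?A"
    then obtain k where k: "x = (1, k)" "k < ?n" by auto
    have "M ! k \<in> H" using M(1) k(2) by auto
    moreover have "take 1 (drop k M) = [M ! k]" using k(2) by (simp add: take_Suc_conv_app_nth)
    ultimately have "X (take 1 (drop k M)) = hzero Z" by (simp add: X_single)
    then show "?g x = 0"
      unfolding k(1) insert_op_def using f_hzero[OF lists_sub(1)[OF M(1), of k] lists_sub(2)[OF M(1), of "k + 1"]] by simp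
  qed
  ultimately have "f [X M] + sum ?g ?B = bd (f M) + (\<Sum>j = 1..<?n. mult (f (take j M)) (f (drop j M)))"
    using morphism[OF M(1) ne] unfolding S by simp
  then have "f [X M] + (sum ?g ?B + (\<Sum>j = 1..<?n. mult (f (take j M)) (f (drop j M)))) =
    bd (f M) + ((\<Sum>j = 1..<?n. mult (f (take j M)) (f (drop j M))) + (\<Sum>j = 1..<?n. mult (f (take j M)) (f (drop j M))))"
    unfolding add.assoc[symmetric] by simp
  then show ?thesis unfolding U_op_def by (simp add: add.commute)
qed

lemma bd_f_single:
  assumes "c \<in> H"
  shows "bd (f [c]) = 0"
proof -
  have S: "{(j, k). 1 \<le> j \<and> j + k \<le> length [c]} = {(1, 0)}" by auto
  have "f (insert_op X 0 1 [c]) = bd (f [c])"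
    using morphism[of "[c]"] assms unfolding S by simp
  moreover have "f (insert_op X 0 1 [c]) = 0"
    using f_hzero[of "[]" "[]"] X_single[OF assms] by (simp add: insert_op_def)
  ultimately show ?thesis by simp
qed

lemma f_not_F:
  assumes "M \<in> lists (dgm_classes Z)" "M \<noteq> []" "f M \<notin> ideal_F Z"
  shows "viable Z M" "\<exists>\<phi>\<in>keys (f M). nonF Z \<phi>"
proof -
  have fs: "f M \<in> strand_alg Z" using f_strand_alg dgm_lists assms by blast
  show "viable Z M" using arises_dgm(1)[OF assms(1,2)] bar_eq_iff[OF fs] assms(3) by blast
  show "\<exists>\<phi>\<in>keys (f M). nonF Z \<phi>" using not_ideal_F[OF fs] assms(3) by blast
qed

lemma tensor_frame:
  assumes "viable Z M" "x \<in> alg_summand Z (tensor_hdata Z M)" "x \<noteq> 0"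
  shows "viable_frame Z (tensor_h Z M) (cls_s Z (hd M)) (cls_t Z (last M))"
proof -
  obtain \<phi> where "\<phi> \<in> keys x" using assms(3) by fastforce
  with assms(2) have "\<phi> \<in> tm Z (tensor_h Z M) (cls_s Z (hd M)) (cls_t Z (last M))"
    "cls_s Z (hd M) \<subseteq> pairs Z" "cls_t Z (last M) \<subseteq> pairs Z"
    unfolding tensor_hdata_def using alg_summand_tm by blast+
  with assms(1) show ?thesis unfolding viable_def by (blast intro: term_viable_frame)
qed

text \<open>For viable H-data this is the case in which the summand is acyclic by
  \<open>homology_once_occupied\<close>, and in which \<open>astar\<close> has a pair to act
  on.\<close>

definition once_data :: "'i hdat \<Rightarrow> bool" where
  "once_data g \<longleftrightarrow> (\<exists>P\<in>fst (snd g) \<inter> snd (snd g). \<exists>p. once_occupied_at Z (fst g) P p)"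

text \<open>Homology of viable summands is represented by uncrossed diagrams. So a nonzero
  \<open>X M\<close> is again a class of a diagram and may be an entry of a further list, and its
  H-data has no once occupied pair in both idempotents.\<close>

lemma X_nonzero:
  assumes M: "M \<in> lists (dgm_classes Z)" "M \<noteq> []" and nz: "X M \<noteq> hzero Z"
  obtains x where "x \<in> graded_summand Z (tensor_hdata Z M) (tensor_maslov Z M + of_nat (length M) - 2)"
    "bd x = 0" "X M = hclass Z x" "x \<noteq> 0" "viable Z M" "X M \<in> dgm_classes Z" "\<not> once_data (tensor_hdata Z M)"
    "\<exists>\<phi>\<in>keys x. nonF Z \<phi>"
proof -
  have via: "viable Z M" using arises_dgm(2)[OF M] nz by blast
  obtain x where x: "x \<in> graded_summand Z (tensor_hdata Z M) (tensor_maslov Z M + of_nat (length M) - 2)"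
    "bd x = 0" "X M = hclass Z x" using arises_dgm(3)[OF M] by blast
  note xs = graded_summandD(1)[OF x(1)]
  have nb: "x \<notin> bd ` strand_alg Z" using nz x(3) by (simp add: hclass_zero_iff)
  then have x0: "x \<noteq> 0" using bd_group_0 by blast
  interpret V: viable_frame Z "tensor_h Z M" "cls_s Z (hd M)" "cls_t Z (last M)"
    using via xs x0 by (rule tensor_frame)
  obtain \<psi> where \<psi>: "\<psi> \<in> V.T" "hclass Z (elt Z (dg Z \<psi>)) = hclass Z x" "bd (elt Z (dg Z \<psi>)) = 0"
    "\<And>P p. P \<in> cls_s Z (hd M) \<Longrightarrow> P \<in> cls_t Z (last M) \<Longrightarrow> \<not> once_occupied_at Z (tensor_h Z M) P p"
    "\<exists>\<phi>\<in>keys x. \<forall>P\<in>V.occ. broken \<phi> \<inter> pair_places Z P \<noteq> {}"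
    using V.homology_viable[OF xs[unfolded tensor_hdata_def] x(2) nb] by metis
  have "X M \<in> dgm_classes Z"
    unfolding dgm_classes_def using tm_dg(4)[OF \<psi>(1) V.s_pairs V.t_pairs] \<psi>(2,3) x(3) nz by blast
  moreover have "\<not> once_data (tensor_hdata Z M)" unfolding once_data_def tensor_hdata_def using \<psi>(4) by auto
  moreover have "\<exists>\<phi>\<in>keys x. nonF Z \<phi>"
    using \<psi>(5) V.nonF_iff V.summandD(1)[OF xs[unfolded tensor_hdata_def]] by blast
  ultimately show thesis using that x x0 via by blast
qed

end

section \<open>Terms of least Maslov grading\<close>

context viable_frame
begin

lemma maslov_T:
  assumes "\<phi> \<in> T"
  shows "maslov Z (dg Z \<phi>) = (\<Sum>p\<in>places Z. - (of_bool (h p = 1 \<and> h (prv p) = 0) / 2)) - of_nat (card (broken \<phi>))"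
proof -
  note d = tm_dg[OF assms]
  have hd: "hgrade (dg Z \<phi>) = h" using d(3) hdata_eq[of "dg Z \<phi>"] by simp
  have "maslov Z (dg Z \<phi>) = (\<Sum>p\<in>places Z. local_maslov h p (of_bool (p \<in> broken \<phi>)))"
    using maslov_local[OF d(4)[OF s_pairs t_pairs]] h_le unfolding hd unfolding d(1) by (simp add: broken_mv)
  also have "\<dots> = (\<Sum>p\<in>places Z. - (of_bool (h p = 1 \<and> h (prv p) = 0) / 2)) - (\<Sum>p\<in>places Z. of_bool (p \<in> broken \<phi>))"
    unfolding sum_subtractf[symmetric] by (rule sum.cong) (simp_all add: local_maslov_def)
  also have "(\<Sum>p\<in>places Z. of_bool (p \<in> broken \<phi>)) = (of_nat (card (broken \<phi>)) :: rat)"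
  proof -
    have "places Z \<inter> broken \<phi> = broken \<phi>" using broken_facts(1)[OF assms] by blast
    then show ?thesis using finite_places by (simp only: sum_of_bool_eq Collect_mem_eq)
  qed
  finally show ?thesis .
qed

text \<open>Each break lies at a pair of \<open>occ\<close> and no pair is used twice, so breaking
  at every pair of \<open>occ\<close> is extremal.\<close>

lemma card_broken_max:
  assumes "\<phi> \<in> T" "\<psi> \<in> T" "\<forall>P\<in>occ. broken \<phi> \<inter> pair_places Z P \<noteq> {}"
  shows "card (broken \<psi>) \<le> card (broken \<phi>)"
proof -
  have "inj_on (matching Z) (broken \<psi>)"
  proof (rule inj_onI)
    fix p q assume p: "p \<in> broken \<psi>" and q: "q \<in> broken \<psi>" and eq: "matching Z p = matching Z q"
    show "p = q"
      by (rule broken_pair_unique[OF assms(2) p _ broken_facts(7)[OF assms(2) p]])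
        (use broken_facts(3,7)[OF assms(2) q] eq in auto)
  qed
  then have "card (broken \<psi>) = card (matching Z ` broken \<psi>)" by (simp add: card_image)
  also have "\<dots> \<le> card (matching Z ` broken \<phi>)"
  proof (rule card_mono)
    show "finite (matching Z ` broken \<phi>)" using finite_broken[OF assms(1)] by simp
    show "matching Z ` broken \<psi> \<subseteq> matching Z ` broken \<phi>"
    proof (rule image_subsetI)
    fix p assume "p \<in> broken \<psi>"
    then have "broken \<phi> \<inter> pair_places Z (matching Z p) \<noteq> {}" using assms(3) broken_facts(5)[OF assms(2)] by blast
    then obtain q where q: "q \<in> broken \<phi>" "q \<in> pair_places Z (matching Z p)" by blast
    then have "matching Z p = matching Z q" by (simp add: pair_places_def)
    with q(1) show "matching Z p \<in> matching Z ` broken \<phi>" by simp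
    qed
  qed
  also have "\<dots> \<le> card (broken \<phi>)" using finite_broken[OF assms(1)] by (rule card_image_le)
  finally show ?thesis .
qed

text \<open>At an unbroken pair of \<open>occ\<close> that is not doubly occupied, the dotted strand
  forces the pair to be once occupied.\<close>

lemma nonF_unbroken:
  assumes "\<phi> \<in> T" "nonF Z \<phi>" "\<And>P p. P \<in> s \<Longrightarrow> P \<in> t \<Longrightarrow> \<not> once_occupied_at Z h P p"
  shows "\<forall>P\<in>occ. broken \<phi> \<inter> pair_places Z P \<noteq> {}"
proof (intro ballI notI)
  fix P assume P: "P \<in> occ" "broken \<phi> \<inter> pair_places Z P = {}"
  then have "\<not> doubly_occupied Z h P" using assms(2) unfolding nonF_iff[OF assms(1)] by blast
  then obtain p where "once_occupied_at Z h P p" using unbroken_once_occupied[OF assms(1) P] by blast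
  with assms(3) P(1) show False by (auto simp: occ_def)
qed

end

context ainf_frame
begin

text \<open>
  Among the diagrams with given H-data the uncrossed ones have the smallest Maslov grading, so without a
  once occupied pair of both idempotents the values of f are cycles outside F.
\<close>

lemma f_once:
  assumes M: "M \<in> lists (dgm_classes Z)" "2 \<le> length M" and nF: "f M \<notin> ideal_F Z"
  shows "once_data (tensor_hdata Z M)"
proof (rule ccontr)
  assume no: "\<not> once_data (tensor_hdata Z M)"
  have ne: "M \<noteq> []" using M(2) by auto
  note fF = f_not_F[OF M(1) ne nF]
  obtain \<phi> where \<phi>: "\<phi> \<in> keys (f M)" "nonF Z \<phi>" using fF(2) by blast
  have f0: "f M \<noteq> 0" using \<phi>(1) by auto
  note fg = graded_summandD[OF arises_dgm(4)[OF M(1) ne]]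
  interpret V: viable_frame Z "tensor_h Z M" "cls_s Z (hd M)" "cls_t Z (last M)"
    using fF(1) fg(1) f0 by (rule tensor_frame)
  have fs: "f M \<in> alg_summand Z (tensor_h Z M, cls_s Z (hd M), cls_t Z (last M))"
    using fg(1) unfolding tensor_hdata_def .
  have T: "\<psi> \<in> V.T" if "\<psi> \<in> keys (f M)" for \<psi> using V.summandD(1)[OF fs] that by blast
  have once: "\<not> once_occupied_at Z (tensor_h Z M) P p" if "P \<in> cls_s Z (hd M)" "P \<in> cls_t Z (last M)" for P p
    using no that unfolding once_data_def tensor_hdata_def by auto
  have max: "card (broken \<psi>) \<le> card (broken \<phi>)" if "\<psi> \<in> V.T" for \<psi>
    by (rule V.card_broken_max[OF T[OF \<phi>(1)] that V.nonF_unbroken[OF T[OF \<phi>(1)] \<phi>(2) once]])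
  have eq: "card (broken \<psi>) = card (broken \<phi>)" if "\<psi> \<in> keys (f M)" for \<psi>
    using fg(2)[OF that] fg(2)[OF \<phi>(1)] V.maslov_T[OF T[OF that]] V.maslov_T[OF T[OF \<phi>(1)]] by simp
  have "keys (bd (f M)) = {}"
  proof (rule ccontr)
    assume "keys (bd (f M)) \<noteq> {}"
    then obtain \<psi> where \<psi>: "\<psi> \<in> keys (bd (f M))" by blast
    have \<psi>T: "\<psi> \<in> V.T" using V.keys_bd[OF V.summandD(1)[OF fs]] \<psi> by blast
    have "lookup (bd (f M)) \<psi> \<noteq> 0" using \<psi> by (simp add: lookup_bit)
    then have "\<exists>p\<in>broken \<psi>. lookup (f M) (unbrk p \<psi>) \<noteq> 0"
      unfolding V.lookup_bd[OF V.summandD(1)[OF fs] \<psi>T] by (meson sum.neutral)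
    then obtain p where p: "p \<in> broken \<psi>" "unbrk p \<psi> \<in> keys (f M)" by (auto simp: lookup_bit split: if_splits)
    have "card (broken \<psi> - {p}) = card (broken \<phi>)"
      using eq[OF p(2)] unbrk_strands(5)[OF V.T_facts(1,2)[OF \<psi>T] p(1)] by simp
    moreover have "card (broken \<psi> - {p}) < card (broken \<psi>)"
      using V.finite_broken[OF \<psi>T] p(1) by (meson card_Diff1_less)
    ultimately show False using max[OF \<psi>T] by simp
  qed
  then have "bd (f M) = 0" by (intro chain_eqI) simp
  \<comment> \<open>By the morphism relation this difference is the boundary of \<open>f M\<close>;
    where it vanishes, \<open>f M\<close> is required to vanish too.\<close>
  then have "f [X M] - U_op X f M = 0" using bd_f[OF dgm_lists[OF M(1)] M(2)] by simp
  then have "f M = 0" by (rule arises_dgm(5)[OF M(1) ne M(2)])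
  with f0 show False by contradiction
qed

lemma astar_pair:
  assumes "s \<subseteq> pairs Z" "once_data (h, s, t)"
  shows "astar_pair Z ord (h, s, t) \<in> s \<inter> t" "\<exists>p. once_occupied_at Z h (astar_pair Z ord (h, s, t)) p"
proof -
  let ?C = "{P \<in> s \<inter> t. \<exists>p. once_occupied_at Z h P p}"
  have R: "linear_order_on (pairs Z) (fst ord)" using ord by (cases ord) simp
  have fin: "finite ?C" by (rule finite_subset[of _ "pairs Z"]) (use assms(1) in \<open>auto simp: pairs_def\<close>)
  have ne: "?C \<noteq> {}" using assms(2) unfolding once_data_def by auto
  have "\<exists>!P. P \<in> ?C \<and> (\<forall>P'\<in>?C. (P, P') \<in> fst ord)"
    by (rule linear_order_least[OF R fin ne]) (use assms(1) in auto)
  from theI'[OF this] have "astar_pair Z ord (h, s, t) \<in> ?C" unfolding astar_pair_def Let_def by simp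
  then show "astar_pair Z ord (h, s, t) \<in> s \<inter> t" "\<exists>p. once_occupied_at Z h (astar_pair Z ord (h, s, t)) p" by auto
qed

lemma once_occupied_unique: "once_occupied_at Z h P p \<Longrightarrow> once_occupied_at Z h P q \<Longrightarrow> p = q"
  unfolding once_occupied_at_def covers_place_def avoids_place_def by blast

text \<open>Here \<open>f M\<close> is \<open>astar\<close> of its own boundary, so each of its
  terms comes from a term of the boundary by joining at the break of the selected pair, which leaves
  a dotted strand there. The old term is outside F if the new one is: a strand starting in the new
  term starts in the old one as well, so a break of the new term leaves no horizontal strand at its
  pair in the old one.\<close>

lemma f_astar:
  assumes M: "M \<in> lists (dgm_classes Z)" "2 \<le> length M" and nF: "f M \<notin> ideal_F Z"
    and \<chi>: "\<chi> \<in> keys (f M)"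
  shows "\<exists>r\<in>pair_places Z (astar_pair Z ord (tensor_hdata Z M)). (r, r) \<in> \<chi>"
    "nonF Z \<chi> \<Longrightarrow> \<exists>\<phi>\<in>keys (bd (f M)). nonF Z \<phi> \<and>
      (\<forall>r\<in>pair_places Z (astar_pair Z ord (tensor_hdata Z M)). (r, r) \<notin> \<phi>)"
proof -
  let ?g = "tensor_hdata Z M"
  let ?P = "astar_pair Z ord ?g"
  have ne: "M \<noteq> []" using M(2) by auto
  note fF = f_not_F[OF M(1) ne nF]
  have f0: "f M \<noteq> 0" using \<chi> by auto
  note fg = graded_summandD[OF arises_dgm(4)[OF M(1) ne]]
  let ?h = "tensor_h Z M" and ?s = "cls_s Z (hd M)" and ?t = "cls_t Z (last M)"
  interpret V: viable_frame Z ?h ?s ?t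
    using fF(1) fg(1) f0 by (rule tensor_frame)
  have g: "?g = (?h, ?s, ?t)" by (simp add: tensor_hdata_def)
  have fs: "f M \<in> alg_summand Z (?h, ?s, ?t)" using fg(1) unfolding g .
  have \<chi>T: "\<chi> \<in> V.T" using V.summandD(1)[OF fs] \<chi> by blast
  have once: "once_data (?h, ?s, ?t)" using f_once[OF M nF] unfolding g .
  note ap = astar_pair[OF V.s_pairs once, folded g]
  obtain p where p: "once_occupied_at Z ?h ?P p" using ap(2) by blast
  have Ps: "?P \<in> ?s" "?P \<in> ?t" using ap(1) by auto
  note oo = V.once_occupied_occ[OF Ps p]
  \<comment> \<open>The description of \<open>f M\<close> by \<open>astar\<close> requires twisted
    H-data.\<close>
  have tw: "twisted_hdata Z ?g" unfolding g by (rule V.twisted_hdataI[OF \<chi>T Ps p])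
  let ?x = "bd (f M)"
  have xs: "?x \<in> alg_summand Z (?h, ?s, ?t)" using V.bd_summand[OF fs] .
  then have xa: "?x \<in> strand_alg Z" unfolding alg_summand_def span_iff' by blast
  have "f [X M] - U_op X f M = ?x" using bd_f[OF dgm_lists[OF M(1)] M(2)] by simp
  then have fM: "f M = astar Z ord ?x" using arises_dgm(6)[OF M(1) ne M(2) fF(1) tw] by simp
  have "astar Z ord ?x = (\<Sum>d\<in>dg Z ` keys ?x. astar_dgm Z ord d)"
    unfolding astar_def dgm_support_eq[OF xa] ..
  with fM have "f M = (\<Sum>d\<in>dg Z ` keys ?x. astar_dgm Z ord d)" by (rule trans)
  from arg_cong[OF this, of keys] \<chi> have "\<chi> \<in> keys (\<Sum>d\<in>dg Z ` keys ?x. astar_dgm Z ord d)" by blast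
  from keys_sumD[OF this] obtain \<phi> where \<phi>: "\<phi> \<in> keys ?x" "\<chi> \<in> keys (astar_dgm Z ord (dg Z \<phi>))" by blast
  have \<phi>T: "\<phi> \<in> V.T" using V.summandD(1)[OF xs] \<phi>(1) by blast
  note d = tm_dg[OF \<phi>T]
  have the: "(THE q. once_occupied_at Z ?h ?P q) = p"
    by (rule the_equality) (fact p, rule once_occupied_unique[OF _ p])
  have hd: "hgrade (?s, mv \<phi>, ?t) = ?h" "hdata (?s, mv \<phi>, ?t) = ?g"
    using d(3) unfolding d(1) g hdata_eq by simp_all
  have k: "\<not> crossed_at Z ?P (dg Z \<phi>)" "\<chi> \<in> keys (elt Z (?s, join_at p (mv \<phi>), ?t))"
  proof -
    have "astar_dgm Z ord (dg Z \<phi>) = (if crossed_at Z ?P (dg Z \<phi>) then 0 else elt Z (?s, join_at p (mv \<phi>), ?t))"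
      unfolding d(1) astar_dgm.simps Let_def hd the ..
    with \<phi>(2) show "\<not> crossed_at Z ?P (dg Z \<phi>)" "\<chi> \<in> keys (elt Z (?s, join_at p (mv \<phi>), ?t))"
      by (auto split: if_splits simp del: elt.simps)
  qed
  have Pp: "?P \<in> pairs Z" using Ps V.s_pairs by blast
  have "broken \<phi> \<inter> pair_places Z ?P \<noteq> {}" using k(1) oo(1) unfolding V.crossed_at_iff[OF \<phi>T Pp] by blast
  then obtain q where q: "q \<in> broken \<phi>" "q \<in> pair_places Z ?P" by blast
  \<comment> \<open>A once occupied pair can break at its covered place only, and this is where
    \<open>astar\<close> joins.\<close>
  have "q = p" using oo(4)[OF q(2) V.broken_facts(2)[OF \<phi>T q(1)]] .
  then have pb: "p \<in> broken \<phi>" using q(1) by simp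
  note pf = V.broken_facts[OF \<phi>T pb]
  from k(2) obtain U where U: "\<chi> = join_at p (mv \<phi>) \<union> Id_on U"
    "U \<subseteq> points Z - (Domain (join_at p (mv \<phi>)) \<union> Range (join_at p (mv \<phi>)))"
    "Domain (join_at p (mv \<phi>)) \<union> U \<in> sections Z ?s" unfolding keys_elt by blast
  have jd: "x \<in> Domain (mv \<phi>)" "x \<noteq> p" if x: "x \<in> Domain (join_at p (mv \<phi>))" for x
  proof -
    obtain y where "(x, y) \<in> join_at p (mv \<phi>)" using x by blast
    then have "(x, y) \<in> mv \<phi> \<and> x \<noteq> p \<or> (x, p) \<in> mv \<phi>" unfolding join_at_def by blast
    moreover have "(p, p) \<notin> mv \<phi>" by (simp add: mv_def)
    ultimately show "x \<in> Domain (mv \<phi>)" "x \<noteq> p" by auto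
  qed
  note f = V.T_facts[OF \<phi>T]
  have uq: "r = p" if "r \<in> Domain \<phi>" "r \<in> pair_places Z ?P" for r
    using sections_unique[OF f(6) that(1) pf(3) that(2) oo(2)] .
  show "\<exists>r\<in>pair_places Z ?P. (r, r) \<in> \<chi>"
  proof -
    obtain r where r: "r \<in> Domain (join_at p (mv \<phi>)) \<union> U" "r \<in> pair_places Z ?P"
      using U(3) Ps(1) by (rule sections_ex)
    have "r \<notin> Domain (join_at p (mv \<phi>))"
    proof
      assume j: "r \<in> Domain (join_at p (mv \<phi>))"
      then have "r \<in> Domain \<phi>" using jd(1)[OF j] V.mv_Domain_subset(1)[of \<phi>] by blast
      then have "r = p" using uq r(2) by blast
      with jd(2)[OF j] show False by contradiction
    qed
    with r show ?thesis unfolding U(1) by blast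
  qed
  assume nF\<chi>: "nonF Z \<chi>"
  have "nonF Z \<phi>"
    unfolding V.nonF_iff[OF \<phi>T]
  proof (intro ballI impI notI)
    fix P' assume P': "P' \<in> V.occ" "doubly_occupied Z ?h P'" and b: "broken \<phi> \<inter> pair_places Z P' = {}"
    have "P' \<in> pairs Z" using P'(1) V.s_pairs by (auto simp: V.occ_def)
    then obtain r where r: "r \<in> pair_places Z P'" "(r, r) \<in> \<phi>"
      using V.horizontal_pair_iff[OF \<phi>T P'(2)] P'(1) b by blast
    have "broken \<chi> \<inter> pair_places Z P' \<noteq> {}" using nF\<chi> P' unfolding V.nonF_iff[OF \<chi>T] by blast
    then obtain w where w: "w \<in> broken \<chi>" "w \<in> pair_places Z P'" by blast
    then have "w \<in> Domain (mv \<chi>)" by (simp add: broken_iff)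
    then have "w \<in> Domain (join_at p (mv \<phi>))" unfolding U(1) mv_def by blast
    then have wm: "w \<in> Domain (mv \<phi>)" by (rule jd)
    then have "w \<in> Domain \<phi>" using V.mv_Domain_subset(1)[of \<phi>] by blast
    then have "w = r" using sections_unique[OF f(6) _ _ w(2) r(1)] r(2) by blast
    with wm horizontal_free(1)[OF f(2) r(2)] show False by simp
  qed
  moreover have "(r, r) \<notin> \<phi>" if "r \<in> pair_places Z ?P" for r
  proof
    assume "(r, r) \<in> \<phi>"
    moreover from this have "r = p" using uq that by blast
    ultimately show False using pf(6) by simp
  qed
  ultimately show "\<exists>\<phi>\<in>keys ?x. nonF Z \<phi> \<and> (\<forall>r\<in>pair_places Z ?P. (r, r) \<notin> \<phi>)" using \<phi>(1) by blast
qed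

text \<open>A proper sublist is replaced by one class, so the new list still has at least two
  entries, and that class is nonzero, hence a class of a diagram. Thus \<open>f_once\<close> and
  \<open>f_astar\<close> apply to the new list, whose H-data can be read off from the term.\<close>

lemma insert_op_term:
  assumes M: "M \<in> lists (dgm_classes Z)" and jk: "2 \<le> j" "j + 1 \<le> length M" "j + k \<le> length M"
    and \<phi>: "\<phi> \<in> keys (f (insert_op X k j M))" "nonF Z \<phi>" "\<phi> \<in> tm Z h s t"
  shows "once_data (h, s, t)" "\<exists>r\<in>pair_places Z (astar_pair Z ord (h, s, t)). (r, r) \<in> \<phi>"
proof -
  let ?S = "take j (drop k M)"
  let ?N = "insert_op X k j M"
  have S: "?S \<in> lists (dgm_classes Z)" "?S \<noteq> []"
    using lists_sub(1)[OF lists_sub(2)[OF M]] jk by auto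
  note HM = lists_sub(1)[OF dgm_lists[OF M], of k] lists_sub(2)[OF dgm_lists[OF M], of "k + j"]
  have "X ?S \<noteq> hzero Z"
  proof
    assume "X ?S = hzero Z"
    then have "f ?N = 0" unfolding insert_op_def using f_hzero[OF HM] by simp
    with \<phi>(1) show False by simp
  qed
  then have "X ?S \<in> dgm_classes Z" using X_nonzero[OF S] by blast
  then have N: "?N \<in> lists (dgm_classes Z)" "?N \<noteq> []" "2 \<le> length ?N"
    unfolding insert_op_def using lists_sub(1)[OF M, of k] lists_sub(2)[OF M, of "k + j"] jk by auto
  have nF: "f ?N \<notin> ideal_F Z"
    using not_ideal_F[OF f_strand_alg[OF dgm_lists[OF N(1)] N(2)]] \<phi>(1,2) by blast
  have "\<phi> \<in> tm Z (tensor_h Z ?N) (cls_s Z (hd ?N)) (cls_t Z (last ?N))"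
    using alg_summand_tm(1)[OF graded_summandD(1)[OF arises_dgm(4)[OF N(1,2)], unfolded tensor_hdata_def] \<phi>(1)] .
  then have g: "tensor_hdata Z ?N = (h, s, t)" using tm_data_eq[OF \<phi>(3)] unfolding tensor_hdata_def by simp
  show "once_data (h, s, t)" using f_once[OF N(1,3) nF] unfolding g .
  show "\<exists>r\<in>pair_places Z (astar_pair Z ord (h, s, t)). (r, r) \<in> \<phi>"
    using f_astar(1)[OF N(1,3) nF \<phi>(1)] unfolding g .
qed

lemma product_term:
  assumes M: "M \<in> lists (dgm_classes Z)" and j: "1 \<le> j" "j < length M"
    and \<phi>: "\<phi> \<in> keys (mult (f (take j M)) (f (drop j M)))" "nonF Z \<phi>"
  shows "f (take j M) \<notin> ideal_F Z" "f (drop j M) \<notin> ideal_F Z"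
proof -
  note L = lists_sub(1)[OF M, of j] lists_sub(2)[OF M, of j]
  have ne: "take j M \<noteq> []" "drop j M \<noteq> []" using j by auto
  note fs = f_strand_alg[OF dgm_lists[OF L(1)] ne(1)] f_strand_alg[OF dgm_lists[OF L(2)] ne(2)]
  obtain \<alpha> \<beta> where ab: "\<alpha> \<in> keys (f (take j M))" "\<beta> \<in> keys (f (drop j M))" "Range \<alpha> = Domain \<beta>" "\<phi> = \<alpha> O \<beta>"
    using \<phi>(1) by (rule keys_multD)
  have sd: "\<alpha> \<in> strand_diagrams Z" "\<beta> \<in> strand_diagrams Z"
    using strand_alg_dg(2)[OF fs(1) ab(1)] strand_alg_dg(2)[OF fs(2) ab(2)] by (auto simp: dg_def)
  from nonF_factors[OF sd ab(3)] \<phi>(2) ab(4) have "nonF Z \<alpha>" "nonF Z \<beta>" by auto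
  with ab(1,2) show "f (take j M) \<notin> ideal_F Z" "f (drop j M) \<notin> ideal_F Z"
    using not_ideal_F[OF fs(1)] not_ideal_F[OF fs(2)] by blast+
qed

text \<open>
  A term of U applying f to a list with an inner X is a value of A* and so crossed at the pair chosen
  by A*, which A* annihilates; without such a pair it lies in F.  Hence only products matter.
\<close>

lemma split:
  assumes M: "M \<in> lists (dgm_classes Z)" "2 \<le> length M" and nz: "f M \<notin> ideal_F Z \<or> X M \<noteq> hzero Z"
  obtains j where "1 \<le> j" "j < length M" "f (take j M) \<notin> ideal_F Z" "f (drop j M) \<notin> ideal_F Z"
proof -
  have ne: "M \<noteq> []" using M(2) by auto
  let ?g = "tensor_hdata Z M"
  \<comment> \<open>A term outside F that no inner application of X can have produced: such a term
    would have a dotted strand at the pair selected for the H-data of \<open>M\<close>.\<close>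
  have "\<exists>\<phi>\<in>keys (U_op X f M). nonF Z \<phi> \<and> \<phi> \<in> tm Z (tensor_h Z M) (cls_s Z (hd M)) (cls_t Z (last M)) \<and>
    \<not> (once_data ?g \<and> (\<exists>r\<in>pair_places Z (astar_pair Z ord ?g). (r, r) \<in> \<phi>))"
  proof (cases "X M = hzero Z")
    case True
    then have nF: "f M \<notin> ideal_F Z" using nz by blast
    note fF = f_not_F[OF M(1) ne nF]
    obtain \<chi> where \<chi>: "\<chi> \<in> keys (f M)" "nonF Z \<chi>" using fF(2) by blast
    obtain \<phi> where \<phi>: "\<phi> \<in> keys (bd (f M))" "nonF Z \<phi>"
      "\<forall>r\<in>pair_places Z (astar_pair Z ord ?g). (r, r) \<notin> \<phi>"
      using f_astar(2)[OF M nF \<chi>] by blast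
    note fg = graded_summandD[OF arises_dgm(4)[OF M(1) ne]]
    have f0: "f M \<noteq> 0" using \<chi> by auto
    interpret V: viable_frame Z "tensor_h Z M" "cls_s Z (hd M)" "cls_t Z (last M)"
      using fF(1) fg(1) f0 by (rule tensor_frame)
    have "\<phi> \<in> V.T" using V.keys_bd[OF V.summandD(1)[OF fg(1)[unfolded tensor_hdata_def]]] \<phi>(1) by blast
    moreover have "bd (f M) = U_op X f M"
      using bd_f[OF dgm_lists[OF M(1)] M(2)] f_hzero[of "[]" "[]"] True by simp
    ultimately show ?thesis using \<phi> by auto
  next
    case False
    obtain x where x: "x \<in> graded_summand Z ?g (tensor_maslov Z M + of_nat (length M) - 2)"
      "bd x = 0" "X M = hclass Z x" "x \<noteq> 0" "viable Z M" "\<not> once_data ?g"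
      using X_nonzero[OF M(1) ne False] by metis
    note xs = graded_summandD(1)[OF x(1)]
    interpret V: viable_frame Z "tensor_h Z M" "cls_s Z (hd M)" "cls_t Z (last M)"
      using x(5) xs x(4) by (rule tensor_frame)
    note xs' = xs[unfolded tensor_hdata_def]
    have "hclass Z x = hclass Z (U_op X f M)" using X_U[OF dgm_lists[OF M(1)] M(2)] x(3) by simp
    then obtain y where y: "y \<in> strand_alg Z" "x + U_op X f M = bd y" unfolding hclass_eq_iff by blast
    note r = V.restr_T[OF y(1)]
    \<comment> \<open>Only the part of \<open>U_op X f M\<close> with the H-data of \<open>M\<close>
      is compared with \<open>x\<close>. It is homologous to \<open>x\<close>, hence not a boundary,
      and so has a term that breaks at all pairs of \<open>occ\<close>.\<close>
    let ?u = "restr V.T (U_op X f M)"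
    have "x + ?u = bd (restr V.T y)"
      using r(2) y(2) restr_id[OF V.summandD(1)[OF xs']] by (metis restr_add)
    then have u: "?u = x + bd (restr V.T y)" by (metis chain_add_self_left)
    have us: "?u \<in> alg_summand Z (tensor_h Z M, cls_s Z (hd M), cls_t Z (last M))"
      unfolding u using xs' V.bd_summand[OF r(1)] strand_alg_add
      unfolding alg_summand_def span_iff' by (auto simp: keys_chain_add)
    have bu: "bd ?u = 0" unfolding u by (simp add: bd_add x(2) V.bd_bd[OF r(1)])
    have nu: "?u \<notin> bd ` strand_alg Z"
    proof
      assume "?u \<in> bd ` strand_alg Z"
      moreover have "bd (restr V.T y) \<in> bd ` strand_alg Z"
        using r(1) unfolding alg_summand_def span_iff' by blast
      ultimately have "?u + bd (restr V.T y) \<in> bd ` strand_alg Z" by (rule bd_group)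
      moreover have "?u + bd (restr V.T y) = x" unfolding u by (simp add: add.assoc)
      ultimately show False using False x(3) by (simp add: hclass_zero_iff)
    qed
    obtain \<phi> where \<phi>: "\<phi> \<in> keys ?u" "\<forall>P\<in>V.occ. broken \<phi> \<inter> pair_places Z P \<noteq> {}"
      using V.homology_viable[OF us bu nu] by metis
    then have "\<phi> \<in> V.T" "\<phi> \<in> keys (U_op X f M)" by auto
    moreover from this have "nonF Z \<phi>" using V.nonF_iff \<phi>(2) by blast
    ultimately show ?thesis using x(6) by blast
  qed
  then obtain \<phi> where \<phi>: "\<phi> \<in> keys (U_op X f M)" "nonF Z \<phi>"
    "\<phi> \<in> tm Z (tensor_h Z M) (cls_s Z (hd M)) (cls_t Z (last M))"
    "\<not> (once_data ?g \<and> (\<exists>r\<in>pair_places Z (astar_pair Z ord ?g). (r, r) \<in> \<phi>))" by blast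
  have "\<phi> \<notin> keys (\<Sum>(j, k) \<in> {(j, k). 2 \<le> j \<and> j + 1 \<le> length M \<and> j + k \<le> length M}. f (insert_op X k j M))"
  proof
    assume "\<phi> \<in> keys (\<Sum>(j, k) \<in> {(j, k). 2 \<le> j \<and> j + 1 \<le> length M \<and> j + k \<le> length M}. f (insert_op X k j M))"
    from keys_sumD[OF this] obtain y where y: "y \<in> {(j, k). 2 \<le> j \<and> j + 1 \<le> length M \<and> j + k \<le> length M}"
      "\<phi> \<in> keys (case y of (j, k) \<Rightarrow> f (insert_op X k j M))" by blast
    obtain j k where "y = (j, k)" by fastforce
    with y have jk: "2 \<le> j" "j + 1 \<le> length M" "j + k \<le> length M" "\<phi> \<in> keys (f (insert_op X k j M))"
      by simp_all
    from insert_op_term[OF M(1) jk \<phi>(2,3)] \<phi>(4) show False unfolding tensor_hdata_def by blast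
  qed
  then have "\<phi> \<in> keys (\<Sum>j = 1..<length M. mult (f (take j M)) (f (drop j M)))"
    using \<phi>(1) unfolding U_op_def keys_chain_add by blast
  then obtain j where j: "j \<in> {1..<length M}" "\<phi> \<in> keys (mult (f (take j M)) (f (drop j M)))"
    by (blast dest: keys_sumD)
  then have "1 \<le> j" "j < length M" by auto
  with product_term[OF M(1) this j(2) \<phi>(2)] that show thesis by blast
qed

text \<open>Multiplying by an idempotent identifies c with the class of f [c], a cycle of viable H-data.\<close>

lemma leaf_tight:
  assumes c: "c \<in> dgm_classes Z" and nF: "f [c] \<notin> ideal_F Z"
  shows "tight_dgm Z (tight_rep Z c)"
proof -
  obtain d where d: "c = hclass Z (elt Z d)" "diagram Z d" "bd (elt Z d) = 0" "c \<noteq> hzero Z"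
    using c unfolding dgm_classes_def by blast
  let ?t = "snd (snd d)"
  obtain \<phi>0 where \<phi>0: "\<phi>0 \<in> tm Z (hgrade d) (fst d) ?t" using d(2) by (rule diagram_dg)
  have tp: "?t \<subseteq> pairs Z" using diagram_pairs[OF d(2)] by blast
  have tt: "tight_dgm Z (?t, {}, ?t)" using idem_tight[OF tp] \<phi>0 by (auto simp: tm_def)
  have std: "standard_dgm Z ord (?t, {}, ?t)"
  proof -
    have "\<not> doubly_occupied Z (hgrade (?t, {}, ?t)) P" if "P \<in> ?t" for P
    proof -
      have "pair_places Z P \<noteq> {}" using card_pair_places[of P] tp that by force
      then show ?thesis by (auto simp: doubly_occupied_def covers_place_def hgrade_hg hg_def)
    qed
    with tt show ?thesis by (simp del: elt.simps)
  qed
  let ?e = "hclass Z (idem Z ?t)"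
  have fe: "f [?e] = idem Z ?t" using f_standard[OF std] unfolding idem_elt .
  have dt: "diagram Z (?t, {}, ?t)" "bd (idem Z ?t) = 0"
    using tt uncrossed_cycle[of "(?t, {}, ?t)"] unfolding idem_elt tight_dgm_def by auto
  have ea: "idem Z ?t \<in> strand_alg Z" using elt_strand_alg[OF dt(1)] unfolding idem_elt .
  have cH: "c \<in> H" "?e \<in> H" using c dgm_classes_homology ea dt(2) unfolding homology_def by auto
  have Mr: "mult x (idem Z ?t) = restr {\<phi>. Range \<phi> \<in> sections Z ?t} x" for x
  proof -
    have x: "x = (\<Sum>\<phi>\<in>keys x. basis \<phi>)" by (rule chain_eqI) (simp add: keys_basis_sum)
    have "mult x (idem Z ?t) = (\<Sum>\<phi>\<in>{\<phi>\<in>keys x. Range \<phi> \<in> sections Z ?t}. basis \<phi>)"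
      by (subst x, rule mult_idem_right) simp
    then show ?thesis by (intro chain_eqI) (auto simp: keys_basis_sum)
  qed
  have "mult (elt Z d) (idem Z ?t) = elt Z d"
    unfolding Mr by (rule restr_id) (use keys_elt_diagram[OF d(2)] diagram_tm(1)[OF d(2)] in \<open>auto simp: tm_def\<close>)
  then have "X [c, ?e] = c"
    using X_pair[OF elt_strand_alg[OF d(2)] ea d(3) dt(2)] unfolding d(1) by simp
  moreover have "X [c, ?e] = hclass Z (U_op X f [c, ?e])" using X_U[of "[c, ?e]"] cH by simp
  moreover have "U_op X f [c, ?e] = mult (f [c]) (idem Z ?t)"
  proof -
    have none: "{(j::nat, k::nat). 2 \<le> j \<and> j + 1 \<le> length [c, ?e] \<and> j + k \<le> length [c, ?e]} = {}" by auto
    have one: "{1..<length [c, ?e]} = {1}" by auto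
    show ?thesis unfolding U_op_def none one sum.empty by (simp add: fe)
  qed
  ultimately have cf: "c = hclass Z (mult (f [c]) (idem Z ?t))" by simp
  have L: "[c] \<in> lists (dgm_classes Z)" using c by simp
  note fF = f_not_F[OF L _ nF, simplified]
  note fg = graded_summandD[OF arises_dgm(4)[OF L], simplified]
  have f0: "f [c] \<noteq> 0" using fF(2) by auto
  interpret V: viable_frame Z "tensor_h Z [c]" "cls_s Z c" "cls_t Z c"
    using tensor_frame[OF fF(1) fg(1) f0] by simp
  have fs: "f [c] \<in> alg_summand Z (tensor_h Z [c], cls_s Z c, cls_t Z c)"
    using fg(1) unfolding tensor_hdata_def by simp
  \<comment> \<open>\<open>cls_t\<close> reads off a chosen representative before it is known to be
    tight. If it differed from the right idempotent of \<open>d\<close>, the product with the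
    idempotent and hence \<open>c\<close> would be zero.\<close>
  have "cls_t Z c = ?t"
  proof (rule ccontr)
    assume ne: "cls_t Z c \<noteq> ?t"
    have "Range \<phi> \<notin> sections Z ?t" if "\<phi> \<in> keys (f [c])" for \<phi>
      using V.T_facts(7)[of \<phi>] V.summandD(1)[OF fs] that ne sections_eq by blast
    then have "mult (f [c]) (idem Z ?t) = 0" unfolding Mr by (intro restr_disjoint) auto
    then show False using cf d(4) by (simp add: hzero_def)
  qed
  then have "mult (f [c]) (idem Z ?t) = f [c]"
    unfolding Mr using V.T_facts(7) V.summandD(1)[OF fs] by (intro restr_id) auto
  then have cf': "c = hclass Z (f [c])" using cf by simp
  have "f [c] \<notin> bd ` strand_alg Z" using cf' d(4) hclass_zero_iff by metis
  from V.homology_viable[OF fs bd_f_single[OF cH(1)] this]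
  obtain \<psi> where \<psi>: "\<psi> \<in> V.T" "\<not> has_crossings Z (dg Z \<psi>)" "hclass Z (elt Z (dg Z \<psi>)) = c"
    using cf' by metis
  have "tight_dgm Z (dg Z \<psi>)"
    unfolding tight_dgm_def
  proof (intro conjI)
    show "diagram Z (dg Z \<psi>)" by (rule tm_dg(4)[OF \<psi>(1) V.s_pairs V.t_pairs])
    show "viable_h Z (hgrade (dg Z \<psi>))"
      using V.T_viable[OF \<psi>(1)] V.T_facts(4)[OF \<psi>(1)] unfolding tm_dg(1)[OF \<psi>(1)] hgrade_hg hg_mv by simp
  qed (use \<psi> d(4) in auto)
  then show ?thesis using tight_rep_facts(1) \<psi>(3) by blast
qed

text \<open>The degree of \<open>f\<close> or X exceeds the grading of \<open>M\<close> by at least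
  \<open>length M - 2\<close>, while \<open>maslov_count\<close> bounds the excess for a term
  outside F. The leaves must be tight for the grading of \<open>M\<close> to count breaks.\<close>

lemma root_bound:
  assumes M: "M \<in> lists (dgm_classes Z)" "M \<noteq> []" and nz: "f M \<notin> ideal_F Z \<or> X M \<noteq> hzero Z"
    and leaves: "\<forall>c\<in>set M. tight_dgm Z (tight_rep Z c)"
  shows "viable Z M" "\<not> singular_tensor Z M"
    "length M \<le> card {P \<in> pairs Z. twisted_at Z P M \<or> critical_at Z P M} + 2"
proof -
  \<comment> \<open>The shift is \<open>length M - 1\<close> for \<open>f\<close> and
    \<open>length M - 2\<close> for X; the common lower bound lets both cases be finished
    together.\<close>
  obtain x q where x: "viable Z M" "x \<in> graded_summand Z (tensor_hdata Z M) q" "\<exists>\<phi>\<in>keys x. nonF Z \<phi>"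
    "tensor_maslov Z M + of_nat (length M) - 2 \<le> q"
  proof (cases "X M = hzero Z")
    case True
    then have nF: "f M \<notin> ideal_F Z" using nz by blast
    show thesis by (rule that[OF f_not_F(1)[OF M nF] arises_dgm(4)[OF M] f_not_F(2)[OF M nF]]) simp
  next
    case False
    show thesis by (rule X_nonzero[OF M False]) (rule that, assumption+, simp)
  qed
  show "viable Z M" by fact
  obtain \<phi> where \<phi>: "\<phi> \<in> keys x" "nonF Z \<phi>" using x(3) by blast
  then have x0: "x \<noteq> 0" by auto
  note xg = graded_summandD[OF x(2)]
  show "\<not> singular_tensor Z M" using xg(1) x0 unfolding singular_tensor_def by blast
  interpret V: viable_frame Z "tensor_h Z M" "cls_s Z (hd M)" "cls_t Z (last M)"
    using x(1) xg(1) x0 by (rule tensor_frame)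
  have T: "\<phi> \<in> V.T" using V.summandD(1)[OF xg(1)[unfolded tensor_hdata_def]] \<phi>(1) by blast
  have "\<not> mismatch Z M" using x(1) by (simp add: viable_def)
  from V.maslov_count[OF M(2) leaves this refl refl refl T]
  have "q - tensor_maslov Z M \<le> of_nat (card {P \<in> pairs Z. twisted_at Z P M \<or> critical_at Z P M})"
    using \<phi>(2) V.nonF_iff[OF T] xg(2)[OF \<phi>(1)] by blast
  with x(4) have "(of_nat (length M) :: rat) \<le> of_nat (card {P \<in> pairs Z. twisted_at Z P M \<or> critical_at Z P M} + 2)"
    by simp
  then show "length M \<le> card {P \<in> pairs Z. twisted_at Z P M \<or> critical_at Z P M} + 2"
    unfolding of_nat_le_iff .
qed

text \<open>Tightness of the leaves is carried through the induction because
  \<open>root_bound\<close> needs it at every vertex, while it becomes available only when a list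
  has been split down to single classes. Below the root only the alternative about \<open>f\<close>
  is passed on.\<close>

lemma exists_tree:
  assumes "M \<in> lists (dgm_classes Z)" "M \<noteq> []" "f M \<notin> ideal_F Z \<or> X M \<noteq> hzero Z"
  shows "(\<forall>c\<in>set M. tight_dgm Z (tight_rep Z c)) \<and>
    (\<exists>T. operation_tree Z M T \<and> valid_tree Z T \<and> distributive_tree Z T)"
  using assms
proof (induction "length M" arbitrary: M rule: less_induct)
  case less
  show ?case
  proof (cases "length M = 1")
    case True
    then obtain c where M: "M = [c]" by (auto simp: length_Suc_conv)
    have c: "c \<in> dgm_classes Z" using less.prems M by simp
    have "X M = hzero Z" using X_single c dgm_classes_homology unfolding M by blast
    then have "f [c] \<notin> ideal_F Z" using less.prems M by simp
    with c have "tight_dgm Z (tight_rep Z c)" by (rule leaf_tight)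
    then have leaves: "\<forall>c\<in>set M. tight_dgm Z (tight_rep Z c)" unfolding M by simp
    note root = root_bound[OF less.prems leaves]
    have "operation_tree Z M (Leaf c)" "valid_tree Z (Leaf c)" "distributive_tree Z (Leaf c)"
      using root c unfolding operation_tree_def valid_tree_def distributive_tree_def M by simp_all
    with leaves show ?thesis by blast
  next
    case False
    then have "2 \<le> length M" using less.prems(2) by (cases M) (auto simp: Suc_le_eq)
    obtain j where j: "1 \<le> j" "j < length M" "f (take j M) \<notin> ideal_F Z" "f (drop j M) \<notin> ideal_F Z"
      using less.prems(1) \<open>2 \<le> length M\<close> less.prems(3) by (rule split)
    note L = lists_sub(1)[OF less.prems(1), of j] lists_sub(2)[OF less.prems(1), of j]
    have 1: "(\<forall>c\<in>set (take j M). tight_dgm Z (tight_rep Z c)) \<and>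
      (\<exists>T. operation_tree Z (take j M) T \<and> valid_tree Z T \<and> distributive_tree Z T)"
      by (rule less.hyps) (use j L in auto)
    have 2: "(\<forall>c\<in>set (drop j M). tight_dgm Z (tight_rep Z c)) \<and>
      (\<exists>T. operation_tree Z (drop j M) T \<and> valid_tree Z T \<and> distributive_tree Z T)"
      by (rule less.hyps) (use j L in auto)
    have "set M = set (take j M) \<union> set (drop j M)" by (metis append_take_drop_id set_append)
    with 1 2 have leaves: "\<forall>c\<in>set M. tight_dgm Z (tight_rep Z c)" by blast
    note root = root_bound[OF less.prems leaves]
    obtain T1 T2 where T: "operation_tree Z (take j M) T1" "valid_tree Z T1" "distributive_tree Z T1"
      "operation_tree Z (drop j M) T2" "valid_tree Z T2" "distributive_tree Z T2" using 1 2 by blast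
    have lab: "label (Node T1 T2) = M" using T(1,4) by (simp add: operation_tree_def)
    have vert: "vertices (Node T1 T2) = insert (Node T1 T2) (vertices T1 \<union> vertices T2)" by simp
    have "operation_tree Z M (Node T1 T2)"
      using T(1,4) root(1) less.prems(1) unfolding operation_tree_def lab vert by (auto simp: lab simp del: label.simps)
    moreover have "valid_tree Z (Node T1 T2)"
      using T(2,5) root(2) unfolding valid_tree_def vert by (auto simp: lab simp del: label.simps)
    moreover have "distributive_tree Z (Node T1 T2)"
      using T(3,6) root(3) unfolding distributive_tree_def vert by (auto simp: lab simp del: label.simps)
    ultimately show ?thesis using leaves by blast
  qed
qed

end

theorem proposition1p3:
  fixes Z :: "'i arc" and ord :: "'i pair_ord"
    and X :: "'i chain set list \<Rightarrow> 'i chain set" and f :: "'i chain set list \<Rightarrow> 'i chain"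
    and M :: "'i chain set list"
  assumes "arc_diagram Z" and "pair_ordering Z ord" and "arises_from Z ord X f"
    and "M \<noteq> []" and "set M \<subseteq> dgm_classes Z"
    and "X M \<noteq> hzero Z \<or> bar Z (f M) \<noteq> ideal_F Z"
  shows "\<exists>T. operation_tree Z M T \<and> valid_tree Z T \<and> distributive_tree Z T"
proof -
  interpret arc_frame Z using assms(1) by (rule arc_diagram_frame)
  interpret ainf_frame Z ord X f by unfold_locales (rule assms(2,3))+
  have M: "M \<in> lists (dgm_classes Z)" using assms(5) by blast
  have "f M \<in> strand_alg Z" using f_strand_alg[OF dgm_lists[OF M] assms(4)] .
  then have "f M \<notin> ideal_F Z \<or> X M \<noteq> hzero Z" using assms(6) bar_eq_iff by blast
  with exists_tree[OF M assms(4)] show ?thesis by blast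
qed

end
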